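(* Let $p_1,p_2>1$ be constants with $p_1\le p_2$, let $k$ be the security parameter, let $n$ be polynomial in $k$, and let $(\mathrm{Enc},\mathrm{Dec})$ be an Enc-IND-CPA secure symmetric encryption scheme. The optimized Melbourne shuffle $\mathrm{optim\_shuffle}(I,\pi,O)$ (with parameters $p_1,p_2$) is a randomized shuffle algorithm that succeeds with very high probability (for every initial permutation $\pi_0$ of $I$ and every desired permutation $\pi$, it outputs fail with probability at most $\mathrm{negl}(n)$, and otherwise $O$ contains re-encryptions of the elements of $I$ arranged according to $\pi$), and it is an oblivious shuffle: every probabilistic polynomial-time adversary wins the Shuffle-IND game against it with probability at most $\frac12+\mathrm{negl}(k)$.
   Context: Conventions. $\mathrm{negl}$ denotes a negligible function. $n$ is a fourth power of an integer; rounding of $p_1\sqrt[4]n$, $p_2\sqrt[4]n$ is ignored. Elements are equal-size pairs $(x,v)$ with distinct keys $x\in[1,n]$. An array of $n$ elements is arranged according to a permutation $\pi$ of $[1,n]$ if the element with key $x$ is at position $\pi(x)$. Storage model. A client accesses arrays on a server through requests: getRange$(S,\mathrm{loc},\ell)$ returns the $\ell$ elements of array $S$ at positions starting at loc; putRange$(S,\mathrm{loc},a)$ writes the array $a$ into $S$ starting at loc; getRangeDist and putRangeDist do the same for several ranges in one request. All elements on the server are encrypted with the client's secret key; each element read is decrypted and re-encrypted with fresh randomness before being written back. Single pass $\mathrm{optim\_shuffle\_pass}(I,T_1,T_2,\rho,O)$. $I$ and $O$ have $n$ positions, $T_1$ has $p_1n$ and $T_2$ has $p_2n$ positions. Each array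 is split into $\sqrt n$ consecutive buckets (of size $\sqrt n$, $\sqrt n$, $p_1\sqrt n$, $p_2\sqrt n$, respectively), and the buckets are grouped into $\sqrt[4]n$ consecutive chunks of $\sqrt[4]n$ buckets each. Distribution phase I: for each bucket $i$ of $I$ in order, read and decrypt it; for each chunk index $c$ collect the elements $(x,v)$ whose target position $\rho(x)$ lies in chunk $c$ of $O$. If some collection has more than $p_1\sqrt[4]n$ elements, output fail and stop. Otherwise pad each of the $\sqrt[4]n$ batches with dummies (of the same size as real elements) to exactly $p_1\sqrt[4]n$ elements, encrypt, and write batch $c$ into chunk $c$ of $T_1$ at offset $i\cdot p_1\sqrt[4]n$ (all batches in one putRangeDist). Distribution phase II: for each chunk $i$ of $T_1$ and each bucket $j$ in it, in order, read and decrypt the bucket, discard dummies, and for each $b\in\{0,\dots,\sqrt[4]n-1\}$ collect the real elements whose target position $\rho(x)$ lies in the $b$-th bucket of chunk $i$ of $O$. If some collection has more than $p_2\sqrt[4]n$ elements, output fail and stop. Otherwise pad each batch with dummies to exactly $p_2\sqrt[4]n$ elements, encrypt, and write batch $b$ into the $b$-th bucket of chunk $i$ of $T_2$ at offset $j\cdot p_2\sqrt[4]n$ (all batches in one putRangeDist). Clean-up phase: for each bucket $j$ of $T_2$ in order, read and decrypt it, remove dummies, sort the remaining $\sqrt n$ elements by $\rho(x)$, re-encrypt them, and write them as bucket $j$ of $O$. Optimized Melbourne shuffle $\mathrm{optim\_shuffle}(I,\pi,O)$. Pick a random permutation $\pi_1$ (uniformly, secretly, and independently of everything else); run $\mathrm{optim\_shuffle\_pass}(I,T_1,T_2,\pi_1,O)$;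 set $I\leftarrow O$; run $\mathrm{optim\_shuffle\_pass}(I,T_1,T_2,\pi,O)$. Enc-IND-CPA security. A PPT adversary makes polynomially many queries to the oracles $\mathrm{Enc}_{key}$, $\mathrm{Dec}_{key}$ on sequences of messages, then submits two sequences $M_0,M_1$ of $l$ messages each; a challenger picks a secret bit $b$ and returns the sequence $C$ of encryptions of the messages of $M_b$; the adversary continues querying (but may not decrypt ciphertexts in $C$) and guesses $b$. The scheme is secure if every PPT adversary guesses correctly with probability at most $1/2+\mathrm{negl}(k)$. Shuffle-IND game between a shuffle $\mathcal S=(\mathrm{Setup},\mathrm{Shuffle})$ and a PPT adversary $\mathcal A$. $\mathrm{Setup}(1^k)$ generates the encryption key (kept in the secret client state) and allocates a datastore on the server. $\mathrm{Shuffle}$ on an input array $A$ and a permutation $\pi$ (starting from $\mathrm{Enc}(A)$ on the server) returns $\mathrm{Enc}(\pi(A))$ together with the transcript $\alpha$, the sequence of all (request, response) pairs exchanged between client and server. (1) $\mathcal S$ runs Setup. (2) For polynomially many rounds, $\mathcal A$ picks an array $B_j$ and a permutation $\rho_j$; $\mathcal S$ runs Shuffle on $(B_j,\rho_j)$ and reveals the output array and transcript to $\mathcal A$. (3) $\mathcal A$ picks two challenges $(A_0,\tau_0),(A_1,\tau_1)$ of the same length. (4) $\mathcal S$ picks a secret bit $b$, runs Shuffle on $(A_b,\tau_b)$, and reveals the output array and transcript. (5) As in (2), for polynomially many further rounds, where $\mathcal A$ picks encrypted arrays $B_j$ and permutations $\rho_j$. (6) $\mathcal A$ outputs $b'$ and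 wins if $b'=b$. $\mathcal S$ is an oblivious shuffle over $n$ items if every PPT adversary wins with probability at most $1/2+\mathrm{negl}(k)$. *)

theory Defs
  imports "HOL-Probability.Probability" "HOL-Combinatorics.Permutations" "HOL-Library.Monad_Syntax"
begin

section \<open>Probabilistic polynomial time\<close>

text \<open>
  The model of computation is a structured WHILE language over binary trees in the style of Jones
  (\<^emph>\<open>Computability and Complexity from a Programming Perspective\<close>), where unit-cost tree
  operations are polynomially equivalent to Turing machine time, extended by uniform choice from a
  range given in unary (a fair coin is the case of two values; the shuffle itself samples
  permutations exactly uniformly) and by calls to an oracle.
\<close>

type_synonym bits = "bool list"

datatype data = Atom | Cell data data

primrec car :: "data \<Rightarrow> data" where
  "car Atom = Atom"
| "car (Cell x y) = x"

primrec cdr :: "data \<Rightarrow> data" where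
  "cdr Atom = Atom"
| "cdr (Cell x y) = y"

text \<open>Decoding is total: every tree is read as a list along its right spine, a number is the length
  of such a list (unary), and a truth value is whether a tree is a cell.\<close>

primrec list_of_data :: "data \<Rightarrow> data list" where
  "list_of_data Atom = []"
| "list_of_data (Cell x y) = x # list_of_data y"

definition nat_of_data :: "data \<Rightarrow> nat" where
  "nat_of_data d = length (list_of_data d)"

definition bool_of_data :: "data \<Rightarrow> bool" where
  "bool_of_data d \<longleftrightarrow> d \<noteq> Atom"

definition bits_of_data :: "data \<Rightarrow> bits" where
  "bits_of_data d = map bool_of_data (list_of_data d)"

primrec data_of_list :: "data list \<Rightarrow> data" where
  "data_of_list [] = Atom"
| "data_of_list (x # xs) = Cell x (data_of_list xs)"

definition data_of_nat :: "nat \<Rightarrow> data" where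
  "data_of_nat n = data_of_list (replicate n Atom)"

definition data_of_bits :: "bits \<Rightarrow> data" where
  "data_of_bits bs = data_of_list (map (\<lambda>b. if b then Cell Atom Atom else Atom) bs)"

primrec data_of_option :: "data option \<Rightarrow> data" where
  "data_of_option None = Atom"
| "data_of_option (Some d) = Cell d Atom"

text \<open>Computations with random choices (\<open>Choose n\<close> is uniform on \<open>{..n}\<close>) and oracle queries.\<close>

datatype 'a comp = Done 'a | Choose nat "nat \<Rightarrow> 'a comp" | Ask data "data \<Rightarrow> 'a comp"

primrec bind_comp :: "'a comp \<Rightarrow> ('a \<Rightarrow> 'b comp) \<Rightarrow> 'b comp" where
  "bind_comp (Done x) g = g x"
| "bind_comp (Choose n f) g = Choose n (\<lambda>i. bind_comp (f i) g)"
| "bind_comp (Ask q f) g = Ask q (\<lambda>r. bind_comp (f r) g)"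

primrec outcomes :: "'a comp \<Rightarrow> 'a set" where
  "outcomes (Done x) = {x}"
| "outcomes (Choose n f) = (\<Union>i\<le>n. outcomes (f i))"
| "outcomes (Ask q f) = (\<Union>r. outcomes (f r))"

primrec interact :: "('s \<Rightarrow> data \<Rightarrow> (data \<times> 's) pmf) \<Rightarrow> 'a comp \<Rightarrow> 's \<Rightarrow> ('a \<times> 's) pmf" where
  "interact orc (Done x) s = return_pmf (x, s)"
| "interact orc (Choose n f) s = bind_pmf (pmf_of_set {..n}) (\<lambda>i. interact orc (f i) s)"
| "interact orc (Ask q f) s = bind_pmf (orc s q) (\<lambda>(r, s'). interact orc (f r) s')"

datatype prog =
    Id
  | Nul
  | Car
  | Cdr
  | Fork prog prog
  | Seq prog prog
  | Cond prog prog prog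
  | While prog prog
  | Rand
  | Call

text \<open>
  A timed computation maps an input and a time budget to an output and the remaining budget, or to
  \<open>None\<close> if the budget is exceeded.
\<close>

type_synonym timed = "data \<Rightarrow> nat \<Rightarrow> (data \<times> nat) option comp"

definition and_then :: "(data \<times> nat) option comp \<Rightarrow> timed \<Rightarrow> (data \<times> nat) option comp" where
  "and_then m f = bind_comp m (\<lambda>z. case z of None \<Rightarrow> Done None | Some (y, t) \<Rightarrow> f y t)"

definition pay :: "nat \<Rightarrow> nat \<Rightarrow> (nat \<Rightarrow> (data \<times> nat) option comp) \<Rightarrow> (data \<times> nat) option comp" where
  "pay a t m = (if t < a then Done None else m (t - a))"

text \<open>Since every round of a loop costs at least one step, the time budget also bounds the number
  of rounds; it is passed as the first argument of \<open>loop\<close>.\<close>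

primrec loop :: "nat \<Rightarrow> timed \<Rightarrow> timed \<Rightarrow> timed" where
  "loop 0 c b x t = Done None"
| "loop (Suc j) c b x t = pay 1 t (\<lambda>t.
     and_then (c x t) (\<lambda>v t.
       if bool_of_data v then and_then (b x t) (loop j c b) else Done (Some (x, t))))"

primrec exec :: "prog \<Rightarrow> timed" where
  "exec Id x t = pay 1 t (\<lambda>t. Done (Some (x, t)))"
| "exec Nul x t = pay 1 t (\<lambda>t. Done (Some (Atom, t)))"
| "exec Car x t = pay 1 t (\<lambda>t. Done (Some (car x, t)))"
| "exec Cdr x t = pay 1 t (\<lambda>t. Done (Some (cdr x, t)))"
| "exec (Fork p q) x t = pay 1 t (\<lambda>t.
     and_then (exec p x t) (\<lambda>y t. and_then (exec q x t) (\<lambda>z t. Done (Some (Cell y z, t)))))"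
| "exec (Seq p q) x t = pay 1 t (\<lambda>t. and_then (exec p x t) (exec q))"
| "exec (Cond c p q) x t = pay 1 t (\<lambda>t.
     and_then (exec c x t) (\<lambda>v t. if bool_of_data v then exec p x t else exec q x t))"
| "exec (While c p) x t = loop t (exec c) (exec p) x t"
| "exec Rand x t = pay (1 + nat_of_data x) t (\<lambda>t.
     Choose (nat_of_data x) (\<lambda>i. Done (Some (data_of_nat i, t))))"
| "exec Call x t = pay (1 + size x) t (\<lambda>t. Ask x (\<lambda>r. Done (Some (r, t))))"

definition poly_bounded :: "(nat \<Rightarrow> nat) \<Rightarrow> bool" where
  "poly_bounded f \<longleftrightarrow> (\<exists>c. \<forall>k. f k \<le> k ^ c + c)"

text \<open>An oracle machine started on \<open>1^k\<close> is PPT with time bound \<open>T\<close> if, whatever the random choices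
  and the oracle's answers, it halts within \<open>T k\<close> steps.\<close>

definition ppt :: "prog \<Rightarrow> (nat \<Rightarrow> nat) \<Rightarrow> bool" where
  "ppt p T \<longleftrightarrow> poly_bounded T \<and> (\<forall>k. None \<notin> outcomes (exec p (data_of_nat k) (T k)))"

text \<open>Polynomial time in the size of the input for algorithms without an oracle (\<open>Call\<close> just
  returns \<open>Atom\<close>).\<close>

definition poly_time :: "(data \<Rightarrow> data pmf) \<Rightarrow> bool" where
  "poly_time F \<longleftrightarrow> (\<exists>p T. poly_bounded T \<and>
     (\<forall>x. map_pmf (map_option fst \<circ> fst)
            (interact (\<lambda>_ _. return_pmf (Atom, ())) (exec p x (T (size x))) ())
          = map_pmf Some (F x)))"

definition poly_time_nat :: "(nat \<Rightarrow> nat) \<Rightarrow> bool" where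
  "poly_time_nat f \<longleftrightarrow> poly_time (\<lambda>x. return_pmf (data_of_nat (f (nat_of_data x))))"

definition negligible :: "(nat \<Rightarrow> real) \<Rightarrow> bool" where
  "negligible \<nu> \<longleftrightarrow> (\<forall>c::nat. \<forall>\<^sub>F k in sequentially. \<bar>\<nu> k\<bar> \<le> 1 / real k ^ c)"

section \<open>Symmetric encryption\<close>

type_synonym keygen = "nat \<Rightarrow> bits pmf"
type_synonym encryption = "bits \<Rightarrow> bits \<Rightarrow> bits pmf"
type_synonym decryption = "bits \<Rightarrow> bits \<Rightarrow> bits option"

definition symmetric_encryption :: "keygen \<Rightarrow> encryption \<Rightarrow> decryption \<Rightarrow> bool" where
  "symmetric_encryption Gen Enc Dec \<longleftrightarrow>
     poly_time (\<lambda>x. map_pmf data_of_bits (Gen (nat_of_data x))) \<and>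
     poly_time (\<lambda>x. map_pmf data_of_bits (Enc (bits_of_data (car x)) (bits_of_data (cdr x)))) \<and>
     poly_time (\<lambda>x. return_pmf (data_of_option (map_option data_of_bits
                       (Dec (bits_of_data (car x)) (bits_of_data (cdr x)))))) \<and>
     (\<forall>k. \<forall>key \<in> set_pmf (Gen k). \<forall>m. \<forall>c \<in> set_pmf (Enc key m). Dec key c = Some m)"

primrec mapM_pmf :: "('a \<Rightarrow> 'b pmf) \<Rightarrow> 'a list \<Rightarrow> 'b list pmf" where
  "mapM_pmf f [] = return_pmf []"
| "mapM_pmf f (x # xs) = do { y \<leftarrow> f x; ys \<leftarrow> mapM_pmf f xs; return_pmf (y # ys) }"

datatype cpa_query = EncQ "bits list" | DecQ "bits list" | ChallengeQ "bits list" "bits list"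

definition bits_list_of_data :: "data \<Rightarrow> bits list" where
  "bits_list_of_data d = map bits_of_data (list_of_data d)"

definition data_of_bits_list :: "bits list \<Rightarrow> data" where
  "data_of_bits_list xs = data_of_list (map data_of_bits xs)"

definition cpa_query_of_data :: "data \<Rightarrow> cpa_query" where
  "cpa_query_of_data d =
     (if nat_of_data (car d) = 0 then EncQ (bits_list_of_data (cdr d))
      else if nat_of_data (car d) = 1 then DecQ (bits_list_of_data (cdr d))
      else ChallengeQ (bits_list_of_data (car (cdr d))) (bits_list_of_data (cdr (cdr d))))"

text \<open>
  State of the game: the challenge ciphertexts, if any, and whether the adversary has broken the
  rules, in which case it loses. Corresponding messages of the two challenge sequences must have the
  same bit length, as usual for schemes that encrypt messages of every length.
\<close>

type_synonym cpa_state = "bits list option \<times> bool"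

fun cpa_oracle :: "encryption \<Rightarrow> decryption \<Rightarrow> bits \<Rightarrow> bool \<Rightarrow> cpa_state \<Rightarrow> cpa_query
    \<Rightarrow> (data \<times> cpa_state) pmf" where
  "cpa_oracle Enc Dec key b (ch, lost) (EncQ ms) =
     map_pmf (\<lambda>cs. (data_of_bits_list cs, (ch, lost))) (mapM_pmf (Enc key) ms)"
| "cpa_oracle Enc Dec key b (ch, lost) (DecQ cs) =
     return_pmf
       (if \<exists>C. ch = Some C \<and> set cs \<inter> set C \<noteq> {} then (Atom, (ch, True))
        else (data_of_list (map (\<lambda>c. data_of_option (map_option data_of_bits (Dec key c))) cs),
              (ch, lost)))"
| "cpa_oracle Enc Dec key b (ch, lost) (ChallengeQ M0 M1) =
     (if ch = None \<and> list_all2 (\<lambda>m m'. length m = length m') M0 M1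
      then map_pmf (\<lambda>C. (data_of_bits_list C, (Some C, lost)))
             (mapM_pmf (Enc key) (if b then M1 else M0))
      else return_pmf (Atom, (ch, True)))"

text \<open>The adversary's guess is the truth value of its final output.\<close>

definition wins :: "bool \<Rightarrow> bool \<Rightarrow> (data \<times> nat) option \<Rightarrow> bool" where
  "wins b lost out \<longleftrightarrow> \<not> lost \<and> (\<exists>y t. out = Some (y, t) \<and> bool_of_data y = b)"

definition cpa_game :: "keygen \<Rightarrow> encryption \<Rightarrow> decryption \<Rightarrow> prog \<Rightarrow> (nat \<Rightarrow> nat) \<Rightarrow> nat \<Rightarrow> bool pmf" where
  "cpa_game Gen Enc Dec p T k = do {
     key \<leftarrow> Gen k;
     b \<leftarrow> pmf_of_set (UNIV :: bool set);
     (out, st) \<leftarrow> interact (\<lambda>s q. cpa_oracle Enc Dec key b s (cpa_query_of_data q))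
                    (exec p (data_of_nat k) (T k)) (None, False);
     return_pmf (wins b (snd st) out) }"

definition enc_ind_cpa :: "keygen \<Rightarrow> encryption \<Rightarrow> decryption \<Rightarrow> bool" where
  "enc_ind_cpa Gen Enc Dec \<longleftrightarrow>
     (\<forall>p T. ppt p T \<longrightarrow>
        (\<exists>\<nu>. negligible \<nu> \<and> (\<forall>k. measure_pmf.prob (cpa_game Gen Enc Dec p T k) {True} \<le> 1/2 + \<nu> k)))"

section \<open>Storage model\<close>

datatype arr = ArrI | ArrT1 | ArrT2 | ArrO

datatype request =
    GetRange arr nat nat
  | PutRange arr nat "bits list"
  | GetRangeDist arr "(nat \<times> nat) list"
  | PutRangeDist arr "(nat \<times> bits list) list"

datatype response = Elems "bits list" | ElemsDist "bits list list" | Ack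

type_synonym server = "arr \<Rightarrow> bits list"
type_synonym transcript = "(request \<times> response) list"

text \<open>Locations are offsets from \<open>0\<close>, so position \<open>p \<in> {1..n}\<close> of an array is location \<open>p - 1\<close>.\<close>

definition read_range :: "nat \<Rightarrow> nat \<Rightarrow> bits list \<Rightarrow> bits list" where
  "read_range loc l S = take l (drop loc S)"

definition write_range :: "nat \<Rightarrow> bits list \<Rightarrow> bits list \<Rightarrow> bits list" where
  "write_range loc a S = take loc S @ a @ drop (loc + length a) S"

fun serve :: "request \<Rightarrow> server \<Rightarrow> response \<times> server" where
  "serve (GetRange S loc l) srv = (Elems (read_range loc l (srv S)), srv)"
| "serve (PutRange S loc a) srv = (Ack, srv(S := write_range loc a (srv S)))"
| "serve (GetRangeDist S rs) srv = (ElemsDist (map (\<lambda>(loc, l). read_range loc l (srv S)) rs), srv)"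
| "serve (PutRangeDist S ws) srv = (Ack, srv(S := fold (\<lambda>(loc, a). write_range loc a) ws (srv S)))"

text \<open>Client programs: the result \<open>None\<close> means that the client has output fail and stopped.\<close>

type_synonym 'a client = "server \<times> transcript \<Rightarrow> ('a option \<times> server \<times> transcript) pmf"

definition bind_client :: "'a client \<Rightarrow> ('a \<Rightarrow> 'b client) \<Rightarrow> 'b client" where
  "bind_client m f = (\<lambda>s. bind_pmf (m s) (\<lambda>(r, s').
     case r of None \<Rightarrow> return_pmf (None, s') | Some a \<Rightarrow> f a s'))"

adhoc_overloading Monad_Syntax.bind \<rightleftharpoons> bind_client

definition return_client :: "'a \<Rightarrow> 'a client" where
  "return_client a = (\<lambda>s. return_pmf (Some a, s))"

definition fail_client :: "'a client" where
  "fail_client = (\<lambda>s. return_pmf (None, s))"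

definition sample :: "'a pmf \<Rightarrow> 'a client" where
  "sample p = (\<lambda>s. map_pmf (\<lambda>a. (Some a, s)) p)"

definition request :: "request \<Rightarrow> response client" where
  "request rq = (\<lambda>(srv, tr). let (rs, srv') = serve rq srv
                             in return_pmf (Some rs, (srv', tr @ [(rq, rs)])))"

definition assign_array :: "arr \<Rightarrow> arr \<Rightarrow> unit client" where
  "assign_array S S' = (\<lambda>(srv, tr). return_pmf (Some (), (srv(S := srv S'), tr)))"

primrec for_each :: "'a list \<Rightarrow> ('a \<Rightarrow> unit client) \<Rightarrow> unit client" where
  "for_each [] f = return_client ()"
| "for_each (x # xs) f = do { _ \<leftarrow> f x; for_each xs f }"

section \<open>The optimized Melbourne shuffle\<close>

text \<open>
  Plaintexts of slots of an array with \<open>n\<close> keys: a flag bit (real element or dummy), the key in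
  fixed-width binary, and the value. For values of length \<open>L\<close> all slots have the same length.
\<close>

type_synonym element = "nat \<times> bits"

definition key_width :: "nat \<Rightarrow> nat" where
  "key_width n = (LEAST w. n < 2 ^ w)"

definition real_slot :: "nat \<Rightarrow> element \<Rightarrow> bits" where
  "real_slot n e = True # map (bit (fst e)) [0..<key_width n] @ snd e"

definition dummy_slot :: "nat \<Rightarrow> nat \<Rightarrow> bits" where
  "dummy_slot n L = False # replicate (key_width n + L) False"

fun open_slot :: "nat \<Rightarrow> bits option \<Rightarrow> element option" where
  "open_slot n (Some (True # bs)) =
     Some (horner_sum of_bool 2 (take (key_width n) bs), drop (key_width n) bs)"
| "open_slot n _ = None"

definition real_elements :: "nat \<Rightarrow> (bits \<Rightarrow> bits option) \<Rightarrow> bits list \<Rightarrow> element list" where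
  "real_elements n D cs = List.map_filter (\<lambda>c. open_slot n (D c)) cs"

definition pad_batch :: "nat \<Rightarrow> nat \<Rightarrow> nat \<Rightarrow> element list \<Rightarrow> bits list" where
  "pad_batch n L q es = map (real_slot n) es @ replicate (q - length es) (dummy_slot n L)"

definition read_elements :: "nat \<Rightarrow> (bits \<Rightarrow> bits option) \<Rightarrow> arr \<Rightarrow> nat \<Rightarrow> nat \<Rightarrow> element list client" where
  "read_elements n D S loc l = do {
     rs \<leftarrow> request (GetRange S loc l);
     return_client (case rs of Elems cs \<Rightarrow> real_elements n D cs | _ \<Rightarrow> []) }"

text \<open>
  In what follows \<open>r\<close> is the fourth root of \<open>n\<close>, \<open>E\<close> and \<open>D\<close> are encryption and decryption under the
  client's key, \<open>L\<close> is the length of the values, and \<open>q1\<close>, \<open>q2\<close> are the batch sizes \<open>p\<^sub>1 r\<close>, \<open>p\<^sub>2 r\<close>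
  rounded to integers. A bucket of \<open>O\<close> has \<open>r ^ 2\<close> positions and a chunk of \<open>O\<close> has \<open>r ^ 3\<close>; buckets
  of \<open>T1\<close> and \<open>T2\<close> have \<open>r * q1\<close> and \<open>r * q2\<close> positions.
\<close>

definition distribute_batches ::
  "nat \<Rightarrow> (bits \<Rightarrow> bits pmf) \<Rightarrow> nat \<Rightarrow> nat \<Rightarrow> arr \<Rightarrow> (nat \<Rightarrow> nat) \<Rightarrow> (nat \<Rightarrow> element list) \<Rightarrow> nat \<Rightarrow> unit client"
where
  "distribute_batches n E L q S loc batch r =
     (if \<exists>c<r. length (batch c) > q then fail_client
      else do {
        css \<leftarrow> sample (mapM_pmf (mapM_pmf E) (map (\<lambda>c. pad_batch n L q (batch c)) [0..<r]));
        _ \<leftarrow> request (PutRangeDist S (zip (map loc [0..<r]) css));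
        return_client () })"

definition distribution_phase1 ::
  "nat \<Rightarrow> nat \<Rightarrow> (bits \<Rightarrow> bits pmf) \<Rightarrow> (bits \<Rightarrow> bits option) \<Rightarrow> nat \<Rightarrow> (nat \<Rightarrow> nat) \<Rightarrow> unit client" where
  "distribution_phase1 r q1 E D L \<rho> =
     for_each [0..<r^2] (\<lambda>i. do {
       es \<leftarrow> read_elements (r^4) D ArrI (i * r^2) (r^2);
       distribute_batches (r^4) E L q1 ArrT1
         (\<lambda>c. c * (r * (r * q1)) + i * q1)
         (\<lambda>c. filter (\<lambda>e. (\<rho> (fst e) - 1) div r^3 = c) es) r })"

definition distribution_phase2 ::
  "nat \<Rightarrow> nat \<Rightarrow> nat \<Rightarrow> (bits \<Rightarrow> bits pmf) \<Rightarrow> (bits \<Rightarrow> bits option) \<Rightarrow> nat \<Rightarrow> (nat \<Rightarrow> nat) \<Rightarrow> unit client" where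
  "distribution_phase2 r q1 q2 E D L \<rho> =
     for_each [0..<r] (\<lambda>i. for_each [0..<r] (\<lambda>j. do {
       es \<leftarrow> read_elements (r^4) D ArrT1 ((i * r + j) * (r * q1)) (r * q1);
       distribute_batches (r^4) E L q2 ArrT2
         (\<lambda>b. (i * r + b) * (r * q2) + j * q2)
         (\<lambda>b. filter (\<lambda>e. (\<rho> (fst e) - 1) div r^2 = i * r + b) es) r }))"

definition cleanup_phase ::
  "nat \<Rightarrow> nat \<Rightarrow> (bits \<Rightarrow> bits pmf) \<Rightarrow> (bits \<Rightarrow> bits option) \<Rightarrow> (nat \<Rightarrow> nat) \<Rightarrow> unit client" where
  "cleanup_phase r q2 E D \<rho> =
     for_each [0..<r^2] (\<lambda>j. do {
       es \<leftarrow> read_elements (r^4) D ArrT2 (j * (r * q2)) (r * q2);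
       cs \<leftarrow> sample (mapM_pmf E (map (real_slot (r^4)) (sort_key (\<lambda>e. \<rho> (fst e)) es)));
       _ \<leftarrow> request (PutRange ArrO (j * r^2) cs);
       return_client () })"

definition optim_shuffle_pass ::
  "nat \<Rightarrow> nat \<Rightarrow> nat \<Rightarrow> (bits \<Rightarrow> bits pmf) \<Rightarrow> (bits \<Rightarrow> bits option) \<Rightarrow> nat \<Rightarrow> (nat \<Rightarrow> nat) \<Rightarrow> unit client" where
  "optim_shuffle_pass r q1 q2 E D L \<rho> = do {
     _ \<leftarrow> distribution_phase1 r q1 E D L \<rho>;
     _ \<leftarrow> distribution_phase2 r q1 q2 E D L \<rho>;
     cleanup_phase r q2 E D \<rho> }"

definition optim_shuffle_client ::
  "nat \<Rightarrow> nat \<Rightarrow> nat \<Rightarrow> (bits \<Rightarrow> bits pmf) \<Rightarrow> (bits \<Rightarrow> bits option) \<Rightarrow> nat \<Rightarrow> (nat \<Rightarrow> nat) \<Rightarrow> unit client" where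
  "optim_shuffle_client r q1 q2 E D L \<pi> = do {
     \<pi>\<^sub>1 \<leftarrow> sample (pmf_of_set {\<sigma>. \<sigma> permutes {1..r^4}});
     _ \<leftarrow> optim_shuffle_pass r q1 q2 E D L \<pi>\<^sub>1;
     _ \<leftarrow> assign_array ArrI ArrO;
     optim_shuffle_pass r q1 q2 E D L \<pi> }"

text \<open>The server with input array \<open>cs\<close> and freshly allocated arrays \<open>T1\<close>, \<open>T2\<close>, \<open>O\<close>.\<close>

definition init_server :: "nat \<Rightarrow> nat \<Rightarrow> nat \<Rightarrow> bits list \<Rightarrow> server" where
  "init_server r q1 q2 cs = (\<lambda>S. case S of
       ArrI \<Rightarrow> cs
     | ArrT1 \<Rightarrow> replicate (r^3 * q1) []
     | ArrT2 \<Rightarrow> replicate (r^3 * q2) []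
     | ArrO \<Rightarrow> replicate (r^4) [])"

definition batch_size :: "real \<Rightarrow> nat \<Rightarrow> nat" where
  "batch_size p r = nat \<lceil>p * real r\<rceil>"

text \<open>Output array (\<open>None\<close> for fail) and transcript of a run on the array \<open>cs\<close> of \<open>r ^ 4\<close> ciphertexts.\<close>

definition optim_shuffle ::
  "encryption \<Rightarrow> decryption \<Rightarrow> real \<Rightarrow> real \<Rightarrow> nat \<Rightarrow> nat \<Rightarrow> bits \<Rightarrow> (nat \<Rightarrow> nat) \<Rightarrow> bits list
     \<Rightarrow> (bits list option \<times> transcript) pmf" where
  "optim_shuffle Enc Dec p1 p2 r L key \<pi> cs =
     map_pmf (\<lambda>(res, srv, tr). (map_option (\<lambda>_. srv ArrO) res, tr))
       (optim_shuffle_client r (batch_size p1 r) (batch_size p2 r) (Enc key) (Dec key) L \<pi>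
          (init_server r (batch_size p1 r) (batch_size p2 r) cs, []))"

text \<open>\<open>cs\<close> consists of encryptions of the elements \<open>(x, v x)\<close>, \<open>x \<in> {1..n}\<close>, the one with key \<open>x\<close>
  being at position \<open>\<pi> x\<close>.\<close>

definition encrypts_arranged ::
  "encryption \<Rightarrow> bits \<Rightarrow> nat \<Rightarrow> (nat \<Rightarrow> bits) \<Rightarrow> (nat \<Rightarrow> nat) \<Rightarrow> bits list \<Rightarrow> bool" where
  "encrypts_arranged Enc key n v \<pi> cs \<longleftrightarrow>
     length cs = n \<and> (\<forall>x\<in>{1..n}. cs ! (\<pi> x - 1) \<in> set_pmf (Enc key (real_slot n (x, v x))))"

definition shuffles_whp :: "keygen \<Rightarrow> encryption \<Rightarrow> decryption \<Rightarrow> real \<Rightarrow> real \<Rightarrow> bool" where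
  "shuffles_whp Gen Enc Dec p1 p2 \<longleftrightarrow>
     (\<exists>\<nu>. negligible \<nu> \<and>
       (\<forall>k r L v \<pi>\<^sub>0 \<pi>. \<forall>key \<in> set_pmf (Gen k). \<forall>cs.
          (\<forall>x\<in>{1..r^4}. length (v x) = L) \<longrightarrow> \<pi>\<^sub>0 permutes {1..r^4} \<longrightarrow> \<pi> permutes {1..r^4} \<longrightarrow>
          encrypts_arranged Enc key (r^4) v \<pi>\<^sub>0 cs \<longrightarrow>
          measure_pmf.prob (optim_shuffle Enc Dec p1 p2 r L key \<pi> cs) {z. fst z = None} \<le> \<nu> (r^4) \<and>
          (\<forall>out tr. (Some out, tr) \<in> set_pmf (optim_shuffle Enc Dec p1 p2 r L key \<pi> cs) \<longrightarrow>
                    encrypts_arranged Enc key (r^4) v \<pi> out)))"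

section \<open>Oblivious shuffles\<close>

text \<open>A shuffle for security parameter \<open>k\<close> gets the value length, the key, the desired permutation
  and the encrypted input array stored on the server.\<close>

type_synonym shuffle =
  "nat \<Rightarrow> nat \<Rightarrow> bits \<Rightarrow> (nat \<Rightarrow> nat) \<Rightarrow> bits list \<Rightarrow> (bits list option \<times> transcript) pmf"

definition element_of_data :: "data \<Rightarrow> element" where
  "element_of_data d = (nat_of_data (car d), bits_of_data (cdr d))"

definition array_of_data :: "data \<Rightarrow> element list" where
  "array_of_data d = map element_of_data (list_of_data d)"

text \<open>A permutation of \<open>{1..n}\<close> is transmitted as the list of its values.\<close>

definition perm_list_of_data :: "data \<Rightarrow> nat list" where
  "perm_list_of_data d = map nat_of_data (list_of_data d)"

definition fun_of_perm_list :: "nat list \<Rightarrow> nat \<Rightarrow> nat" where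
  "fun_of_perm_list ps x = (if x \<in> {1..length ps} then ps ! (x - 1) else x)"

definition valid_perm :: "nat \<Rightarrow> nat list \<Rightarrow> bool" where
  "valid_perm n ps \<longleftrightarrow> length ps = n \<and> distinct ps \<and> set ps = {1..n}"

definition value_length :: "element list \<Rightarrow> nat" where
  "value_length A = (case A of [] \<Rightarrow> 0 | (x, v) # _ \<Rightarrow> length v)"

definition valid_array :: "nat \<Rightarrow> element list \<Rightarrow> bool" where
  "valid_array n A \<longleftrightarrow> length A = n \<and> distinct (map fst A) \<and> fst ` set A = {1..n} \<and>
     (\<forall>(x, v) \<in> set A. length v = value_length A)"

definition valid_enc_array :: "nat \<Rightarrow> (bits \<Rightarrow> bits option) \<Rightarrow> bits list \<Rightarrow> bool" where
  "valid_enc_array n D cs \<longleftrightarrow> (\<exists>A. valid_array n A \<and> map D cs = map (Some \<circ> real_slot n) A)"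

datatype shuffle_query =
    PlainQ "element list" "nat list"
  | ShuffleChallengeQ "element list" "nat list" "element list" "nat list"
  | EncryptedQ "bits list" "nat list"

definition shuffle_query_of_data :: "data \<Rightarrow> shuffle_query" where
  "shuffle_query_of_data d = (let a = cdr d in
     if nat_of_data (car d) = 0 then PlainQ (array_of_data (car a)) (perm_list_of_data (cdr a))
     else if nat_of_data (car d) = 1 then
       ShuffleChallengeQ (array_of_data (car (car a))) (perm_list_of_data (cdr (car a)))
                         (array_of_data (car (cdr a))) (perm_list_of_data (cdr (cdr a)))
     else EncryptedQ (bits_list_of_data (car a)) (perm_list_of_data (cdr a)))"

primrec data_of_arr :: "arr \<Rightarrow> data" where
  "data_of_arr ArrI = data_of_nat 0"
| "data_of_arr ArrT1 = data_of_nat 1"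
| "data_of_arr ArrT2 = data_of_nat 2"
| "data_of_arr ArrO = data_of_nat 3"

primrec data_of_request :: "request \<Rightarrow> data" where
  "data_of_request (GetRange S loc l) =
     data_of_list [data_of_nat 0, data_of_arr S, data_of_nat loc, data_of_nat l]"
| "data_of_request (PutRange S loc a) =
     data_of_list [data_of_nat 1, data_of_arr S, data_of_nat loc, data_of_bits_list a]"
| "data_of_request (GetRangeDist S rs) =
     data_of_list [data_of_nat 2, data_of_arr S,
       data_of_list (map (\<lambda>(loc, l). Cell (data_of_nat loc) (data_of_nat l)) rs)]"
| "data_of_request (PutRangeDist S ws) =
     data_of_list [data_of_nat 3, data_of_arr S,
       data_of_list (map (\<lambda>(loc, a). Cell (data_of_nat loc) (data_of_bits_list a)) ws)]"

primrec data_of_response :: "response \<Rightarrow> data" where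
  "data_of_response (Elems cs) = data_of_list [data_of_nat 0, data_of_bits_list cs]"
| "data_of_response (ElemsDist css) =
     data_of_list [data_of_nat 1, data_of_list (map data_of_bits_list css)]"
| "data_of_response Ack = data_of_list [data_of_nat 2]"

fun data_of_run :: "bits list option \<times> transcript \<Rightarrow> data" where
  "data_of_run (out, tr) = Cell (data_of_option (map_option data_of_bits_list out))
     (data_of_list (map (\<lambda>(rq, rs). Cell (data_of_request rq) (data_of_response rs)) tr))"

text \<open>
  State of the game: whether the challenge has been issued, and whether the adversary has broken the
  rules, in which case it loses. All arrays it submits, encrypted ones included, must consist of
  \<open>n\<close> elements of equal size with distinct keys in \<open>{1..n}\<close>. Answering ill-formed encrypted arrays
  in any way other than by a loss would let the adversary test the contents of challenge ciphertexts
  by mixing them with elements of known keys.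
\<close>

type_synonym shuffle_state = "bool \<times> bool"

definition shuffle_plain :: "encryption \<Rightarrow> nat \<Rightarrow> (nat \<Rightarrow> bits \<Rightarrow> (nat \<Rightarrow> nat) \<Rightarrow> bits list
    \<Rightarrow> (bits list option \<times> transcript) pmf) \<Rightarrow> bits \<Rightarrow> element list \<Rightarrow> nat list \<Rightarrow> data pmf" where
  "shuffle_plain Enc n Sh key A ps = do {
     cs \<leftarrow> mapM_pmf (Enc key) (map (real_slot n) A);
     map_pmf data_of_run (Sh (value_length A) key (fun_of_perm_list ps) cs) }"

text \<open>In a valid encrypted array every plaintext consists of a flag bit, \<open>key_width n\<close> bits of key
  and the value; this yields the value length of the array.\<close>

definition enc_value_length :: "nat \<Rightarrow> (bits \<Rightarrow> bits option) \<Rightarrow> bits list \<Rightarrow> nat" where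
  "enc_value_length n D cs = value_length (real_elements n D cs)"

fun shuffle_oracle :: "encryption \<Rightarrow> decryption \<Rightarrow> nat \<Rightarrow> (nat \<Rightarrow> bits \<Rightarrow> (nat \<Rightarrow> nat) \<Rightarrow> bits list
    \<Rightarrow> (bits list option \<times> transcript) pmf) \<Rightarrow> bits \<Rightarrow> bool \<Rightarrow> shuffle_state \<Rightarrow> shuffle_query
    \<Rightarrow> (data \<times> shuffle_state) pmf" where
  "shuffle_oracle Enc Dec n Sh key b (ch, lost) (PlainQ A ps) =
     (if \<not> ch \<and> valid_array n A \<and> valid_perm n ps
      then map_pmf (\<lambda>d. (d, (ch, lost))) (shuffle_plain Enc n Sh key A ps)
      else return_pmf (Atom, (ch, True)))"
| "shuffle_oracle Enc Dec n Sh key b (ch, lost) (ShuffleChallengeQ A0 ps0 A1 ps1) =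
     (if \<not> ch \<and> valid_array n A0 \<and> valid_perm n ps0 \<and> valid_array n A1 \<and> valid_perm n ps1
         \<and> value_length A0 = value_length A1
      then map_pmf (\<lambda>d. (d, (True, lost)))
             (if b then shuffle_plain Enc n Sh key A1 ps1 else shuffle_plain Enc n Sh key A0 ps0)
      else return_pmf (Atom, (ch, True)))"
| "shuffle_oracle Enc Dec n Sh key b (ch, lost) (EncryptedQ cs ps) =
     (if ch \<and> valid_enc_array n (Dec key) cs \<and> valid_perm n ps
      then map_pmf (\<lambda>z. (data_of_run z, (ch, lost)))
             (Sh (enc_value_length n (Dec key) cs) key (fun_of_perm_list ps) cs)
      else return_pmf (Atom, (ch, True)))"

definition shuffle_ind_game ::
  "keygen \<Rightarrow> encryption \<Rightarrow> decryption \<Rightarrow> (nat \<Rightarrow> nat) \<Rightarrow> shuffle \<Rightarrow> prog \<Rightarrow> (nat \<Rightarrow> nat) \<Rightarrow> nat \<Rightarrow> bool pmf" where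
  "shuffle_ind_game Gen Enc Dec n Shuffle p T k = do {
     key \<leftarrow> Gen k;
     b \<leftarrow> pmf_of_set (UNIV :: bool set);
     (out, st) \<leftarrow> interact
         (\<lambda>s q. shuffle_oracle Enc Dec (n k) (Shuffle k) key b s (shuffle_query_of_data q))
         (exec p (data_of_nat k) (T k)) (False, False);
     return_pmf (wins b (snd st) out) }"

definition oblivious_shuffle ::
  "keygen \<Rightarrow> encryption \<Rightarrow> decryption \<Rightarrow> (nat \<Rightarrow> nat) \<Rightarrow> shuffle \<Rightarrow> bool" where
  "oblivious_shuffle Gen Enc Dec n Shuffle \<longleftrightarrow>
     (\<forall>p T. ppt p T \<longrightarrow>
        (\<exists>\<nu>. negligible \<nu> \<and>
          (\<forall>k. measure_pmf.prob (shuffle_ind_game Gen Enc Dec n Shuffle p T k) {True} \<le> 1/2 + \<nu> k)))"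

end

theory Submission
  imports Defs
begin

text \<open>
  In a run that does not fail, the server only sees a sequence of ciphertexts whose number, lengths and
  positions depend on the parameters alone: the transcript is a fixed function of the input
  ciphertexts and of the encryptions of a list of plaintexts. A run fails only if some
  batch overflows. The number of elements of a set \<open>S\<close> that a uniform permutation maps into \<open>T\<close> has
  the moment generating function \<open>E[(1 + t)^X] \<le> (1 + t |T| / n)^|S|\<close> or less, as in the case of
  independent choices, so an overflow has probability at most \<open>exp (- \<epsilon> r)\<close>; in the second pass the
  random permutation is the one that arranged the input.

  Obliviousness is a reduction to the encryption scheme. A hybrid argument over the encryption queries turns
  a single challenge into an oracle that replaces all plaintexts by zeros of the same length and
  decrypts by table lookup. An adversary against the shuffle, simulated on top of
  this oracle, wins with almost the same probability. Once the plaintexts are zeros, the runs for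
  the two challenges are identical, so that it wins with probability at most one half. Since
  adversaries are programs of a concrete machine, the simulation is compiled:
  \<open>ptime\<close> is closed under the constructions from which the simulator is built, and \<open>compile\<close>
  replaces oracle calls of a program by another program.
\<close>

section \<open>Query trees with random choices, and couplings between them\<close>

section \<open>Computations\<close>

text \<open>The CPA game allows one challenge and forbids decrypting it, whereas the shuffle
  adversary may submit arrays that mix challenge ciphertexts with its own. The simulator can open
  these only through a table of intended plaintexts. Once zeros are encrypted, this table is the
  only trace of the challenge bit. It can still matter: an array may be well-formed for one bit and
  ill-formed for the other, and then exactly one of the two runs is a loss. So the runs are not
  compared for equality. It is shown that a win with bit 0 is at most as likely as a non-win with
  bit 1, and a loss on either side makes this comparison trivial. Failures depend on the data as
  well; the simulator never fails and pays the overflow probability per query. Two features of the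
  machine shape the rest. \<open>Fork\<close> can double a tree at unit cost, so each time bound is
  accompanied by a size bound, and for unknown programs only the depth of the output is bounded,
  which suffices for the length of a bit string. And \<open>ppt\<close> demands halting whatever the
  oracle answers, so simulating programs must cut off answers beyond a fixed size.\<close>

lemma bind_comp_assoc:
  "bind_comp (bind_comp m f) g = bind_comp m (\<lambda>x. bind_comp (f x) g)"
  by (induction m) auto

lemma bind_comp_Done [simp]: "bind_comp m Done = m"
  by (induction m) auto

lemma interact_bind:
  "interact orc (bind_comp m f) s = bind_pmf (interact orc m s) (\<lambda>(x, s'). interact orc (f x) s')"
proof (induction m arbitrary: s)
  case (Choose n g)
  then show ?case by (simp add: bind_assoc_pmf)
next
  case (Ask q g)
  then show ?case by (simp add: bind_assoc_pmf split_def)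
qed (simp add: bind_return_pmf)

lemma outcomes_bind: "outcomes (bind_comp m f) = (\<Union>x\<in>outcomes m. outcomes (f x))"
  by (induction m) auto

lemma outcomes_interact: "z \<in> set_pmf (interact orc m s) \<Longrightarrow> fst z \<in> outcomes m"
proof (induction m arbitrary: s z)
  case (Choose n g)
  have "set_pmf (pmf_of_set {..n}) = {..n}" by (rule set_pmf_of_set) auto
  with Choose.prems obtain i where "i \<le> n" "z \<in> set_pmf (interact orc (g i) s)" by auto
  then have "fst z \<in> outcomes (g i)" using Choose.IH by blast
  then show ?case using \<open>i \<le> n\<close> by auto
next
  case (Ask q g)
  then obtain r s' where "z \<in> set_pmf (interact orc (g r) s')" by auto
  then have "fst z \<in> outcomes (g r)" using Ask.IH by blast
  then show ?case by auto
qed simp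

text \<open>Related computations make the same choices and queries in the same order, so they stay
  coupled under every oracle. Branches beyond \<open>n\<close> of a choice are never sampled and are
  left free, whereas every answer to a query has to be followed.\<close>

inductive crel :: "('a \<Rightarrow> 'b \<Rightarrow> bool) \<Rightarrow> 'a comp \<Rightarrow> 'b comp \<Rightarrow> bool" for R where
  Done: "R x y \<Longrightarrow> crel R (Done x) (Done y)"
| Choose: "(\<And>i. i \<le> n \<Longrightarrow> crel R (f i) (g i)) \<Longrightarrow> crel R (Choose n f) (Choose n g)"
| Ask: "(\<And>r. crel R (f r) (g r)) \<Longrightarrow> crel R (Ask q f) (Ask q g)"

inductive_cases crel_DoneE: "crel R m (Done y)"

lemma crel_bind:
  assumes "crel R m m'"
    and "\<And>x y. x \<in> outcomes m \<Longrightarrow> y \<in> outcomes m' \<Longrightarrow> R x y \<Longrightarrow> crel S (f x) (g y)"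
  shows "crel S (bind_comp m f) (bind_comp m' g)"
  using assms
proof (induction)
  case (Choose n h h')
  show ?case by (auto intro!: crel.Choose Choose.IH Choose.prems)
next
  case (Ask h h' q)
  show ?case by (auto intro!: crel.Ask Ask.IH Ask.prems)
qed auto

lemma crel_mono:
  assumes "crel R m m'" and "\<And>x y. x \<in> outcomes m \<Longrightarrow> y \<in> outcomes m' \<Longrightarrow> R x y \<Longrightarrow> S x y"
  shows "crel S m m'"
  using crel_bind[OF assms(1), of S Done Done] assms(2) by (auto intro: crel.Done)

lemma crel_outcomes:
  assumes "crel R m m'" and "x \<in> outcomes m"
  shows "\<exists>y\<in>outcomes m'. R x y"
  using assms by induction fastforce+

lemma crel_interact:
  assumes "crel R m m'"
  shows "rel_pmf (\<lambda>z z'. R (fst z) (fst z') \<and> snd z = snd z') (interact orc m s) (interact orc m' s)"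
  using assms
proof (induction arbitrary: s)
  case (Choose n f g)
  have "set_pmf (pmf_of_set {..n}) = {..n}" by (rule set_pmf_of_set) auto
  then have "rel_pmf (\<lambda>i j. i = j \<and> i \<le> n) (pmf_of_set {..n}) (pmf_of_set {..n})"
    by (intro rel_pmf_reflI) auto
  then show ?case using Choose by (auto intro: rel_pmf_bindI)
next
  case (Ask f g q)
  have "rel_pmf (=) (orc s q) (orc s q)" by (simp add: pmf.rel_eq)
  then show ?case by (auto intro!: rel_pmf_bindI[where R="(=)"] Ask)
qed simp

section \<open>Closure of polynomial bounds under arithmetic and composition\<close>

section \<open>Polynomial bounds\<close>

text \<open>The form \<open>k ^ c + c\<close> is not visibly closed under sums and products, but
  \<open>c * (k + 1) ^ d\<close> is; bounds are translated back and forth between the two.\<close>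

lemma poly_boundedI:
  assumes "\<And>k. f k \<le> c * (k + 1) ^ d"
  shows "poly_bounded f"
  unfolding poly_bounded_def
proof (intro exI allI)
  fix k
  \<comment> \<open>For \<open>k \<ge> 2\<close> the estimates
    \<open>c \<le> 2 ^ c \<le> k ^ c\<close> and \<open>k + 1 \<le> k ^ 2\<close> account for the
    exponent \<open>c + 2 * d\<close>; for \<open>k \<le> 1\<close> the additive constant covers
    \<open>c * 2 ^ d\<close>.\<close>
  let ?e = "c + 2 * d + c * 2 ^ d"
  show "f k \<le> k ^ ?e + ?e"
  proof (cases "k \<ge> 2")
    case True
    have "c * (k + 1) ^ d \<le> 2 ^ c * (k ^ 2) ^ d"
    proof (intro mult_mono power_mono)
      have "k + 1 \<le> 2 * k" "2 * k \<le> k * k" using True by auto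
      then show "k + 1 \<le> k\<^sup>2" unfolding power2_eq_square by linarith
    qed (use less_exp[of c] in auto)
    also have "\<dots> \<le> k ^ c * (k ^ 2) ^ d" using True by (intro mult_mono power_mono) auto
    also have "\<dots> = k ^ (c + 2 * d)" by (simp add: power_add power_mult)
    also have "\<dots> \<le> k ^ ?e" using True by (intro power_increasing) auto
    finally show ?thesis using assms[of k] by linarith
  next
    case False
    then have "k + 1 \<le> 2" by simp
    then have "c * (k + 1) ^ d \<le> c * 2 ^ d" by (intro mult_mono power_mono) auto
    then show ?thesis using assms[of k] by linarith
  qed
qed

lemma poly_boundedE:
  assumes "poly_bounded f"
  obtains c where "\<And>k. f k \<le> c * (k + 1) ^ c"
proof -
  obtain c where c: "\<And>k. f k \<le> k ^ c + c" using assms unfolding poly_bounded_def by auto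
  have "f k \<le> (c + 1) * (k + 1) ^ (c + 1)" for k
  proof -
    have "k ^ c \<le> (k + 1) ^ c" by (intro power_mono) auto
    also have "\<dots> \<le> (k + 1) ^ (c + 1)" by (intro power_increasing) auto
    finally have "k ^ c \<le> (k + 1) ^ (c + 1)" .
    moreover have "c * 1 \<le> c * (k + 1) ^ (c + 1)" by (intro mult_le_mono2 one_le_power) simp
    ultimately show ?thesis using c[of k] unfolding add_mult_distrib by linarith
  qed
  then show ?thesis using that by blast
qed

text \<open>Monotonicity allows a time bound at the actual size of an intermediate value to be
  replaced by the bound at an estimate of this size, as composition of programs requires.\<close>

definition pmono :: "(nat \<Rightarrow> nat) \<Rightarrow> bool" where
  "pmono g \<longleftrightarrow> mono g \<and> poly_bounded g"

lemma pmonoD: "pmono g \<Longrightarrow> x \<le> y \<Longrightarrow> g x \<le> g y"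
  by (simp add: pmono_def monoD)

named_theorems pmono_intros

lemma pmono_const [pmono_intros]: "pmono (\<lambda>_. c)"
  unfolding pmono_def by (auto intro!: monoI poly_boundedI[of _ c 0])

lemma pmono_id [pmono_intros]: "pmono (\<lambda>x. x)"
  unfolding pmono_def by (auto intro!: monoI poly_boundedI[of _ 1 1])

lemma pmono_add [pmono_intros]:
  assumes "pmono f" and "pmono g"
  shows "pmono (\<lambda>x. f x + g x)"
proof -
  obtain c d where c: "\<And>k. f k \<le> c * (k + 1) ^ c" and d: "\<And>k. g k \<le> d * (k + 1) ^ d"
    using assms unfolding pmono_def by (metis poly_boundedE)
  have "f k + g k \<le> (c + d) * (k + 1) ^ (c + d)" for k
  proof -
    have "c * (k + 1) ^ c \<le> c * (k + 1) ^ (c + d)" "d * (k + 1) ^ d \<le> d * (k + 1) ^ (c + d)"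
      by (intro mult_mono power_increasing; simp)+
    then show ?thesis using c[of k] d[of k] unfolding add_mult_distrib by linarith
  qed
  then have "poly_bounded (\<lambda>x. f x + g x)" by (rule poly_boundedI)
  then show ?thesis using assms unfolding pmono_def by (auto intro!: monoI add_mono dest: monoD)
qed

lemma pmono_Suc [pmono_intros]: "pmono f \<Longrightarrow> pmono (\<lambda>x. Suc (f x))"
  using pmono_add[of f "\<lambda>_. 1"] pmono_const[of 1] by simp

lemma pmono_mult [pmono_intros]:
  assumes "pmono f" and "pmono g"
  shows "pmono (\<lambda>x. f x * g x)"
proof -
  obtain c d where c: "\<And>k. f k \<le> c * (k + 1) ^ c" and d: "\<And>k. g k \<le> d * (k + 1) ^ d"
    using assms unfolding pmono_def by (metis poly_boundedE)
  have "f k * g k \<le> (c * d) * (k + 1) ^ (c + d)" for k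
    using mult_mono[OF c[of k] d[of k]] by (simp add: power_add mult_ac)
  then have "poly_bounded (\<lambda>x. f x * g x)" by (rule poly_boundedI)
  then show ?thesis using assms unfolding pmono_def by (auto intro!: monoI mult_mono dest: monoD)
qed

lemma poly_bounded_comp:
  assumes "poly_bounded f" and "poly_bounded g"
  shows "poly_bounded (\<lambda>x. g (f x))"
proof -
  obtain c d where c: "\<And>k. f k \<le> c * (k + 1) ^ c" and d: "\<And>k. g k \<le> d * (k + 1) ^ d"
    using assms by (metis poly_boundedE)
  have "g (f k) \<le> (d * (c + 1) ^ d) * (k + 1) ^ (c * d)" for k
  proof -
    have "f k + 1 \<le> (c + 1) * (k + 1) ^ c"
      using c[of k] one_le_power[of "k + 1" c] unfolding add_mult_distrib by linarith
    then have "(f k + 1) ^ d \<le> ((c + 1) * (k + 1) ^ c) ^ d" by (rule power_mono) simp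
    then have "d * (f k + 1) ^ d \<le> d * ((c + 1) * (k + 1) ^ c) ^ d" by simp
    then show ?thesis using d[of "f k"] unfolding power_mult_distrib
      by (metis le_trans mult.assoc power_mult)
  qed
  then show "poly_bounded (\<lambda>x. g (f x))" by (rule poly_boundedI)
qed

lemma pmono_comp:
  assumes "pmono g" and "pmono f"
  shows "pmono (\<lambda>x. g (f x))"
  using assms poly_bounded_comp[of f g] unfolding pmono_def by (auto intro!: monoI dest: monoD)

lemma pmono_power [pmono_intros]: "pmono f \<Longrightarrow> pmono (\<lambda>x. f x ^ d)"
  by (induction d) (auto intro: pmono_intros)

lemma poly_bounded_pmono:
  assumes "poly_bounded f"
  obtains g where "pmono g" and "\<And>x. f x \<le> g x"
proof -
  obtain c where "\<And>k. f k \<le> k ^ c + c" using assms unfolding poly_bounded_def by auto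
  moreover have "pmono (\<lambda>k. k ^ c + c)" by (intro pmono_intros)
  ultimately show ?thesis using that by blast
qed

section \<open>Programs that meet a specification within a time bound\<close>

section \<open>Running programs\<close>

text \<open>Encodings are chosen to coincide: a number is a list of units, \<open>Some x\<close> is
  the pair \<open>(x, ())\<close>, and a nonempty list is the pair of its head and tail. Conversions
  between these types then cost nothing.\<close>

class codable =
  fixes enc :: "'a \<Rightarrow> data"

instantiation data :: codable
begin
definition enc_data :: "data \<Rightarrow> data" where [simp]: "enc_data d = d"
instance ..
end

instantiation unit :: codable
begin
definition enc_unit :: "unit \<Rightarrow> data" where [simp]: "enc_unit d = Atom"
instance ..
end

instantiation bool :: codable
begin
definition enc_bool :: "bool \<Rightarrow> data" where "enc_bool b = (if b then Cell Atom Atom else Atom)"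
instance ..
end

instantiation nat :: codable
begin
definition enc_nat :: "nat \<Rightarrow> data" where "enc_nat = data_of_nat"
instance ..
end

instantiation prod :: (codable, codable) codable
begin
definition enc_prod :: "'a \<times> 'b \<Rightarrow> data" where "enc_prod z = Cell (enc (fst z)) (enc (snd z))"
instance ..
end

instantiation list :: (codable) codable
begin
definition enc_list :: "'a list \<Rightarrow> data" where "enc_list xs = data_of_list (map enc xs)"
instance ..
end

instantiation option :: (codable) codable
begin
definition enc_option :: "'a option \<Rightarrow> data" where "enc_option z = data_of_option (map_option enc z)"
instance ..
end

lemma enc_pair [simp]: "enc (a, b) = Cell (enc a) (enc b)"
  by (simp add: enc_prod_def)

lemma enc_Nil [simp]: "enc [] = Atom" and enc_Cons [simp]: "enc (x # xs) = Cell (enc x) (enc xs)"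
  by (simp_all add: enc_list_def)

lemma enc_None [simp]: "enc None = Atom" and enc_Some [simp]: "enc (Some x) = Cell (enc x) Atom"
  by (simp_all add: enc_option_def)

lemma enc_bits: "enc bs = data_of_bits bs"
  by (simp add: enc_list_def data_of_bits_def enc_bool_def[abs_def])

lemma enc_bits_list: "enc xs = data_of_bits_list xs"
  by (simp add: enc_list_def data_of_bits_list_def enc_bits[abs_def])

lemma bool_of_data_simps [simp]:
  "bool_of_data (enc b) = b" "\<not> bool_of_data Atom" "bool_of_data (Cell x y)"
  by (simp_all add: bool_of_data_def enc_bool_def)

definition esize :: "'a::codable \<Rightarrow> nat" where
  "esize a = size (enc a)"

lemma esize_simps [simp]:
  "esize (a, b) = Suc (esize a + esize b)"
  "esize [] = 0" "esize (x # xs) = Suc (esize x + esize xs)"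
  "esize None = 0" "esize (Some x) = Suc (esize x)"
  "esize () = 0" "esize d = size (d :: data)"
  by (simp_all add: esize_def)

lemma esize_fst: "esize z = Suc (esize (fst z) + esize (snd z))"
  by (cases z) simp

lemma esize_bool: "esize (b::bool) \<le> 1"
  by (simp add: esize_def enc_bool_def)

lemma enc_0 [simp]: "enc (0::nat) = Atom" and enc_Suc [simp]: "enc (Suc n) = Cell Atom (enc n)"
  by (simp_all add: enc_nat_def data_of_nat_def)

lemma esize_nat [simp]: "esize (n::nat) = n"
  by (induction n) (simp_all add: esize_def)

lemma esize_append [simp]: "esize (xs @ ys) = esize xs + esize ys"
  by (induction xs) auto

lemma esize_mem: "x \<in> set xs \<Longrightarrow> esize x < esize xs"
  by (induction xs) auto

lemma length_le_esize: "length xs \<le> esize xs"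
  by (induction xs) auto

text \<open>\<open>N\<close> bounds the time spent, for every budget of at least \<open>N\<close>.
  The specification \<open>m\<close> has no clock; by \<open>crel\<close> it agrees with the program
  choice by choice and query by query, so it can replace the program in any game.\<close>

definition runs :: "(nat \<Rightarrow> (data \<times> nat) option comp) \<Rightarrow> nat \<Rightarrow> 'b::codable comp \<Rightarrow> bool" where
  "runs F N m \<longleftrightarrow>
     (\<forall>t\<ge>N. crel (\<lambda>z b. \<exists>t'. z = Some (enc b, t') \<and> t' \<le> t \<and> t \<le> t' + N) (F t) m)"

lemma runs_mono: "runs F N m \<Longrightarrow> N \<le> M \<Longrightarrow> runs F M m"
  unfolding runs_def by (intro allI impI, drule spec, drule mp, erule (1) order_trans) (auto elim!: crel_mono)

lemma runs_ret: "runs (\<lambda>t. Done (Some (enc b, t))) 0 (Done b)"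
  unfolding runs_def by (auto intro: crel.Done)

lemma runs_pay: "runs F N m \<Longrightarrow> runs (\<lambda>t. pay a t F) (N + a) m"
  unfolding runs_def pay_def
proof (intro allI impI)
  fix t assume "\<forall>t\<ge>N. crel (\<lambda>z b. \<exists>t'. z = Some (enc b, t') \<and> t' \<le> t \<and> t \<le> t' + N) (F t) m"
    and t: "N + a \<le> t"
  then have "crel (\<lambda>z b. \<exists>t'. z = Some (enc b, t') \<and> t' \<le> t - a \<and> t - a \<le> t' + N) (F (t - a)) m"
    by simp
  then show "crel (\<lambda>z b. \<exists>t'. z = Some (enc b, t') \<and> t' \<le> t \<and> t \<le> t' + (N + a))
     (if t < a then Done None else F (t - a)) m"
    using t by (auto elim!: crel_mono)
qed

lemma crel_Done_iff: "crel R m (Done y) \<longleftrightarrow> (\<exists>x. m = Done x \<and> R x y)"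
  by (auto elim: crel_DoneE intro: crel.Done)

lemma runs_Done_cong: "runs F N (Done a) \<Longrightarrow> enc a = enc b \<Longrightarrow> runs F N (Done b)"
  unfolding runs_def crel_Done_iff by simp

lemma exec_fun:
  "exec Id x = (\<lambda>t. pay 1 t (\<lambda>t. Done (Some (x, t))))"
  "exec Nul x = (\<lambda>t. pay 1 t (\<lambda>t. Done (Some (Atom, t))))"
  "exec Car x = (\<lambda>t. pay 1 t (\<lambda>t. Done (Some (car x, t))))"
  "exec Cdr x = (\<lambda>t. pay 1 t (\<lambda>t. Done (Some (cdr x, t))))"
  "exec (Fork p q) x = (\<lambda>t. pay 1 t (\<lambda>t.
     and_then (exec p x t) (\<lambda>y t. and_then (exec q x t) (\<lambda>z t. Done (Some (Cell y z, t))))))"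
  "exec (Seq p q) x = (\<lambda>t. pay 1 t (\<lambda>t. and_then (exec p x t) (exec q)))"
  "exec (Cond c p q) x = (\<lambda>t. pay 1 t (\<lambda>t.
     and_then (exec c x t) (\<lambda>v t. if bool_of_data v then exec p x t else exec q x t)))"
  by (rule ext, simp only: exec.simps)+

lemma runs_and_then:
  assumes "runs F N m" and "\<And>b. b \<in> outcomes m \<Longrightarrow> runs (G (enc b)) M (h b)"
  shows "runs (\<lambda>t. and_then (F t) G) (N + M) (bind_comp m h)"
  unfolding runs_def
proof (intro allI impI)
  fix t assume t: "N + M \<le> t"
  then have *: "crel (\<lambda>z b. \<exists>t'. z = Some (enc b, t') \<and> t' \<le> t \<and> t \<le> t' + N) (F t) m"
    using assms(1) by (simp add: runs_def)
  show "crel (\<lambda>z b. \<exists>t'. z = Some (enc b, t') \<and> t' \<le> t \<and> t \<le> t' + (N + M))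
          (and_then (F t) G) (bind_comp m h)"
    unfolding and_then_def
  proof (rule crel_bind[OF *])
    fix z b assume b: "b \<in> outcomes m"
      and "\<exists>t'. z = Some (enc b, t') \<and> t' \<le> t \<and> t \<le> t' + N"
    then obtain t' where z: "z = Some (enc b, t')" and t': "t' \<le> t" "t \<le> t' + N" by auto
    have "crel (\<lambda>z b. \<exists>s. z = Some (enc b, s) \<and> s \<le> t' \<and> t' \<le> s + M) (G (enc b) t') (h b)"
      using assms(2)[OF b] t t' by (simp add: runs_def)
    then show "crel (\<lambda>z b. \<exists>s. z = Some (enc b, s) \<and> s \<le> t \<and> t \<le> s + (N + M))
       (case z of None \<Rightarrow> Done None | Some (y, t) \<Rightarrow> G y t) (h b)"
      using t' by (auto simp: z elim!: crel_mono)
  qed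
qed

lemma runs_Id: "runs (exec Id (enc b)) 1 (Done b)"
  and runs_Nul: "runs (exec Nul x) 1 (Done ())"
  unfolding exec_fun using runs_pay[OF runs_ret, of 1 b] runs_pay[OF runs_ret, of 1 "()"] by simp_all

lemma runs_fst: "runs (exec Car (enc (a, b))) 1 (Done a)"
  and runs_hd: "runs (exec Car (enc (x # xs))) 1 (Done x)"
  and runs_snd: "runs (exec Cdr (enc (a, b))) 1 (Done b)"
  and runs_tl: "runs (exec Cdr (enc (x # xs))) 1 (Done xs)"
  unfolding exec_fun
  using runs_pay[OF runs_ret, of 1 a] runs_pay[OF runs_ret, of 1 b]
    runs_pay[OF runs_ret, of 1 x] runs_pay[OF runs_ret, of 1 xs] by simp_all

lemma runs_Seq:
  assumes "runs (exec p x) N m" and "\<And>b. b \<in> outcomes m \<Longrightarrow> runs (exec q (enc b)) M (h b)"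
  shows "runs (exec (Seq p q) x) (Suc (N + M)) (bind_comp m h)"
proof -
  have "runs (\<lambda>t. and_then (exec p x t) (exec q)) (N + M) (bind_comp m h)"
    by (rule runs_and_then) fact+
  from runs_pay[OF this, of 1] show ?thesis unfolding exec_fun by simp
qed

lemma runs_Seq_Done:
  assumes "runs (exec p x) N (Done b)" and "runs (exec q (enc b)) M m"
  shows "runs (exec (Seq p q) x) (Suc (N + M)) m"
  using runs_Seq[OF assms(1), of q M "\<lambda>_. m"] assms(2) by simp

lemma runs_Fork:
  assumes "runs (exec p x) N m" and "\<And>a. a \<in> outcomes m \<Longrightarrow> runs (exec q x) M (h a)"
  shows "runs (exec (Fork p q) x) (Suc (N + M)) (bind_comp m (\<lambda>a. bind_comp (h a) (\<lambda>b. Done (a, b))))"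
proof -
  have "runs (\<lambda>t. and_then (exec q x t) (\<lambda>z t. Done (Some (Cell (enc a) z, t)))) (M + 0)
          (bind_comp (h a) (\<lambda>b. Done (a, b)))" if "a \<in> outcomes m" for a
    by (intro runs_and_then assms that) (use runs_ret[of "(a, b)" for b] in auto)
  then have "runs (\<lambda>t. and_then (exec p x t) (\<lambda>y t. and_then (exec q x t) (\<lambda>z t. Done (Some (Cell y z, t)))))
     (N + M) (bind_comp m (\<lambda>a. bind_comp (h a) (\<lambda>b. Done (a, b))))"
    by (intro runs_and_then[OF assms(1)]) auto
  from runs_pay[OF this, of 1] show ?thesis unfolding exec_fun by simp
qed

lemma runs_Fork_Done:
  assumes "runs (exec p x) N (Done a)" and "runs (exec q x) M m"
  shows "runs (exec (Fork p q) x) (Suc (N + M)) (bind_comp m (\<lambda>b. Done (a, b)))"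
  using runs_Fork[OF assms(1), of q M "\<lambda>_. m"] assms(2) by simp

lemma runs_Fork2:
  assumes "runs (exec p x) N (Done a)" and "runs (exec q x) M (Done b)"
  shows "runs (exec (Fork p q) x) (Suc (N + M)) (Done (a, b))"
  using runs_Fork_Done[OF assms] by simp

lemma runs_Cond:
  assumes "runs (exec c x) N (Done b)" and "bool_of_data (enc b) = b'"
    and "b' \<Longrightarrow> runs (exec p x) M m" and "\<not> b' \<Longrightarrow> runs (exec q x) M m'"
  shows "runs (exec (Cond c p q) x) (Suc (N + M)) (if b' then m else m')"
proof -
  have "runs (\<lambda>t. and_then (exec c x t) (\<lambda>v t. if bool_of_data v then exec p x t else exec q x t))
    (N + M) (bind_comp (Done b) (\<lambda>b. if b' then m else m'))"
    by (rule runs_and_then[OF assms(1)]) (use assms(2-) in auto)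
  from runs_pay[OF this, of 1] show ?thesis unfolding exec_fun by (simp split del: if_split)
qed

section \<open>A calculus of polynomial-time functions and computations\<close>

section \<open>Polynomial-time typed functions\<close>

text \<open>The size bound on the outcomes does not follow from the time bound, since a tree can
  double its size in one step. Without it compositions would not be polynomial.\<close>

definition ptime :: "('a::codable \<Rightarrow> 'b::codable comp) \<Rightarrow> bool" where
  "ptime F \<longleftrightarrow> (\<exists>p g. pmono g \<and> (\<forall>a. runs (exec p (enc a)) (g (esize a)) (F a) \<and>
     (\<forall>b\<in>outcomes (F a). esize b \<le> g (esize a))))"

abbreviation fp :: "('a::codable \<Rightarrow> 'b::codable) \<Rightarrow> bool" where
  "fp f \<equiv> ptime (\<lambda>a. Done (f a))"

lemma ptimeI:
  assumes "pmono g" and "pmono h" and "\<And>a. runs (exec p (enc a)) (g (esize a)) (F a)"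
    and "\<And>a b. b \<in> outcomes (F a) \<Longrightarrow> esize b \<le> h (esize a)"
  shows "ptime F"
  unfolding ptime_def
proof (rule exI[of _ p], rule exI[of _ "\<lambda>x. g x + h x"], intro conjI allI ballI)
  show "runs (exec p (enc a)) (g (esize a) + h (esize a)) (F a)" for a
    by (rule runs_mono[OF assms(3)]) simp
qed (use assms in \<open>auto intro: pmono_add trans_le_add2\<close>)

lemma ptimeE:
  assumes "ptime F"
  obtains p g where "pmono g" and "\<And>a. runs (exec p (enc a)) (g (esize a)) (F a)"
    and "\<And>a b. b \<in> outcomes (F a) \<Longrightarrow> esize b \<le> g (esize a)"
  using assms unfolding ptime_def by auto

named_theorems fp_intros

lemma fp_id [fp_intros]: "fp (\<lambda>x. x)"
  by (rule ptimeI[where p=Id and g="\<lambda>_. 1" and h="\<lambda>x. x"]) (auto intro: pmono_intros runs_Id[simplified])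

lemma ptime_comp:
  assumes "ptime G" and "fp f"
  shows "ptime (\<lambda>a. G (f a))"
proof -
  obtain p g where p: "pmono g" "\<And>a. runs (exec p (enc a)) (g (esize a)) (G a)"
    "\<And>a b. b \<in> outcomes (G a) \<Longrightarrow> esize b \<le> g (esize a)" using assms(1) by (rule ptimeE) auto
  obtain q h where q: "pmono h" "\<And>a. runs (exec q (enc a)) (h (esize a)) (Done (f a))"
    "\<And>a. esize (f a) \<le> h (esize a)" using assms(2) by (rule ptimeE) auto
  have le: "g (esize (f a)) \<le> g (h (esize a))" for a using p(1) q(3) by (rule pmonoD)
  show ?thesis
    by (rule ptimeI[where p="Seq q p" and g="\<lambda>x. Suc (h x + g (h x))" and h="\<lambda>x. g (h x)"])
       (auto intro!: pmono_intros pmono_comp[OF p(1)] q p runs_Seq_Done intro: runs_mono[OF p(2) le]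
             order_trans[OF p(3) le])
qed

lemma ptime_pair:
  assumes "ptime F" and "ptime G"
  shows "ptime (\<lambda>a. bind_comp (F a) (\<lambda>b. bind_comp (G a) (\<lambda>c. Done (b, c))))"
proof -
  obtain p g where p: "pmono g" "\<And>a. runs (exec p (enc a)) (g (esize a)) (F a)"
    "\<And>a b. b \<in> outcomes (F a) \<Longrightarrow> esize b \<le> g (esize a)" using assms(1) by (rule ptimeE) auto
  obtain q h where q: "pmono h" "\<And>a. runs (exec q (enc a)) (h (esize a)) (G a)"
    "\<And>a b. b \<in> outcomes (G a) \<Longrightarrow> esize b \<le> h (esize a)" using assms(2) by (rule ptimeE) auto
  show ?thesis
  proof (rule ptimeI[where p="Fork p q" and g="\<lambda>x. Suc (g x + h x)" and h="\<lambda>x. Suc (g x + h x)"])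
    fix a b assume "b \<in> outcomes (bind_comp (F a) (\<lambda>b. bind_comp (G a) (\<lambda>c. Done (b, c))))"
    then show "esize b \<le> Suc (g (esize a) + h (esize a))"
      using p(3)[of _ a] q(3)[of _ a] by (fastforce simp: outcomes_bind intro: add_mono)
  qed (auto intro!: pmono_intros p q runs_Fork)
qed

lemma ptime_bind [fp_intros]:
  assumes "ptime F" and "ptime (\<lambda>z. G (fst z) (snd z))"
  shows "ptime (\<lambda>a. bind_comp (F a) (\<lambda>b. G a b))"
proof -
  \<comment> \<open>The argument has to survive the run of \<open>F\<close>, since \<open>G\<close>
    reads it too: a copy is forked off and paired with the result.\<close>
  have 1: "ptime (\<lambda>a. bind_comp (Done a) (\<lambda>b. bind_comp (F a) (\<lambda>c. Done (b, c))))"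
    by (rule ptime_pair[OF fp_id assms(1)])
  obtain p g where p: "pmono g"
    "\<And>a. runs (exec p (enc a)) (g (esize a)) (bind_comp (F a) (\<lambda>c. Done (a, c)))"
    "\<And>a b. b \<in> outcomes (bind_comp (F a) (\<lambda>c. Done (a, c))) \<Longrightarrow> esize b \<le> g (esize a)"
    using 1 by (rule ptimeE) auto
  obtain q h where q: "pmono h"
    "\<And>z. runs (exec q (enc z)) (h (esize z)) (G (fst z) (snd z))"
    "\<And>z b. b \<in> outcomes (G (fst z) (snd z)) \<Longrightarrow> esize b \<le> h (esize z)"
    using assms(2) by (rule ptimeE) auto
  have eq: "bind_comp (F a) (\<lambda>b. G a b)
      = bind_comp (bind_comp (F a) (\<lambda>c. Done (a, c))) (\<lambda>z. G (fst z) (snd z))" for a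
    by (simp add: bind_comp_assoc)
  have le: "h (esize z) \<le> h (g (esize a))" if "z \<in> outcomes (bind_comp (F a) (\<lambda>c. Done (a, c)))" for a z
    using p(3)[OF that] by (rule pmonoD[OF q(1)])
  show ?thesis unfolding eq
  proof (rule ptimeI[where p="Seq p q" and g="\<lambda>x. Suc (g x + h (g x))" and h="\<lambda>x. h (g x)"])
    fix a b assume "b \<in> outcomes (bind_comp (bind_comp (F a) (\<lambda>c. Done (a, c))) (\<lambda>z. G (fst z) (snd z)))"
    then obtain z where "z \<in> outcomes (bind_comp (F a) (\<lambda>c. Done (a, c)))" "b \<in> outcomes (G (fst z) (snd z))"
      by (auto simp: outcomes_bind)
    then show "esize b \<le> h (g (esize a))" using q(3) le le_trans by blast
  qed (auto intro!: pmono_intros pmono_comp[OF q(1)] p q intro: runs_Seq runs_mono[OF q(2) le])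
qed

lemma fp_pair [fp_intros]: "fp f \<Longrightarrow> fp g \<Longrightarrow> fp (\<lambda>x. (f x, g x))"
  using ptime_pair[of "\<lambda>a. Done (f a)" "\<lambda>a. Done (g a)"] by simp

text \<open>A program that returns its argument under two different types witnesses conversions.\<close>

lemma fp_same_enc:
  assumes "\<And>a. enc (f a) = enc a"
  shows "fp f"
  by (rule ptimeI[where p=Id and g="\<lambda>_. 1" and h="\<lambda>x. x"])
     (use assms in \<open>auto intro: pmono_intros runs_Done_cong[OF runs_Id[simplified]] simp: esize_def\<close>)

lemma fp_fst1: "fp fst"
  by (rule ptimeI[where p=Car and g="\<lambda>_. 1" and h="\<lambda>x. x"])
     (auto intro: pmono_intros runs_fst[simplified] simp: esize_fst)

lemma fp_snd1: "fp snd"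
  by (rule ptimeI[where p=Cdr and g="\<lambda>_. 1" and h="\<lambda>x. x"])
     (auto intro: pmono_intros runs_snd[simplified] simp: esize_fst)

lemmas fp_fst [fp_intros] = ptime_comp[OF fp_fst1]
lemmas fp_snd [fp_intros] = ptime_comp[OF fp_snd1]

lemma fp_const [fp_intros]: "fp (\<lambda>_. c)"
proof -
  have "\<exists>p N. \<forall>x. runs (exec p x) N (Done d)" for d :: data
  proof (induction d)
    case Atom
    have "runs (exec Nul x) 1 (Done Atom)" for x
      by (rule runs_Done_cong[OF runs_Nul]) simp
    then show ?case by (intro exI allI)
  next
    case (Cell d1 d2)
    from Cell(1) obtain p N where p: "\<forall>x. runs (exec p x) N (Done d1)" by (elim exE)
    from Cell(2) obtain q M where q: "\<forall>x. runs (exec q x) M (Done d2)" by (elim exE)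
    have "runs (exec (Fork p q) x) (Suc (N + M)) (Done (Cell d1 d2))" for x
      by (rule runs_Done_cong[OF runs_Fork2[OF p[rule_format] q[rule_format]]]) simp
    then show ?case by (intro exI allI)
  qed
  then obtain p N where p: "\<forall>x. runs (exec p x) N (Done (enc c))" by metis
  have "runs (exec p x) N (Done c)" for x
    by (rule runs_Done_cong[OF p[rule_format]]) simp
  then show ?thesis
    by (intro ptimeI[where p=p and g="\<lambda>_. N" and h="\<lambda>_. esize c"]) (auto intro: pmono_intros)
qed

lemma ptime_if [fp_intros]:
  assumes "fp c" and "ptime F" and "ptime G"
  shows "ptime (\<lambda>a. if c a then F a else G a)"
proof -
  obtain p g where p: "pmono g" "\<And>a. runs (exec p (enc a)) (g (esize a)) (F a)"
    "\<And>a b. b \<in> outcomes (F a) \<Longrightarrow> esize b \<le> g (esize a)" using assms(2) by (rule ptimeE) auto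
  obtain q h where q: "pmono h" "\<And>a. runs (exec q (enc a)) (h (esize a)) (G a)"
    "\<And>a b. b \<in> outcomes (G a) \<Longrightarrow> esize b \<le> h (esize a)" using assms(3) by (rule ptimeE) auto
  obtain r f where r: "pmono f" "\<And>a. runs (exec r (enc a)) (f (esize a)) (Done (c a))"
    using assms(1) by (rule ptimeE) auto
  have "runs (exec (Cond r p q) (enc a)) (Suc (f (esize a) + (g (esize a) + h (esize a))))
      (if c a then F a else G a)" for a
    by (rule runs_Cond[OF r(2)]) (auto intro: runs_mono[OF p(2)] runs_mono[OF q(2)])
  then show ?thesis
    by (intro ptimeI[where p="Cond r p q" and g="\<lambda>x. Suc (f x + (g x + h x))" and h="\<lambda>x. g x + h x"])
       (auto intro!: pmono_intros p q r split: if_splits intro: trans_le_add1[OF p(3)] trans_le_add2[OF q(3)])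
qed

lemma fp_if [fp_intros]: "fp c \<Longrightarrow> fp f \<Longrightarrow> fp g \<Longrightarrow> fp (\<lambda>a. if c a then f a else g a)"
  using ptime_if[of c "\<lambda>a. Done (f a)" "\<lambda>a. Done (g a)"] by (simp only: if_distrib[of Done])

lemma exec_Rand: "exec Rand x = (\<lambda>t. pay (1 + nat_of_data x) t (\<lambda>t.
     Choose (nat_of_data x) (\<lambda>i. Done (Some (data_of_nat i, t)))))"
  by (rule ext) simp

lemma ptime_Choose [fp_intros]:
  assumes "fp n"
  shows "ptime (\<lambda>a. Choose (n a) Done)"
proof -
  have 1: "runs (exec Rand (enc m)) (Suc m) (Choose m Done)" for m :: nat
  proof -
    have m: "nat_of_data (enc m) = m"
      by (induction m) (simp_all add: nat_of_data_def)
    have "runs (\<lambda>t. Choose m (\<lambda>i. Done (Some (data_of_nat i, t)))) 0 (Choose m Done)"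
      unfolding runs_def by (intro allI impI crel.Choose crel.Done) (simp add: enc_nat_def)
    from runs_pay[OF this, of "1 + m"] show ?thesis
      by (simp add: exec_Rand m)
  qed
  have "ptime (\<lambda>m. Choose m Done)"
    by (rule ptimeI[where p=Rand and g=Suc and h="\<lambda>x. x"])
       (use 1 pmono_Suc[OF pmono_id] in \<open>auto intro: pmono_intros\<close>)
  then show ?thesis by (rule ptime_comp[OF _ assms])
qed

section \<open>Iteration along a list\<close>

section \<open>Loops\<close>

primrec foldM :: "('b \<Rightarrow> 's \<Rightarrow> 's comp) \<Rightarrow> 'b list \<Rightarrow> 's \<Rightarrow> 's comp" where
  "foldM f [] s = Done s"
| "foldM f (x # xs) s = bind_comp (f x s) (foldM f xs)"

lemma foldM_Done: "foldM (\<lambda>x s. Done (f x s)) xs s = Done (fold f xs s)"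
  by (induction xs arbitrary: s) auto

lemma foldM_append: "foldM f (xs @ ys) s = bind_comp (foldM f xs s) (foldM f ys)"
proof (induction xs arbitrary: s)
  case (Cons x xs)
  then have "foldM f (xs @ ys) = (\<lambda>s. bind_comp (foldM f xs s) (foldM f ys))" by (rule ext)
  then show ?case by (simp add: bind_comp_assoc)
qed simp

lemma loop_Suc:
  "loop (Suc j) c b x = (\<lambda>t. pay 1 t (\<lambda>t. and_then (c x t) (\<lambda>v t.
     if bool_of_data v then and_then (b x t) (loop j c b) else Done (Some (x, t)))))"
  by (rule ext) simp

lemma runs_While:
  "(\<And>j. N \<le> j \<Longrightarrow> runs (loop j (exec c) (exec p) x) N m) \<Longrightarrow> runs (exec (While c p) x) N m"
  unfolding runs_def by simp

text \<open>Iterating a polynomial-time step may let the accumulator explode, hence the bound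
  \<open>G\<close> on all accumulators reachable on a prefix of the list. The loop state consists of
  the remaining list, the accumulator and the parameter; since the code of the empty list counts as
  false, \<open>Car\<close> is the test.\<close>

lemma ptime_foldM:
  fixes L :: "'a::codable \<Rightarrow> 'b::codable list" and init :: "'a \<Rightarrow> 's::codable"
  assumes "ptime (\<lambda>z. step (fst z) (fst (snd z)) (snd (snd z)))" and "fp L" and "fp init"
    and G: "pmono G"
    and bound: "\<And>a xs ys s. L a = xs @ ys \<Longrightarrow> s \<in> outcomes (foldM (step a) xs (init a))
                   \<Longrightarrow> esize s \<le> G (esize a)"
  shows "ptime (\<lambda>a. foldM (step a) (L a) (init a))"
proof -
  obtain ps gs where ps: "pmono gs"
    "\<And>a y s. runs (exec ps (enc (a, y, s))) (gs (esize (a, y, s))) (step a y s)"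
    using assms(1) by (rule ptimeE) (metis fst_conv snd_conv)
  obtain pl gl where pl: "pmono gl" "\<And>a. runs (exec pl (enc a)) (gl (esize a)) (Done (L a))"
    "\<And>a. esize (L a) \<le> gl (esize a)" using assms(2) by (rule ptimeE) auto
  obtain pin gin where pin: "pmono gin" "\<And>a. runs (exec pin (enc a)) (gin (esize a)) (Done (init a))"
    using assms(3) by (rule ptimeE) auto
  define arg where "arg = Fork (Seq Cdr Cdr) (Fork (Seq Car Car) (Seq Cdr Car))"
  define body where "body = Fork (Seq Car Cdr) (Fork (Seq arg ps) (Seq Cdr Cdr))"
  \<comment> \<open>Cost of one round: the step on a triple whose components are all bounded, and a
    constant for taking the state apart and rebuilding it.\<close>
  define C where "C x = gs (Suc (Suc (x + gl x + G x))) + 30" for x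
  have arg: "runs (exec arg (enc (y # ys, s, a))) 11 (Done (a, y, s))"
    for a :: 'a and y :: 'b and ys and s :: 's
    unfolding arg_def
    by (rule runs_mono[OF runs_Fork2[OF runs_Seq_Done[OF runs_snd runs_snd]
          runs_Fork2[OF runs_Seq_Done[OF runs_fst runs_hd] runs_Seq_Done[OF runs_snd runs_fst]]]]) simp
  have body: "runs (exec body (enc (y # ys, s, a))) (gs (esize (a, y, s)) + 25)
      (bind_comp (step a y s) (\<lambda>s'. Done (ys, s', a)))"
    for a :: 'a and y :: 'b and ys and s :: 's
    unfolding body_def
    by (rule runs_mono[OF runs_Fork_Done[OF runs_Seq_Done[OF runs_fst runs_tl]
          runs_Fork[OF runs_Seq_Done[OF arg ps(2)] runs_Seq_Done[OF runs_snd runs_snd]],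
          unfolded bind_comp_assoc bind_comp.simps]]) simp
  \<comment> \<open>The consumed prefix \<open>xs\<close> is carried along because only accumulators
    reachable through a prefix of \<open>L a\<close> are known to be small.\<close>
  have loop: "runs (loop j (exec Car) (exec body) (enc (zs, s, a))) (length zs * C (esize a) + 2)
      (bind_comp (foldM (step a) zs s) (\<lambda>s'. Done ([] :: 'b list, s', a)))"
    if "length zs < j" and "L a = xs @ zs" and "s \<in> outcomes (foldM (step a) xs (init a))"
    for a xs zs s j
    using that
  proof (induction zs arbitrary: j xs s)
    case Nil
    then obtain i where [simp]: "j = Suc i" by (cases j) auto
    have "runs (\<lambda>t. and_then (exec Car (enc ([] :: 'b list, s, a)) t)
         (\<lambda>v t. if bool_of_data v then and_then (exec body (enc ([] :: 'b list, s, a)) t) (loop i (exec Car) (exec body))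
                else Done (Some (enc ([] :: 'b list, s, a), t)))) (1 + 0)
         (bind_comp (Done []) (\<lambda>_ :: 'b list. Done ([] :: 'b list, s, a)))"
      by (rule runs_and_then[OF runs_fst]) (use runs_ret[of "([] :: 'b list, s, a)"] in simp)
    from runs_pay[OF this, of 1] show ?case unfolding \<open>j = Suc i\<close> loop_Suc by simp
  next
    case (Cons y ys)
    then obtain i where [simp]: "j = Suc i" by (cases j) auto
    let ?x = "enc (y # ys, s, a)"
    have y: "esize y \<le> gl (esize a)"
      using esize_mem[of y "L a"] Cons.prems(2) pl(3)[of a] by simp
    have s: "esize s \<le> G (esize a)" using bound Cons.prems by blast
    have le: "gs (esize (a, y, s)) + 25 \<le> C (esize a) - 2"
      using pmonoD[OF ps(1), of "esize (a, y, s)" "Suc (Suc (esize a + gl (esize a) + G (esize a)))"] y s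
      by (simp add: C_def)
    have "runs (\<lambda>t. and_then (exec body ?x t) (loop i (exec Car) (exec body)))
        (C (esize a) - 2 + (length ys * C (esize a) + 2))
        (bind_comp (bind_comp (step a y s) (\<lambda>s'. Done (ys, s', a)))
          (\<lambda>z. bind_comp (foldM (step a) ys (fst (snd z))) (\<lambda>s'. Done ([] :: 'b list, s', a))))"
    proof (rule runs_and_then[OF runs_mono[OF body le]])
      fix z assume "z \<in> outcomes (bind_comp (step a y s) (\<lambda>s'. Done (ys, s', a)))"
      then obtain s' where z: "z = (ys, s', a)" and s': "s' \<in> outcomes (step a y s)"
        by (auto simp: outcomes_bind)
      have "runs (loop i (exec Car) (exec body) (enc (ys, s', a))) (length ys * C (esize a) + 2)
         (bind_comp (foldM (step a) ys s') (\<lambda>s'. Done ([] :: 'b list, s', a)))"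
        by (rule Cons.IH[of _ "xs @ [y]"])
           (use Cons.prems s' in \<open>auto simp: foldM_append outcomes_bind\<close>)
      then show "runs (loop i (exec Car) (exec body) (enc z)) (length ys * C (esize a) + 2)
          (bind_comp (foldM (step a) ys (fst (snd z))) (\<lambda>s'. Done ([] :: 'b list, s', a)))"
        by (simp add: z)
    qed
    then have "runs (\<lambda>t. and_then (exec Car ?x t)
         (\<lambda>v t. if bool_of_data v then and_then (exec body ?x t) (loop i (exec Car) (exec body))
                else Done (Some (?x, t)))) (1 + (C (esize a) - 2 + (length ys * C (esize a) + 2)))
         (bind_comp (Done (y # ys)) (\<lambda>_. bind_comp (foldM (step a) (y # ys) s) (\<lambda>s'. Done ([] :: 'b list, s', a))))"
      by (intro runs_and_then[OF runs_fst]) (simp add: bind_comp_assoc)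
    from runs_pay[OF this, of 1] show ?case unfolding \<open>j = Suc i\<close> loop_Suc
      unfolding bind_comp.simps by (rule runs_mono) (simp add: C_def)
  qed
  define main where "main = Seq (Fork pl (Fork pin Id)) (Seq (While Car body) (Seq Cdr Car))"
  have "runs (exec main (enc a)) (gl (esize a) + gin (esize a) + (Suc (gl (esize a)) * C (esize a)) + 20)
     (foldM (step a) (L a) (init a))" for a
  proof -
    have 1: "runs (exec (Fork pl (Fork pin Id)) (enc a))
       (Suc (gl (esize a) + Suc (gin (esize a) + 1))) (Done (L a, init a, a))"
      by (intro runs_Fork2 pl pin runs_Id)
    let ?N = "length (L a) * C (esize a) + 2"
    \<comment> \<open>A loop is granted as many rounds as there is budget. As each round costs
      something, a budget that covers the cost exceeds the number of rounds.\<close>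
    have "length (L a) \<le> length (L a) * C (esize a)" by (simp add: C_def)
    then have 2: "runs (exec (While Car body) (enc (L a, init a, a))) ?N
       (bind_comp (foldM (step a) (L a) (init a)) (\<lambda>s'. Done ([] :: 'b list, s', a)))"
    proof (intro runs_While loop[where xs="[]"])
      show "length (L a) < j" if "?N \<le> j" for j
        using that \<open>length (L a) \<le> length (L a) * C (esize a)\<close> by linarith
    qed simp_all
    have 3: "runs (exec main (enc a)) (Suc (Suc (gl (esize a) + Suc (gin (esize a) + 1)) + Suc (?N + 3)))
       (bind_comp (bind_comp (foldM (step a) (L a) (init a)) (\<lambda>s'. Done ([] :: 'b list, s', a)))
          (\<lambda>z. Done (fst (snd z))))"
      unfolding main_def
    proof (intro runs_Seq_Done[OF 1] runs_Seq[OF 2])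
      fix b assume "b \<in> outcomes (bind_comp (foldM (step a) (L a) (init a)) (\<lambda>s'. Done ([] :: 'b list, s', a)))"
      then obtain s where "b = ([], s, a)" by (auto simp: outcomes_bind)
      then show "runs (exec (Seq Cdr Car) (enc b)) 3 (Done (fst (snd b)))"
        using runs_Seq_Done[OF runs_snd[of "[] :: 'b list" "(s, a)"] runs_fst] by (simp add: numeral_3_eq_3)
    qed
    have "length (L a) * C (esize a) \<le> gl (esize a) * C (esize a)"
      by (rule mult_le_mono1) (rule order_trans[OF length_le_esize pl(3)])
    then show ?thesis
      unfolding mult_Suc
      by (intro runs_mono[OF 3[unfolded bind_comp_assoc bind_comp.simps fst_conv snd_conv bind_comp_Done]])
         linarith
  qed
  then show ?thesis
    by (rule ptimeI[where h=G, rotated 2])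
       (use bound[of _ _ "[]"] in
          \<open>auto intro!: pmono_intros pmono_comp[OF ps(1)] pl pin G simp: C_def\<close>)
qed

section \<open>Polynomial-time operations on lists, unary numbers and trees\<close>

section \<open>A library of polynomial-time functions\<close>

lemma fold_esize_additive:
  assumes "\<And>y s. y \<in> set ys \<Longrightarrow> esize (f y s) \<le> esize s + K"
  shows "esize (fold f ys s) \<le> esize s + length ys * K"
  using assms
proof (induction ys arbitrary: s)
  case (Cons y ys)
  have "esize (fold f ys (f y s)) \<le> esize (f y s) + length ys * K" by (rule Cons) (use Cons in auto)
  moreover have "esize (f y s) \<le> esize s + K" using Cons by auto
  ultimately show ?case by simp
qed simp

lemma fp_bound:
  assumes "fp f"
  obtains g where "pmono g" and "\<And>a. esize (f a) \<le> g (esize a)"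
  using assms unfolding ptime_def by auto

lemma fp_fold_bounded:
  fixes L :: "'a::codable \<Rightarrow> 'b::codable list" and init :: "'a \<Rightarrow> 's::codable"
  assumes "fp (\<lambda>z. step (fst z) (fst (snd z)) (snd (snd z)))" and "fp L" and "fp init"
    and "pmono G" and "\<And>a xs ys. L a = xs @ ys \<Longrightarrow> esize (fold (step a) xs (init a)) \<le> G (esize a)"
  shows "fp (\<lambda>a. fold (step a) (L a) (init a))"
proof -
  have "ptime (\<lambda>a. foldM (\<lambda>y s. Done (step a y s)) (L a) (init a))"
    by (rule ptime_foldM[where G=G]) (use assms in \<open>auto simp: foldM_Done\<close>)
  then show ?thesis by (simp add: foldM_Done)
qed

text \<open>If the growth in a round is bounded independently of the accumulator, the growths only
  add up, and the accumulator stays polynomial.\<close>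

lemma fp_fold:
  fixes L :: "'a::codable \<Rightarrow> 'b::codable list" and init :: "'a \<Rightarrow> 's::codable"
  assumes step: "fp (\<lambda>z. step (fst z) (fst (snd z)) (snd (snd z)))" and L: "fp L" and init: "fp init"
    and G: "pmono G" "\<And>a y s. esize (step a y s) \<le> esize s + G (esize a + esize y)"
  shows "fp (\<lambda>a. fold (step a) (L a) (init a))"
proof -
  obtain gl where gl: "pmono gl" "\<And>a. esize (L a) \<le> gl (esize a)" using L by (rule fp_bound) (rule that)
  obtain gi where gi: "pmono gi" "\<And>a. esize (init a) \<le> gi (esize a)" using init by (rule fp_bound) (rule that)
  show ?thesis
  proof (rule fp_fold_bounded[OF step L init])
    show "pmono (\<lambda>x. gi x + gl x * G (x + gl x))"
      by (intro pmono_intros pmono_comp[OF G(1)] gl gi)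
    fix a xs ys assume eq: "L a = xs @ ys"
    have len: "length xs \<le> gl (esize a)"
      using length_le_esize[of "L a"] gl(2)[of a] by (simp add: eq)
    have "esize (fold (step a) xs (init a)) \<le> esize (init a) + length xs * G (esize a + gl (esize a))"
    proof (rule fold_esize_additive)
      fix y s assume "y \<in> set xs"
      then have "esize y \<le> gl (esize a)"
        using esize_mem[of y "L a"] gl(2)[of a] by (simp add: eq)
      then show "esize (step a y s) \<le> esize s + G (esize a + gl (esize a))"
        using G(2)[of a y s] pmonoD[OF G(1), of "esize a + esize y" "esize a + gl (esize a)"] by simp
    qed
    also have "\<dots> \<le> gi (esize a) + gl (esize a) * G (esize a + gl (esize a))"
      using gi(2)[of a] len by (intro add_mono mult_right_mono) auto
    finally show "esize (fold (step a) xs (init a)) \<le> gi (esize a) + gl (esize a) * G (esize a + gl (esize a))" .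
  qed
qed

subsection \<open>Lists\<close>

lemma fp_Cons [fp_intros]: "fp f \<Longrightarrow> fp g \<Longrightarrow> fp (\<lambda>x. f x # g x)"
  using ptime_comp[OF fp_same_enc[of "\<lambda>z. fst z # snd z"], of "\<lambda>x. (f x, g x)"] fp_pair[of f g]
  by (simp add: enc_prod_def)

lemma fp_Some [fp_intros]: "fp f \<Longrightarrow> fp (\<lambda>x. Some (f x))"
  using ptime_comp[OF fp_same_enc[of "\<lambda>z. Some (fst z)"], of "\<lambda>x. (f x, ())"] fp_pair[of f "\<lambda>_. ()"]
  by (simp add: enc_prod_def fp_const)

lemma fp_bool_of_data [fp_intros]:
  assumes "fp f"
  shows "fp (\<lambda>x. bool_of_data (f x))"
proof -
  have "runs (exec (Cond Id (Fork Nul Nul) Nul) d) 5 (Done (bool_of_data d))" for d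
  proof -
    have 1: "runs (exec (Fork Nul Nul) d) 3 (Done True)"
      by (rule runs_Done_cong[OF runs_mono[OF runs_Fork2[OF runs_Nul runs_Nul]]])
         (auto simp: enc_bool_def)
    have 2: "runs (exec Nul d) 3 (Done False)"
      by (rule runs_Done_cong[OF runs_mono[OF runs_Nul]]) (auto simp: enc_bool_def)
    have "runs (exec (Cond Id (Fork Nul Nul) Nul) d) (Suc (1 + 3))
        (if bool_of_data d then Done True else Done False)"
      by (rule runs_Cond[OF runs_Id[of d, simplified enc_data_def] _ 1 2]) simp
    then have "runs (exec (Cond Id (Fork Nul Nul) Nul) d) (Suc (1 + 3)) (Done (bool_of_data d))"
      by (cases "bool_of_data d") auto
    then show ?thesis by simp
  qed
  then have "fp (\<lambda>d. bool_of_data d)"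
    by (intro ptimeI[where p="Cond Id (Fork Nul Nul) Nul" and g="\<lambda>_. 5" and h="\<lambda>_. 1"])
       (auto intro: pmono_intros simp: esize_bool[simplified])
  from ptime_comp[OF this assms] show ?thesis .
qed

lemma fp_enc [fp_intros]: "fp f \<Longrightarrow> fp (\<lambda>x. enc (f x))"
  using ptime_comp[OF fp_same_enc[of enc], of f] by simp

lemma fp_not_Nil: "fp f \<Longrightarrow> fp (\<lambda>x. f x \<noteq> [])"
proof -
  assume "fp f"
  then have "fp (\<lambda>x. bool_of_data (enc (f x)))" by (intro fp_intros)
  moreover have "bool_of_data (enc xs) = (xs \<noteq> [])" for xs :: "'b list" by (cases xs) auto
  ultimately show ?thesis by simp
qed

lemma fp_not_None: "fp f \<Longrightarrow> fp (\<lambda>x. f x \<noteq> None)"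
proof -
  assume "fp f"
  then have "fp (\<lambda>x. bool_of_data (enc (f x)))" by (intro fp_intros)
  moreover have "bool_of_data (enc z) = (z \<noteq> None)" for z :: "'b option" by (cases z) auto
  ultimately show ?thesis by simp
qed

lemma ptime_dest_Cons:
  assumes "fp L"
  shows "fp (\<lambda>x. case L x of [] \<Rightarrow> None | y # ys \<Rightarrow> Some (y, ys))"
proof -
  define f :: "'b list \<Rightarrow> ('b \<times> 'b list) option"
    where "f xs = (case xs of [] \<Rightarrow> None | y # ys \<Rightarrow> Some (y, ys))" for xs
  have 0: "bool_of_data (enc xs) = (xs \<noteq> [])" for xs :: "'b list" by (cases xs) auto
  have "runs (exec (Cond Id (Fork Id Nul) Nul) (enc xs)) 5 (Done (f xs))" for xs
  proof -
    have 1: "runs (exec (Fork Id Nul) (enc xs)) 3 (Done (f xs))" if "xs \<noteq> []"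
      by (rule runs_Done_cong[OF runs_mono[OF runs_Fork2[OF runs_Id runs_Nul]]])
         (use that in \<open>auto simp: f_def neq_Nil_conv\<close>)
    have 2: "runs (exec Nul (enc xs)) 3 (Done (f xs))" if "\<not> xs \<noteq> []"
      by (rule runs_Done_cong[OF runs_mono[OF runs_Nul]]) (use that in \<open>auto simp: f_def\<close>)
    have "runs (exec (Cond Id (Fork Id Nul) Nul) (enc xs)) (Suc (1 + 3))
        (if xs \<noteq> [] then Done (f xs) else Done (f xs))"
      by (rule runs_Cond[OF runs_Id 0 1 2])
    then show ?thesis by simp
  qed
  moreover have "esize (f xs) \<le> Suc (esize xs)" for xs
    by (auto simp: f_def split: list.split)
  ultimately have "fp f"
    by (intro ptimeI[where p="Cond Id (Fork Id Nul) Nul" and g="\<lambda>_. 5" and h=Suc])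
       (auto intro: pmono_intros)
  from ptime_comp[OF this assms] show ?thesis by (simp add: f_def)
qed

lemma ptime_case_prod [fp_intros]:
  "ptime (\<lambda>x. F x (fst (g x)) (snd (g x))) \<Longrightarrow> ptime (\<lambda>x. case g x of (a, b) \<Rightarrow> F x a b)"
  by (simp add: split_def)

text \<open>The default argument of \<open>the\<close> makes it independent of the unspecified value of \<open>the None\<close>.\<close>

definition the_or :: "'a \<Rightarrow> 'a option \<Rightarrow> 'a" where
  "the_or d z = (case z of None \<Rightarrow> d | Some x \<Rightarrow> x)"

lemma the_or_simps [simp]: "the_or d None = d" "the_or d (Some x) = x"
  by (simp_all add: the_or_def)

lemma fp_the_or [fp_intros]:
  assumes "fp z" and "fp d"
  shows "fp (\<lambda>x. the_or (d x) (z x))"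
proof -
  have 0: "bool_of_data (enc z) = (z \<noteq> None)" for z :: "'b option" by (cases z) auto
  have "runs (exec (Cond Car (Seq Car Car) Cdr) (enc (z, d))) 5 (Done (the_or d z))" for z and d :: 'b
  proof -
    have 1: "runs (exec (Seq Car Car) (enc (z, d))) 3 (Done (the_or d z))" if ne: "z \<noteq> None"
    proof -
      obtain y where z: "z = Some y" using ne by auto
      have "runs (exec (Seq Car Car) (enc ((y, ()), d))) (Suc (1 + 1)) (Done y)"
        by (rule runs_Seq_Done[OF runs_fst runs_fst])
      then show ?thesis by (simp add: z numeral_3_eq_3)
    qed
    have 2: "runs (exec Cdr (enc (z, d))) 3 (Done (the_or d z))" if "\<not> z \<noteq> None"
      by (rule runs_Done_cong[OF runs_mono[OF runs_snd]]) (use that in auto)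
    have "runs (exec (Cond Car (Seq Car Car) Cdr) (enc (z, d))) (Suc (1 + 3))
        (if z \<noteq> None then Done (the_or d z) else Done (the_or d z))"
      by (rule runs_Cond[OF runs_fst 0 1 2])
    then show ?thesis by simp
  qed
  moreover have "esize (the_or d z) \<le> esize (z, d)" for z and d :: 'b by (cases z) auto
  ultimately have "fp (\<lambda>z. the_or (snd z) (fst z :: 'b option))"
    by (intro ptimeI[where p="Cond Car (Seq Car Car) Cdr" and g="\<lambda>_. 5" and h="\<lambda>x. x"])
       (auto intro: pmono_intros simp: split_paired_all)
  from ptime_comp[OF this fp_pair[OF assms]] show ?thesis by simp
qed

lemma ptime_case_option [fp_intros]:
  assumes "fp z" and "ptime F" and "ptime (\<lambda>w. G (fst w) (snd w))"
  shows "ptime (\<lambda>x. case z x of None \<Rightarrow> F x | Some y \<Rightarrow> G x y)"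
proof -
  \<comment> \<open>\<open>undefined\<close> is some fixed value of the type, so a program can
    produce it as a constant; its choice is irrelevant, because the branch is taken only if
    \<open>z x\<close> is a \<open>Some\<close>.\<close>
  have eq: "(case z x of None \<Rightarrow> F x | Some y \<Rightarrow> G x y)
      = (if z x \<noteq> None then G x (the_or undefined (z x)) else F x)" for x
    by (cases "z x") auto
  have "ptime (\<lambda>x. G (fst (x, the_or undefined (z x))) (snd (x, the_or undefined (z x))))"
    by (rule ptime_comp[OF assms(3)]) (intro fp_intros assms)
  then show ?thesis unfolding eq by (intro ptime_if fp_not_None assms) simp_all
qed

lemma fp_case_option [fp_intros]:
  "fp z \<Longrightarrow> fp f \<Longrightarrow> fp (\<lambda>w. g (fst w) (snd w)) \<Longrightarrow> fp (\<lambda>x. case z x of None \<Rightarrow> f x | Some y \<Rightarrow> g x y)"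
  using ptime_case_option[of z "\<lambda>x. Done (f x)" "\<lambda>x y. Done (g x y)"]
  by (simp add: option.case_distrib[of Done])

lemma ptime_case_list [fp_intros]:
  assumes "fp L" and "ptime F" and "ptime (\<lambda>w. G (fst w) (fst (snd w)) (snd (snd w)))"
  shows "ptime (\<lambda>x. case L x of [] \<Rightarrow> F x | y # ys \<Rightarrow> G x y ys)"
proof -
  have "ptime (\<lambda>x. case (case L x of [] \<Rightarrow> None | y # ys \<Rightarrow> Some (y, ys)) of
     None \<Rightarrow> F x | Some w \<Rightarrow> G x (fst w) (snd w))"
    by (intro ptime_case_option ptime_dest_Cons assms)
  moreover have "(case (case L x of [] \<Rightarrow> None | y # ys \<Rightarrow> Some (y, ys)) of
     None \<Rightarrow> F x | Some w \<Rightarrow> G x (fst w) (snd w)) = (case L x of [] \<Rightarrow> F x | y # ys \<Rightarrow> G x y ys)" for x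
    by (cases "L x") auto
  ultimately show ?thesis by simp
qed

lemma fp_case_list [fp_intros]:
  "fp L \<Longrightarrow> fp f \<Longrightarrow> fp (\<lambda>w. g (fst w) (fst (snd w)) (snd (snd w)))
   \<Longrightarrow> fp (\<lambda>x. case L x of [] \<Rightarrow> f x | y # ys \<Rightarrow> g x y ys)"
  using ptime_case_list[of L "\<lambda>x. Done (f x)" "\<lambda>x y ys. Done (g x y ys)"]
  by (simp add: list.case_distrib[of Done])

lemma fp_conj [fp_intros]: "fp f \<Longrightarrow> fp g \<Longrightarrow> fp (\<lambda>x. f x \<and> g x)"
  and fp_disj [fp_intros]: "fp f \<Longrightarrow> fp g \<Longrightarrow> fp (\<lambda>x. f x \<or> g x)"
  and fp_Not [fp_intros]: "fp f \<Longrightarrow> fp (\<lambda>x. \<not> f x)"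
proof -
  have eq: "(a \<and> b) = (if a then b else False)" "(a \<or> b) = (if a then True else b)"
    "(\<not> a) = (if a then False else True)" for a b by auto
  show "fp f \<Longrightarrow> fp g \<Longrightarrow> fp (\<lambda>x. f x \<and> g x)" "fp f \<Longrightarrow> fp g \<Longrightarrow> fp (\<lambda>x. f x \<or> g x)"
    "fp f \<Longrightarrow> fp (\<lambda>x. \<not> f x)"
    unfolding eq by (intro fp_if fp_const; assumption)+
qed

lemma fp_Nil_eq [fp_intros]: "fp f \<Longrightarrow> fp (\<lambda>x. f x = [])"
  using fp_Not[OF fp_not_Nil[of f]] by simp

lemma fp_None_eq [fp_intros]: "fp f \<Longrightarrow> fp (\<lambda>x. f x = None)"
  using fp_Not[OF fp_not_None[of f]] by simp

lemma fp_rev [fp_intros]: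
  assumes "fp f"
  shows "fp (\<lambda>x. rev (f x))"
proof -
  have "fp (\<lambda>x. fold (\<lambda>y s. y # s) (f x) [])"
    by (rule fp_fold[where G="\<lambda>x. Suc x"]) (intro fp_intros pmono_intros assms | simp)+
  then show ?thesis by (simp add: fold_Cons_rev)
qed

lemma fp_append [fp_intros]:
  assumes "fp f" and "fp g"
  shows "fp (\<lambda>x. f x @ g x)"
proof -
  have "fp (\<lambda>x. fold (\<lambda>y s. y # s) (rev (f x)) (g x))"
    by (rule fp_fold[where G="\<lambda>x. Suc x"]) (intro fp_intros pmono_intros assms | simp)+
  then show ?thesis by (simp add: fold_Cons_rev)
qed

lemma fold_map_rev: "fold (\<lambda>y s. f y # s) xs s = rev (map f xs) @ s"
  by (induction xs arbitrary: s) auto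

lemma fp_map [fp_intros]:
  assumes f: "fp (\<lambda>z. f (fst z) (snd z))" and L: "fp L"
  shows "fp (\<lambda>x. map (f x) (L x))"
proof -
  obtain g where g: "pmono g" "\<And>z. esize (f (fst z) (snd z)) \<le> g (esize z)"
    using f by (rule fp_bound) (rule that)
  have f': "fp (\<lambda>z. f (fst z) (fst (snd z)))"
    using ptime_comp[OF f, of "\<lambda>z. (fst z, fst (snd z))"] by (simp add: fp_intros)
  have "fp (\<lambda>x. fold (\<lambda>y s. f x y # s) (L x) [])"
  proof (rule fp_fold[where G="\<lambda>x. Suc (g (Suc x))"])
    show "fp (\<lambda>z. f (fst z) (fst (snd z)) # snd (snd z))" by (intro fp_intros f')
    show "esize (f a y # s) \<le> esize s + Suc (g (Suc (esize a + esize y)))" for a y s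
      using g(2)[of "(a, y)"] by simp
  qed (intro fp_intros L pmono_intros pmono_comp[OF g(1)])+
  then have "fp (\<lambda>x. rev (fold (\<lambda>y s. f x y # s) (L x) []))" by (rule fp_rev)
  then show ?thesis by (simp add: fold_map_rev)
qed

lemma fold_filter_rev: "fold (\<lambda>y s. if P y then y # s else s) xs s = rev (filter P xs) @ s"
  by (induction xs arbitrary: s) auto

lemma fp_filter [fp_intros]:
  assumes P: "fp (\<lambda>z. P (fst z) (snd z))" and L: "fp L"
  shows "fp (\<lambda>x. filter (P x) (L x))"
proof -
  have P': "fp (\<lambda>z. P (fst z) (fst (snd z)))"
    using ptime_comp[OF P, of "\<lambda>z. (fst z, fst (snd z))"] by (simp add: fp_intros)
  have "fp (\<lambda>x. fold (\<lambda>y s. if P x y then y # s else s) (L x) [])"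
    by (rule fp_fold[where G="\<lambda>x. Suc x"]) (intro fp_intros L P' pmono_intros | simp)+
  then have "fp (\<lambda>x. rev (fold (\<lambda>y s. if P x y then y # s else s) (L x) []))" by (rule fp_rev)
  then show ?thesis by (simp add: fold_filter_rev)
qed

lemma fp_concat [fp_intros]:
  assumes "fp L"
  shows "fp (\<lambda>x. concat (L x))"
proof -
  have "fp (\<lambda>x. fold (\<lambda>y s. y @ s) (rev (L x)) [])"
    by (rule fp_fold[where G="\<lambda>x. x"]) (intro fp_intros assms pmono_intros | simp)+
  moreover have "fold (\<lambda>y s. y @ s) (rev xs) s = concat xs @ s" for xs and s :: "'b list"
    by (induction xs arbitrary: s) auto
  ultimately show ?thesis by simp
qed

lemma fp_Bex [fp_intros]:
  assumes P: "fp (\<lambda>z. P (fst z) (snd z))" and L: "fp L"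
  shows "fp (\<lambda>x. \<exists>y\<in>set (L x). P x y)"
proof -
  have "fp (\<lambda>x. filter (P x) (L x) \<noteq> [])" by (intro fp_not_Nil fp_intros assms)
  then show ?thesis by (simp add: filter_empty_conv)
qed

lemma fp_Ball [fp_intros]:
  assumes P: "fp (\<lambda>z. P (fst z) (snd z))" and L: "fp L"
  shows "fp (\<lambda>x. \<forall>y\<in>set (L x). P x y)"
proof -
  have "fp (\<lambda>x. filter (\<lambda>y. \<not> P x y) (L x) = [])" by (intro fp_intros assms)
  then show ?thesis by (simp add: filter_empty_conv)
qed

subsection \<open>Natural numbers\<close>

lemma fp_replicate_unit:
  assumes "fp f"
  shows "fp (\<lambda>x. replicate (f x) ())"
proof -
  have "enc (replicate n ()) = enc n" for n by (induction n) auto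
  from ptime_comp[OF fp_same_enc[OF this] assms] show ?thesis .
qed

lemma fp_length [fp_intros]:
  assumes "fp f"
  shows "fp (\<lambda>x. length (f x))"
proof -
  have "enc (length xs) = enc xs" for xs :: "unit list" by (induction xs) auto
  from ptime_comp[OF fp_same_enc[OF this] fp_map[OF fp_const assms, of "()"]]
  show ?thesis by simp
qed

lemma fp_replicate [fp_intros]:
  assumes "fp n" and "fp f"
  shows "fp (\<lambda>x. replicate (n x) (f x))"
proof -
  have "fp (\<lambda>x. map (\<lambda>_. f x) (replicate (n x) ()))"
    by (intro fp_map fp_replicate_unit assms ptime_comp[OF assms(2) fp_fst1])
  then show ?thesis by (simp add: map_replicate_const)
qed

lemma fp_add [fp_intros]: "fp f \<Longrightarrow> fp g \<Longrightarrow> fp (\<lambda>x. f x + g x :: nat)"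
  using fp_length[OF fp_append[OF fp_replicate_unit[of f] fp_replicate_unit[of g]]] by simp

lemma fp_Suc [fp_intros]: "fp f \<Longrightarrow> fp (\<lambda>x. Suc (f x))"
  using fp_add[OF fp_const[of 1], of f] by simp

lemma fp_mult [fp_intros]: "fp f \<Longrightarrow> fp g \<Longrightarrow> fp (\<lambda>x. f x * g x :: nat)"
  using fp_length[OF fp_concat[OF fp_replicate[of f, OF _ fp_replicate_unit[of g]]]]
  by (simp add: length_concat sum_list_replicate)

lemma fp_power [fp_intros]: "fp f \<Longrightarrow> fp (\<lambda>x. f x ^ c :: nat)"
  by (induction c) (simp_all only: power.simps fp_const fp_mult)

lemma fp_drop [fp_intros]:
  assumes "fp n" and "fp f"
  shows "fp (\<lambda>x. drop (n x) (f x))"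
proof -
  have tl: "esize (case s of [] \<Rightarrow> [] | z # zs \<Rightarrow> zs) \<le> esize s" for s :: "'b list"
    by (cases s) auto
  have "fp (\<lambda>x. fold (\<lambda>y s. case s of [] \<Rightarrow> [] | z # zs \<Rightarrow> zs) (replicate (n x) ()) (f x))"
    by (rule fp_fold[where G="\<lambda>_. 0"])
       (intro fp_intros fp_replicate_unit assms pmono_intros | simp add: tl)+
  moreover have "fold (\<lambda>y s. case s of [] \<Rightarrow> [] | z # zs \<Rightarrow> zs) (replicate m ()) s = drop m s"
    for m and s :: "'b list"
    by (induction m arbitrary: s) (auto simp: drop_Suc split: list.split)
  ultimately show ?thesis by simp
qed

lemma fp_diff [fp_intros]: "fp f \<Longrightarrow> fp g \<Longrightarrow> fp (\<lambda>x. f x - g x :: nat)"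
  using fp_length[OF fp_drop[OF _ fp_replicate_unit[of f], of g]] by simp

lemma fp_take [fp_intros]: "fp n \<Longrightarrow> fp f \<Longrightarrow> fp (\<lambda>x. take (n x) (f x))"
proof -
  assume *: "fp n" "fp f"
  have "fp (\<lambda>x. rev (drop (length (f x) - n x) (rev (f x))))" by (intro fp_intros *)
  moreover have "rev (drop (length xs - m) (rev xs)) = take m xs" for m and xs :: "'b list"
    by (cases "m \<le> length xs") (simp_all add: rev_drop)
  ultimately show ?thesis by simp
qed

lemma fp_le [fp_intros]: "fp f \<Longrightarrow> fp g \<Longrightarrow> fp (\<lambda>x. f x \<le> (g x :: nat))"
proof -
  assume *: "fp f" "fp g"
  have "fp (\<lambda>x. replicate (f x - g x) () = [])" by (intro fp_intros fp_replicate_unit *)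
  then show ?thesis by simp
qed

lemma fp_less [fp_intros]: "fp f \<Longrightarrow> fp g \<Longrightarrow> fp (\<lambda>x. f x < (g x :: nat))"
  using fp_le[of "\<lambda>x. Suc (f x)" g] by (simp add: fp_Suc Suc_le_eq)

lemma fp_nat_eq [fp_intros]: "fp f \<Longrightarrow> fp g \<Longrightarrow> fp (\<lambda>x. f x = (g x :: nat))"
  unfolding eq_iff by (intro fp_intros)

lemma fp_upt [fp_intros]:
  assumes "fp n" and "fp m"
  shows "fp (\<lambda>x. [n x..<m x])"
proof -
  have *: "fp (\<lambda>x. length (fst (snd x) :: nat list))" by (intro fp_intros)
  have eq: "fold (\<lambda>y s. s @ [length s]) (replicate k ()) [0..<l] = [0..<l + k]" for k l
    by (induction k arbitrary: l) (auto simp del: upt_Suc simp: upt_Suc_append[symmetric] simp flip: add_Suc_right)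
  have sz: "esize [0..<l] \<le> l * l" for l by (induction l) auto
  obtain g where g: "pmono g" "\<And>a. m a \<le> g (esize a)" using fp_bound[OF assms(2)] by auto
  \<comment> \<open>Here a round adds the current length, which depends on the accumulator, so the
    additive rule does not apply. The accumulators are initial segments of the numbers and of at
    most quadratic size.\<close>
  have "fp (\<lambda>x. fold (\<lambda>y s. s @ [length s]) (replicate (m x) ()) [])"
  proof (rule fp_fold_bounded)
    show "pmono (\<lambda>x. g x * g x)" by (intro pmono_intros g)
    fix a xs ys assume "replicate (m a) () = xs @ ys"
    then have "length xs \<le> m a" by (metis le_add1 length_append length_replicate)
    moreover have "xs = replicate (length xs) ()" by (simp add: list_eq_iff_nth_eq)
    ultimately have xs: "xs = replicate (length xs) ()" "length xs \<le> m a" by auto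
    have "fold (\<lambda>y s. s @ [length s]) xs [] = [0..<length xs]"
      using eq[of "length xs" 0] xs(1) by simp
    also have "esize \<dots> \<le> g (esize a) * g (esize a)"
      using sz[of "length xs"] xs(2) g(2)[of a] by (meson le_trans mult_le_mono)
    finally show "esize (fold (\<lambda>y s. s @ [length s]) xs []) \<le> g (esize a) * g (esize a)" .
  qed (intro fp_intros fp_replicate_unit assms)+
  then have "fp (\<lambda>x. drop (n x) [0..<m x])" using eq[of _ 0] by (intro fp_drop assms) simp
  then show ?thesis by simp
qed

subsection \<open>Equality\<close>

definition fp_eq :: "'a::codable itself \<Rightarrow> bool" where
  "fp_eq _ \<longleftrightarrow> fp (\<lambda>z :: 'a \<times> 'a. fst z = snd z)"

lemma fp_eqD: "fp_eq TYPE('b::codable) \<Longrightarrow> fp f \<Longrightarrow> fp g \<Longrightarrow> fp (\<lambda>x. f x = (g x :: 'b))"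
  unfolding fp_eq_def using ptime_comp[of "\<lambda>z :: 'b \<times> 'b. Done (fst z = snd z)" "\<lambda>x. (f x, g x)"]
  by (simp add: fp_pair)

lemma fp_eq_bool: "fp_eq TYPE(bool)"
proof -
  have "fp (\<lambda>z :: bool \<times> bool. (fst z \<and> snd z) \<or> (\<not> fst z \<and> \<not> snd z))" by (intro fp_intros)
  moreover have "(a \<and> b) \<or> (\<not> a \<and> \<not> b) \<longleftrightarrow> a = b" for a b by auto
  ultimately show ?thesis unfolding fp_eq_def by simp
qed

lemma fp_eq_list:
  assumes "fp_eq TYPE('b::codable)"
  shows "fp_eq TYPE('b list)"
proof -
  \<comment> \<open>Running out of the second list resets the state to \<open>(False, [])\<close>,
    which is a fixed point. The lists agree exactly if the flag survives and nothing is left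
    over.\<close>
  let ?step = "\<lambda>y s. case snd s of [] \<Rightarrow> (False, []) | z # zs \<Rightarrow> (fst s \<and> z = y, zs :: 'b list)"
  have step: "esize (?step y s) \<le> esize s + 1" for y s
    using esize_bool[of "fst s \<and> hd (snd s) = y"] esize_bool[of False]
    by (cases s; cases "snd s") auto
  have *: "fold ?step xs (b, ys) = (True, []) \<longleftrightarrow> b \<and> xs = ys" for xs ys b
  proof (induction xs arbitrary: b ys)
    case (Cons x xs)
    have "fold ?step xs (False, []) = (False, [])" by (induction xs) auto
    then show ?case using Cons by (cases ys) auto
  qed auto
  have eq: "(fst s \<and> snd s = []) = (s = (True, []))" for s :: "bool \<times> 'b list" by (cases s) auto
  have "fp (\<lambda>z. fold ?step (fst z) (True, snd z))"
    by (rule fp_fold[where G="\<lambda>_. 1"]) (intro fp_intros fp_eqD[OF assms] pmono_intros step)+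
  then have "fp (\<lambda>z. fst (fold ?step (fst z) (True, snd z)) \<and> snd (fold ?step (fst z) (True, snd z)) = [])"
    by (intro fp_intros)
  then show ?thesis unfolding fp_eq_def eq * by simp
qed

lemmas fp_bits_eq [fp_intros] = fp_eqD[OF fp_eq_list[OF fp_eq_bool]]

subsection \<open>Decoding\<close>

lemma enc_list_of_data: "enc (list_of_data d) = d"
  by (induction d) auto

lemma list_of_enc [simp]: "list_of_data (enc xs) = map enc xs"
  by (induction xs) auto

lemma fp_list_of_data [fp_intros]: "fp f \<Longrightarrow> fp (\<lambda>x. list_of_data (f x))"
  by (rule ptime_comp[OF fp_same_enc]) (simp_all add: enc_list_of_data)

lemma fp_nat_of_data [fp_intros]: "fp f \<Longrightarrow> fp (\<lambda>x. nat_of_data (f x))"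
  unfolding nat_of_data_def by (intro fp_intros)

lemma fp_bits_of_data [fp_intros]: "fp f \<Longrightarrow> fp (\<lambda>x. bits_of_data (f x))"
  unfolding bits_of_data_def by (intro fp_intros)

lemma fp_bits_list_of_data [fp_intros]: "fp f \<Longrightarrow> fp (\<lambda>x. bits_list_of_data (f x))"
  unfolding bits_list_of_data_def by (intro fp_intros)

lemma fp_car [fp_intros]: "fp f \<Longrightarrow> fp (\<lambda>x. car (f x))"
  and fp_cdr [fp_intros]: "fp f \<Longrightarrow> fp (\<lambda>x. cdr (f x))"
proof -
  have "runs (exec Car d) 1 (Done (car d))" "runs (exec Cdr d) 1 (Done (cdr d))" for d
    unfolding exec_fun using runs_pay[OF runs_ret, of 1 "car d"] runs_pay[OF runs_ret, of 1 "cdr d"] by simp_all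
  moreover have "size (car d) \<le> size d" "size (cdr d) \<le> size d" for d by (cases d; simp)+
  ultimately have "fp car" and "fp cdr"
    by - (rule ptimeI[where p=Car and g="\<lambda>_. 1" and h="\<lambda>x. x"]
          ptimeI[where p=Cdr and g="\<lambda>_. 1" and h="\<lambda>x. x"]; simp add: pmono_intros)+
  then show "fp f \<Longrightarrow> fp (\<lambda>x. car (f x))" "fp f \<Longrightarrow> fp (\<lambda>x. cdr (f x))"
    by (auto intro: ptime_comp)
qed

lemma nat_of_enc [simp]: "nat_of_data (enc n) = n"
proof -
  have "enc n = enc (replicate n ())" by (induction n) auto
  then show ?thesis by (simp add: nat_of_data_def)
qed

lemma bits_of_enc [simp]: "bits_of_data (enc bs) = bs"
  by (simp add: bits_of_data_def comp_def)

lemma bits_list_of_enc [simp]: "bits_list_of_data (enc xs) = xs"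
  by (simp add: bits_list_of_data_def comp_def)

section \<open>Cutting off oracle answers of unknown size\<close>

section \<open>Truncated oracle answers\<close>

definition trunc :: "nat \<Rightarrow> data \<Rightarrow> data" where
  "trunc N r = (if size r \<le> N then r else Atom)"

lemma size_trunc: "size (trunc N r) \<le> N"
  by (simp add: trunc_def)

fun pop :: "data list \<Rightarrow> data list" where
  "pop [] = []"
| "pop (Atom # s) = s"
| "pop (Cell x y # s) = x # y # s"

text \<open>\<open>size d\<close> counts cells, so \<open>2 * size d + 1\<close> is the number of
  all nodes of \<open>d\<close>, leaves included. Each \<open>pop\<close> on a nonempty stack
  removes exactly one node.\<close>

lemma funpow_pop: "(pop ^^ j) s = [] \<longleftrightarrow> sum_list (map (\<lambda>d. 2 * size d + 1) s) \<le> j"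
proof (induction j arbitrary: s)
  case (Suc j)
  have "sum_list (map (\<lambda>d. 2 * size d + 1) (pop s)) = sum_list (map (\<lambda>d. 2 * size d + 1) s) - 1"
    by (cases s rule: pop.cases) auto
  then show ?case using Suc[of "pop s"] by (simp add: funpow_swap1 funpow_Suc_right del: funpow.simps) linarith
qed (cases s, auto)

text \<open>The answer is traversed with a stack for at most \<open>2 N + 1\<close> steps of constant cost, so that the
  running time does not depend on its size.\<close>

lemma ptime_Ask [fp_intros]:
  assumes q: "fp q" and N: "fp N"
  shows "ptime (\<lambda>a. Ask (q a) (\<lambda>r. Done (trunc (N a) r)))"
proof -
  define step where "step = Cond Id (Cond Car (Fork (Seq Car Car) (Fork (Seq Car Cdr) Cdr)) Cdr) Nul"
  define body where "body = Fork (Seq Car Cdr) (Fork (Seq (Seq Cdr Car) step) (Seq Cdr Cdr))"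
  have step: "runs (exec step (enc s)) 20 (Done (pop s))" for s
  proof (cases s rule: pop.cases)
    case 1
    show ?thesis unfolding runs_def step_def 1 crel_Done_iff by (auto simp: pay_def and_then_def)
  next
    case (2 s)
    show ?thesis unfolding runs_def step_def 2 crel_Done_iff by (auto simp: pay_def and_then_def)
  next
    case (3 x y s)
    show ?thesis unfolding runs_def step_def 3 crel_Done_iff by (auto simp: pay_def and_then_def)
  qed
  have body: "runs (exec body (enc (u # us, s, r))) 34 (Done (us, pop s, r))"
    for u :: unit and us s and r :: data
    unfolding body_def
    by (rule runs_mono[OF runs_Fork2[OF runs_Seq_Done[OF runs_fst runs_tl]
          runs_Fork2[OF runs_Seq_Done[OF runs_Seq_Done[OF runs_snd runs_fst] step]
            runs_Seq_Done[OF runs_snd runs_snd]]]]) simp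
  have loop: "runs (loop j (exec Car) (exec body) (enc (replicate m (), s, r))) (m * 40 + 2)
     (Done ([] :: unit list, (pop ^^ m) s, r))" if "m < j" for j m s and r :: data
    using that
  proof (induction m arbitrary: j s)
    case 0
    then obtain i where [simp]: "j = Suc i" by (cases j) auto
    have "runs (\<lambda>t. and_then (exec Car (enc ([] :: unit list, s, r)) t)
         (\<lambda>v t. if bool_of_data v then and_then (exec body (enc ([] :: unit list, s, r)) t) (loop i (exec Car) (exec body))
                else Done (Some (enc ([] :: unit list, s, r), t)))) (1 + 0)
         (bind_comp (Done []) (\<lambda>_ :: unit list. Done ([] :: unit list, s, r)))"
      by (rule runs_and_then[OF runs_fst]) (use runs_ret[of "([] :: unit list, s, r)"] in simp)
    from runs_pay[OF this, of 1] show ?case unfolding \<open>j = Suc i\<close> loop_Suc replicate_0 by simp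
  next
    case (Suc m)
    then obtain i where [simp]: "j = Suc i" by (cases j) auto
    let ?x = "enc (replicate (Suc m) (), s, r)"
    have "runs (\<lambda>t. and_then (exec body ?x t) (loop i (exec Car) (exec body))) (34 + (m * 40 + 2))
        (bind_comp (Done (replicate m (), pop s, r)) (\<lambda>_. Done ([] :: unit list, (pop ^^ m) (pop s), r)))"
      by (rule runs_and_then)
         (use body[of "()" "replicate m ()" s r] Suc.IH[of i "pop s"] Suc.prems in \<open>simp_all del: exec.simps\<close>)
    then have "runs (\<lambda>t. and_then (exec Car ?x t)
         (\<lambda>v t. if bool_of_data v then and_then (exec body ?x t) (loop i (exec Car) (exec body))
                else Done (Some (?x, t)))) (1 + (34 + (m * 40 + 2)))
         (bind_comp (Done (replicate (Suc m) ())) (\<lambda>_. Done ([] :: unit list, (pop ^^ Suc m) s, r)))"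
      by (intro runs_and_then[OF runs_fst]) (simp add: funpow_swap1)
    from runs_pay[OF this, of 1] show ?case unfolding \<open>j = Suc i\<close> loop_Suc bind_comp.simps
      by (rule runs_mono) simp
  qed
  \<comment> \<open>The answer is kept twice: as the only entry of the stack to be consumed, and
    intact as the value to be returned.\<close>
  define prep where "prep = Seq (Fork Car (Seq Cdr Call)) (Fork Car (Fork (Fork Cdr Nul) Cdr))"
  define fin where "fin = Cond (Seq Cdr Car) Nul (Seq Cdr Cdr)"
  have call: "runs (exec Call (enc d)) (Suc (size d)) (Ask d Done)" for d :: data
  proof -
    have "runs (\<lambda>t. Ask d (\<lambda>r. Done (Some (r, t)))) 0 (Ask d Done)"
      unfolding runs_def by (intro allI impI crel.Ask crel.Done) simp
    from runs_pay[OF this, of "1 + size d"] show ?thesis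
      unfolding runs_def by simp
  qed
  have fin: "runs (exec fin (enc ([] :: unit list, s, r))) 7 (Done (if s = [] then r else Atom))"
    for s :: "data list" and r :: data
    unfolding runs_def fin_def crel_Done_iff by (cases s) (auto simp: pay_def and_then_def)
  have prep: "runs (exec prep (enc (us, d))) (size d + 20) (Ask d (\<lambda>r. Done (us, [r], r)))"
    for us :: "unit list" and d :: data
  proof -
    have 1: "runs (exec (Fork Car (Seq Cdr Call)) (enc (us, d))) (Suc (1 + Suc (1 + Suc (size d))))
      (bind_comp (Ask d Done) (\<lambda>r. Done (us, r)))"
      by (rule runs_Fork_Done[OF runs_fst runs_Seq_Done[OF runs_snd call]])
    have 2: "runs (exec (Fork Car (Fork (Fork Cdr Nul) Cdr)) (enc (us, r))) 8 (Done (us, [r], r))" for r :: data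
      unfolding runs_def crel_Done_iff by (auto simp: pay_def and_then_def)
    have "runs (exec prep (enc (us, d))) (Suc (Suc (1 + Suc (1 + Suc (size d))) + 8))
       (bind_comp (bind_comp (Ask d Done) (\<lambda>r. Done (us, r))) (\<lambda>z. Done (us, [snd z], snd z)))"
      unfolding prep_def
      by (rule runs_Seq[OF 1]) (use 2 in \<open>auto simp: outcomes_bind\<close>)
    then show ?thesis by (simp add: bind_comp_assoc) (erule runs_mono, simp)
  qed
  define all where "all = Seq prep (Seq (While Car body) fin)"
  have all: "runs (exec all (enc (replicate (2 * n + 1) (), d))) (size d + n * 80 + 100)
      (Ask d (\<lambda>r. Done (trunc n r)))" for n and d :: data
  proof -
    \<comment> \<open>A tree of size at most \<open>n\<close> has at most \<open>2 * n + 1\<close>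
      nodes, so after this many pops the stack is empty exactly if the answer fits.\<close>
    let ?m = "2 * n + 1"
    have "runs (exec (Seq (While Car body) fin) (enc (replicate ?m (), [r], r))) (Suc ((?m * 40 + 2) + 7))
      (Done (trunc n r))" for r
    proof -
      have "(if (pop ^^ ?m) [r] = [] then r else Atom) = trunc n r"
        by (simp add: funpow_pop trunc_def del: funpow.simps)
      then show ?thesis using runs_Seq_Done[OF runs_While[OF loop] fin[of "(pop ^^ ?m) [r]" r]] by simp
    qed
    then have "runs (exec all (enc (replicate ?m (), d))) (Suc (size d + 20 + Suc ((?m * 40 + 2) + 7)))
       (bind_comp (Ask d (\<lambda>r. Done (replicate ?m (), [r], r))) (\<lambda>z. Done (trunc n (snd (snd z)))))"
      unfolding all_def by (intro runs_Seq[OF prep]) auto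
    then show ?thesis by simp (erule runs_mono, simp)
  qed
  have "fp (\<lambda>a. (replicate (2 * N a + 1) (), q a))"
    by (intro fp_intros q N)
  then obtain p g where p: "pmono g" "\<And>a. runs (exec p (enc a)) (g (esize a)) (Done (replicate (2 * N a + 1) (), q a))"
    by (rule ptimeE) (rule that)
  obtain gq where gq: "pmono gq" "\<And>a. size (q a) \<le> gq (esize a)" using fp_bound[OF q] by auto
  obtain gn where gn: "pmono gn" "\<And>a. N a \<le> gn (esize a)" using fp_bound[OF N] by auto
  show ?thesis
  proof (rule ptimeI[where h=gn and p="Seq p all" and g="\<lambda>x. Suc (g x + (gq x + gn x * 80 + 100))"])
    fix a
    show "runs (exec (Seq p all) (enc a)) (Suc (g (esize a) + (gq (esize a) + gn (esize a) * 80 + 100)))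
      (Ask (q a) (\<lambda>r. Done (trunc (N a) r)))"
      by (rule runs_Seq_Done[OF p(2) runs_mono[OF all]]) (use gq(2)[of a] gn(2)[of a] in simp)
    fix b assume "b \<in> outcomes (Ask (q a) (\<lambda>r. Done (trunc (N a) r)))"
    then show "esize b \<le> gn (esize a)" using size_trunc[of "N a"] gn(2)[of a] by (auto intro: le_trans)
  qed (intro pmono_intros p gq gn)+
qed

section \<open>Stateful oracle handlers and their compilation into programs\<close>

section \<open>Simulating the oracle of a program\<close>

text \<open>A stateful handler in the sense of algebraic effects: queries are interpreted by
  computations that may in turn query an outer oracle.\<close>

primrec subst_comp :: "(data \<Rightarrow> 's \<Rightarrow> (data \<times> 's) comp) \<Rightarrow> 'a comp \<Rightarrow> 's \<Rightarrow> ('a \<times> 's) comp" where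
  "subst_comp h (Done x) s = Done (x, s)"
| "subst_comp h (Choose n f) s = Choose n (\<lambda>i. subst_comp h (f i) s)"
| "subst_comp h (Ask q f) s = bind_comp (h q s) (\<lambda>z. subst_comp h (f (fst z)) (snd z))"

lemma subst_comp_bind:
  "subst_comp h (bind_comp m f) s = bind_comp (subst_comp h m s) (\<lambda>z. subst_comp h (f (fst z)) (snd z))"
  by (induction m arbitrary: s) (simp_all add: bind_comp_assoc)

lemma outcomes_subst_comp: "z \<in> outcomes (subst_comp h m s) \<Longrightarrow> fst z \<in> outcomes m"
  by (induction m arbitrary: s z) (auto simp: outcomes_bind, blast+)

lemma interact_subst_comp:
  "interact orc (subst_comp h m s) u =
     map_pmf (\<lambda>(x, s, u). ((x, s), u))
       (interact (\<lambda>(s, u) q. map_pmf (\<lambda>((r, s), u). (r, (s, u))) (interact orc (h q s) u)) m (s, u))"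
proof (induction m arbitrary: s u)
  case (Choose n f)
  then show ?case by (simp add: map_bind_pmf)
next
  case (Ask q f)
  then show ?case
    by (simp add: interact_bind map_bind_pmf bind_map_pmf split_def)
qed simp

text \<open>Compiled programs map pairs of a value and a handler state to such pairs. The state is
  threaded through tests as well, since a test may ask queries: its result
  \<open>((v, s'), x)\<close> is turned into \<open>(x, s')\<close> by
  \<open>Fork Cdr (Seq Car Cdr)\<close>, which restores the argument together with the new
  state.\<close>

primrec compile :: "prog \<Rightarrow> prog \<Rightarrow> prog" where
  "compile H Id = Id"
| "compile H Nul = Fork Nul Cdr"
| "compile H Car = Fork (Seq Car Car) Cdr"
| "compile H Cdr = Fork (Seq Car Cdr) Cdr"
| "compile H (Fork p q) = Seq (Fork (compile H p) Car)
     (Seq (Fork (Seq Car Car) (Seq (Fork Cdr (Seq Car Cdr)) (compile H q)))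
        (Fork (Fork Car (Seq Cdr Car)) (Seq Cdr Cdr)))"
| "compile H (Seq p q) = Seq (compile H p) (compile H q)"
| "compile H (Cond c p q) = Seq (Fork (compile H c) Car)
     (Cond (Seq Car Car) (Seq (Fork Cdr (Seq Car Cdr)) (compile H p)) (Seq (Fork Cdr (Seq Car Cdr)) (compile H q)))"
| "compile H (While c p) = Seq (Seq (Fork (compile H c) Car)
     (While (Seq Car Car) (Seq (Fork Cdr (Seq Car Cdr)) (Seq (compile H p) (Fork (compile H c) Car)))))
     (Fork Cdr (Seq Car Cdr))"
| "compile H Rand = Fork (Seq Car Rand) Cdr"
| "compile H Call = H"

lemma exec_While: "exec (While c p) = (\<lambda>x t. loop t (exec c) (exec p) x t)"
  by (intro ext) simp

lemma and_then_assoc: "and_then (and_then m f) g = and_then m (\<lambda>y t. and_then (f y t) g)"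
  unfolding and_then_def bind_comp_assoc
  by (rule arg_cong[where f="bind_comp m"]) (auto split: option.split simp: fun_eq_iff)

lemma and_then_Done [simp]: "and_then (Done (Some (y, t))) f = f y t"
  "and_then (Done None) f = Done None"
  by (simp_all add: and_then_def)

lemma pay_ok [simp]: "a \<le> t \<Longrightarrow> pay a t f = f (t - a)"
  by (simp add: pay_def)

text \<open>\<open>I t s\<close> describes the handler states possible while \<open>t\<close> units
  of the simulated budget are left. It supplies the size bound under which one constant
  \<open>K\<close> can cover every handler call.\<close>

context
  fixes h :: "data \<Rightarrow> 's::codable \<Rightarrow> (data \<times> 's) comp"
    and H :: prog and K :: nat and I :: "nat \<Rightarrow> 's \<Rightarrow> bool"
  assumes H: "\<And>q s t. I t s \<Longrightarrow> size q < t \<Longrightarrow> runs (exec H (Cell q (enc s))) K (h q s)"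
    and I_step: "\<And>q s t r s'. I t s \<Longrightarrow> size q < t \<Longrightarrow> (r, s') \<in> outcomes (h q s) \<Longrightarrow> I (t - 1 - size q) s'"
    and I_mono: "\<And>s t t'. I t s \<Longrightarrow> t' \<le> t \<Longrightarrow> I t' s"
begin

text \<open>The price of one simulated step: a handler call and a constant for moving values and
  state around.\<close>

private definition C where "C = K + 40"

text \<open>A run that exhausts its budget has no counterpart, as the compiled program has a larger
  budget and would go on. The simulation is therefore restricted to runs that never do;
  \<open>ppt\<close> guarantees this for adversaries.\<close>

private definition nn :: "(data \<times> nat) option comp \<Rightarrow> 's \<Rightarrow> bool" where
  "nn m s \<longleftrightarrow> None \<notin> fst ` outcomes (subst_comp h m s)"

private lemma pay_nn: "nn (pay a t f) s \<Longrightarrow> a \<le> t \<and> nn (f (t - a)) s"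
  by (auto simp: pay_def nn_def split: if_splits)

private lemma nn_None [simp]: "\<not> nn (Done None) s"
  by (simp add: nn_def)

private lemma nn_and_then: "nn (and_then m f) s \<Longrightarrow> nn m s"
  unfolding nn_def and_then_def subst_comp_bind by (force simp: outcomes_bind)

text \<open>The credit \<open>u - C t\<close> of the simulating program never decreases.\<close>

private definition sim where
  "sim t u z w \<longleftrightarrow> (\<exists>y t' u'. fst w = Some (y, t') \<and> z = Some (Cell y (enc (snd w)), u') \<and>
     t' \<le> t \<and> u' \<le> u \<and> u + C * t' \<le> u' + C * t \<and> I t' (snd w))"

private lemma sim_trans:
  "sim t1 u1 z w \<Longrightarrow> t1 \<le> t \<Longrightarrow> u1 \<le> u \<Longrightarrow> u + C * t1 \<le> u1 + C * t \<Longrightarrow> sim t u z w"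
  unfolding sim_def by fastforce

private lemma sim_and_then:
  assumes "crel (sim t u) M (subst_comp h N s)"
    and "nn (and_then N f) s"
    and "\<And>y t' u' s'. t' \<le> t \<Longrightarrow> u' \<le> u \<Longrightarrow> u + C * t' \<le> u' + C * t \<Longrightarrow> I t' s' \<Longrightarrow>
       nn (f y t') s' \<Longrightarrow> crel S (g (Cell y (enc s')) u') (subst_comp h (f y t') s')"
  shows "crel S (and_then M g) (subst_comp h (and_then N f) s)"
  unfolding and_then_def subst_comp_bind
proof (rule crel_bind[OF assms(1)])
  fix z w assume w: "w \<in> outcomes (subst_comp h N s)" and "sim t u z w"
  then obtain y t' u' where *: "fst w = Some (y, t')" "z = Some (Cell y (enc (snd w)), u')"
    "t' \<le> t" "u' \<le> u" "u + C * t' \<le> u' + C * t" "I t' (snd w)" unfolding sim_def by auto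
  have "nn (f y t') (snd w)"
    using assms(2) w *(1) unfolding nn_def and_then_def subst_comp_bind by (force simp: outcomes_bind)
  from assms(3)[OF *(3-6) this]
  show "crel S (case z of None \<Rightarrow> Done None | Some (y, t) \<Rightarrow> g y t)
         (subst_comp h (case fst w of None \<Rightarrow> Done None | Some (y, t) \<Rightarrow> f y t) (snd w))"
    by (simp add: *)
qed

private lemma sim_Done: "I t' s \<Longrightarrow> t' \<le> t \<Longrightarrow> u' \<le> u \<Longrightarrow> u + C * t' \<le> u' + C * t \<Longrightarrow>
    crel (sim t u) (Done (Some (Cell y (enc s), u'))) (subst_comp h (Done (Some (y, t'))) s)"
  by (auto simp: sim_def intro!: crel.Done)

private definition ok where
  "ok p \<longleftrightarrow> (\<forall>x t s u. I t s \<longrightarrow> C * t \<le> u \<longrightarrow> nn (exec p x t) s \<longrightarrow>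
     crel (sim t u) (exec (compile H p) (Cell x (enc s)) u) (subst_comp h (exec p x t) s))"

private lemma okD: "ok p \<Longrightarrow> I t s \<Longrightarrow> C * t \<le> u \<Longrightarrow> nn (exec p x t) s \<Longrightarrow>
     crel (sim t u) (exec (compile H p) (Cell x (enc s)) u) (subst_comp h (exec p x t) s)"
  unfolding ok_def by blast

text \<open>The state of the compiled loop already contains the result of the test, which is
  evaluated before the loop and again at the end of each round. The induction therefore starts in
  front of a test. \<open>g\<close> abstracts from the round counter, which is the whole budget at
  first and a fixed number later; the slack of 2 pays for entering the two sequences around the
  loop.\<close>

private lemma ok_loop:
  assumes c: "ok c" and p: "ok p"
  defines "pre \<equiv> Fork (compile H c) Car" and "sh \<equiv> Fork Cdr (Seq Car Cdr)"
  defines "body \<equiv> Seq sh (Seq (compile H p) pre)"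
  assumes "I t s" and "C * t \<le> u + 2" and "\<And>v. v \<le> u \<Longrightarrow> v \<le> g v"
    and "nn (loop j (exec c) (exec p) x t) s"
  shows "crel (sim t (u + 2))
     (and_then (exec pre (Cell x (enc s)) u)
        (\<lambda>w u. and_then (loop (g u) (exec (Seq Car Car)) (exec body) w u) (exec sh)))
     (subst_comp h (loop j (exec c) (exec p) x t) s)"
  using assms(6-9)
proof (induction j arbitrary: x t s u g)
  case (Suc j)
  then obtain t0 where t: "t = Suc t0" by (cases t) (auto dest: pay_nn)
  have ct: "C * t = C + C * t0" by (simp add: t)
  have u: "C + C * t0 \<le> u + 2" "C \<ge> 40" using Suc.prems(2) by (auto simp: t C_def)
  let ?A = "\<lambda>v t. if bool_of_data v then and_then (exec p x t) (loop j (exec c) (exec p)) else Done (Some (x, t))"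
  have n1: "nn (and_then (exec c x t0) ?A) s" using Suc.prems(4) by (simp add: t)
  have "crel (sim t (u + 2))
    (and_then (exec (compile H c) (Cell x (enc s)) (u - 1)) (\<lambda>y u. and_then (exec Car (Cell x (enc s)) u)
       (\<lambda>z u. and_then (loop (g u) (exec (Seq Car Car)) (exec body) (Cell y z) u) (exec sh))))
    (subst_comp h (and_then (exec c x t0) ?A) s)"
  proof (rule sim_and_then[where t=t0 and u="u - 1", OF okD[OF c] n1])
    show "I t0 s" using I_mono[OF Suc.prems(1)] t by simp
    show "C * t0 \<le> u - 1" using u by linarith
    show "nn (exec c x t0) s" by (rule nn_and_then[OF n1])
    fix v t' u' s' assume *: "t' \<le> t0" "u' \<le> u - 1" "u - 1 + C * t' \<le> u' + C * t0" "I t' s'"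
      and nn': "nn (?A v t') s'"
    have u': "C * t' + 30 \<le> u'" using * u by linarith
    then obtain i where i: "g (u' - 1) = Suc i" "u' - 2 \<le> i"
    proof -
      have "u' - 1 \<le> g (u' - 1)" by (rule Suc.prems(3)) (use * in linarith)
      then have "g (u' - 1) = Suc (g (u' - 1) - 1)" "u' - 2 \<le> g (u' - 1) - 1" using u' by linarith+
      then show ?thesis by (rule that)
    qed
    have 1: "and_then (loop (Suc i) (exec (Seq Car Car)) (exec body) (Cell (Cell v (enc s')) x) (u' - 1)) (exec sh)
      = (if bool_of_data v then and_then (exec (compile H p) (Cell x (enc s')) (u' - 12))
            (\<lambda>w u. and_then (exec pre w u) (\<lambda>w u. and_then (loop i (exec (Seq Car Car)) (exec body) w u) (exec sh)))
         else Done (Some (Cell x (enc s'), u' - 10)))"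
      using u' by (auto simp: body_def sh_def and_then_assoc eval_nat_numeral dest!: le_Suc_ex)
    show "crel (sim t (u + 2)) (and_then (exec Car (Cell x (enc s)) u')
       (\<lambda>z u. and_then (loop (g u) (exec (Seq Car Car)) (exec body) (Cell (Cell v (enc s')) z) u) (exec sh)))
      (subst_comp h (?A v t') s')"
    proof (cases "bool_of_data v")
      case False
      have "crel (sim t (u + 2)) (Done (Some (Cell x (enc s'), u' - 10))) (subst_comp h (Done (Some (x, t'))) s')"
        by (rule sim_Done[OF *(4)]) (use * u' u ct t in linarith)+
      then show ?thesis using u' i 1 False by simp
    next
      case True
      then have nn2: "nn (and_then (exec p x t') (loop j (exec c) (exec p))) s'"
        using nn' by simp
      have "crel (sim t (u + 2)) (and_then (exec (compile H p) (Cell x (enc s')) (u' - 12))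
            (\<lambda>w u. and_then (exec pre w u) (\<lambda>w u. and_then (loop i (exec (Seq Car Car)) (exec body) w u) (exec sh))))
          (subst_comp h (and_then (exec p x t') (loop j (exec c) (exec p))) s')"
      proof (rule sim_and_then[where t=t' and u="u' - 12", OF okD[OF p] nn2])
        show "C * t' \<le> u' - 12" using u' by linarith
        show "nn (exec p x t') s'" by (rule nn_and_then[OF nn2])
        fix y t2 u2 s2 assume **: "t2 \<le> t'" "u2 \<le> u' - 12" "u' - 12 + C * t2 \<le> u2 + C * t'" "I t2 s2"
          and nn3: "nn (loop j (exec c) (exec p) y t2) s2"
        have "crel (sim t2 (u2 + 2)) (and_then (exec pre (Cell y (enc s2)) u2)
            (\<lambda>w u. and_then (loop i (exec (Seq Car Car)) (exec body) w u) (exec sh)))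
            (subst_comp h (loop j (exec c) (exec p) y t2) s2)"
          by (rule Suc.IH[where g="\<lambda>_. i"]) (use ** u' i nn3 in linarith)+
        then show "crel (sim t (u + 2)) (and_then (exec pre (Cell y (enc s2)) u2)
            (\<lambda>w u. and_then (loop i (exec (Seq Car Car)) (exec body) w u) (exec sh)))
            (subst_comp h (loop j (exec c) (exec p) y t2) s2)"
        proof (rule crel_mono)
          have bd: "u + 2 + C * t2 \<le> u2 + 2 + (C + C * t0)" using * ** u' u by linarith
          show "sim t2 (u2 + 2) a b \<Longrightarrow> sim t (u + 2) a b" for a b
            by (erule sim_trans) (use bd * ** u' u in \<open>simp_all add: t\<close>)
        qed
      qed (use * in simp)
      then show ?thesis using u' i 1 True by simp
    qed
  qed
  then show ?case
    using u by (simp add: t pre_def and_then_assoc del: exec.simps(6))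
qed simp

private lemma ok_Seq:
  assumes "ok p" and "ok q"
  shows "ok (Seq p q)"
  unfolding ok_def
proof (intro allI impI)
  fix x t s u assume I: "I t s" and u: "C * t \<le> u" and n0: "nn (exec (Seq p q) x t) s"
  obtain t0 where t: "t = Suc t0" using n0 by (cases t) (auto dest: pay_nn)
  have ct: "C * t = C + C * t0" by (simp add: t)
  have u: "C + C * t0 \<le> u" "C \<ge> 40" using u by (auto simp: t C_def)
  have n1: "nn (and_then (exec p x t0) (exec q)) s" using n0 by (simp add: t)
  have "crel (sim t u) (and_then (exec (compile H p) (Cell x (enc s)) (u - 1)) (exec (compile H q)))
     (subst_comp h (and_then (exec p x t0) (exec q)) s)"
  proof (rule sim_and_then[where t=t0 and u="u - 1", OF okD[OF assms(1)] n1])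
    fix y t' u' s' assume *: "t' \<le> t0" "u' \<le> u - 1" "u - 1 + C * t' \<le> u' + C * t0" "I t' s'"
      "nn (exec q y t') s'"
    have "crel (sim t' u') (exec (compile H q) (Cell y (enc s')) u') (subst_comp h (exec q y t') s')"
      by (rule okD[OF assms(2)]) (use * u in linarith)+
    then show "crel (sim t u) (exec (compile H q) (Cell y (enc s')) u') (subst_comp h (exec q y t') s')"
      by (rule crel_mono) (erule sim_trans, use * u in \<open>simp_all add: t\<close>)
  qed (use I_mono[OF I, of t0] u nn_and_then[OF n1] in \<open>simp_all add: t\<close>)
  then show "crel (sim t u) (exec (compile H (Seq p q)) (Cell x (enc s)) u) (subst_comp h (exec (Seq p q) x t) s)"
    using u by (simp add: t)
qed

private lemma ok_Fork:
  assumes "ok p" and "ok q"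
  shows "ok (Fork p q)"
  unfolding ok_def
proof (intro allI impI)
  fix x t s u assume I: "I t s" and u: "C * t \<le> u" and n0: "nn (exec (Fork p q) x t) s"
  obtain t0 where t: "t = Suc t0" using n0 by (cases t) (auto dest: pay_nn)
  have ct: "C * t = C + C * t0" by (simp add: t)
  have u: "C + C * t0 \<le> u" "C \<ge> 40" using u by (auto simp: t C_def)
  have n1: "nn (and_then (exec p x t0) (\<lambda>y t. and_then (exec q x t) (\<lambda>z t. Done (Some (Cell y z, t))))) s"
    using n0 by (simp add: t)
  let ?fin = "Fork (Fork Car (Seq Cdr Car)) (Seq Cdr Cdr)"
  let ?sh = "Fork Cdr (Seq Car Cdr)"
  have "crel (sim t u) (and_then (exec (compile H p) (Cell x (enc s)) (u - 2)) (\<lambda>w u.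
        and_then (exec Car (Cell x (enc s)) u) (\<lambda>z u. exec (Seq (Fork (Seq Car Car) (Seq ?sh (compile H q))) ?fin) (Cell w z) u)))
     (subst_comp h (and_then (exec p x t0) (\<lambda>y t. and_then (exec q x t) (\<lambda>z t. Done (Some (Cell y z, t))))) s)"
  proof (rule sim_and_then[where t=t0 and u="u - 2", OF okD[OF assms(1)] n1])
    fix y t' u' s' assume *: "t' \<le> t0" "u' \<le> u - 2" "u - 2 + C * t' \<le> u' + C * t0" "I t' s'"
      and nn': "nn (and_then (exec q x t') (\<lambda>z t. Done (Some (Cell y z, t)))) s'"
    have u': "C * t' + 30 \<le> u'" using * u by linarith
    have "crel (sim t u) (and_then (exec (compile H q) (Cell x (enc s')) (u' - 12)) (\<lambda>z u. exec ?fin (Cell y z) u))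
      (subst_comp h (and_then (exec q x t') (\<lambda>z t. Done (Some (Cell y z, t)))) s')"
    proof (rule sim_and_then[where t=t' and u="u' - 12", OF okD[OF assms(2)] nn'])
      fix z t2 u2 s2 assume **: "t2 \<le> t'" "u2 \<le> u' - 12" "u' - 12 + C * t2 \<le> u2 + C * t'" "I t2 s2"
      have u2: "10 \<le> u2" using ** u' by linarith
      then have "exec ?fin (Cell y (Cell z (enc s2))) u2 = Done (Some (Cell (Cell y z) (enc s2), u2 - 9))"
        by (auto simp: eval_nat_numeral dest!: le_Suc_ex)
      moreover have "crel (sim t u) (Done (Some (Cell (Cell y z) (enc s2), u2 - 9))) (subst_comp h (Done (Some (Cell y z, t2))) s2)"
        by (rule sim_Done[OF **(4)]) (use * ** u' u2 u ct t in linarith)+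
      ultimately show "crel (sim t u) (exec ?fin (Cell y (Cell z (enc s2))) u2) (subst_comp h (Done (Some (Cell y z, t2))) s2)"
        by (simp only:)
    qed (use * u' nn_and_then[OF nn'] in simp_all)
    moreover obtain v where "u' = 12 + v" using u' by (intro that[of "u' - 12"]) linarith
    ultimately show "crel (sim t u) (and_then (exec Car (Cell x (enc s)) u')
        (\<lambda>z u. exec (Seq (Fork (Seq Car Car) (Seq ?sh (compile H q))) ?fin) (Cell (Cell y (enc s')) z) u))
      (subst_comp h (and_then (exec q x t') (\<lambda>z t. Done (Some (Cell y z, t)))) s')"
      by (simp add: and_then_assoc eval_nat_numeral)
  qed (use I_mono[OF I, of t0] u nn_and_then[OF n1] in \<open>simp_all add: t\<close>)
  moreover obtain v where "u = Suc (Suc v)" using u by (intro that[of "u - 2"]) linarith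
  ultimately show "crel (sim t u) (exec (compile H (Fork p q)) (Cell x (enc s)) u) (subst_comp h (exec (Fork p q) x t) s)"
    by (simp add: t and_then_assoc eval_nat_numeral)
qed

private lemma ok_Cond:
  assumes "ok c" and "ok p" and "ok q"
  shows "ok (Cond c p q)"
  unfolding ok_def
proof (intro allI impI)
  fix x t s u assume I: "I t s" and u: "C * t \<le> u" and n0: "nn (exec (Cond c p q) x t) s"
  obtain t0 where t: "t = Suc t0" using n0 by (cases t) (auto dest: pay_nn)
  have ct: "C * t = C + C * t0" by (simp add: t)
  have u: "C + C * t0 \<le> u" "C \<ge> 40" using u by (auto simp: t C_def)
  let ?A = "\<lambda>v t. if bool_of_data v then exec p x t else exec q x t"
  have n1: "nn (and_then (exec c x t0) ?A) s" using n0 by (simp add: t)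
  let ?sh = "Fork Cdr (Seq Car Cdr)"
  have "crel (sim t u) (and_then (exec (compile H c) (Cell x (enc s)) (u - 2)) (\<lambda>w u.
        and_then (exec Car (Cell x (enc s)) u) (\<lambda>z u.
          exec (Cond (Seq Car Car) (Seq ?sh (compile H p)) (Seq ?sh (compile H q))) (Cell w z) u)))
     (subst_comp h (and_then (exec c x t0) ?A) s)"
  proof (rule sim_and_then[where t=t0 and u="u - 2", OF okD[OF assms(1)] n1])
    fix v t' u' s' assume *: "t' \<le> t0" "u' \<le> u - 2" "u - 2 + C * t' \<le> u' + C * t0" "I t' s'"
      and nn': "nn (?A v t') s'"
    have u': "C * t' + 30 \<le> u'" using * u by linarith
    define r where "r = (if bool_of_data v then p else q)"
    have r: "ok r" "?A v t' = exec r x t'" using assms by (auto simp: r_def)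
    have "crel (sim t' (u' - 11)) (exec (compile H r) (Cell x (enc s')) (u' - 11)) (subst_comp h (exec r x t') s')"
      by (rule okD[OF r(1)]) (use * u' nn' r(2) in auto)
    then have "crel (sim t u) (exec (compile H r) (Cell x (enc s')) (u' - 11)) (subst_comp h (exec r x t') s')"
      by (rule crel_mono) (erule sim_trans, use * u u' in \<open>simp_all add: t\<close>)
    moreover have "and_then (exec Car (Cell x (enc s)) u') (\<lambda>z u.
          exec (Cond (Seq Car Car) (Seq ?sh (compile H p)) (Seq ?sh (compile H q))) (Cell (Cell v (enc s')) z) u)
       = exec (compile H r) (Cell x (enc s')) (u' - 11)"
      using u' by (auto simp: and_then_assoc eval_nat_numeral r_def dest!: le_Suc_ex)
    ultimately show "crel (sim t u) (and_then (exec Car (Cell x (enc s)) u') (\<lambda>z u.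
          exec (Cond (Seq Car Car) (Seq ?sh (compile H p)) (Seq ?sh (compile H q))) (Cell (Cell v (enc s')) z) u))
      (subst_comp h (?A v t') s')"
      by (simp only: r(2))
  qed (use I_mono[OF I, of t0] u nn_and_then[OF n1] in \<open>simp_all add: t\<close>)
  moreover obtain v where "u = Suc (Suc v)" using u by (intro that[of "u - 2"]) linarith
  ultimately show "crel (sim t u) (exec (compile H (Cond c p q)) (Cell x (enc s)) u) (subst_comp h (exec (Cond c p q) x t) s)"
    by (simp add: t and_then_assoc eval_nat_numeral)
qed

text \<open>A budget of the form \<open>8 + v\<close> lets the compiled primitive be evaluated by
  simplification; \<open>d\<close> is its exact cost.\<close>

private lemma ok_prim:
  assumes p: "\<And>x t. exec p x t = pay 1 t (\<lambda>t. Done (Some (f x, t)))"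
    and c: "\<And>x e v. exec (compile H p) (Cell x e) (8 + v) = Done (Some (Cell (f x) e, (8 - d) + v))"
    and "d < 8"
  shows "ok p"
  unfolding ok_def
proof (intro allI impI)
  fix x t s u assume I: "I t s" and u: "C * t \<le> u" and n0: "nn (exec p x t) s"
  obtain t0 where t: "t = Suc t0" using n0 by (cases t) (auto simp: p dest: pay_nn)
  have u: "C + C * t0 \<le> u" "C \<ge> 40" using u by (auto simp: t C_def)
  obtain v where v: "u = 8 + v" using u by (intro that[of "u - 8"]) linarith
  have "crel (sim t u) (Done (Some (Cell (f x) (enc s), (8 - d) + v))) (subst_comp h (Done (Some (f x, t0))) s)"
    by (rule sim_Done) (use u I_mono[OF I, of t0] assms(3) in \<open>simp_all add: t v\<close>)
  then show "crel (sim t u) (exec (compile H p) (Cell x (enc s)) u) (subst_comp h (exec p x t) s)"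
    by (simp only: p v c) (simp add: t)
qed

private lemma ok_all: "ok p"
proof (induction p)
  case (While c p)
  show ?case unfolding ok_def
  proof (intro allI impI)
    fix x t s u assume I: "I t s" and u: "C * t \<le> u" and n0: "nn (exec (While c p) x t) s"
    then obtain t0 where t: "t = Suc t0" by (cases t) auto
    have u': "C \<le> u" "C \<ge> 40" using u by (auto simp: t C_def)
    let ?sh = "Fork Cdr (Seq Car Cdr)" and ?pre = "Fork (compile H c) Car"
    have "crel (sim t (u - 2 + 2)) (and_then (exec ?pre (Cell x (enc s)) (u - 2))
        (\<lambda>w u. and_then (loop u (exec (Seq Car Car)) (exec (Seq ?sh (Seq (compile H p) ?pre))) w u) (exec ?sh)))
        (subst_comp h (loop t (exec c) (exec p) x t) s)"
      by (rule ok_loop[OF While.IH, where g="\<lambda>u. u"]) (use I u u' n0 in simp_all)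
    moreover have "exec (compile H (While c p)) (Cell x (enc s)) u = and_then (exec ?pre (Cell x (enc s)) (u - 2))
        (\<lambda>w u. and_then (loop u (exec (Seq Car Car)) (exec (Seq ?sh (Seq (compile H p) ?pre))) w u) (exec ?sh))"
    proof -
      obtain v where v: "u = Suc (Suc v)" using u' by (intro that[of "u - 2"]) linarith
      show ?thesis unfolding v by (simp add: exec_While and_then_assoc del: exec.simps(5,8))
    qed
    moreover have "u - 2 + 2 = u" using u' by linarith
    ultimately show "crel (sim t u) (exec (compile H (While c p)) (Cell x (enc s)) u)
        (subst_comp h (exec (While c p) x t) s)"
      by (simp only: exec.simps(8))
  qed
next
  case Call
  show ?case unfolding ok_def
  proof (intro allI impI)
    fix x t s u assume I: "I t s" and u: "C * t \<le> u" and n0: "nn (exec Call x t) s"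
    then have t: "size x < t" by (auto dest: pay_nn)
    \<comment> \<open>The source pays at least one unit for the call, and the credit for this unit
      covers the handler.\<close>
    have "C * (t - 1 - size x) + C * 1 \<le> C * t"
      unfolding add_mult_distrib2[symmetric] by (intro mult_le_mono2) (use t in linarith)
    then have u': "K \<le> u" "C * (t - 1 - size x) + K \<le> C * t" using u by (auto simp: C_def)
    have "crel (\<lambda>z b. \<exists>t'. z = Some (enc b, t') \<and> t' \<le> u \<and> u \<le> t' + K) (exec H (Cell x (enc s)) u) (h x s)"
      using H[OF I t] u' by (simp add: runs_def)
    then have "crel (sim t u) (bind_comp (exec H (Cell x (enc s)) u) Done)
       (bind_comp (h x s) (\<lambda>z. Done (Some (fst z, t - Suc (size x)), snd z)))"
    proof (rule crel_bind)
      fix z b assume "b \<in> outcomes (h x s)" and "\<exists>t'. z = Some (enc b, t') \<and> t' \<le> u \<and> u \<le> t' + K"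
      then show "crel (sim t u) (Done z) (Done (Some (fst b, t - Suc (size x)), snd b))"
        using I_step[OF I t] u' by (cases b) (auto simp: sim_def intro!: crel.Done)
    qed
    then show "crel (sim t u) (exec (compile H Call) (Cell x (enc s)) u) (subst_comp h (exec Call x t) s)"
      using t by simp
  qed
next
  case Rand
  show ?case unfolding ok_def
  proof (intro allI impI)
    fix x t s u assume I: "I t s" and u: "C * t \<le> u" and n0: "nn (exec Rand x t) s"
    define n where "n = nat_of_data x"
    have t: "Suc n \<le> t" using n0 by (auto dest: pay_nn simp: n_def)
    have "C * (t - Suc n) + C * Suc n = C * t"
      unfolding add_mult_distrib2[symmetric] using t by simp
    moreover have "40 * Suc n \<le> C * Suc n" by (intro mult_le_mono1) (simp add: C_def)
    ultimately have "C * (t - Suc n) + 40 * Suc n \<le> C * t" by (metis add_left_mono)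
    then have u': "C * (t - Suc n) + (n + 5) \<le> C * t" by simp
    then have "n + 5 \<le> u" using u by linarith
    then obtain v where v: "u = Suc (Suc (Suc (Suc (Suc (n + v)))))"
      by (intro that[of "u - (n + 5)"]) linarith
    have "exec (compile H Rand) (Cell x (enc s)) u
        = Choose n (\<lambda>i. Done (Some (Cell (data_of_nat i) (enc s), u - (n + 5))))"
      by (simp add: v n_def[symmetric] and_then_def)
    then show "crel (sim t u) (exec (compile H Rand) (Cell x (enc s)) u) (subst_comp h (exec Rand x t) s)"
      using t u u' I_mono[OF I] by (auto simp: n_def[symmetric] sim_def intro!: crel.intros)
  qed
next
  case Id
  show ?case by (rule ok_prim[where f="\<lambda>x. x" and d=1]) (simp_all add: eval_nat_numeral)
next
  case Nul
  show ?case by (rule ok_prim[where f="\<lambda>_. Atom" and d=3]) (simp_all add: eval_nat_numeral)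
next
  case Car
  show ?case by (rule ok_prim[where f=car and d=5]) (simp_all add: eval_nat_numeral)
next
  case Cdr
  show ?case by (rule ok_prim[where f=cdr and d=5]) (simp_all add: eval_nat_numeral)
qed (rule ok_Seq ok_Fork ok_Cond; assumption)+

text \<open>The clock of the simulated run disappears from the specification. The default
  \<open>Atom\<close> is never reached, since no outcome is \<open>None\<close>.\<close>

lemma runs_compile:
  assumes "I t s" and "None \<notin> fst ` outcomes (subst_comp h (exec p x t) s)"
  shows "runs (exec (compile H p) (Cell x (enc s))) ((K + 40) * t)
     (bind_comp (subst_comp h (exec p x t) s) (\<lambda>z. Done (the_or Atom (map_option fst (fst z)), snd z)))"
  unfolding runs_def
proof (intro allI impI)
  fix u assume u: "(K + 40) * t \<le> u"
  have "crel (sim t u) (exec (compile H p) (Cell x (enc s)) u) (subst_comp h (exec p x t) s)"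
    by (rule okD[OF ok_all assms(1) _ assms(2)[folded nn_def]]) (use u in \<open>simp add: C_def\<close>)
  then have "crel (\<lambda>z b. \<exists>t'. z = Some (enc b, t') \<and> t' \<le> u \<and> u \<le> t' + (K + 40) * t)
     (bind_comp (exec (compile H p) (Cell x (enc s)) u) Done)
     (bind_comp (subst_comp h (exec p x t) s) (\<lambda>z. Done (the_or Atom (map_option fst (fst z)), snd z)))"
    by (rule crel_bind) (auto simp: sim_def C_def[symmetric] intro!: crel.Done)
  then show "crel (\<lambda>z b. \<exists>t'. z = Some (enc b, t') \<and> t' \<le> u \<and> u \<le> t' + (K + 40) * t)
     (exec (compile H p) (Cell x (enc s)) u)
     (bind_comp (subst_comp h (exec p x t) s) (\<lambda>z. Done (the_or Atom (map_option fst (fst z)), snd z)))"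
    by simp
qed

end

section \<open>Output lengths of polynomial-time algorithms\<close>

section \<open>Programs without oracle queries\<close>

text \<open>\<open>poly_time\<close> runs programs against the oracle that always answers
  \<open>Atom\<close>, so, unlike in \<open>outcomes\<close>, this is the only answer to be
  followed.\<close>

primrec outs :: "'a comp \<Rightarrow> 'a set" where
  "outs (Done x) = {x}"
| "outs (Choose n f) = (\<Union>i\<le>n. outs (f i))"
| "outs (Ask q f) = outs (f Atom)"

lemma outcomes_nonempty: "outcomes m \<noteq> {}"
  by (induction m) auto

lemma outs_bind: "outs (bind_comp m f) = (\<Union>x\<in>outs m. outs (f x))"
  by (induction m) auto

lemma outs_and_then: "outs (and_then m f) = (\<Union>z\<in>outs m. case z of None \<Rightarrow> {None} | Some (y, t) \<Rightarrow> outs (f y t))"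
  unfolding and_then_def by (auto simp: outs_bind split: option.splits)

lemma outs_and_thenE:
  assumes "Some w \<in> outs (and_then m f)"
  obtains y t where "Some (y, t) \<in> outs m" and "Some w \<in> outs (f y t)"
  using assms by (auto simp: outs_and_then split: option.splits)

lemma set_interact_outs: "set_pmf (interact (\<lambda>_ _. return_pmf (Atom, ())) m ()) = (\<lambda>x. (x, ())) ` outs m"
proof (induction m)
  case (Choose n f)
  have "set_pmf (pmf_of_set {..n}) = {..n}" by (rule set_pmf_of_set) auto
  with Choose show ?case by auto
qed auto

abbreviation no_oracle :: "data \<Rightarrow> unit \<Rightarrow> (data \<times> unit) comp" where
  "no_oracle \<equiv> \<lambda>_ _. Done (Atom, ())"

lemma outcomes_no_oracle: "outcomes (subst_comp no_oracle m ()) = (\<lambda>x. (x, ())) ` outs m"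
  by (induction m) auto

primrec depth :: "data \<Rightarrow> nat" where
  "depth Atom = 0"
| "depth (Cell x y) = Suc (max (depth x) (depth y))"

lemma depth_le_size: "depth d \<le> size d"
  by (induction d) auto

lemma length_le_depth: "length xs \<le> depth (enc xs)"
  by (induction xs) auto

lemma nat_of_data_le_depth: "nat_of_data d \<le> depth d"
  by (induction d) (auto simp: nat_of_data_def)

lemma depth_nat: "depth (data_of_nat n) = n"
  by (induction n) (auto simp: data_of_nat_def)

text \<open>Within a step the depth grows by at most one, whereas the size may double.\<close>

lemma depth_exec: "Some (y, t') \<in> outs (exec p x t) \<Longrightarrow> t' \<le> t \<and> depth y + t' \<le> depth x + t"
proof (induction p arbitrary: x t y t')
  case (Fork p q)
  then obtain a s b u where t: "0 < t" and p: "Some (a, s) \<in> outs (exec p x (t - 1))"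
    and q: "Some (b, u) \<in> outs (exec q x s)" and y: "y = Cell a b" "t' = u"
    by (auto simp: pay_def outs_and_then split: if_splits option.splits)
  from Fork.IH(1)[OF p] Fork.IH(2)[OF q] t show ?case by (auto simp: y)
next
  case (Seq p q)
  then obtain a s where t: "0 < t" and p: "Some (a, s) \<in> outs (exec p x (t - 1))"
    and q: "Some (y, t') \<in> outs (exec q a s)"
    by (auto simp: pay_def outs_and_then split: if_splits option.splits)
  from Seq.IH(1)[OF p] Seq.IH(2)[OF q] t show ?case by auto
next
  case (Cond c p q)
  then have t: "0 < t" and "Some (y, t') \<in> outs (and_then (exec c x (t - 1))
      (\<lambda>v t. if bool_of_data v then exec p x t else exec q x t))"
    by (auto simp: pay_def split: if_splits)
  then obtain a s where c: "Some (a, s) \<in> outs (exec c x (t - 1))"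
    and pq: "Some (y, t') \<in> outs (exec p x s) \<or> Some (y, t') \<in> outs (exec q x s)"
    by (auto elim!: outs_and_thenE split: if_splits)
  from Cond.IH(1)[OF c] Cond.IH(2)[of y t' x s] Cond.IH(3)[of y t' x s] pq t show ?case by auto
next
  case (While c p)
  have "t' \<le> t \<and> depth y + t' \<le> depth x + t"
    if "Some (y, t') \<in> outs (loop j (exec c) (exec p) x t)" for j x t
    using that
  proof (induction j arbitrary: x t)
    case (Suc j)
    then have t: "0 < t" and "Some (y, t') \<in> outs (and_then (exec c x (t - 1)) (\<lambda>v s.
        if bool_of_data v then and_then (exec p x s) (loop j (exec c) (exec p)) else Done (Some (x, s))))"
      by (auto simp: pay_def split: if_splits)
    then obtain v s where c: "Some (v, s) \<in> outs (exec c x (t - 1))"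
      and r: "Some (y, t') \<in> outs (if bool_of_data v then and_then (exec p x s) (loop j (exec c) (exec p))
         else Done (Some (x, s)))"
      by (auto elim!: outs_and_thenE)
    have s: "s \<le> t - 1" using While.IH(1)[OF c] by simp
    show ?case
    proof (cases "bool_of_data v")
      case True
      then obtain a u where p: "Some (a, u) \<in> outs (exec p x s)"
        and l: "Some (y, t') \<in> outs (loop j (exec c) (exec p) a u)"
        using r by (auto elim!: outs_and_thenE)
      from While.IH(2)[OF p] Suc.IH[OF l] s show ?thesis by auto
    qed (use r s in auto)
  qed simp
  then show ?case using While.prems by simp
next
  case Rand
  then show ?case using nat_of_data_le_depth[of x]
    by (auto simp: pay_def depth_nat split: if_splits)
next
  case Car
  then show ?case by (cases x) (auto simp: pay_def split: if_splits)
next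
  case Cdr
  then show ?case by (cases x) (auto simp: pay_def split: if_splits)
qed (auto simp: pay_def split: if_splits)

text \<open>The output tree of an arbitrary polynomial-time program may be exponentially large by
  duplication, but its depth is polynomial, and a list is at most as long as its code is deep. This
  is how lengths of keys, ciphertexts and decrypted messages are bounded.\<close>

lemma poly_time_depth:
  assumes "poly_time F"
  obtains g where "pmono g" and "\<And>x y. y \<in> set_pmf (F x) \<Longrightarrow> depth y \<le> g (size x)"
proof -
  obtain p T where T: "poly_bounded T" and F: "\<And>x. map_pmf (map_option fst \<circ> fst)
            (interact (\<lambda>_ _. return_pmf (Atom, ())) (exec p x (T (size x))) ())
          = map_pmf Some (F x)"
    using assms unfolding poly_time_def by auto
  obtain g where g: "pmono g" "\<And>x. T x \<le> g x" using T by (rule poly_bounded_pmono) (rule that)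
  have "depth y \<le> size x + g (size x)" if "y \<in> set_pmf (F x)" for x y
  proof -
    have "Some y \<in> set_pmf (map_pmf Some (F x))" using that by simp
    then obtain t' where "Some (y, t') \<in> outs (exec p x (T (size x)))"
      unfolding F[symmetric] by (auto simp: set_interact_outs dest: sym)
    from depth_exec[OF this] show ?thesis using depth_le_size[of x] g(2)[of "size x"] by simp
  qed
  then show ?thesis using that[of "\<lambda>x. x + g x"] by (simp add: pmono_intros g)
qed

text \<open>The given program may contain \<open>Call\<close>. Compiled with a handler that answers
  \<open>Atom\<close>, it makes no queries any more and computes \<open>f\<close> in front of every
  oracle.\<close>

lemma poly_time_nat_ptime:
  assumes "poly_time_nat f"
  obtains F where "ptime F" and "\<And>k. outcomes (F k) = {f k}"
    and "\<And>k orc s. interact orc (F k) s = return_pmf (f k, s)"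
proof -
  obtain p T where T: "poly_bounded T" and F: "\<And>x. map_pmf (map_option fst \<circ> fst)
            (interact (\<lambda>_ _. return_pmf (Atom, ())) (exec p x (T (size x))) ())
          = map_pmf Some (return_pmf (data_of_nat (f (nat_of_data x))))"
    using assms unfolding poly_time_nat_def poly_time_def by auto
  obtain g where g: "pmono g" "\<And>x. T x \<le> g x" using T by (rule poly_bounded_pmono) (rule that)
  obtain g' where g': "pmono g'" "\<And>x y. y \<in> set_pmf (return_pmf (data_of_nat (f (nat_of_data x)))) \<Longrightarrow> depth y \<le> g' (size x)"
    using assms unfolding poly_time_nat_def by (rule poly_time_depth) (rule that)
  have f: "f k \<le> g' k" for k
    using g'(2)[of _ "enc k"] by (simp add: depth_nat esize_def[symmetric])
  define e where "e k = exec p (enc k) (T k)" for k :: nat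
  have outs: "map_option fst z = Some (enc (f k))" if "z \<in> outs (e k)" for z k
  proof -
    have "map_option fst z \<in> set_pmf (map_pmf (map_option fst \<circ> fst)
       (interact (\<lambda>_ _. return_pmf (Atom, ())) (exec p (enc k) (T (size (enc k)))) ()))"
      using that by (force simp: set_interact_outs e_def esize_def[symmetric])
    then show ?thesis unfolding F using nat_of_enc[of k] by (simp add: enc_nat_def)
  qed
  define F where "F k = bind_comp (subst_comp no_oracle (e k) ())
    (\<lambda>z. Done (nat_of_data (the_or Atom (map_option fst (fst z)))))" for k
  have out: "b = f k" if "b \<in> outcomes (F k)" for b k
    using that by (auto simp: F_def outcomes_bind outcomes_no_oracle dest!: outs split: if_splits)
  have outF: "outcomes (F k) = {f k}" for k
  proof -
    obtain b where "b \<in> outcomes (F k)" using outcomes_nonempty[of "F k"] by auto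
    with out show ?thesis by auto
  qed
  show ?thesis
  proof (rule that)
    show "interact orc (F k) s = return_pmf (f k, s)" for orc k s
    proof -
      have noask: "interact orc (subst_comp no_oracle m ()) s =
          map_pmf (\<lambda>z. ((fst z, ()), s)) (interact (\<lambda>_ _. return_pmf (Atom, ())) m ())" for m :: "'c comp"
        by (induction m) (simp_all add: map_bind_pmf bind_return_pmf)
      let ?triv = "interact (\<lambda>_ _. return_pmf (Atom, ())) (e k) ()"
      have "interact orc (F k) s = bind_pmf ?triv
          (\<lambda>z. return_pmf (nat_of_data (the_or Atom (map_option fst (fst z))), s))"
        by (simp add: F_def interact_bind noask bind_map_pmf)
      also have "\<dots> = bind_pmf ?triv (\<lambda>_. return_pmf (f k, s))"
        by (rule bind_pmf_cong) (auto simp: set_interact_outs dest!: outs)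
      finally show ?thesis by simp
    qed
    show "outcomes (F k) = {f k}" for k by (rule outF)
    have nn: "None \<notin> outs (e k)" for k using outs[of None k] by auto
    have H: "runs (exec (Fork Nul Nul) y) 3 (no_oracle q s)" for y q s
      by (rule runs_Done_cong[OF runs_mono[OF runs_Fork2[OF runs_Nul runs_Nul]]]) auto
    have "fp (\<lambda>z :: data \<times> unit. nat_of_data (fst z))" by (intro fp_intros)
    then obtain q h where q: "pmono h" "\<And>z :: data \<times> unit. runs (exec q (enc z)) (h (esize z)) (Done (nat_of_data (fst z)))"
      by (rule ptimeE) (rule that)
    show "ptime F"
    proof (rule ptimeI[where p="Seq (Fork Id Nul) (Seq (compile (Fork Nul Nul) p) q)"])
      fix k
      have C: "runs (exec (compile (Fork Nul Nul) p) (Cell (enc k) (enc ()))) ((3 + 40) * T k)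
         (bind_comp (subst_comp no_oracle (e k) ()) (\<lambda>z. Done (the_or Atom (map_option fst (fst z)), snd z)))"
        unfolding e_def
        by (rule runs_compile[where I="\<lambda>_ _. True"])
           (use nn[of k] H in \<open>auto simp: outcomes_no_oracle e_def\<close>)
      have "runs (exec (Seq (Fork Id Nul) (Seq (compile (Fork Nul Nul) p) q)) (enc k))
          (Suc (Suc (1 + 1) + Suc ((3 + 40) * T k + h (Suc (f k))))) (bind_comp
           (bind_comp (subst_comp no_oracle (e k) ()) (\<lambda>z. Done (the_or Atom (map_option fst (fst z)), snd z)))
           (\<lambda>z. Done (nat_of_data (fst z))))"
      proof (rule runs_Seq_Done[OF runs_Fork2[OF runs_Id runs_Nul]], rule runs_Seq)
        show "runs (exec (compile (Fork Nul Nul) p) (enc (k, ()))) ((3 + 40) * T k)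
         (bind_comp (subst_comp no_oracle (e k) ()) (\<lambda>z. Done (the_or Atom (map_option fst (fst z)), snd z)))"
          using C by simp
        fix b assume "b \<in> outcomes (bind_comp (subst_comp no_oracle (e k) ())
             (\<lambda>z. Done (the_or Atom (map_option fst (fst z)), snd z)))"
        then have "b = (enc (f k), ())" by (auto simp: outcomes_bind outcomes_no_oracle dest!: outs split: if_splits)
        then show "runs (exec q (enc b)) (h (Suc (f k))) (Done (nat_of_data (fst b)))"
          using q(2)[of b] by (simp add: esize_def[symmetric])
      qed
      moreover have "43 * T k + h (Suc (f k)) \<le> 43 * g k + h (Suc (g' k))"
        using g(2)[of k] pmonoD[OF q(1), of "Suc (f k)" "Suc (g' k)"] f[of k] by simp
      ultimately show "runs (exec (Seq (Fork Id Nul) (Seq (compile (Fork Nul Nul) p) q)) (enc k))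
          (43 * g (esize k) + h (Suc (g' (esize k))) + 10) (F k)"
        by (simp add: F_def bind_comp_assoc) (erule runs_mono, simp)
      show "esize b \<le> g' (esize k)" if "b \<in> outcomes (F k)" for b
        using out[OF that] f[of k] by simp
    qed (intro pmono_intros pmono_comp[OF q(1)] g g')+
  qed
qed

section \<open>One-sided approximate couplings of games\<close>

section \<open>Game hops\<close>

text \<open>An approximate coupling in dual form: there is no joint distribution, but a test on the
  left that is dominated along \<open>R\<close> by a test on the right exceeds it in expectation by
  at most \<open>d\<close>. In this form errors simply add up under \<open>bind_pmf\<close>.\<close>

definition hop :: "ennreal \<Rightarrow> ('a \<Rightarrow> 'b \<Rightarrow> bool) \<Rightarrow> 'a pmf \<Rightarrow> 'b pmf \<Rightarrow> bool" where
  "hop d R p q \<longleftrightarrow> (\<forall>F G. (\<forall>x. F x \<le> 1) \<longrightarrow> (\<forall>x\<in>set_pmf p. \<forall>y\<in>set_pmf q. R x y \<longrightarrow> F x \<le> G y) \<longrightarrow>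
     (\<integral>\<^sup>+x. F x \<partial>measure_pmf p) \<le> (\<integral>\<^sup>+y. G y \<partial>measure_pmf q) + d)"

lemma hopD:
  assumes "hop d R p q" and "\<And>x. F x \<le> 1"
    and "\<And>x y. x \<in> set_pmf p \<Longrightarrow> y \<in> set_pmf q \<Longrightarrow> R x y \<Longrightarrow> F x \<le> G y"
  shows "(\<integral>\<^sup>+x. F x \<partial>measure_pmf p) \<le> (\<integral>\<^sup>+y. G y \<partial>measure_pmf q) + d"
  using assms unfolding hop_def by blast

lemma nn_integral_pmf_mono:
  "(\<And>x. x \<in> set_pmf p \<Longrightarrow> F x \<le> G x) \<Longrightarrow>
   (\<integral>\<^sup>+x. F x \<partial>measure_pmf p) \<le> (\<integral>\<^sup>+x. G x \<partial>measure_pmf p)"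
  by (intro nn_integral_mono_AE) (simp add: AE_measure_pmf_iff)

lemma nn_integral_pmf_le_1: "(\<And>x. F x \<le> 1) \<Longrightarrow> (\<integral>\<^sup>+x. F x \<partial>measure_pmf p) \<le> 1"
  using nn_integral_pmf_mono[of p F "\<lambda>_. 1"] by simp

lemma hop_rel_pmf:
  assumes "rel_pmf R p q"
  shows "hop 0 R p q"
proof -
  from assms obtain pq where pq: "\<And>x y. (x, y) \<in> set_pmf pq \<Longrightarrow> R x y" and
    p: "p = map_pmf fst pq" and q: "q = map_pmf snd pq" by (auto elim!: rel_pmf.cases)
  show ?thesis unfolding hop_def p q
    by (auto simp: nn_integral_map_pmf intro!: nn_integral_pmf_mono) (use pq in fastforce)
qed

lemma hop_bind:
  assumes "hop d R p q" and "\<And>x y. x \<in> set_pmf p \<Longrightarrow> y \<in> set_pmf q \<Longrightarrow> R x y \<Longrightarrow> hop e S (f x) (g y)"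
  shows "hop (d + e) S (bind_pmf p f) (bind_pmf q g)"
  unfolding hop_def
proof (intro allI impI)
  fix F G
  assume F: "\<forall>x. F x \<le> (1::ennreal)"
    and le: "\<forall>x\<in>set_pmf (bind_pmf p f). \<forall>y\<in>set_pmf (bind_pmf q g). S x y \<longrightarrow> F x \<le> G y"
  have "(\<integral>\<^sup>+x. \<integral>\<^sup>+y. F y \<partial>f x \<partial>p) \<le> (\<integral>\<^sup>+x. (\<integral>\<^sup>+y. G y \<partial>g x) + e \<partial>q) + d"
  proof (rule hopD[OF assms(1)])
    show "(\<integral>\<^sup>+y. F y \<partial>f x) \<le> 1" for x using F by (intro nn_integral_pmf_le_1) auto
    fix x y assume "x \<in> set_pmf p" "y \<in> set_pmf q" "R x y"
    then show "(\<integral>\<^sup>+y. F y \<partial>f x) \<le> (\<integral>\<^sup>+y. G y \<partial>g y) + e"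
      using F le by (intro hopD[OF assms(2)]) auto
  qed
  then show "(\<integral>\<^sup>+x. F x \<partial>bind_pmf p f) \<le> (\<integral>\<^sup>+x. G x \<partial>bind_pmf q g) + (d + e)"
    by (simp add: nn_integral_add ac_simps)
qed

lemma hop_mono:
  "hop d R p q \<Longrightarrow> d \<le> e \<Longrightarrow> (\<And>x y. x \<in> set_pmf p \<Longrightarrow> y \<in> set_pmf q \<Longrightarrow> R x y \<Longrightarrow> S x y) \<Longrightarrow> hop e S p q"
  unfolding hop_def
proof (intro allI impI)
  fix F G
  assume hop: "\<forall>F G. (\<forall>x. F x \<le> 1) \<longrightarrow> (\<forall>x\<in>set_pmf p. \<forall>y\<in>set_pmf q. R x y \<longrightarrow> F x \<le> G y) \<longrightarrow>
      (\<integral>\<^sup>+x. F x \<partial>p) \<le> (\<integral>\<^sup>+y. G y \<partial>q) + d" and "d \<le> e"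
    and RS: "\<And>x y. x \<in> set_pmf p \<Longrightarrow> y \<in> set_pmf q \<Longrightarrow> R x y \<Longrightarrow> S x y"
    and F: "\<forall>x. F x \<le> (1::ennreal)" and le: "\<forall>x\<in>set_pmf p. \<forall>y\<in>set_pmf q. S x y \<longrightarrow> F x \<le> G y"
  have "(\<integral>\<^sup>+x. F x \<partial>p) \<le> (\<integral>\<^sup>+y. G y \<partial>q) + d" using hop F le RS by simp
  also have "\<dots> \<le> (\<integral>\<^sup>+y. G y \<partial>q) + e" using \<open>d \<le> e\<close> by (rule add_left_mono)
  finally show "(\<integral>\<^sup>+x. F x \<partial>p) \<le> (\<integral>\<^sup>+y. G y \<partial>q) + e" .
qed

text \<open>Identical until bad: tests on the left are bounded by 1, so the bad event contributes no
  more than its probability.\<close>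

lemma hop_bad:
  assumes "emeasure (measure_pmf p) {x. \<not> R x x} \<le> d"
  shows "hop d R p p"
  unfolding hop_def
proof (intro allI impI)
  fix F G
  assume F: "\<forall>x. F x \<le> (1::ennreal)" and le: "\<forall>x\<in>set_pmf p. \<forall>y\<in>set_pmf p. R x y \<longrightarrow> F x \<le> G y"
  have "(\<integral>\<^sup>+x. F x \<partial>p) \<le> (\<integral>\<^sup>+x. G x + indicator {x. \<not> R x x} x \<partial>p)"
    using F le by (intro nn_integral_pmf_mono) (auto split: split_indicator intro: order_trans)
  also have "\<dots> \<le> (\<integral>\<^sup>+x. G x \<partial>p) + d"
    using assms by (simp add: nn_integral_add add_left_mono)
  finally show "(\<integral>\<^sup>+x. F x \<partial>p) \<le> (\<integral>\<^sup>+x. G x \<partial>p) + d" .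
qed

lemma hop_all:
  assumes "\<And>x y. x \<in> set_pmf p \<Longrightarrow> y \<in> set_pmf q \<Longrightarrow> R x y"
  shows "hop 0 R p q"
proof -
  have "rel_pmf (\<lambda>x y. R x y) p q"
    by (rule rel_pmf.intros[where pq="pair_pmf p q"]) (use assms in \<open>auto simp: map_fst_pair_pmf map_snd_pair_pmf\<close>)
  then show ?thesis by (rule hop_rel_pmf)
qed

text \<open>The budget bounds the number and the sizes of the queries.\<close>

primrec paced :: "(data \<times> nat) option comp \<Rightarrow> nat \<Rightarrow> bool" where
  "paced (Done z) t = (\<forall>y t'. z = Some (y, t') \<longrightarrow> t' \<le> t)"
| "paced (Choose n f) t = (\<forall>i. paced (f i) t)"
| "paced (Ask q f) t = (size q < t \<and> (\<forall>r. paced (f r) (t - 1 - size q)))"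

lemma paced_mono: "paced m t \<Longrightarrow> t \<le> t' \<Longrightarrow> paced m t'"
proof (induction m arbitrary: t t')
  case (Choose n f)
  then show ?case by (auto intro: Choose.IH[OF rangeI])
next
  case (Ask q f)
  then show ?case by (auto intro: Ask.IH[OF rangeI, of _ "t - 1 - size q"])
qed auto

lemma paced_and_then: "paced m t \<Longrightarrow> (\<And>y s. s \<le> t \<Longrightarrow> paced (f y s) s) \<Longrightarrow> paced (and_then m f) t"
  unfolding and_then_def
proof (induction m arbitrary: t)
  case (Done z)
  have "paced (f y t') t" if "z = Some (y, t')" for y t'
    using Done that by (intro paced_mono[OF Done.prems(2), of t']) auto
  then show ?case by (auto split: option.split)
qed auto

lemma paced_pay: "(a \<le> t \<Longrightarrow> paced (f (t - a)) t) \<Longrightarrow> paced (pay a t f) t"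
  by (simp add: pay_def)

lemma paced_exec: "paced (exec p x t) t"
proof (induction p arbitrary: x t)
  case (While c p)
  have "paced (loop j (exec c) (exec p) x t) t" for j
  proof (induction j arbitrary: x t)
    case (Suc j)
    have "paced (and_then (exec c x (t - 1)) (\<lambda>v s. if bool_of_data v
       then and_then (exec p x s) (loop j (exec c) (exec p)) else Done (Some (x, s)))) (t - 1)"
      by (rule paced_and_then[OF While(1)]) (auto intro!: paced_and_then While Suc.IH)
    then show ?case unfolding loop.simps by (intro paced_pay) (auto elim: paced_mono)
  qed simp
  then show ?case by simp
next
  case (Fork p q)
  have "paced (and_then (exec p x (t - 1)) (\<lambda>y s. and_then (exec q x s) (\<lambda>z t. Done (Some (Cell y z, t))))) (t - 1)"
    by (intro paced_and_then Fork) auto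
  then show ?case unfolding exec.simps by (intro paced_pay) (auto elim: paced_mono)
next
  case (Seq p q)
  have "paced (and_then (exec p x (t - 1)) (exec q)) (t - 1)"
    by (intro paced_and_then Seq)
  then show ?case unfolding exec.simps by (intro paced_pay) (auto elim: paced_mono)
next
  case (Cond c p q)
  have "paced (and_then (exec c x (t - 1)) (\<lambda>v s. if bool_of_data v then exec p x s else exec q x s)) (t - 1)"
    by (intro paced_and_then Cond(1)) (auto intro: Cond)
  then show ?case unfolding exec.simps by (intro paced_pay) (auto elim: paced_mono)
qed (auto simp: pay_def)

lemma interact_persist:
  assumes "\<And>s q z. P s \<Longrightarrow> z \<in> set_pmf (orc s q) \<Longrightarrow> P (snd z)" and "P s"
    and "z \<in> set_pmf (interact orc m s)"
  shows "P (snd z)"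
  using assms(2,3)
proof (induction m arbitrary: s z)
  case (Choose n f)
  then obtain i where "z \<in> set_pmf (interact orc (f i) s)" by auto
  then show ?case by (rule Choose.IH[OF rangeI Choose.prems(1)])
next
  case (Ask q f)
  then obtain y where y: "y \<in> set_pmf (orc s q)" "z \<in> set_pmf (interact orc (f (fst y)) (snd y))" by auto
  show ?case by (rule Ask.IH[OF rangeI assms(1)[OF Ask.prems(1) y(1)] y(2)])
qed auto

text \<open>Each query uses up budget and may cost the error \<open>d\<close>, whence
  \<open>t * d\<close>. The relation may be given up as soon as the left state is dead, where the
  left test is 0 from then on, or the right state is won, where the right test is at least 1 from
  then on; both conditions persist.\<close>

lemma interact_hop:
  fixes o1 :: "'s1 \<Rightarrow> data \<Rightarrow> (data \<times> 's1) pmf" and o2 :: "'s2 \<Rightarrow> data \<Rightarrow> (data \<times> 's2) pmf"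
  assumes step: "\<And>t s1 s2 q. R t s1 s2 \<Longrightarrow> size q < t \<Longrightarrow>
      hop d (\<lambda>z1 z2. dead (snd z1) \<or> won (snd z2) \<or> fst z1 = fst z2 \<and> R (t - 1 - size q) (snd z1) (snd z2))
        (o1 s1 q) (o2 s2 q)"
    and dead: "\<And>s q z. dead s \<Longrightarrow> z \<in> set_pmf (o1 s q) \<Longrightarrow> dead (snd z)"
    and won: "\<And>s q z. won s \<Longrightarrow> z \<in> set_pmf (o2 s q) \<Longrightarrow> won (snd z)"
    and F: "\<And>z. F z \<le> 1" "\<And>x s. dead s \<Longrightarrow> F (x, s) = 0"
    and G: "\<And>x s. won s \<Longrightarrow> G (x, s) \<ge> 1"
    and FG: "\<And>t x s1 s2. R t s1 s2 \<Longrightarrow> F (x, s1) \<le> G (x, s2)"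
    and "paced m t" and "R t s1 s2"
  shows "(\<integral>\<^sup>+z. F z \<partial>interact o1 m s1) \<le> (\<integral>\<^sup>+z. G z \<partial>interact o2 m s2) + of_nat t * d"
  using assms(8,9)
proof (induction m arbitrary: t s1 s2)
  case (Done x)
  then have "F (x, s1) \<le> G (x, s2) + of_nat t * d" using FG by (intro add_increasing2) auto
  then show ?case by simp
next
  case (Choose n f)
  have "(\<integral>\<^sup>+i. (\<integral>\<^sup>+z. F z \<partial>interact o1 (f i) s1) \<partial>pmf_of_set {..n}) \<le>
    (\<integral>\<^sup>+i. (\<integral>\<^sup>+z. G z \<partial>interact o2 (f i) s2) + of_nat t * d \<partial>pmf_of_set {..n})"
    using Choose.prems by (intro nn_integral_mono Choose.IH[OF rangeI]) auto
  then show ?case by (simp add: nn_integral_add)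
next
  case (Ask q f)
  let ?t = "t - 1 - size q"
  have q: "size q < t" and w: "\<And>r. paced (f r) ?t" using Ask.prems by auto
  have deadF: "(\<integral>\<^sup>+z. F z \<partial>interact o1 m s) = 0" if "dead s" for m :: "(data \<times> nat) option comp" and s
  proof -
    have "(\<integral>\<^sup>+z. F z \<partial>interact o1 m s) \<le> (\<integral>\<^sup>+z. 0 \<partial>interact o1 m s)"
    proof (rule nn_integral_pmf_mono)
      fix z assume "z \<in> set_pmf (interact o1 m s)"
      from interact_persist[where P=dead, OF dead that this] have "dead (snd z)" .
      then show "F z \<le> 0" using F(2)[of "snd z" "fst z"] by simp
    qed
    then show ?thesis by simp
  qed
  have topG: "(\<integral>\<^sup>+z. G z \<partial>interact o2 m s) \<ge> 1" if "won s" for m :: "(data \<times> nat) option comp" and s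
  proof -
    have "(\<integral>\<^sup>+z. 1 \<partial>interact o2 m s) \<le> (\<integral>\<^sup>+z. G z \<partial>interact o2 m s)"
    proof (rule nn_integral_pmf_mono)
      fix z assume "z \<in> set_pmf (interact o2 m s)"
      from interact_persist[where P=won, OF won that this] have "won (snd z)" .
      then show "1 \<le> G z" using G[of "snd z" "fst z"] by simp
    qed
    then show ?thesis by simp
  qed
  have "(\<integral>\<^sup>+y. (\<integral>\<^sup>+z. F z \<partial>interact o1 (f (fst y)) (snd y)) \<partial>o1 s1 q) \<le>
     (\<integral>\<^sup>+y. (\<integral>\<^sup>+z. G z \<partial>interact o2 (f (fst y)) (snd y)) + of_nat ?t * d \<partial>o2 s2 q) + d"
  proof (rule hopD[OF step[OF Ask.prems(2) q]])
    show le1: "(\<integral>\<^sup>+z. F z \<partial>interact o1 (f (fst y)) (snd y)) \<le> 1" for y :: "data \<times> 's1"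
      by (intro nn_integral_pmf_le_1 F)
    fix y :: "data \<times> 's1" and y' :: "data \<times> 's2"
    assume "dead (snd y) \<or> won (snd y') \<or> fst y = fst y' \<and> R (t - 1 - size q) (snd y) (snd y')"
    then show "(\<integral>\<^sup>+z. F z \<partial>interact o1 (f (fst y)) (snd y))
        \<le> (\<integral>\<^sup>+z. G z \<partial>interact o2 (f (fst y')) (snd y')) + of_nat ?t * d"
    proof (elim disjE conjE)
      assume "dead (snd y)"
      then show ?thesis by (simp add: deadF)
    next
      assume "won (snd y')"
      from order_trans[OF le1 topG[OF this]] show ?thesis by (simp add: add_increasing2)
    next
      assume "fst y = fst y'" "R (t - 1 - size q) (snd y) (snd y')"
      then show ?thesis using Ask.IH[OF rangeI w] by auto
    qed
  qed
  also have "\<dots> = (\<integral>\<^sup>+y. (\<integral>\<^sup>+z. G z \<partial>interact o2 (f (fst y)) (snd y)) \<partial>o2 s2 q) + (of_nat ?t * d + d)"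
    by (simp add: nn_integral_add ac_simps)
  also have "of_nat ?t * d + d = of_nat (Suc ?t) * d" by (simp add: algebra_simps)
  also have "\<dots> \<le> of_nat t * d" using q by (intro mult_right_mono of_nat_mono) auto
  finally show ?case by (simp add: split_def add_left_mono)
qed

lemma interact_rel:
  assumes step: "\<And>t s1 s2 q. R t s1 s2 \<Longrightarrow> size q < t \<Longrightarrow>
      rel_pmf (\<lambda>z1 z2. fst z1 = fst z2 \<and> R (t - 1 - size q) (snd z1) (snd z2)) (o1 s1 q) (o2 s2 q)"
    and "paced m t" and "R t s1 s2"
  shows "rel_pmf (\<lambda>z1 z2. fst z1 = fst z2 \<and> (\<exists>t. R t (snd z1) (snd z2))) (interact o1 m s1) (interact o2 m s2)"
  using assms(2,3)
proof (induction m arbitrary: t s1 s2)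
  case (Choose n f)
  have "rel_pmf (=) (pmf_of_set {..n}) (pmf_of_set {..n})" by (simp add: pmf.rel_eq)
  then show ?case using Choose.prems by (auto intro!: rel_pmf_bindI[where R="(=)"] Choose.IH[OF rangeI])
next
  case (Ask q f)
  then have q: "size q < t" and w: "\<And>r. paced (f r) (t - 1 - size q)" by auto
  show ?case unfolding interact.simps split_def
    by (rule rel_pmf_bindI[OF step[OF Ask.prems(2) q]]) (use Ask.IH[OF rangeI w] in auto)
qed auto

section \<open>Negligible functions multiplied by polynomials\<close>

section \<open>Negligible functions\<close>

lemma poly_bounded_power:
  assumes "poly_bounded f"
  obtains e where "\<forall>\<^sub>F k in sequentially. f k \<le> k ^ e"
proof -
  obtain a where a: "\<And>k. f k \<le> k ^ a + a" using assms unfolding poly_bounded_def by auto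
  have "\<forall>\<^sub>F k in sequentially. f k \<le> k ^ (a + 1)"
    using eventually_ge_at_top[of "max 2 a"]
  proof eventually_elim
    case (elim k)
    show ?case
    proof (cases a)
      case 0
      then show ?thesis using a[of k] elim by simp
    next
      case (Suc b)
      have "k \<le> k ^ a" using elim Suc by (simp add: one_le_power)
      then have "k ^ a + a \<le> k ^ a * 2" using elim by linarith
      also have "\<dots> \<le> k ^ a * k" using elim by (intro mult_le_mono2) simp
      finally show ?thesis using a[of k] by (simp add: mult.commute)
    qed
  qed
  then show ?thesis by (rule that)
qed

lemma negligible_poly_mult:
  assumes "poly_bounded f" and "negligible \<nu>"
  shows "negligible (\<lambda>k. real (f k) * \<nu> k)"
  unfolding negligible_def
proof
  fix c :: nat
  obtain e where e: "\<forall>\<^sub>F k in sequentially. f k \<le> k ^ e"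
    using assms(1) by (rule poly_bounded_power)
  have "\<forall>\<^sub>F k in sequentially. \<bar>\<nu> k\<bar> \<le> 1 / real k ^ (e + c)"
    using assms(2) unfolding negligible_def by blast
  with e eventually_gt_at_top[of 0] show "\<forall>\<^sub>F k in sequentially. \<bar>real (f k) * \<nu> k\<bar> \<le> 1 / real k ^ c"
  proof eventually_elim
    case (elim k)
    have "\<bar>real (f k) * \<nu> k\<bar> \<le> real k ^ e * (1 / real k ^ (e + c))"
      unfolding abs_mult using elim of_nat_mono[OF elim(1), where 'a=real]
      by (intro mult_mono) auto
    also have "\<dots> = 1 / real k ^ c" using elim(2) by (simp add: power_add)
    finally show ?case .
  qed
qed

section \<open>The hybrid argument over encryption queries\<close>

section \<open>From a single challenge to all encryptions\<close>

type_synonym lr_state = "nat \<times> (bits \<times> bits) list"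

definition lookup_dec :: "decryption \<Rightarrow> bits \<Rightarrow> (bits \<times> bits) list \<Rightarrow> bits \<Rightarrow> bits option" where
  "lookup_dec Dec key tab c = (case map_of tab c of None \<Rightarrow> Dec key c | Some m \<Rightarrow> Some m)"

abbreviation zeros :: "bits \<Rightarrow> bits" where
  "zeros m \<equiv> replicate (length m) False"

text \<open>Decryption always pretends that the messages themselves were encrypted.\<close>

fun lr_oracle :: "encryption \<Rightarrow> decryption \<Rightarrow> bits \<Rightarrow> (nat \<Rightarrow> bool) \<Rightarrow> lr_state \<Rightarrow> cpa_query
    \<Rightarrow> (data \<times> lr_state) pmf" where
  "lr_oracle Enc Dec key w (i, tab) (EncQ ms) =
     map_pmf (\<lambda>cs. (enc cs, (Suc i, zip cs ms @ tab))) (mapM_pmf (Enc key) (if w i then ms else map zeros ms))"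
| "lr_oracle Enc Dec key w (i, tab) (DecQ cs) =
     return_pmf (enc (map (lookup_dec Dec key tab) cs), (i, tab))"
| "lr_oracle Enc Dec key w (i, tab) (ChallengeQ M0 M1) = return_pmf (Atom, (i, tab))"

definition lr_game :: "keygen \<Rightarrow> encryption \<Rightarrow> decryption \<Rightarrow> (nat \<Rightarrow> bool) \<Rightarrow> prog \<Rightarrow> (nat \<Rightarrow> nat) \<Rightarrow> nat \<Rightarrow> bool pmf" where
  "lr_game Gen Enc Dec w p T k = do {
     key \<leftarrow> Gen k;
     z \<leftarrow> interact (\<lambda>s q. lr_oracle Enc Dec key w s (cpa_query_of_data q)) (exec p (enc k) (T k)) (0, []);
     return_pmf (bool_of_data (the_or Atom (map_option fst (fst z)))) }"

lemma fp_map_of [fp_intros]: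
  assumes "fp f" and "fp L"
  shows "fp (\<lambda>x. map_of (L x :: (bits \<times> 'b::codable) list) (f x))"
proof -
  have "fp (\<lambda>x. case filter (\<lambda>p. fst p = f x) (L x) of [] \<Rightarrow> None | p # ps \<Rightarrow> Some (snd p))"
    by (intro fp_intros assms(2) ptime_comp[OF assms(1)])
  moreover have "(case filter (\<lambda>p. fst p = c) xs of [] \<Rightarrow> None | p # ps \<Rightarrow> Some (snd p)) = map_of xs c"
    for xs :: "(bits \<times> 'b) list" and c
    by (induction xs) auto
  ultimately show ?thesis by simp
qed

lemma fp_zip [fp_intros]:
  assumes "fp f" and "fp g"
  shows "fp (\<lambda>x. zip (f x) (g x))"
proof -
  define step :: "'b \<Rightarrow> ('b \<times> 'c) list \<times> 'c list \<Rightarrow> ('b \<times> 'c) list \<times> 'c list"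
    where "step y s = (case snd s of [] \<Rightarrow> (fst s, []) | z # zs \<Rightarrow> ((y, z) # fst s, zs))" for y s
  have eq: "rev (fst (fold step xs (acc, ys))) = rev acc @ zip xs ys" for xs ys acc
  proof (induction xs arbitrary: ys acc)
    case (Cons x xs)
    have "fst (fold step xs (acc, [])) = acc" for xs by (induction xs) (auto simp: step_def)
    then show ?case using Cons by (cases ys) (auto simp: step_def)
  qed simp
  have size: "esize (step y s) \<le> esize s + (esize y + 1)" for y s
    by (cases s; cases "snd s") (auto simp: step_def)
  have "fp (\<lambda>x. fold step (f x) ([], g x))"
  proof (rule fp_fold[where G="\<lambda>x. x + 1"])
    show "fp (\<lambda>z. step (fst (snd z)) (snd (snd z)))"
      unfolding step_def by (intro fp_intros)
    show "esize (step y s) \<le> esize s + (esize a + esize y + 1)" for a y s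
      using size[of y s] by simp
  qed (intro fp_intros assms pmono_intros)+
  then have "fp (\<lambda>x. rev (fst (fold step (f x) ([], g x))))" by (intro fp_intros)
  then show ?thesis by (simp add: eq)
qed

lemma esize_zip: "esize (zip xs ys) \<le> esize xs + esize ys"
proof (induction xs arbitrary: ys)
  case (Cons x xs)
  show ?case
  proof (cases ys)
    case (Cons y zs)
    then show ?thesis using Cons.IH[of zs] by simp
  qed simp
qed simp

lemma esize_bits: "esize (bs::bits) \<le> 2 * length bs"
proof (induction bs)
  case (Cons b bs)
  then show ?case using esize_bool[of b] by simp
qed simp

lemma esize_list_le:
  assumes "\<And>x. x \<in> set xs \<Longrightarrow> esize x \<le> B"
  shows "esize xs \<le> length xs * (B + 1)"
  using assms by (induction xs) (fastforce simp: add_mono)+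

lemma esize_bits_of_data: "esize (bits_of_data d) \<le> size d"
proof -
  have "esize (map bool_of_data (list_of_data d)) \<le> size d"
  proof (induction d)
    case (Cell x y)
    have "esize (bool_of_data x) \<le> size x" by (cases x) (auto simp: esize_def enc_bool_def)
    then show ?case using Cell(2) by simp
  qed simp
  then show ?thesis by (simp add: bits_of_data_def)
qed

lemma esize_bits_list_of_data: "esize (bits_list_of_data d) \<le> size d"
proof -
  have "esize (map bits_of_data (list_of_data d)) \<le> size d"
  proof (induction d)
    case (Cell x y)
    then show ?case using esize_bits_of_data[of x] by simp
  qed simp
  then show ?thesis by (simp add: bits_list_of_data_def)
qed

lemma size_car_cdr: "size (car d) \<le> size d" "size (cdr d) \<le> size d"
  by (cases d; simp)+

lemma length_le_esize_mem: "m \<in> set ms \<Longrightarrow> length m \<le> esize ms"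
  using esize_mem[of m ms] length_le_esize[of m] by linarith

lemma mapM_pmf_set: "cs \<in> set_pmf (mapM_pmf f ms) \<Longrightarrow> list_all2 (\<lambda>c m. c \<in> set_pmf (f m)) cs ms"
  by (induction ms arbitrary: cs) auto

text \<open>State of the reduction: bound on the answers, index of the challenge, number of encryption
  queries so far, and table of all ciphertexts received with their intended plaintexts.\<close>

type_synonym red_state = "nat \<times> nat \<times> nat \<times> (bits \<times> bits) list"

definition reduction :: "data \<Rightarrow> red_state \<Rightarrow> (data \<times> red_state) comp" where
  "reduction q st = (case st of (N, j, i, tab) \<Rightarrow>
     if nat_of_data (car q) = 0 then
       bind_comp (Ask (if i < j then enc (0::nat, map zeros (bits_list_of_data (cdr q)))
                       else if i = j then enc (2::nat, map zeros (bits_list_of_data (cdr q)), bits_list_of_data (cdr q))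
                       else enc (0::nat, bits_list_of_data (cdr q)))
                  (\<lambda>r. Done (trunc N r)))
         (\<lambda>r. Done (enc (bits_list_of_data r),
            (N, j, Suc i, zip (bits_list_of_data r) (bits_list_of_data (cdr q)) @ tab)))
     else if nat_of_data (car q) = 1 then
       bind_comp (Ask (enc (1::nat, filter (\<lambda>c. map_of tab c = None) (bits_list_of_data (cdr q))))
                  (\<lambda>r. Done (trunc N r)))
         (\<lambda>r. Done (enc (map (\<lambda>c. case map_of tab c of
               None \<Rightarrow> the_or Atom (map_of (zip (filter (\<lambda>c. map_of tab c = None) (bits_list_of_data (cdr q))) (list_of_data r)) c)
             | Some m \<Rightarrow> enc (Some m)) (bits_list_of_data (cdr q))), st))
     else Done (Atom, st))"

lemma fp_zeros [fp_intros]: "fp f \<Longrightarrow> fp (\<lambda>x. zeros (f x))"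
  by (intro fp_intros)

lemma ptime_reduction: "ptime (\<lambda>z. reduction (fst z) (snd z))"
  unfolding reduction_def
  by (intro fp_intros)

lemma reduction_state:
  assumes "(r, N', j', i', tab') \<in> outcomes (reduction q (N, j, i, tab))"
  shows "N' = N" and "j' = j" and "esize (N', j', i', tab') \<le> esize (N, j, i, tab) + (N + size q + 1)"
proof -
  have "esize (zip (bits_list_of_data (trunc N r)) (bits_list_of_data (cdr q))) \<le> N + size q" for r
    using esize_zip[of "bits_list_of_data (trunc N r)" "bits_list_of_data (cdr q)"]
      esize_bits_list_of_data[of "trunc N r"] size_trunc[of N r]
      esize_bits_list_of_data[of "cdr q"] size_car_cdr[of q] by linarith
  then show "N' = N" "j' = j" "esize (N', j', i', tab') \<le> esize (N, j, i, tab) + (N + size q + 1)"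
    using assms by (auto simp: reduction_def add_increasing split: if_splits)
qed

lemma cpa_query_of_enc [simp]:
  "cpa_query_of_data (enc (0::nat, ms)) = EncQ ms"
  "cpa_query_of_data (enc (1::nat, ms)) = DecQ ms"
  "cpa_query_of_data (enc (Suc 0, ms)) = DecQ ms"
  "cpa_query_of_data (enc (2::nat, ms, ms')) = ChallengeQ ms ms'"
  by (simp_all add: cpa_query_of_data_def del: enc_0 enc_Suc)

lemma trunc_enc: "esize a \<le> N \<Longrightarrow> trunc N (enc a) = enc a"
  by (simp add: trunc_def esize_def)

definition red_rel :: "nat \<Rightarrow> nat \<Rightarrow> nat \<Rightarrow> nat \<Rightarrow> red_state \<times> cpa_state \<Rightarrow> lr_state \<Rightarrow> bool" where
  "red_rel N j B t s s' \<longleftrightarrow> t \<le> B \<and> (\<exists>i tab ch. s = ((N, j, i, tab), (ch, False)) \<and> s' = (i, tab) \<and>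
     (i \<le> j \<longrightarrow> ch = None) \<and> (\<forall>C. ch = Some C \<longrightarrow> set C \<subseteq> fst ` set tab))"

text \<open>A bit string of length at most \<open>G\<close> has a code of size at most
  \<open>2 * G\<close>; one cell is added by \<open>Some\<close> and one by the list, and a query
  contains at most \<open>B\<close> strings. With \<open>N\<close> at least this product truncation
  changes nothing, and the reduction answers exactly as the hybrid oracle does.\<close>

lemma reduction_step:
  assumes Enc: "\<And>m c. m \<in> Collect (\<lambda>m. length m \<le> B) \<Longrightarrow> c \<in> set_pmf (Enc key m) \<Longrightarrow> length c \<le> G"
    and Dec: "\<And>m c. length c \<le> B \<Longrightarrow> Dec key c = Some m \<Longrightarrow> length m \<le> G"
    and N: "B * (2 * G + 2) \<le> N"
    and R: "red_rel N j B t s s'" and q: "size q < t"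
  shows "rel_pmf (\<lambda>z1 z2. fst z1 = fst z2 \<and> red_rel N j B (t - 1 - size q) (snd z1) (snd z2))
     ((\<lambda>(s, u) q. map_pmf (\<lambda>((r, s), u). (r, (s, u)))
        (interact (\<lambda>s q. cpa_oracle Enc Dec key b s (cpa_query_of_data q)) (reduction q s) u)) s q)
     (lr_oracle Enc Dec key (\<lambda>i. j < i \<or> i = j \<and> b) s' (cpa_query_of_data q))"
proof -
  obtain i tab ch where s: "s = ((N, j, i, tab), (ch, False))" and s': "s' = (i, tab)"
    and ch: "i \<le> j \<Longrightarrow> ch = None" and sub: "\<And>C. ch = Some C \<Longrightarrow> set C \<subseteq> fst ` set tab"
    and t: "t \<le> B" using R unfolding red_rel_def by auto
  define ms where "ms = bits_list_of_data (cdr q)"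
  have ms: "esize ms \<le> B"
    using esize_bits_list_of_data[of "cdr q"] size_car_cdr[of q] q t unfolding ms_def by linarith
  then have len: "length ms \<le> B" "\<And>m. m \<in> set ms \<Longrightarrow> length m \<le> B"
    using length_le_esize[of ms] length_le_esize_mem[of _ ms] by (auto intro: order_trans)
  consider "nat_of_data (car q) = 0" | "nat_of_data (car q) = 1" | "nat_of_data (car q) > 1" by linarith
  then show ?thesis
  proof cases
    case 1
    then have Q: "cpa_query_of_data q = EncQ ms" by (simp add: cpa_query_of_data_def ms_def)
    define ms' where "ms' = (if j < i \<or> i = j \<and> b then ms else map zeros ms)"
    define ch' where "ch' cs = (if i = j then Some cs else ch)" for cs :: "bits list"
    have cs: "fst ` set (zip cs ms) = set cs \<and> trunc N (enc cs) = enc cs"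
      if "cs \<in> set_pmf (mapM_pmf (Enc key) ms')" for cs
    proof -
      from mapM_pmf_set[OF that] have l: "list_all2 (\<lambda>c m. c \<in> set_pmf (Enc key m)) cs ms'" .
      have lm: "length m \<le> B" if "m \<in> set ms'" for m
        using that len(2) by (auto simp: ms'_def split: if_splits)
      have c: "esize c \<le> 2 * G" if mem: "c \<in> set cs" for c
      proof -
        obtain i where i: "i < length cs" "c = cs ! i" using mem by (auto simp: in_set_conv_nth)
        with l have "ms' ! i \<in> set ms'" "c \<in> set_pmf (Enc key (ms' ! i))"
          by (auto simp: list_all2_conv_all_nth)
        then have "length c \<le> G" using Enc lm by auto
        then show ?thesis using esize_bits[of c] by linarith
      qed
      have ln: "length cs = length ms" using l by (auto simp: ms'_def dest: list_all2_lengthD split: if_splits)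
      have "esize cs \<le> length cs * (2 * G + 1)" by (rule esize_list_le[OF c])
      also have "\<dots> \<le> B * (2 * G + 2)" using len(1) by (intro mult_le_mono) (auto simp: ln)
      finally have "esize cs \<le> N" using N by linarith
      moreover have "set (map fst (zip cs ms)) = set cs" using ln by (simp only: map_fst_zip)
      ultimately show ?thesis by (simp add: trunc_enc)
    qed
    have "interact (\<lambda>s q. cpa_oracle Enc Dec key b s (cpa_query_of_data q)) (reduction q (N, j, i, tab)) (ch, False)
      = map_pmf (\<lambda>cs. ((enc (bits_list_of_data (trunc N (enc cs))),
           (N, j, Suc i, zip (bits_list_of_data (trunc N (enc cs))) ms @ tab)), (ch' cs, False)))
         (mapM_pmf (Enc key) ms')"
    proof -
      consider "i < j" | "i = j" "b" | "i = j" "\<not> b" | "j < i" by linarith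
      then show ?thesis
        by cases (simp_all add: reduction_def 1 ms_def[symmetric] ms'_def ch'_def ch interact_bind
            bind_map_pmf map_pmf_def bind_assoc_pmf bind_return_pmf enc_bits_list[symmetric]
            list_all2_conv_all_nth del: enc_pair)
    qed
    then show ?thesis using t q sub ch
      unfolding s s' Q
      by (auto simp: pmf.map_comp o_def pmf.rel_map ms'_def[symmetric] red_rel_def ch'_def cs image_Un
          intro!: rel_pmf_reflI split: if_splits)
  next
    case 2
    then have Q: "cpa_query_of_data q = DecQ ms" by (simp add: cpa_query_of_data_def ms_def)
    define unk where "unk = filter (\<lambda>c. map_of tab c = None) ms"
    have "\<not> (\<exists>C. ch = Some C \<and> set unk \<inter> set C \<noteq> {})"
      using sub by (fastforce simp: unk_def map_of_eq_None_iff)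
    moreover have "trunc N (enc (map (Dec key) unk)) = enc (map (Dec key) unk)"
    proof (rule trunc_enc)
      have "esize (map (Dec key) unk) \<le> length (map (Dec key) unk) * ((2 * G + 1) + 1)"
      proof (rule esize_list_le)
        fix z assume "z \<in> set (map (Dec key) unk)"
        then obtain c where c: "c \<in> set ms" "z = Dec key c" by (auto simp: unk_def)
        show "esize z \<le> 2 * G + 1"
        proof (cases z)
          case (Some m)
          then have "length m \<le> G" using Dec len(2) c by auto
          then show ?thesis using esize_bits[of m] Some by simp
        qed simp
      qed
      also have "\<dots> \<le> B * (2 * G + 2)"
        using order_trans[OF length_filter_le len(1)] by (intro mult_le_mono) (simp_all add: unk_def)
      finally show "esize (map (Dec key) unk) \<le> N" using N by linarith
    qed
    moreover have "data_of_list (map (\<lambda>c. data_of_option (map_option data_of_bits (Dec key c))) unk)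
        = enc (map (Dec key) unk)"
      by (simp add: enc_list_def enc_option_def enc_bits[abs_def] comp_def)
    ultimately have "interact (\<lambda>s q. cpa_oracle Enc Dec key b s (cpa_query_of_data q)) (reduction q (N, j, i, tab)) (ch, False)
      = return_pmf ((enc (map (\<lambda>c. case map_of tab c of
               None \<Rightarrow> the_or Atom (map_of (zip unk (map enc (map (Dec key) unk))) c)
             | Some m \<Rightarrow> enc (Some m)) ms), (N, j, i, tab)), (ch, False))"
      by (simp add: reduction_def 2 ms_def[symmetric] unk_def[symmetric] interact_bind bind_return_pmf
            cong: option.case_cong del: enc_pair enc_Suc)
    also have "(\<lambda>c. case map_of tab c of
               None \<Rightarrow> the_or Atom (map_of (zip unk (map enc (map (Dec key) unk))) c)
             | Some m \<Rightarrow> enc (Some m)) c = enc (lookup_dec Dec key tab c)" if "c \<in> set ms" for c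
      using that
      by (auto simp: lookup_dec_def map_of_zip_map comp_def unk_def split: option.split)
    then have "map (\<lambda>c. case map_of tab c of
               None \<Rightarrow> the_or Atom (map_of (zip unk (map enc (map (Dec key) unk))) c)
             | Some m \<Rightarrow> enc (Some m)) ms = map (\<lambda>c. enc (lookup_dec Dec key tab c)) ms" by simp
    finally show ?thesis using R t q
      unfolding s s' Q by (simp add: red_rel_def enc_list_def comp_def)
  next
    case 3
    then show ?thesis using R t q
      unfolding s s' by (simp add: reduction_def cpa_query_of_data_def red_rel_def)
  qed
qed

text \<open>The inputs of encryption and decryption include the key, whose length has to be bounded
  through \<open>Gen\<close> first.\<close>

lemma encryption_bounds:
  assumes "symmetric_encryption Gen Enc Dec"
  obtains e where
    "\<And>k key m c. key \<in> set_pmf (Gen k) \<Longrightarrow> c \<in> set_pmf (Enc key m) \<Longrightarrow> length c \<le> (k + length m) ^ e + e"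
    "\<And>k key m c. key \<in> set_pmf (Gen k) \<Longrightarrow> Dec key c = Some m \<Longrightarrow> length m \<le> (k + length c) ^ e + e"
proof -
  obtain g1 where g1: "pmono g1" "\<And>x y. y \<in> set_pmf (map_pmf data_of_bits (Gen (nat_of_data x))) \<Longrightarrow> depth y \<le> g1 (size x)"
    using assms unfolding symmetric_encryption_def by (auto elim!: poly_time_depth)
  obtain g2 where g2: "pmono g2" "\<And>x y. y \<in> set_pmf (map_pmf data_of_bits (Enc (bits_of_data (car x)) (bits_of_data (cdr x)))) \<Longrightarrow> depth y \<le> g2 (size x)"
    using assms unfolding symmetric_encryption_def by (auto elim!: poly_time_depth)
  obtain g3 where g3: "pmono g3" "\<And>x y. y \<in> set_pmf (return_pmf (data_of_option (map_option data_of_bits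
                       (Dec (bits_of_data (car x)) (bits_of_data (cdr x)))))) \<Longrightarrow> depth y \<le> g3 (size x)"
    using assms unfolding symmetric_encryption_def by (auto elim!: poly_time_depth)
  define g where "g x = g2 (1 + 2 * (g1 x + x)) + g3 (1 + 2 * (g1 x + x))" for x
  have "pmono g" unfolding g_def
    by (intro pmono_intros pmono_comp[OF g2(1)] pmono_comp[OF g3(1)] g1)
  then obtain e where e: "\<And>x. g x \<le> x ^ e + e" unfolding pmono_def poly_bounded_def by auto
  have key: "length key \<le> g1 k" if "key \<in> set_pmf (Gen k)" for k key
    using g1(2)[of "enc key" "enc k"] length_le_depth[of key] that
    by (simp add: enc_bits esize_def[symmetric])
  have sz: "size (enc (key, m)) \<le> 1 + 2 * (g1 (k + length m) + (k + length m))"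
    if "key \<in> set_pmf (Gen k)" for k key and m :: bits
    using key[OF that] pmonoD[OF g1(1), of k "k + length m"] esize_bits[of key] esize_bits[of m]
    by (simp add: esize_def)
  show ?thesis
  proof (rule that)
    fix k key and m c :: bits assume k: "key \<in> set_pmf (Gen k)"
    show "length c \<le> (k + length m) ^ e + e" if "c \<in> set_pmf (Enc key m)"
    proof -
      have "length c \<le> depth (enc c)" by (rule length_le_depth)
      also have "\<dots> \<le> g2 (size (enc (key, m)))" by (rule g2(2)) (use that in \<open>simp add: enc_bits[symmetric]\<close>)
      also have "\<dots> \<le> g (k + length m)" using pmonoD[OF g2(1) sz[OF k]] by (simp add: g_def trans_le_add1)
      finally show ?thesis using e[of "k + length m"] by linarith
    qed
    show "length m \<le> (k + length c) ^ e + e" if "Dec key c = Some m"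
    proof -
      have "length m \<le> depth (enc m)" by (rule length_le_depth)
      also have "\<dots> \<le> depth (enc (Some m))" by simp
      also have "\<dots> \<le> g3 (size (enc (key, c)))"
        by (rule g3(2)) (use that in \<open>simp add: enc_bits[symmetric]\<close>)
      also have "\<dots> \<le> g (k + length c)" using pmonoD[OF g3(1) sz[OF k]] by (simp add: g_def trans_le_add2)
      finally show ?thesis using e[of "k + length c"] by linarith
    qed
  qed
qed

lemma rel_pmf_map_eq:
  assumes "rel_pmf R p q" and "\<And>x y. R x y \<Longrightarrow> f x = g y"
  shows "map_pmf f p = map_pmf g q"
proof -
  have "rel_pmf (=) (map_pmf f p) (map_pmf g q)"
    unfolding pmf.rel_map by (rule pmf.rel_mono_strong[OF assms(1)]) (rule assms(2))
  then show ?thesis by (simp add: pmf.rel_eq)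
qed

lemma pmf_map_eq_bool: "pmf (map_pmf (\<lambda>x. x = b) P) True = (if b then pmf P True else 1 - pmf P True)"
proof -
  have "map_pmf (\<lambda>x. x = True) P = P" by simp
  moreover have "pmf (map_pmf (\<lambda>x. x = False) P) True = pmf P False"
    using pmf_map_inj'[of Not P False] by (simp add: inj_on_def)
  moreover have "pmf P False = 1 - pmf P True"
    using sum_pmf_eq_1[of "UNIV :: bool set" P, OF finite subset_UNIV] unfolding UNIV_bool by simp
  ultimately show ?thesis by simp
qed

text \<open>The loss is \<open>2 * (Q k + 1)\<close>: one factor for guessing the hybrid at which
  the challenge is placed, and 2 for passing from the probability of a correct guess to a difference
  of two probabilities.\<close>

theorem lr_security:
  assumes se: "symmetric_encryption Gen Enc Dec" and cpa: "enc_ind_cpa Gen Enc Dec"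
    and p: "ppt p T"
  obtains \<nu> where "negligible \<nu>"
    and "\<And>k. pmf (lr_game Gen Enc Dec (\<lambda>_. True) p T k) True \<le>
              pmf (lr_game Gen Enc Dec (\<lambda>_. False) p T k) True + \<nu> k"
proof -
  obtain a where a: "\<And>k. T k \<le> k ^ a + a" using p unfolding ppt_def poly_bounded_def by auto
  obtain e where
    eE: "\<And>k key m c. key \<in> set_pmf (Gen k) \<Longrightarrow> c \<in> set_pmf (Enc key m) \<Longrightarrow> length c \<le> (k + length m) ^ e + e" and
    eD: "\<And>k key m c. key \<in> set_pmf (Gen k) \<Longrightarrow> Dec key c = Some m \<Longrightarrow> length m \<le> (k + length c) ^ e + e"
    using se by (rule encryption_bounds) (rule that)
  define Q where "Q k = k ^ a + a" for k
  define N where "N k = Q k * (2 * ((k + Q k) ^ e + e) + 2)" for k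
  define init :: "nat \<Rightarrow> (nat \<times> red_state) comp"
    where "init k = bind_comp (Choose (Q k) Done) (\<lambda>j. Done (k, (N k, j, 0, [])))" for k
  have Qp: "pmono Q" and Np: "pmono N" unfolding Q_def N_def by (intro pmono_intros)+
  have "ptime (init :: nat \<Rightarrow> (nat \<times> red_state) comp)"
    unfolding init_def N_def Q_def by (intro fp_intros)
  then obtain ip gi where ip: "pmono gi"
    "\<And>k. runs (exec ip (enc k)) (gi k) (init k :: (nat \<times> red_state) comp)" by (rule ptimeE) auto
  obtain H gh where H: "pmono gh" "\<And>q st. runs (exec H (enc (q, st))) (gh (esize (q, st))) (reduction q st)"
    using ptime_reduction by (rule ptimeE) (metis fst_conv snd_conv)
  define Bd where "Bd k = N k + Q k + 3 + (N k + 1) * Q k" for k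
  define K where "K k = gh (Suc (Bd k + Bd k))" for k
  \<comment> \<open>A potential: a query of size \<open>s\<close> uses \<open>1 + s\<close> units of
    budget and enlarges the state by at most \<open>N k + s + 1\<close>, which is at most
    \<open>(N k + 1) * (1 + s)\<close>. So the sum never increases.\<close>
  define I where "I k t st \<longleftrightarrow> fst st = N k \<and> esize st + (N k + 1) * t \<le> Bd k" for k t and st :: red_state
  define B where "B = Seq ip (Seq (compile H p) Car)"
  define TB where "TB k = Suc (gi k + Suc ((K k + 40) * Q k + 1))" for k
  define out where "out k j = bind_comp (subst_comp reduction (exec p (enc k) (T k)) (N k, j, 0, []))
      (\<lambda>z. Done (the_or Atom (map_option fst (fst z))))" for k j
  have Bdp: "pmono Bd" unfolding Bd_def by (intro pmono_intros Np Qp)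
  have TBp: "pmono TB" unfolding TB_def K_def
    by (intro pmono_intros pmono_comp[OF H(1)] Bdp Qp ip)
  have runH: "runs (exec H (Cell q (enc st))) (K k) (reduction q st)" if "I k t st" "size q < t" for k q st t
  proof -
    have "t \<le> (N k + 1) * t" by simp
    then have "esize (q, st) \<le> Suc (Bd k + Bd k)" using that by (simp add: I_def)
    then have "gh (esize (q, st)) \<le> K k" unfolding K_def by (rule pmonoD[OF H(1)])
    with H(2)[of q st] show ?thesis by (auto intro: runs_mono)
  qed
  have I_step: "I k (t - 1 - size q) st'" if "I k t st" "size q < t" "(r, st') \<in> outcomes (reduction q st)"
    for k t q r st st'
  proof -
    obtain j i tab where st: "st = (N k, j, i, tab)" using \<open>I k t st\<close> by (cases st) (auto simp: I_def)
    obtain N' j' i' tab' where st': "st' = (N', j', i', tab')" by (cases st') auto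
    have *: "N' = N k" "esize st' \<le> esize st + (N k + size q + 1)"
      using reduction_state[of r N' j' i' tab' q "N k" j i tab] that(3) unfolding st st' by auto
    have "(N k + 1) * (t - 1 - size q) + (N k + 1) * (1 + size q) = (N k + 1) * t"
      unfolding add_mult_distrib2[symmetric] using that(2) by simp
    moreover have "N k + size q + 1 \<le> (N k + 1) * (1 + size q)" by simp
    ultimately show ?thesis using that(1) * unfolding I_def by (simp add: st')
  qed
  have I_mono: "I k t st \<Longrightarrow> t' \<le> t \<Longrightarrow> I k t' st" for k t t' st
    unfolding I_def using mult_le_mono2[of t' t "N k + 1"] by linarith
  have I0: "I k (T k) (N k, j, 0, [])" if "j \<le> Q k" for k j
    unfolding I_def using that a[of k] mult_le_mono2[of "T k" "Q k" "N k + 1"]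
    by (simp add: Bd_def Q_def[symmetric])
  have runB: "runs (exec B (enc k)) (TB k) (bind_comp (Choose (Q k) Done) (out k))" for k
  proof -
    have "runs (exec (Seq (compile H p) Car) (enc z)) (Suc ((K k + 40) * Q k + 1)) (out k (fst (snd (snd z))))"
      if "z \<in> outcomes (init k)" for z
    proof -
      from that obtain j where z: "z = (k, (N k, j, 0, []))" and j: "j \<le> Q k"
        unfolding init_def by (auto simp: outcomes_bind)
      have "None \<notin> outcomes (exec p (enc k) (T k))"
        using p unfolding ppt_def by (simp add: enc_nat_def)
      then have nn: "None \<notin> fst ` outcomes (subst_comp reduction (exec p (enc k) (T k)) (N k, j, 0, []))"
        using outcomes_subst_comp by force
      have "runs (exec (compile H p) (Cell (enc k) (enc (N k, j, 0::nat, [] :: (bits \<times> bits) list)))) ((K k + 40) * T k)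
        (bind_comp (subst_comp reduction (exec p (enc k) (T k)) (N k, j, 0, []))
           (\<lambda>z. Done (the_or Atom (map_option fst (fst z)), snd z)))"
        by (rule runs_compile[where I="I k", OF runH I_step I_mono I0[OF j] nn])
      moreover have "(K k + 40) * T k \<le> (K k + 40) * Q k" using a[of k] by (simp add: Q_def)
      ultimately have "runs (exec (compile H p) (enc z)) ((K k + 40) * Q k)
        (bind_comp (subst_comp reduction (exec p (enc k) (T k)) (N k, j, 0, []))
           (\<lambda>z. Done (the_or Atom (map_option fst (fst z)), snd z)))"
        unfolding z enc_pair[of k] by (rule runs_mono)
      then have "runs (exec (Seq (compile H p) Car) (enc z)) (Suc ((K k + 40) * Q k + 1))
        (bind_comp (bind_comp (subst_comp reduction (exec p (enc k) (T k)) (N k, j, 0, []))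
           (\<lambda>z. Done (the_or Atom (map_option fst (fst z)), snd z))) (\<lambda>w. Done (fst w)))"
      proof (rule runs_Seq)
        fix b :: "data \<times> red_state"
        show "runs (exec Car (enc b)) 1 (Done (fst b))" using runs_fst[of "fst b" "snd b"] by simp
      qed
      then show ?thesis by (simp add: z out_def bind_comp_assoc)
    qed
    from runs_Seq[OF ip(2) this] show ?thesis
      unfolding B_def TB_def init_def by (simp add: bind_comp_assoc)
  qed
  have pptB: "ppt B TB"
    unfolding ppt_def
  proof (intro conjI allI notI)
    show "poly_bounded TB" using TBp by (simp add: pmono_def)
    fix k assume "None \<in> outcomes (exec B (data_of_nat k) (TB k))"
    moreover have "crel (\<lambda>z b. \<exists>t'. z = Some (enc b, t') \<and> t' \<le> TB k \<and> TB k \<le> t' + TB k)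
        (exec B (enc k) (TB k)) (bind_comp (Choose (Q k) Done) (out k))"
      using runB[of k] unfolding runs_def by blast
    ultimately show False using crel_outcomes by (fastforce simp: enc_nat_def)
  qed
  obtain \<mu> where \<mu>: "negligible \<mu>"
    and adv: "\<And>k. measure_pmf.prob (cpa_game Gen Enc Dec B TB k) {True} \<le> 1 / 2 + \<mu> k"
    using cpa pptB unfolding enc_ind_cpa_def by blast
  \<comment> \<open>With the challenge placed at query \<open>j\<close>, later queries are answered
    truthfully, earlier ones by zeros, and query \<open>j\<close> according to the challenger's
    bit.\<close>
  define w where "w j b i \<longleftrightarrow> j < i \<or> i = j \<and> b" for j i :: nat and b
  define X where "X k W = pmf (lr_game Gen Enc Dec W p T k) True" for k W
  have hyb: "map_pmf (\<lambda>(z, st). wins b (snd st) z)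
      (interact (\<lambda>s q. cpa_oracle Enc Dec key b s (cpa_query_of_data q)) (exec B (enc k) (TB k)) (None, False))
    = bind_pmf (pmf_of_set {..Q k}) (\<lambda>j. map_pmf (\<lambda>z. bool_of_data (the_or Atom (map_option fst (fst z))) = b)
        (interact (\<lambda>s q. lr_oracle Enc Dec key (w j b) s (cpa_query_of_data q)) (exec p (enc k) (T k)) (0, [])))"
    if key: "key \<in> set_pmf (Gen k)" for key b k
  proof -
    let ?orc = "\<lambda>s q. cpa_oracle Enc Dec key b s (cpa_query_of_data q)"
    let ?lr = "\<lambda>j s q. lr_oracle Enc Dec key (w j b) s (cpa_query_of_data q)"
    let ?G = "(k + Q k) ^ e + e"
    have rel: "rel_pmf (\<lambda>z1 z2. fst z1 = fst z2 \<and> (\<exists>t. red_rel (N k) j (Q k) t (snd z1) (snd z2)))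
      (interact (\<lambda>(s, u) q. map_pmf (\<lambda>((r, s), u). (r, (s, u))) (interact ?orc (reduction q s) u))
         (exec p (enc k) (T k)) ((N k, j, 0, []), (None, False)))
      (interact (?lr j) (exec p (enc k) (T k)) (0, []))" for j
    proof (rule interact_rel[OF _ paced_exec])
      show "red_rel (N k) j (Q k) (T k) ((N k, j, 0, []), (None, False)) (0, [])"
        using a[of k] by (simp add: red_rel_def Q_def)
      fix t s1 s2 and q :: data assume "red_rel (N k) j (Q k) t s1 s2" "size q < t"
      then show "rel_pmf (\<lambda>z1 z2. fst z1 = fst z2 \<and> red_rel (N k) j (Q k) (t - 1 - size q) (snd z1) (snd z2))
          ((\<lambda>(s, u) q. map_pmf (\<lambda>((r, s), u). (r, (s, u))) (interact ?orc (reduction q s) u)) s1 q) (?lr j s2 q)"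
        unfolding w_def
      proof (rule reduction_step[where G="?G", rotated 3])
        show "length c \<le> ?G" if "m \<in> Collect (\<lambda>m. length m \<le> Q k)" "c \<in> set_pmf (Enc key m)" for m c
          using eE[OF key that(2)] power_mono[of "k + length m" "k + Q k" e] that(1) by simp
        show "length m \<le> ?G" if "length c \<le> Q k" "Dec key c = Some m" for m c
          using eD[OF key that(2)] power_mono[of "k + length c" "k + Q k" e] that(1) by simp
      qed (simp add: N_def)
    qed
    have 1: "map_pmf (\<lambda>(y, st). \<not> snd st \<and> bool_of_data y = b) (interact ?orc (out k j) (None, False))
      = map_pmf (\<lambda>z. bool_of_data (the_or Atom (map_option fst (fst z))) = b)
          (interact (?lr j) (exec p (enc k) (T k)) (0, []))" for j
    proof -
      have "map_pmf (\<lambda>(y, st). \<not> snd st \<and> bool_of_data y = b) (interact ?orc (out k j) (None, False))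
        = map_pmf (\<lambda>z. \<not> snd (snd (snd z)) \<and> bool_of_data (the_or Atom (map_option fst (fst z))) = b)
          (interact (\<lambda>(s, u) q. map_pmf (\<lambda>((r, s), u). (r, (s, u))) (interact ?orc (reduction q s) u))
             (exec p (enc k) (T k)) ((N k, j, 0, []), (None, False)))"
        unfolding out_def interact_bind interact_subst_comp
        by (simp add: map_bind_pmf bind_map_pmf split_def map_pmf_def[symmetric] pmf.map_comp comp_def) 
      also have "\<dots> = map_pmf (\<lambda>z. bool_of_data (the_or Atom (map_option fst (fst z))) = b)
          (interact (?lr j) (exec p (enc k) (T k)) (0, []))"
        by (rule rel_pmf_map_eq[OF rel]) (auto simp: red_rel_def)
      finally show ?thesis .
    qed
    have "crel (\<lambda>z b. \<exists>t'. z = Some (enc b, t') \<and> t' \<le> TB k \<and> TB k \<le> t' + TB k)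
        (exec B (enc k) (TB k)) (bind_comp (Choose (Q k) Done) (out k))"
      using runB[of k] unfolding runs_def by blast
    then have "map_pmf (\<lambda>(z, st). wins b (snd st) z) (interact ?orc (exec B (enc k) (TB k)) (None, False))
       = map_pmf (\<lambda>(y, st). \<not> snd st \<and> bool_of_data y = b)
          (interact ?orc (bind_comp (Choose (Q k) Done) (out k)) (None, False))"
      by (rule rel_pmf_map_eq[OF crel_interact]) (auto simp: wins_def)
    also have "\<dots> = bind_pmf (pmf_of_set {..Q k}) (\<lambda>j.
        map_pmf (\<lambda>(y, st). \<not> snd st \<and> bool_of_data y = b) (interact ?orc (out k j) (None, False)))"
      by (simp add: map_bind_pmf)
    finally show ?thesis by (simp add: 1)
  qed
  \<comment> \<open>For a fixed \<open>j\<close> the reduction guesses right with probability one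
    half plus half the difference of two neighbouring hybrids; a uniform \<open>j\<close> averages
    this over \<open>Q k + 1\<close> values.\<close>
  have game: "pmf (cpa_game Gen Enc Dec B TB k) True =
     1 / 2 + (\<Sum>j\<le>Q k. X k (w j True) - X k (w j False)) / (2 * (real (Q k) + 1))" for k
  proof -
    let ?L = "\<lambda>key j b. interact (\<lambda>s q. lr_oracle Enc Dec key (w j b) s (cpa_query_of_data q)) (exec p (enc k) (T k)) (0, [])"
    have "cpa_game Gen Enc Dec B TB k = do {
        key \<leftarrow> Gen k; b \<leftarrow> pmf_of_set UNIV; j \<leftarrow> pmf_of_set {..Q k};
        map_pmf (\<lambda>z. bool_of_data (the_or Atom (map_option fst (fst z))) = b) (?L key j b) }"
      unfolding cpa_game_def
    proof (intro bind_pmf_cong refl)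
      fix key b assume "key \<in> set_pmf (Gen k)"
      from hyb[OF this, of b] show "(do {
         (out, st) \<leftarrow> interact (\<lambda>s q. cpa_oracle Enc Dec key b s (cpa_query_of_data q)) (exec B (data_of_nat k) (TB k)) (None, False);
         return_pmf (wins b (snd st) out) }) = do { j \<leftarrow> pmf_of_set {..Q k};
        map_pmf (\<lambda>z. bool_of_data (the_or Atom (map_option fst (fst z))) = b) (?L key j b) }"
        by (simp add: map_pmf_def split_def enc_nat_def)
    qed
    also have "\<dots> = do { b \<leftarrow> pmf_of_set UNIV; j \<leftarrow> pmf_of_set {..Q k};
        map_pmf (\<lambda>x. x = b) (lr_game Gen Enc Dec (w j b) p T k) }"
      unfolding lr_game_def
      by (subst bind_commute_pmf, rule bind_pmf_cong[OF refl], subst bind_commute_pmf)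
         (simp add: map_pmf_def bind_assoc_pmf bind_return_pmf)
    also have "pmf \<dots> True = 1 / 2 + (\<Sum>j\<le>Q k. X k (w j True) - X k (w j False)) / (2 * (real (Q k) + 1))"
    proof -
      let ?a = "\<Sum>j\<le>Q k. X k (w j True)" and ?b = "\<Sum>j\<le>Q k. X k (w j False)"
      have half: "(a / c + (c - b) / c) / 2 = 1 / 2 + (a - b) / (2 * c)" if "c > 0" for a b c :: real
        using that by (simp add: field_simps)
      have "pmf (do { b \<leftarrow> pmf_of_set UNIV; j \<leftarrow> pmf_of_set {..Q k};
          map_pmf (\<lambda>x. x = b) (lr_game Gen Enc Dec (w j b) p T k) }) True
        = (?a / (real (Q k) + 1) + ((real (Q k) + 1) - ?b) / (real (Q k) + 1)) / 2"
        by (simp add: pmf_bind_pmf_of_set UNIV_bool pmf_map_eq_bool X_def sum_subtractf add.commute)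
      also have "\<dots> = 1 / 2 + (?a - ?b) / (2 * (real (Q k) + 1))" by (rule half) simp
      finally show ?thesis by (simp add: sum_subtractf)
    qed
    finally show ?thesis .
  qed
  \<comment> \<open>Hybrid \<open>j\<close> with bit \<open>False\<close> is hybrid
    \<open>Suc j\<close> with bit \<open>True\<close>, so the sum of differences telescopes.\<close>
  have real: "w 0 True = (\<lambda>_. True)" and shift: "w j False = w (Suc j) True" for j
    by (auto simp: w_def fun_eq_iff)
  \<comment> \<open>Every query consumes budget, so fewer than \<open>Q k + 1\<close> of them are
    made, and the last hybrid never reaches a truthful answer.\<close>
  have ideal: "X k (w (Q k) False) = X k (\<lambda>_. False)" for k
  proof -
    have "map_pmf fst (interact (\<lambda>s q. lr_oracle Enc Dec key (w (Q k) False) s (cpa_query_of_data q)) (exec p (enc k) (T k)) (0, []))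
      = map_pmf fst (interact (\<lambda>s q. lr_oracle Enc Dec key (\<lambda>_. False) s (cpa_query_of_data q)) (exec p (enc k) (T k)) (0, []))" for key
    proof (rule rel_pmf_map_eq[OF interact_rel[where R="\<lambda>t s1 s2. s1 = s2 \<and> fst s1 + t \<le> Q k", OF _ paced_exec]])
      fix t q and s1 s2 :: lr_state assume "s1 = s2 \<and> fst s1 + t \<le> Q k" "size (q::data) < t"
      then show "rel_pmf (\<lambda>z1 z2. fst z1 = fst z2 \<and> snd z1 = snd z2 \<and> fst (snd z1) + (t - 1 - size q) \<le> Q k)
         (lr_oracle Enc Dec key (w (Q k) False) s1 (cpa_query_of_data q))
         (lr_oracle Enc Dec key (\<lambda>_. False) s2 (cpa_query_of_data q))"
        by (cases s1; cases "cpa_query_of_data q") (auto simp: w_def pmf.rel_map intro!: rel_pmf_reflI)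
    qed (use a[of k] in \<open>auto simp: Q_def\<close>)
    then have "map_pmf (\<lambda>z. bool_of_data (the_or Atom (map_option fst z))) (map_pmf fst (interact (\<lambda>s q. lr_oracle Enc Dec key (w (Q k) False) s (cpa_query_of_data q)) (exec p (enc k) (T k)) (0, [])))
      = map_pmf (\<lambda>z. bool_of_data (the_or Atom (map_option fst z))) (map_pmf fst (interact (\<lambda>s q. lr_oracle Enc Dec key (\<lambda>_. False) s (cpa_query_of_data q)) (exec p (enc k) (T k)) (0, [])))" for key
      by simp
    then show ?thesis unfolding X_def lr_game_def by (simp add: map_pmf_def bind_assoc_pmf bind_return_pmf)
  qed
  have tele: "(\<Sum>j\<le>n. X k (w j True) - X k (w j False)) = X k (\<lambda>_. True) - X k (w n False)" for k n
    by (induction n) (simp_all add: real shift)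
  show ?thesis
  proof (rule that)
    have "negligible (\<lambda>k. real (2 * (Q k + 1)) * \<mu> k)"
      by (rule negligible_poly_mult[OF _ \<mu>]) (use pmono_mult[OF pmono_const[of 2] pmono_add[OF Qp pmono_const[of 1]]] in \<open>simp add: pmono_def\<close>)
    then show "negligible (\<lambda>k. real (2 * (Q k + 1)) * \<mu> k)" .
    fix k
    have "(X k (\<lambda>_. True) - X k (\<lambda>_. False)) / (2 * (real (Q k) + 1)) \<le> \<mu> k"
      using adv[of k] game[of k] by (simp add: measure_pmf_single tele ideal)
    then show "pmf (lr_game Gen Enc Dec (\<lambda>_. True) p T k) True \<le>
              pmf (lr_game Gen Enc Dec (\<lambda>_. False) p T k) True + real (2 * (Q k + 1)) * \<mu> k"
      unfolding X_def[symmetric] by (simp add: field_simps)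
  qed
qed

section \<open>Runs of the shuffle as functions of a list of ciphertexts\<close>

section \<open>The shuffle as a fixed sequence of encryptions\<close>

subsection \<open>Sequences of encryptions\<close>

definition blk :: "nat \<Rightarrow> 'a list \<Rightarrow> nat \<Rightarrow> 'a list" where
  "blk q ys w = take q (drop (w * q) ys)"

lemma mapM_pmf_append:
  "mapM_pmf f (xs @ ys) = bind_pmf (mapM_pmf f xs) (\<lambda>as. map_pmf ((@) as) (mapM_pmf f ys))"
  by (induction xs) (simp_all add: map_pmf_def bind_return_pmf bind_return_pmf' bind_assoc_pmf)

lemma mapM_pmf_map: "mapM_pmf f (map g xs) = mapM_pmf (\<lambda>x. f (g x)) xs"
  by (induction xs) auto

lemma mapM_pmf_map_pmf: "mapM_pmf (\<lambda>x. map_pmf g (f x)) xs = map_pmf (map g) (mapM_pmf f xs)"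
  by (induction xs) (auto simp: map_bind_pmf bind_map_pmf)

lemma mapM_pmf_cong: "(\<And>x. x \<in> set xs \<Longrightarrow> f x = g x) \<Longrightarrow> mapM_pmf f xs = mapM_pmf g xs"
  by (induction xs) auto

lemma mapM_pmf_length: "ys \<in> set_pmf (mapM_pmf f xs) \<Longrightarrow> length ys = length xs"
  by (induction xs arbitrary: ys) auto

lemma blk_append:
  assumes "length xs = q"
  shows "map (blk q (xs @ ys)) [0..<Suc m] = xs # map (blk q ys) [0..<m]"
proof -
  have "blk q (xs @ ys) (Suc w) = blk q ys w" for w using assms by (simp add: blk_def)
  moreover have "[0..<Suc m] = 0 # map Suc [0..<m]" by (simp add: upt_conv_Cons map_Suc_upt del: upt_Suc)
  moreover have "blk q (xs @ ys) 0 = xs" using assms by (simp add: blk_def)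
  ultimately show ?thesis by simp
qed

lemma concat_blk: "length ys = m * q \<Longrightarrow> concat (map (blk q ys) [0..<m]) = ys"
proof (induction m arbitrary: ys)
  case (Suc m)
  have "length (take q ys) = q" "length (drop q ys) = m * q" using Suc.prems by auto
  then show ?case
    using blk_append[of "take q ys" q "drop q ys" m] Suc.IH[of "drop q ys"] by (simp del: upt_Suc)
qed simp

lemma upt_split: "m < M \<Longrightarrow> [0..<M] = [0..<m] @ m # [Suc m..<M]"
  by (metis less_imp_le upt_add_eq_append upt_conv_Cons le_add_diff_inverse zero_le)

lemma blk_concat:
  assumes "\<And>i. i < m \<Longrightarrow> length (F i) = q" and "w < m"
  shows "blk q (concat (map F [0..<m])) w = F w"
proof -
  have len: "length (concat (map F [0..<k])) = k * q" if "k \<le> m" for k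
    using that assms(1) by (induction k) auto
  have "concat (map F [0..<m]) = concat (map F [0..<w]) @ F w @ concat (map F [Suc w..<m])"
    unfolding upt_split[OF assms(2)] by simp
  then show ?thesis using len[of w] assms by (simp add: blk_def)
qed

lemma blk_blk:
  assumes "c < r"
  shows "blk q (blk (r * q) ys w) c = blk q ys (w * r + c)"
proof -
  have "c * q + q \<le> r * q" using assms by (metis Suc_leI add.commute mult_Suc mult_le_mono1)
  then show ?thesis by (simp add: blk_def drop_take add.commute add_mult_distrib mult.assoc min_def)
qed

lemma length_blk: "length xs = m * q \<Longrightarrow> w < m \<Longrightarrow> length (blk q xs w) = q"
  using mult_le_mono1[of "Suc w" m q] by (simp add: blk_def)

text \<open>Since encryptions are independent, encrypting batch by batch amounts to encrypting the
  concatenation and cutting it up. In this way a whole run is reduced to one flat list of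
  encryptions.\<close>

lemma mapM_pmf_blk:
  assumes "\<And>xs. xs \<in> set xss \<Longrightarrow> length xs = l"
  shows "mapM_pmf (mapM_pmf f) xss = map_pmf (\<lambda>ys. map (blk l ys) [0..<length xss]) (mapM_pmf f (concat xss))"
  using assms
proof (induction xss)
  case (Cons xs xss)
  have "map_pmf (\<lambda>ys. map (blk l ys) [0..<length (xs # xss)]) (mapM_pmf f (concat (xs # xss)))
    = bind_pmf (mapM_pmf f xs) (\<lambda>as. map_pmf (\<lambda>ys. map (blk l (as @ ys)) [0..<Suc (length xss)]) (mapM_pmf f (concat xss)))"
    by (simp add: mapM_pmf_append map_bind_pmf pmf.map_comp comp_def del: upt_Suc)
  also have "\<dots> = bind_pmf (mapM_pmf f xs) (\<lambda>as. map_pmf (\<lambda>ys. as # map (blk l ys) [0..<length xss]) (mapM_pmf f (concat xss)))"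
    using Cons.prems by (intro bind_pmf_cong refl) (simp add: blk_append mapM_pmf_length del: upt_Suc)
  also have "\<dots> = mapM_pmf (mapM_pmf f) (xs # xss)"
    using Cons by (simp add: map_pmf_def bind_assoc_pmf bind_return_pmf)
  finally show ?case by simp
qed simp

lemma mapM_pmf_Dec:
  assumes "\<And>m c. c \<in> set_pmf (E m) \<Longrightarrow> D c = Some m" and "ys \<in> set_pmf (mapM_pmf E ms)"
  shows "map D ys = map Some ms"
  using assms(2) by (induction ms arbitrary: ys) (auto simp: assms(1))

subsection \<open>Writing blocks\<close>

lemma write_blk:
  assumes "\<And>i. i < M \<Longrightarrow> length (F i) = q" and "m < M" and "length a = q"
  shows "write_range (m * q) a (concat (map F [0..<M])) = concat (map (F(m := a)) [0..<M])"
proof -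
  have len: "length (concat (map F [0..<k])) = k * q" if "k \<le> M" for k
    using that assms(1) by (induction k) auto
  have "concat (map F [0..<M]) = concat (map F [0..<m]) @ F m @ concat (map F [Suc m..<M])"
    "concat (map (F(m := a)) [0..<M]) = concat (map F [0..<m]) @ a @ concat (map F [Suc m..<M])"
    unfolding upt_split[OF assms(2)] by (auto intro!: arg_cong[where f=concat] map_cong)
  then show ?thesis using len[of m] assms by (simp add: write_range_def)
qed

text \<open>Every block is written at least once, with contents that depend on its index only;
  neither the order of the writes nor the former contents of \<open>A\<close> matter.\<close>

lemma write_blocks:
  assumes "\<And>x. x \<in> set xs \<Longrightarrow> idx x < M \<and> length (F (idx x)) = q" and "{..<M} \<subseteq> idx ` set xs"
    and "length A = M * q"
  shows "fold (\<lambda>x. write_range (idx x * q) (F (idx x))) xs A = concat (map F [0..<M])"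
proof -
  define G where "G xs m = (if m \<in> idx ` set xs then F m else blk q A m)" for xs m
  have "length (blk q A m) = q" if "m < M" for m
    using that assms(3) by (intro length_blk)
  then have len: "length (G ys m) = q" if "m < M" "set ys \<subseteq> set xs" for ys m
    using that assms(1) by (auto simp: G_def)
  have "fold (\<lambda>x. write_range (idx x * q) (F (idx x))) ys A = concat (map (G ys) [0..<M])"
    if "set ys \<subseteq> set xs" for ys
    using that
  proof (induction ys rule: rev_induct)
    case Nil
    have "G [] = blk q A" by (simp add: G_def fun_eq_iff)
    then show ?case using concat_blk[OF assms(3)] by simp
  next
    case (snoc y ys)
    have "(G ys)(idx y := F (idx y)) = G (ys @ [y])" by (auto simp: G_def fun_eq_iff)
    then show ?case using snoc write_blk[of M "G ys" q "idx y" "F (idx y)"] len[of _ ys] assms(1)[of y] by simp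
  qed
  moreover have "map (G xs) [0..<M] = map F [0..<M]" using assms(2) by (auto simp: G_def)
  ultimately show ?thesis by (metis order_refl)
qed

lemma fold_product:
  "fold (\<lambda>x. fold (\<lambda>y. f x y) ys) xs s = fold (\<lambda>(x, y). f x y) (List.product xs ys) s"
  by (induction xs arbitrary: s) (simp_all add: fold_map comp_def)

subsection \<open>Loops of the client\<close>

text \<open>The rounds read \<open>R\<close> and write another array \<open>S\<close>. Hence
  \<open>R\<close> keeps its contents, the success of a round is decided in advance, and different
  rounds are independent: the loop becomes a single \<open>mapM_pmf\<close>, or fails in every
  outcome.\<close>

lemma for_each_run:
  assumes good: "\<And>i srv tr. i \<in> set xs \<Longrightarrow> srv R = A \<Longrightarrow> good i \<Longrightarrow>
      f i (srv, tr) = map_pmf (\<lambda>y. (Some (), srv(S := W i y (srv S)), tr @ T i y)) (p i)"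
    and bad: "\<And>i srv tr z. i \<in> set xs \<Longrightarrow> srv R = A \<Longrightarrow> \<not> good i \<Longrightarrow>
      z \<in> set_pmf (f i (srv, tr)) \<Longrightarrow> fst z = None"
    and "R \<noteq> S" and "srv R = A"
  shows "\<forall>i\<in>set xs. good i \<Longrightarrow> for_each xs f (srv, tr) = map_pmf
      (\<lambda>ys. (Some (), srv(S := fold (\<lambda>(i, y). W i y) (zip xs ys) (srv S)),
             tr @ concat (map (\<lambda>(i, y). T i y) (zip xs ys)))) (mapM_pmf p xs)"
    and "\<not> (\<forall>i\<in>set xs. good i) \<Longrightarrow> z \<in> set_pmf (for_each xs f (srv, tr)) \<Longrightarrow> fst z = None"
proof -
  have "(\<forall>i\<in>set xs. good i) \<longrightarrow> for_each xs f (srv, tr) = map_pmf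
      (\<lambda>ys. (Some (), srv(S := fold (\<lambda>(i, y). W i y) (zip xs ys) (srv S)),
             tr @ concat (map (\<lambda>(i, y). T i y) (zip xs ys)))) (mapM_pmf p xs)"
    using assms
  proof (induction xs arbitrary: srv tr)
    case Nil
    then show ?case by (simp add: return_client_def)
  next
    case (Cons x xs)
    show ?case
    proof
      assume g: "\<forall>i\<in>set (x # xs). good i"
      have IH: "for_each xs f (srv', tr') = map_pmf
        (\<lambda>ys. (Some (), srv'(S := fold (\<lambda>(i, y). W i y) (zip xs ys) (srv' S)),
             tr' @ concat (map (\<lambda>(i, y). T i y) (zip xs ys)))) (mapM_pmf p xs)" if "srv' R = A" for srv' tr'
      proof (rule Cons.IH[THEN mp])
        show "\<forall>i\<in>set xs. good i" using g by simp
        show "f i (srv, tr) = map_pmf (\<lambda>y. (Some (), srv(S := W i y (srv S)), tr @ T i y)) (p i)"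
          if "i \<in> set xs" "srv R = A" "good i" for i srv tr
          using that by (intro Cons.prems(1)) auto
        show "fst z = None" if "i \<in> set xs" "srv R = A" "\<not> good i" "z \<in> set_pmf (f i (srv, tr))" for i srv tr z
          by (rule Cons.prems(2)[of i srv z tr]) (use that in auto)
      qed fact+
      have IH': "for_each xs f (srv(S := a), tr') = map_pmf
        (\<lambda>ys. (Some (), srv(S := fold (\<lambda>(i, y). W i y) (zip xs ys) a),
             tr' @ concat (map (\<lambda>(i, y). T i y) (zip xs ys)))) (mapM_pmf p xs)" for a tr'
        using IH[of "srv(S := a)" tr'] Cons.prems(3,4) by simp
      have fx: "f x (srv, tr) = map_pmf (\<lambda>y. (Some (), srv(S := W x y (srv S)), tr @ T x y)) (p x)"
        by (rule Cons.prems(1)) (use g Cons.prems(4) in auto)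
      show "for_each (x # xs) f (srv, tr) = map_pmf
      (\<lambda>ys. (Some (), srv(S := fold (\<lambda>(i, y). W i y) (zip (x # xs) ys) (srv S)),
             tr @ concat (map (\<lambda>(i, y). T i y) (zip (x # xs) ys)))) (mapM_pmf p (x # xs))"
        unfolding for_each.simps bind_client_def fx
        by (simp add: bind_map_pmf map_bind_pmf IH' pmf.map_comp comp_def del: fun_upd_apply)
          (simp add: map_pmf_def bind_assoc_pmf bind_return_pmf del: fun_upd_apply)
    qed
  qed
  then show "\<forall>i\<in>set xs. good i \<Longrightarrow> for_each xs f (srv, tr) = map_pmf
      (\<lambda>ys. (Some (), srv(S := fold (\<lambda>(i, y). W i y) (zip xs ys) (srv S)),
             tr @ concat (map (\<lambda>(i, y). T i y) (zip xs ys)))) (mapM_pmf p xs)" by blast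
  assume "\<not> (\<forall>i\<in>set xs. good i)" "z \<in> set_pmf (for_each xs f (srv, tr))"
  then show "fst z = None" using assms
  proof (induction xs arbitrary: srv tr)
    case (Cons x xs)
    show ?case
    proof (cases "good x")
      case False
      obtain w where w: "w \<in> set_pmf (f x (srv, tr))" and z: "z \<in> set_pmf (case w of (r, s') \<Rightarrow>
          case r of None \<Rightarrow> return_pmf (None, s') | Some a \<Rightarrow> for_each xs f s')"
        using Cons.prems(2) by (auto simp: bind_client_def)
      have "fst w = None" by (rule Cons.prems(4)[OF _ Cons.prems(6) False w]) simp
      then show ?thesis using z by (cases w) auto
    next
      case True
      then have f: "f x (srv, tr) = map_pmf (\<lambda>y. (Some (), srv(S := W x y (srv S)), tr @ T x y)) (p x)"
        by (intro Cons.prems(3)) (use Cons.prems(6) in auto)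
      obtain y where nz: "z \<in> set_pmf (for_each xs f (srv(S := W x y (srv S)), tr @ T x y))"
        using Cons.prems(2) unfolding for_each.simps bind_client_def f by (auto simp: bind_map_pmf)
      have ng: "\<not> (\<forall>i\<in>set xs. good i)" using Cons.prems(1) True by simp
      show ?thesis
      proof (rule Cons.IH[OF ng nz])
        show "f i (srv, tr) = map_pmf (\<lambda>y. (Some (), srv(S := W i y (srv S)), tr @ T i y)) (p i)"
          if "i \<in> set xs" "srv R = A" "good i" for i srv tr
          using that by (intro Cons.prems(3)) auto
        show "fst z = None" if "i \<in> set xs" "srv R = A" "\<not> good i" "z \<in> set_pmf (f i (srv, tr))" for i srv tr z
          by (rule Cons.prems(4)[of i srv z tr]) (use that in auto)
      qed (use Cons.prems(5,6) in auto)
    qed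
  qed simp
qed

lemma for_each_map: "for_each (map g xs) f = for_each xs (\<lambda>x. f (g x))"
  by (induction xs) auto

lemma bind_client_assoc:
  fixes m :: "'a client"
  shows "bind_client (bind_client m f) g = bind_client m (\<lambda>x. bind_client (f x) g)"
  unfolding bind_client_def
  by (rule ext) (auto simp: bind_assoc_pmf split_def bind_return_pmf intro!: bind_pmf_cong split: option.split)

lemma bind_return_client [simp]: "bind_client (return_client a) f = f a"
  by (simp add: bind_client_def return_client_def bind_return_pmf)

lemma for_each_append: "for_each (xs @ ys) f = bind_client (for_each xs f) (\<lambda>_. for_each ys f)"
  by (induction xs) (simp_all add: bind_client_assoc)

lemma for_each_product:
  "for_each xs (\<lambda>x. for_each ys (\<lambda>y. f x y)) = for_each (List.product xs ys) (\<lambda>(x, y). f x y)"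
  by (induction xs) (simp_all add: for_each_append for_each_map)

lemma product_upt: "List.product [0..<m] [0..<n] = map (\<lambda>w. (w div n, w mod n)) [0..<m * n]"
proof (induction m)
  case (Suc m)
  have "List.product [0..<Suc m] ys = List.product [0..<m] ys @ map (Pair m) ys" for ys :: "nat list"
    by (simp add: product_concat_map)
  moreover have "[0..<Suc m * n] = [0..<m * n] @ map (\<lambda>j. m * n + j) [0..<n]"
    using upt_add_eq_append[of 0 "m * n" n] map_add_upt[of "m * n" n] by (simp add: add.commute)
  ultimately show ?case using Suc by (auto simp: comp_def)
qed simp

subsection \<open>Slots\<close>

lemma less_key_width: "n < 2 ^ key_width n"
  unfolding key_width_def by (rule LeastI_ex) (use less_exp in blast)

lemma open_real_slot: "fst e \<le> n \<Longrightarrow> open_slot n (Some (real_slot n e)) = Some e"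
  using less_key_width[of n]
  by (cases e) (simp add: real_slot_def horner_sum_bit_eq_take_bit take_bit_nat_eq_self)

lemma open_dummy_slot: "open_slot n (Some (dummy_slot n L)) = None"
  by (simp add: dummy_slot_def)

lemma length_slots:
  "length (real_slot n e) = 1 + key_width n + length (snd e)" "length (dummy_slot n L) = 1 + key_width n + L"
  by (simp_all add: real_slot_def dummy_slot_def)

lemma real_elements_append: "real_elements n D (xs @ ys) = real_elements n D xs @ real_elements n D ys"
  by (simp add: real_elements_def List.map_filter_def)

lemma real_elements_concat: "real_elements n D (concat xss) = concat (map (real_elements n D) xss)"
  by (induction xss) (auto simp: real_elements_append, simp add: real_elements_def List.map_filter_def)

lemma real_elements_real:
  "map D cs = map (Some \<circ> real_slot n) es \<Longrightarrow> \<forall>e\<in>set es. fst e \<le> n \<Longrightarrow> real_elements n D cs = es"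
  by (induction cs arbitrary: es) (auto simp: real_elements_def map_filter_simps open_real_slot Cons_eq_map_conv)

lemma real_elements_dummy: "map D cs = replicate m (Some (dummy_slot n L)) \<Longrightarrow> real_elements n D cs = []"
  by (induction cs arbitrary: m) (auto simp: real_elements_def map_filter_simps open_dummy_slot Cons_replicate_eq)

lemma real_elements_pad:
  assumes "map D cs = map Some (pad_batch n L q es)" and "\<forall>e\<in>set es. fst e \<le> n"
  shows "real_elements n D cs = es"
proof -
  let ?k = "length es"
  have "map D (take ?k cs) = map (Some \<circ> real_slot n) es"
    "map D (drop ?k cs) = replicate (q - ?k) (Some (dummy_slot n L))"
    unfolding take_map[symmetric] drop_map[symmetric] assms(1) pad_batch_def by simp_all
  then have "real_elements n D (take ?k cs) = es" "real_elements n D (drop ?k cs) = []"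
    using assms(2) by (auto intro: real_elements_real real_elements_dummy)
  then have "real_elements n D (take ?k cs @ drop ?k cs) = es" unfolding real_elements_append by simp
  then show ?thesis by simp
qed

subsection \<open>A single pass\<close>

text \<open>Agrees with \<open>pad_batch\<close> unless the batch overflows. Cutting off at
  \<open>q\<close> makes the length independent of the data in every case, so the simulator can go
  on where the client would fail without revealing anything through lengths.\<close>

definition pad :: "nat \<Rightarrow> nat \<Rightarrow> nat \<Rightarrow> element list \<Rightarrow> bits list" where
  "pad n L q es = take q (map (real_slot n) es @ replicate q (dummy_slot n L))"

lemma pad_batch_eq: "length es \<le> q \<Longrightarrow> pad_batch n L q es = pad n L q es"
  by (simp add: pad_batch_def pad_def)

lemma length_pad [simp]: "length (pad n L q es) = q"
  by (simp add: pad_def)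

text \<open>Both distribution phases read block \<open>w\<close> of an array \<open>A\<close> and write its \<open>c\<close>-th batch
  as block \<open>idx w c\<close> of size \<open>q\<close> of another array; \<open>src\<close> inverts \<open>idx\<close>.\<close>

definition dist_msgs :: "nat \<Rightarrow> nat \<Rightarrow> nat \<Rightarrow> nat \<Rightarrow> (nat \<Rightarrow> nat \<Rightarrow> element list) \<Rightarrow> bits list" where
  "dist_msgs n L q r bt = concat (map (\<lambda>w. concat (map (\<lambda>c. pad n L q (bt w c)) [0..<r])) [0..<r^2])"

definition dist_trans :: "nat \<Rightarrow> nat \<Rightarrow> nat \<Rightarrow> (nat \<Rightarrow> nat \<Rightarrow> nat) \<Rightarrow> arr \<Rightarrow> arr \<Rightarrow> bits list \<Rightarrow> bits list \<Rightarrow> transcript" where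
  "dist_trans r l q idx R S A ys = concat (map (\<lambda>w.
     [(GetRange R (w * l) l, Elems (read_range (w * l) l A)),
      (PutRangeDist S (map (\<lambda>c. (idx w c * q, blk q ys (w * r + c))) [0..<r]), Ack)]) [0..<r^2])"

definition spread :: "nat \<Rightarrow> nat \<Rightarrow> (nat \<Rightarrow> nat) \<Rightarrow> bits list \<Rightarrow> bits list" where
  "spread q M src ys = concat (map (\<lambda>m. blk q ys (src m)) [0..<M])"

lemma dist_step:
  "bind_client (read_elements n D R loc l) (\<lambda>es. distribute_batches n E L q S lc (bt es) r) (srv, tr) =
   (let es = real_elements n D (read_range loc l (srv R));
        tr' = tr @ [(GetRange R loc l, Elems (read_range loc l (srv R)))]
    in if \<exists>c<r. length (bt es c) > q then return_pmf (None, (srv, tr'))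
       else map_pmf (\<lambda>css. (Some (), (srv(S := fold (\<lambda>(loc, a). write_range loc a) (zip (map lc [0..<r]) css) (srv S)),
              tr' @ [(PutRangeDist S (zip (map lc [0..<r]) css), Ack)])))
            (mapM_pmf (mapM_pmf E) (map (\<lambda>c. pad_batch n L q (bt es c)) [0..<r])))"
  by (auto simp: read_elements_def distribute_batches_def bind_client_def request_def return_client_def
      fail_client_def sample_def bind_return_pmf bind_map_pmf Let_def map_pmf_def bind_assoc_pmf)

lemma mapM_pmf_upt_blk:
  assumes "\<And>w. w < m \<Longrightarrow> length (M w) = l"
  shows "mapM_pmf (\<lambda>w. mapM_pmf f (M w)) [0..<m]
    = map_pmf (\<lambda>ys. map (blk l ys) [0..<m]) (mapM_pmf f (concat (map M [0..<m])))"
proof -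
  have "mapM_pmf (mapM_pmf f) (map M [0..<m]) = map_pmf (\<lambda>ys. map (blk l ys) [0..<length (map M [0..<m])])
      (mapM_pmf f (concat (map M [0..<m])))"
    by (rule mapM_pmf_blk) (use assms in auto)
  then show ?thesis by (simp add: mapM_pmf_map)
qed

lemma zip_map_self: "zip xs (map g xs) = map (\<lambda>x. (x, g x)) xs"
  by (induction xs) auto

lemma length_concat_const: "(\<And>i. i < m \<Longrightarrow> length (F i) = q) \<Longrightarrow> length (concat (map F [0..<m])) = m * q"
  by (induction m) auto

text \<open>Both distribution phases are instances, with different index maps. Since the blocks of
  \<open>S\<close> correspond one to one to pairs of a round and a batch, the final contents are a
  rearrangement of the blocks of the flat list of encryptions, which \<open>spread\<close>
  describes.\<close>

lemma distribution_loop: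
  fixes E :: "bits \<Rightarrow> bits pmf" and bt :: "nat \<Rightarrow> element list \<Rightarrow> nat \<Rightarrow> element list" and L :: nat
  assumes "R \<noteq> S" and "srv R = A" and "length (srv S) = r^3 * q"
    and es: "\<And>w. w < r^2 \<Longrightarrow> real_elements n D (read_range (w * l) l A) = es w"
    and idx: "\<And>w c. w < r^2 \<Longrightarrow> c < r \<Longrightarrow> idx w c < r^3 \<and> src (idx w c) = w * r + c"
    and surj: "\<And>m. m < r^3 \<Longrightarrow> \<exists>w<r^2. \<exists>c<r. m = idx w c"
  defines "body \<equiv> \<lambda>w. bind_client (read_elements n D R (w * l) l)
      (\<lambda>es. distribute_batches n E L q S (\<lambda>c. idx w c * q) (bt w es) r)"
  shows "\<forall>w<r^2. \<forall>c<r. length (bt w (es w) c) \<le> q \<Longrightarrow> for_each [0..<r^2] body (srv, tr) =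
      map_pmf (\<lambda>ys. (Some (), srv(S := spread q (r^3) src ys), tr @ dist_trans r l q idx R S A ys))
        (mapM_pmf E (dist_msgs n L q r (\<lambda>w. bt w (es w))))"
    and "\<not> (\<forall>w<r^2. \<forall>c<r. length (bt w (es w) c) \<le> q) \<Longrightarrow> z \<in> set_pmf (for_each [0..<r^2] body (srv, tr))
      \<Longrightarrow> fst z = None"
proof -
  let ?good = "\<lambda>w. \<forall>c<r. length (bt w (es w) c) \<le> q"
  define p where "p w = mapM_pmf E (concat (map (\<lambda>c. pad n L q (bt w (es w) c)) [0..<r]))" for w
  define p' where "p' w = map_pmf (\<lambda>ys. map (blk q ys) [0..<r]) (p w)" for w
  define W where "W w css = fold (\<lambda>(loc, a). write_range loc a) (zip (map (\<lambda>c. idx w c * q) [0..<r]) css)" for w css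
  define T where "T w css = [(GetRange R (w * l) l, Elems (read_range (w * l) l A)),
      (PutRangeDist S (zip (map (\<lambda>c. idx w c * q) [0..<r]) css), Ack)]" for w css
  have good: "body w (srv', tr') = map_pmf (\<lambda>y. (Some (), srv'(S := W w y (srv' S)), tr' @ T w y)) (p' w)"
    if "w \<in> set [0..<r^2]" "srv' R = A" "?good w" for w srv' tr'
  proof -
    have "mapM_pmf (mapM_pmf E) (map (\<lambda>c. pad_batch n L q (bt w (es w) c)) [0..<r])
      = mapM_pmf (\<lambda>c. mapM_pmf E (pad n L q (bt w (es w) c))) [0..<r]"
      unfolding mapM_pmf_map using that(3) by (intro mapM_pmf_cong) (simp add: pad_batch_eq)
    also have "\<dots> = p' w"
      unfolding p'_def p_def by (rule mapM_pmf_upt_blk) simp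
    finally have "mapM_pmf (mapM_pmf E) (map (\<lambda>c. pad_batch n L q (bt w (es w) c)) [0..<r]) = p' w" .
    moreover have "\<not> (\<exists>c<r. length (bt w (es w) c) > q)" using that(3) by (auto simp: not_less)
    moreover have "real_elements n D (read_range (w * l) l A) = es w" using es that(1) by simp
    ultimately show ?thesis
      unfolding body_def dist_step Let_def that(2) by (simp only: if_False W_def T_def) simp
  qed
  have bad: "fst z = None" if "w \<in> set [0..<r^2]" "srv' R = A" "\<not> ?good w" "z \<in> set_pmf (body w (srv', tr'))"
    for w srv' tr' z
  proof -
    have "\<exists>c<r. length (bt w (es w) c) > q" using that(3) by (auto simp: not_le)
    moreover have "real_elements n D (read_range (w * l) l A) = es w" using es that(1) by simp
    ultimately show ?thesis
      using that(4) unfolding body_def dist_step Let_def that(2) by (simp only: if_True) simp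
  qed
  have run1: "for_each [0..<r^2] body (srv, tr) = map_pmf (\<lambda>ys. (Some (), srv(S := fold (\<lambda>(i, y). W i y) (zip [0..<r^2] ys) (srv S)),
             tr @ concat (map (\<lambda>(i, y). T i y) (zip [0..<r^2] ys)))) (mapM_pmf p' [0..<r^2])"
    if "\<forall>i\<in>set [0..<r^2]. ?good i"
    by (rule for_each_run(1)[where good="?good" and R=R and A=A])
       ((rule good; assumption) | (rule bad; assumption) | fact)+
  have run2: "fst z = None" if "\<not> (\<forall>i\<in>set [0..<r^2]. ?good i)" "z \<in> set_pmf (for_each [0..<r^2] body (srv, tr))"
    by (rule for_each_run(2)[where good="?good" and R=R and S=S and A=A and f=body and xs="[0..<r^2]" and srv=srv and tr=tr and W=W and T=T and p=p'])
       ((rule good; assumption) | (rule bad; assumption) | fact)+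
  have pw: "length (concat (map (\<lambda>c. pad n L q (bt w (es w) c)) [0..<r])) = r * q" for w
    by (rule length_concat_const) simp
  have bb: "map (blk q (blk (r * q) ys w)) [0..<r] = map (\<lambda>c. blk q ys (w * r + c)) [0..<r]" for ys :: "bits list" and w
    by (rule map_cong) (auto simp: blk_blk)
  have "mapM_pmf p' [0..<r^2] = map_pmf (map (\<lambda>ys. map (blk q ys) [0..<r])) (mapM_pmf p [0..<r^2])"
    unfolding p'_def by (rule mapM_pmf_map_pmf)
  also have "mapM_pmf p [0..<r^2] = map_pmf (\<lambda>ys. map (blk (r * q) ys) [0..<r^2])
      (mapM_pmf E (dist_msgs n L q r (\<lambda>w. bt w (es w))))"
    unfolding p_def dist_msgs_def by (rule mapM_pmf_upt_blk) (rule pw)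
  finally have mp: "mapM_pmf p' [0..<r^2] = map_pmf (\<lambda>ys. map (\<lambda>w. map (\<lambda>c. blk q ys (w * r + c)) [0..<r]) [0..<r^2])
      (mapM_pmf E (dist_msgs n L q r (\<lambda>w. bt w (es w))))"
    by (simp add: pmf.map_comp comp_def bb)
  have lmsgs: "length (dist_msgs n L q r (\<lambda>w. bt w (es w))) = r^2 * (r * q)"
    unfolding dist_msgs_def by (rule length_concat_const) (rule pw)
  show "for_each [0..<r^2] body (srv, tr) =
      map_pmf (\<lambda>ys. (Some (), srv(S := spread q (r^3) src ys), tr @ dist_trans r l q idx R S A ys))
        (mapM_pmf E (dist_msgs n L q r (\<lambda>w. bt w (es w))))"
    if "\<forall>w<r^2. \<forall>c<r. length (bt w (es w) c) \<le> q"
  proof -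
    have content: "fold (\<lambda>(w, y). W w y) (zip [0..<r^2] (map (\<lambda>w. map (\<lambda>c. blk q ys (w * r + c)) [0..<r]) [0..<r^2])) (srv S)
      = spread q (r^3) src ys" if ly: "length ys = r^2 * (r * q)" for ys
    proof -
      let ?xs = "List.product [0..<r^2] [0..<r]"
      have lb: "length (blk q ys (w * r + c)) = q" if wc: "w < r^2" "c < r" for w c
      proof (rule length_blk)
        show "length ys = r^2 * r * q" using ly by simp
        show "w * r + c < r^2 * r" using mult_le_mono1[of "Suc w" "r^2" r] wc by simp
      qed
      have "fold (\<lambda>(w, y). W w y) (zip [0..<r^2] (map (\<lambda>w. map (\<lambda>c. blk q ys (w * r + c)) [0..<r]) [0..<r^2])) (srv S)
        = fold (\<lambda>(w, c). write_range (idx w c * q) (blk q ys (w * r + c))) ?xs (srv S)"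
        unfolding zip_map_self fold_product[symmetric]
        by (simp add: fold_map comp_def W_def zip_map_map zip_same_conv_map)
      also have "\<dots> = fold (\<lambda>x. write_range ((\<lambda>(w, c). idx w c) x * q) (blk q ys (src ((\<lambda>(w, c). idx w c) x)))) ?xs (srv S)"
        by (rule fold_cong) (auto simp: idx)
      also have "\<dots> = spread q (r^3) src ys"
        unfolding spread_def
      proof (rule write_blocks)
        show "{..<r^3} \<subseteq> (\<lambda>(w, c). idx w c) ` set ?xs" using surj by fastforce
      qed (use idx lb assms(3) in auto)
      finally show ?thesis .
    qed
    have trans: "concat (map (\<lambda>(w, y). T w y) (zip [0..<r^2] (map (\<lambda>w. map (\<lambda>c. blk q ys (w * r + c)) [0..<r]) [0..<r^2])))
      = dist_trans r l q idx R S A ys" for ys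
      by (simp add: dist_trans_def T_def zip_map_self zip_map_map zip_same_conv_map comp_def)
    have "for_each [0..<r^2] body (srv, tr) = map_pmf (\<lambda>ys. (Some (), srv(S := fold (\<lambda>(i, y). W i y) (zip [0..<r^2] ys) (srv S)),
             tr @ concat (map (\<lambda>(i, y). T i y) (zip [0..<r^2] ys)))) (mapM_pmf p' [0..<r^2])"
      by (rule run1) (use that in auto)
    also have "\<dots> = map_pmf (\<lambda>ys. (Some (), srv(S := spread q (r^3) src ys), tr @ dist_trans r l q idx R S A ys))
        (mapM_pmf E (dist_msgs n L q r (\<lambda>w. bt w (es w))))"
      unfolding mp pmf.map_comp comp_def trans
      by (rule map_pmf_cong[OF refl]) (simp add: content mapM_pmf_length lmsgs)
    finally show ?thesis .
  qed
  show "fst z = None" if "\<not> (\<forall>w<r^2. \<forall>c<r. length (bt w (es w) c) \<le> q)"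
    "z \<in> set_pmf (for_each [0..<r^2] body (srv, tr))"
    by (rule run2[OF _ that(2)]) (use that(1) in auto)
qed

definition clean_trans :: "nat \<Rightarrow> nat \<Rightarrow> bits list \<Rightarrow> bits list \<Rightarrow> transcript" where
  "clean_trans r q A ys = concat (map (\<lambda>j.
     [(GetRange ArrT2 (j * (r * q)) (r * q), Elems (read_range (j * (r * q)) (r * q) A)),
      (PutRange ArrO (j * r^2) (blk (r^2) ys j), Ack)]) [0..<r^2])"

lemma cleanup_loop:
  assumes A: "srv ArrT2 = A" and O: "length (srv ArrO) = r^4"
    and es: "\<And>j. j < r^2 \<Longrightarrow> sort_key (\<lambda>e. \<rho> (fst e)) (real_elements (r^4) D (read_range (j * (r * q)) (r * q) A)) = blk (r^2) es j"
    and len: "length es = r^4"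
  shows "cleanup_phase r q E D \<rho> (srv, tr) =
     map_pmf (\<lambda>ys. (Some (), srv(ArrO := ys), tr @ clean_trans r q A ys)) (mapM_pmf E (map (real_slot (r^4)) es))"
proof -
  define p where "p j = mapM_pmf E (map (real_slot (r^4)) (blk (r^2) es j))" for j
  define T where "T j cs = [(GetRange ArrT2 (j * (r * q)) (r * q), Elems (read_range (j * (r * q)) (r * q) A)),
      (PutRange ArrO (j * r^2) cs, Ack)]" for j cs
  have r4: "r^4 = r^2 * r^2" by (simp add: power_add[symmetric])
  have lb: "length (blk (r^2) xs j) = r^2" if "length xs = r^4" "j < r^2" for xs :: "'c list" and j
    using that unfolding r4 by (rule length_blk)
  have eq: "cleanup_phase r q E D \<rho> (srv, tr) = map_pmf (\<lambda>ys. (Some (), srv(ArrO := fold (\<lambda>(j, cs). write_range (j * r^2) cs) (zip [0..<r^2] ys) (srv ArrO)),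
      tr @ concat (map (\<lambda>(j, cs). T j cs) (zip [0..<r^2] ys)))) (mapM_pmf p [0..<r^2])"
    unfolding cleanup_phase_def
  proof (rule for_each_run(1)[where good="\<lambda>_. True" and R=ArrT2 and S=ArrO and A=A and p=p and T=T
        and W="\<lambda>j. write_range (j * r^2)"])
    fix j and srv :: server and tr :: transcript
    assume j: "j \<in> set [0..<r^2]" and "srv ArrT2 = A"
    then show "bind_client (read_elements (r^4) D ArrT2 (j * (r * q)) (r * q)) (\<lambda>es.
          bind_client (sample (mapM_pmf E (map (real_slot (r^4)) (sort_key (\<lambda>e. \<rho> (fst e)) es)))) (\<lambda>cs.
            bind_client (request (PutRange ArrO (j * r^2) cs)) (\<lambda>_. return_client ()))) (srv, tr)
       = map_pmf (\<lambda>y. (Some (), srv(ArrO := write_range (j * r^2) y (srv ArrO)), tr @ T j y)) (p j)"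
      using es[of j]
      by (simp add: p_def T_def read_elements_def bind_client_def request_def return_client_def
          sample_def bind_return_pmf bind_map_pmf map_pmf_def bind_assoc_pmf)
  qed (use A in auto)
  have mp: "mapM_pmf p [0..<r^2] = map_pmf (\<lambda>ys. map (blk (r^2) ys) [0..<r^2]) (mapM_pmf E (map (real_slot (r^4)) es))"
  proof -
    have "concat (map (\<lambda>j. map (real_slot (r^4)) (blk (r^2) es j)) [0..<r^2]) = map (real_slot (r^4)) (concat (map (blk (r^2) es) [0..<r^2]))"
      by (simp add: map_concat comp_def)
    also have "concat (map (blk (r^2) es) [0..<r^2]) = es" by (rule concat_blk) (rule len[unfolded r4])
    finally have c: "concat (map (\<lambda>j. map (real_slot (r^4)) (blk (r^2) es j)) [0..<r^2]) = map (real_slot (r^4)) es" .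
    have "mapM_pmf p [0..<r^2] = map_pmf (\<lambda>ys. map (blk (r^2) ys) [0..<r^2])
      (mapM_pmf E (concat (map (\<lambda>j. map (real_slot (r^4)) (blk (r^2) es j)) [0..<r^2])))"
      unfolding p_def by (rule mapM_pmf_upt_blk) (simp add: lb len)
    then show ?thesis by (simp only: c)
  qed
  have content: "fold (\<lambda>(j, cs). write_range (j * r^2) cs) (zip [0..<r^2] (map (blk (r^2) ys) [0..<r^2])) (srv ArrO) = ys"
    if "length ys = r^4" for ys
  proof -
    have "fold (\<lambda>(j, cs). write_range (j * r^2) cs) (zip [0..<r^2] (map (blk (r^2) ys) [0..<r^2])) (srv ArrO)
      = fold (\<lambda>j. write_range ((\<lambda>j. j) j * r^2) (blk (r^2) ys ((\<lambda>j. j) j))) [0..<r^2] (srv ArrO)"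
      by (simp add: zip_map_self fold_map comp_def)
    also have "\<dots> = concat (map (blk (r^2) ys) [0..<r^2])"
      by (rule write_blocks) (use that lb O[unfolded r4] in auto)
    also have "\<dots> = ys" by (rule concat_blk) (rule that[unfolded r4])
    finally show ?thesis .
  qed
  show ?thesis
    unfolding eq mp pmf.map_comp comp_def
    by (rule map_pmf_cong[OF refl])
       (simp add: content[unfolded zip_map_self] mapM_pmf_length len clean_trans_def T_def zip_map_self comp_def)
qed

text \<open>Given by filters rather than by sorting, a form to which the closure rules for
  polynomial time apply.\<close>

definition arrange :: "nat \<Rightarrow> (nat \<Rightarrow> nat) \<Rightarrow> element list \<Rightarrow> element list" where
  "arrange n \<rho> es = concat (map (\<lambda>p. filter (\<lambda>e. \<rho> (fst e) = p) es) [1..<Suc n])"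

lemma filter_unique:
  assumes "distinct (map f es)" and "p \<in> f ` set es"
  shows "\<exists>e\<in>set es. f e = p \<and> filter (\<lambda>e. f e = p) es = [e]"
  using assms
proof (induction es)
  case (Cons e es)
  show ?case
  proof (cases "f e = p")
    case True
    then have "filter (\<lambda>e. f e = p) es = []" using Cons.prems by (auto simp: filter_empty_conv) (metis imageI)
    then show ?thesis using True by simp
  next
    case False
    then show ?thesis using Cons by auto
  qed
qed simp

lemma map_arrange:
  assumes "distinct (map (\<lambda>e. \<rho> (fst e)) es)" and "(\<lambda>e. \<rho> (fst e)) ` set es = {1..n}"
  shows "map (\<lambda>e. \<rho> (fst e)) (arrange n \<rho> es) = [1..<Suc n]"
proof -
  let ?f = "\<lambda>e. \<rho> (fst e)"
  have "map ?f (concat (map (\<lambda>p. filter (\<lambda>e. ?f e = p) es) ps)) = ps" if "set ps \<subseteq> {1..n}" for ps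
    using that
  proof (induction ps)
    case (Cons p ps)
    then obtain e where "?f e = p" "filter (\<lambda>e. ?f e = p) es = [e]"
      using filter_unique[of ?f es p] assms by auto
    then show ?case using Cons by simp
  qed simp
  then show ?thesis unfolding arrange_def by (simp add: atLeastLessThanSuc_atLeastAtMost del: upt_Suc)
qed

lemma set_arrange:
  assumes "(\<lambda>e. \<rho> (fst e)) ` set es \<subseteq> {1..n}"
  shows "set (arrange n \<rho> es) = set es"
  using assms by (fastforce simp: arrange_def simp del: upt_Suc)

lemma map_blk: "map f (blk q xs w) = blk q (map f xs) w"
  by (simp add: blk_def take_map drop_map)

lemma set_blk: "set (blk q xs w) \<subseteq> set xs"
  unfolding blk_def by (meson order_trans set_drop_subset set_take_subset)

lemma blk_upt:
  assumes "w < m"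
  shows "blk q [1..<Suc (m * q)] w = [w * q + 1..<w * q + q + 1]"
proof -
  have "Suc w * q \<le> m * q" using assms by (intro mult_le_mono1) simp
  then show ?thesis by (simp add: blk_def take_upt add.commute del: upt_Suc)
qed

text \<open>As \<open>f\<close> is injective on \<open>es\<close>, a list of its elements is
  determined by the list of their positions. On both sides this is the interval of positions of
  bucket \<open>u\<close> in increasing order.\<close>

lemma sort_key_bucket:
  fixes \<rho> :: "nat \<Rightarrow> nat" and es :: "element list"
  defines "f \<equiv> \<lambda>e. \<rho> (fst e)"
  assumes d: "distinct (map f es)" and im: "f ` set es = {1..m * q}" and u: "u < m"
  shows "sort_key f (filter (\<lambda>e. (f e - 1) div q = u) es) = blk q (arrange (m * q) \<rho> es) u"
proof (cases "q = 0")
  case True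
  then have "es = []" using im by auto
  then show ?thesis by (simp add: blk_def arrange_def True)
next
  case False
  let ?X = "sort_key f (filter (\<lambda>e. (f e - 1) div q = u) es)" and ?Y = "blk q (arrange (m * q) \<rho> es) u"
  have le: "u * q + q \<le> m * q" using mult_le_mono1[of "Suc u" m q] u by simp
  have Y: "map f ?Y = [u * q + 1..<u * q + q + 1]"
    unfolding map_blk f_def map_arrange[OF d[unfolded f_def] im[unfolded f_def]] by (rule blk_upt[OF u])
  have "set (map f ?X) = {u * q + 1..<u * q + q + 1}"
  proof -
    have "set (map f ?X) = {p \<in> f ` set es. (p - 1) div q = u}" by auto
    also have "\<dots> = {u * q + 1..<u * q + q + 1}"
      unfolding im
    proof (intro equalityI subsetI)
      fix p assume p: "p \<in> {p \<in> {1..m * q}. (p - 1) div q = u}"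
      then have "u * q \<le> p - 1" "p - 1 < u * q + q" "1 \<le> p"
        using div_times_less_eq_dividend[of "p - 1" q] dividend_less_div_times[of q "p - 1"] False by auto
      then show "p \<in> {u * q + 1..<u * q + q + 1}" by simp linarith
    next
      fix p assume p: "p \<in> {u * q + 1..<u * q + q + 1}"
      then have "(p - 1) div q = u" by (intro div_nat_eqI) (auto simp: algebra_simps)
      then show "p \<in> {p \<in> {1..m * q}. (p - 1) div q = u}" using p le by auto
    qed
    finally show ?thesis .
  qed
  moreover have "distinct (map f ?X)"
    using d by (simp add: distinct_map) (auto intro: inj_on_subset)
  moreover have "sorted (map f ?X)" by simp
  ultimately have X: "map f ?X = [u * q + 1..<u * q + q + 1]"
    by (intro sorted_distinct_set_unique) (auto simp del: upt_Suc)
  have "inj_on f (set es)" using d by (simp add: distinct_map)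
  moreover have "set ?Y \<subseteq> set es"
    using set_blk[of q "arrange (m * q) \<rho> es" u] set_arrange[of \<rho> es "m * q"] im unfolding f_def by auto
  ultimately show ?thesis
    using X Y by (intro inj_on_map_eq_map[THEN iffD1, of f]) (auto intro: inj_on_subset)
qed

definition sel1 :: "nat \<Rightarrow> (nat \<Rightarrow> nat) \<Rightarrow> element list \<Rightarrow> nat \<Rightarrow> nat \<Rightarrow> element list" where
  "sel1 r \<rho> es w c = filter (\<lambda>e. (\<rho> (fst e) - 1) div r^3 = c) (blk (r^2) es w)"

text \<open>Bucket \<open>w mod r\<close> of chunk \<open>w div r\<close> of \<open>T1\<close>
  consists of the batches from \<open>r\<close> consecutive buckets of the input, hence from
  \<open>r ^ 3\<close> consecutive elements. A target bucket determines its chunk, so the batch can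
  be described from the input array without reference to the first phase.\<close>

definition sel2 :: "nat \<Rightarrow> (nat \<Rightarrow> nat) \<Rightarrow> element list \<Rightarrow> nat \<Rightarrow> nat \<Rightarrow> element list" where
  "sel2 r \<rho> es w b = filter (\<lambda>e. (\<rho> (fst e) - 1) div r^2 = w div r * r + b) (blk (r^3) es (w mod r))"

text \<open>Locations in units of batches. Chunk \<open>c\<close> of \<open>T1\<close> has room for
  \<open>r ^ 2\<close> batches, one per input bucket \<open>w\<close>. In \<open>idx2\<close> the
  number \<open>w\<close> combines chunk \<open>w div r\<close> and bucket \<open>w mod r\<close> of
  \<open>T1\<close>; the batch goes to bucket \<open>b\<close> of the same chunk of
  \<open>T2\<close>, at offset \<open>w mod r\<close>. The maps \<open>src1\<close> and
  \<open>src2\<close> return from a location to the place of the batch in the order of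
  encryption.\<close>

definition idx1 :: "nat \<Rightarrow> nat \<Rightarrow> nat \<Rightarrow> nat" where
  "idx1 r w c = c * r^2 + w"

definition src1 :: "nat \<Rightarrow> nat \<Rightarrow> nat" where
  "src1 r m = m mod r^2 * r + m div r^2"

definition idx2 :: "nat \<Rightarrow> nat \<Rightarrow> nat \<Rightarrow> nat" where
  "idx2 r w b = (w div r * r + b) * r + w mod r"

definition src2 :: "nat \<Rightarrow> nat \<Rightarrow> nat" where
  "src2 r m = (m div r^2 * r + m mod r) * r + m div r mod r"

definition pass_good :: "nat \<Rightarrow> nat \<Rightarrow> nat \<Rightarrow> (nat \<Rightarrow> nat) \<Rightarrow> element list \<Rightarrow> bool" where
  "pass_good r q1 q2 \<rho> es \<longleftrightarrow> (\<forall>w<r^2. \<forall>c<r. length (sel1 r \<rho> es w c) \<le> q1 \<and> length (sel2 r \<rho> es w c) \<le> q2)"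

definition pass_msgs :: "nat \<Rightarrow> nat \<Rightarrow> nat \<Rightarrow> nat \<Rightarrow> (nat \<Rightarrow> nat) \<Rightarrow> element list \<Rightarrow> bits list" where
  "pass_msgs r q1 q2 L \<rho> es = dist_msgs (r^4) L q1 r (sel1 r \<rho> es) @ dist_msgs (r^4) L q2 r (sel2 r \<rho> es)
     @ map (real_slot (r^4)) (arrange (r^4) \<rho> es)"

definition pass_trans :: "nat \<Rightarrow> nat \<Rightarrow> nat \<Rightarrow> bits list \<Rightarrow> bits list \<Rightarrow> transcript" where
  "pass_trans r q1 q2 cs ys =
     dist_trans r (r^2) q1 (idx1 r) ArrI ArrT1 cs (take (r^3 * q1) ys)
   @ dist_trans r (r * q1) q2 (idx2 r) ArrT1 ArrT2 (spread q1 (r^3) (src1 r) (take (r^3 * q1) ys))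
       (take (r^3 * q2) (drop (r^3 * q1) ys))
   @ clean_trans r q2 (spread q2 (r^3) (src2 r) (take (r^3 * q2) (drop (r^3 * q1) ys)))
       (drop (r^3 * q1 + r^3 * q2) ys)"

lemma blk_dist_msgs:
  assumes "w < r^2" and "c < r"
  shows "blk q (dist_msgs n L q r bt) (w * r + c) = pad n L q (bt w c)"
proof -
  have "blk q (dist_msgs n L q r bt) (w * r + c) = blk q (blk (r * q) (dist_msgs n L q r bt) w) c"
    by (rule blk_blk[OF assms(2), symmetric])
  also have "blk (r * q) (dist_msgs n L q r bt) w = concat (map (\<lambda>c. pad n L q (bt w c)) [0..<r])"
    unfolding dist_msgs_def by (rule blk_concat) (use assms(1) in \<open>auto intro: length_concat_const\<close>)
  also have "blk q \<dots> c = pad n L q (bt w c)"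
    by (rule blk_concat) (use assms(2) in auto)
  finally show ?thesis .
qed

lemma blk_concat_blk:
  assumes "length xs = m * (r * q)" and "u < m"
  shows "blk (r * q) xs u = concat (map (\<lambda>k. blk q xs (u * r + k)) [0..<r])"
proof -
  have "concat (map (blk q (blk (r * q) xs u)) [0..<r]) = blk (r * q) xs u"
    by (rule concat_blk) (rule length_blk[OF assms])
  moreover have "map (blk q (blk (r * q) xs u)) [0..<r] = map (\<lambda>k. blk q xs (u * r + k)) [0..<r]"
    by (rule map_cong) (auto simp: blk_blk)
  ultimately show ?thesis by simp
qed

lemma r3: "r^3 = r^2 * (r::nat)"
  by (simp add: power3_eq_cube power2_eq_square)

lemma mult_add_less: "w < a \<Longrightarrow> c < r \<Longrightarrow> w * r + c < a * (r::nat)"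
  using mult_le_mono1[of "Suc w" a r] by simp

lemma length_dist_msgs: "length (dist_msgs n L q r bt) = r^3 * q"
proof -
  have "length (dist_msgs n L q r bt) = r^2 * (r * q)"
    unfolding dist_msgs_def by (rule length_concat_const) (auto intro: length_concat_const)
  then show ?thesis by (simp add: r3)
qed

lemma real_elements_bucket:
  assumes D: "map D ys = map Some (dist_msgs n L q r bt)"
    and fit: "\<And>w c. w < r^2 \<Longrightarrow> c < r \<Longrightarrow> length (bt w c) \<le> q \<and> (\<forall>e\<in>set (bt w c). fst e \<le> n)"
    and u: "u < r^2"
    and bound: "\<And>m. m < r^3 \<Longrightarrow> src m < r^3"
    and src: "\<And>k. k < r \<Longrightarrow> wo k < r^2 \<and> co k < r \<and> src (u * r + k) = wo k * r + co k"
  shows "real_elements n D (read_range (u * (r * q)) (r * q) (spread q (r^3) src ys))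
    = concat (map (\<lambda>k. bt (wo k) (co k)) [0..<r])"
proof -
  define Y where "Y = spread q (r^3) src ys"
  have ly: "length ys = r^3 * q" using arg_cong[OF D, of length] by (simp add: length_dist_msgs)
  have lb: "length (blk q ys (src m)) = q" if "m < r^3" for m
    by (rule length_blk[OF ly bound[OF that]])
  have lY: "length Y = r^3 * q" unfolding Y_def spread_def by (rule length_concat_const[OF lb])
  have part: "real_elements n D (blk q Y (u * r + k)) = bt (wo k) (co k)" if k: "k < r" for k
  proof -
    have "u * r + k < r^3" unfolding r3 by (rule mult_add_less[OF u k])
    then have "blk q Y (u * r + k) = blk q ys (wo k * r + co k)"
      unfolding Y_def spread_def using blk_concat[OF lb] src[OF k] by simp
    moreover have "map D (blk q ys (wo k * r + co k)) = map Some (pad_batch n L q (bt (wo k) (co k)))"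
      unfolding map_blk D using src[OF k] fit by (simp add: map_blk[symmetric] blk_dist_msgs pad_batch_eq)
    ultimately show ?thesis using real_elements_pad src[OF k] fit by metis
  qed
  have "read_range (u * (r * q)) (r * q) Y = blk (r * q) Y u" by (simp add: read_range_def blk_def)
  also have "\<dots> = concat (map (\<lambda>k. blk q Y (u * r + k)) [0..<r])"
    by (rule blk_concat_blk[OF _ u]) (simp add: lY r3)
  finally show ?thesis unfolding Y_def[symmetric] real_elements_concat
    by (auto simp: real_elements_concat part comp_def intro!: arg_cong[where f=concat] map_cong)
qed

lemma length_spread:
  assumes "length ys = M * q" and "\<And>m. m < M \<Longrightarrow> src m < M"
  shows "length (spread q M src ys) = M * q"
  unfolding spread_def by (rule length_concat_const) (use assms in \<open>auto intro: length_blk\<close>)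

lemma dist_msgs_cong:
  "(\<And>w c. w < r^2 \<Longrightarrow> c < r \<Longrightarrow> bt w c = bt' w c) \<Longrightarrow> dist_msgs n L q r bt = dist_msgs n L q r bt'"
  unfolding dist_msgs_def by (auto intro!: arg_cong[where f=concat] map_cong)

lemma bind_client_map:
  "m s = map_pmf (\<lambda>y. (Some (), h y)) p \<Longrightarrow> bind_client m f s = bind_pmf p (\<lambda>y. f () (h y))"
  by (simp add: bind_client_def bind_map_pmf)

lemma bind_client_None:
  "(\<And>z. z \<in> set_pmf (m s) \<Longrightarrow> fst z = None) \<Longrightarrow> z \<in> set_pmf (bind_client m f s) \<Longrightarrow> fst z = None"
  by (fastforce simp: bind_client_def)

text \<open>Only \<open>ArrI\<close> and \<open>ArrO\<close> are described by contents after a pass.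
  Every block of \<open>T1\<close> and \<open>T2\<close> is overwritten in the next pass, for which
  their lengths are enough.\<close>

lemma pass_client:
  fixes E :: "bits \<Rightarrow> bits pmf"
  assumes DE: "\<And>m c. c \<in> set_pmf (E m) \<Longrightarrow> D c = Some m"
    and len: "length es = r^4" and d: "distinct (map fst es)" and im: "fst ` set es = {1..r^4}"
    and \<rho>: "\<rho> permutes {1..r^4}"
    and I: "map D (srv ArrI) = map (Some \<circ> real_slot (r^4)) es"
    and T1: "length (srv ArrT1) = r^3 * q1" and T2: "length (srv ArrT2) = r^3 * q2" and O: "length (srv ArrO) = r^4"
  shows "pass_good r q1 q2 \<rho> es \<Longrightarrow> \<exists>f. (\<forall>ys. f ys ArrI = srv ArrI \<and> f ys ArrO = drop (r^3 * q1 + r^3 * q2) ys \<and>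
          (length ys = r^3 * q1 + r^3 * q2 + r^4 \<longrightarrow> length (f ys ArrT1) = r^3 * q1 \<and> length (f ys ArrT2) = r^3 * q2)) \<and>
      optim_shuffle_pass r q1 q2 E D L \<rho> (srv, tr) =
        map_pmf (\<lambda>ys. (Some (), f ys, tr @ pass_trans r q1 q2 (srv ArrI) ys)) (mapM_pmf E (pass_msgs r q1 q2 L \<rho> es))"
    and "\<not> pass_good r q1 q2 \<rho> es \<Longrightarrow> z \<in> set_pmf (optim_shuffle_pass r q1 q2 E D L \<rho> (srv, tr)) \<Longrightarrow> fst z = None"
proof -
  let ?n = "r^4"
  have r4: "?n = r^2 * r^2" "?n = r * r^3" by (simp_all add: power_add[symmetric] power_Suc[symmetric] del: power_Suc)
  have keys: "\<forall>e\<in>set es. fst e \<le> ?n" using im by (auto simp: set_eq_iff image_iff)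
  have df: "distinct (map (\<lambda>e. \<rho> (fst e)) es)"
    using d permutes_inj_on[OF \<rho>, of "fst ` set es"] by (simp add: distinct_map comp_inj_on[unfolded comp_def])
  have imf: "(\<lambda>e. \<rho> (fst e)) ` set es = {1..?n}"
    using permutes_image[OF \<rho>] im by (simp add: image_image[symmetric])
  \<comment> \<open>The elements in bucket \<open>w\<close> of \<open>T1\<close> after the first
    distribution phase.\<close>
  define es2 where "es2 w = filter (\<lambda>e. (\<rho> (fst e) - 1) div r^3 = w div r) (blk (r^3) es (w mod r))" for w
  define g1 where "g1 \<longleftrightarrow> (\<forall>w<r^2. \<forall>c<r. length (sel1 r \<rho> es w c) \<le> q1)"
  define g2 where "g2 \<longleftrightarrow> (\<forall>w<r^2. \<forall>c<r. length (sel2 r \<rho> es w c) \<le> q2)"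
  have good: "pass_good r q1 q2 \<rho> es \<longleftrightarrow> g1 \<and> g2" unfolding pass_good_def g1_def g2_def by auto
  have sub1: "set (sel1 r \<rho> es w c) \<subseteq> set es" and sub2: "set (sel2 r \<rho> es w c) \<subseteq> set es" for w c
    unfolding sel1_def sel2_def using set_blk[of _ es] by (auto simp: subset_iff)
  have body1: "distribution_phase1 r q1 E D L \<rho> = for_each [0..<r^2] (\<lambda>w. bind_client (read_elements ?n D ArrI (w * r^2) (r^2))
      (\<lambda>xs. distribute_batches ?n E L q1 ArrT1 (\<lambda>c. idx1 r w c * q1) (\<lambda>c. filter (\<lambda>e. (\<rho> (fst e) - 1) div r^3 = c) xs) r))"
  proof -
    have "c * (r * (r * q1)) + w * q1 = idx1 r w c * q1" for c w
      by (simp add: idx1_def power2_eq_square algebra_simps)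
    then show ?thesis unfolding distribution_phase1_def by simp
  qed
  have e1: "real_elements ?n D (read_range (w * r^2) (r^2) (srv ArrI)) = blk (r^2) es w" for w
  proof (rule real_elements_real)
    have "read_range (w * r^2) (r^2) (srv ArrI) = blk (r^2) (srv ArrI) w" by (simp add: read_range_def blk_def)
    then show "map D (read_range (w * r^2) (r^2) (srv ArrI)) = map (Some \<circ> real_slot ?n) (blk (r^2) es w)"
      by (simp only: map_blk I)
    show "\<forall>e\<in>set (blk (r^2) es w). fst e \<le> ?n" using keys set_blk by fast
  qed
  have i1: "idx1 r w c < r^3 \<and> src1 r (idx1 r w c) = w * r + c" if "w < r^2" "c < r" for w c
    using that mult_add_less[of c r w "r^2"] by (simp add: idx1_def src1_def r3 mult.commute)
  have s1: "\<exists>w<r^2. \<exists>c<r. m = idx1 r w c" if "m < r^3" for m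
  proof -
    have "0 < r" using that by (cases r) auto
    then have "m mod r^2 < r^2" "m div r^2 < r"
      using that by (simp_all add: r3 less_mult_imp_div_less mult.commute)
    moreover have "m = idx1 r (m mod r^2) (m div r^2)"
      unfolding idx1_def by (rule div_mult_mod_eq[symmetric])
    ultimately show ?thesis by blast
  qed
  have b1: "src1 r m < r^3" if "m < r^3" for m
    using s1[OF that] i1 mult_add_less[of _ "r^2" _ r] by (auto simp: r3)
  note loop1 = distribution_loop[where R=ArrI and S=ArrT1 and r=r and q=q1 and n="?n" and D=D and l="r^2" and E=E and L=L
      and es="blk (r^2) es" and bt="\<lambda>w xs c. filter (\<lambda>e. (\<rho> (fst e) - 1) div r^3 = c) xs" and idx="idx1 r" and src="src1 r"
      and srv=srv and tr=tr, OF _ refl T1 e1 i1 s1, folded body1, folded sel1_def]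
  have p1: "distribution_phase1 r q1 E D L \<rho> (srv, tr) = map_pmf (\<lambda>ys. (Some (), srv(ArrT1 := spread q1 (r^3) (src1 r) ys),
      tr @ dist_trans r (r^2) q1 (idx1 r) ArrI ArrT1 (srv ArrI) ys)) (mapM_pmf E (dist_msgs ?n L q1 r (sel1 r \<rho> es)))" if g1
    using loop1(1) that unfolding g1_def by simp
  have n1: "fst z = None" if "\<not> g1" "z \<in> set_pmf (distribution_phase1 r q1 E D L \<rho> (srv, tr))" for z
    using that by (intro loop1(2)) (auto simp: g1_def)
  have body2: "distribution_phase2 r q1 q2 E D L \<rho> = for_each [0..<r^2] (\<lambda>w. bind_client (read_elements ?n D ArrT1 (w * (r * q1)) (r * q1))
      (\<lambda>xs. distribute_batches ?n E L q2 ArrT2 (\<lambda>c. idx2 r w c * q2) (\<lambda>b. filter (\<lambda>e. (\<rho> (fst e) - 1) div r^2 = w div r * r + b) xs) r))"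
  proof -
    have "(w div r * r + b) * (r * q2) + w mod r * q2 = idx2 r w b * q2" for b w
      by (simp add: idx2_def algebra_simps)
    then show ?thesis
      unfolding distribution_phase2_def for_each_product product_upt for_each_map by (simp add: power2_eq_square)
  qed
  have T1c: "length (spread q1 (r^3) (src1 r) ys) = r^3 * q1" if "length ys = r^3 * q1" for ys
    by (rule length_spread[OF that b1])
  \<comment> \<open>The \<open>r\<close> batches of this bucket come from the input buckets
    \<open>w mod r * r + k\<close> and were all selected for chunk \<open>w div r\<close>. Selection
    commutes with concatenation, so together they are a selection from one block of
    \<open>r ^ 3\<close> elements.\<close>
  have e2: "real_elements ?n D (read_range (w * (r * q1)) (r * q1) (spread q1 (r^3) (src1 r) ys)) = es2 w"
    if g1 and w: "w < r^2" and ys: "map D ys = map Some (dist_msgs ?n L q1 r (sel1 r \<rho> es))" for w ys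
  proof -
    have r: "w div r < r" "w mod r < r" using w by (cases r; simp add: power2_eq_square less_mult_imp_div_less)+
    have "real_elements ?n D (read_range (w * (r * q1)) (r * q1) (spread q1 (r^3) (src1 r) ys))
      = concat (map (\<lambda>k. sel1 r \<rho> es (w mod r * r + k) (w div r)) [0..<r])"
    proof (rule real_elements_bucket[OF ys _ w b1])
      show "length (sel1 r \<rho> es w c) \<le> q1 \<and> (\<forall>e\<in>set (sel1 r \<rho> es w c). fst e \<le> ?n)" if "w < r^2" "c < r" for w c
        using \<open>g1\<close> that keys sub1 unfolding g1_def by fast
      fix k assume k: "k < r"
      have 1: "w mod r * r + k < r^2" using mult_add_less[OF r(2) k] by (simp add: power2_eq_square)
      have "idx1 r (w mod r * r + k) (w div r) = (w div r * r + w mod r) * r + k"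
        by (simp only: idx1_def power2_eq_square distrib_right mult.assoc add.assoc)
      then have "src1 r (w * r + k) = (w mod r * r + k) * r + w div r"
        using i1[OF 1 r(1)] by simp
      with 1 r show "w mod r * r + k < r^2 \<and> w div r < r \<and> src1 r (w * r + k) = (w mod r * r + k) * r + w div r" by simp
    qed
    also have "\<dots> = filter (\<lambda>e. (\<rho> (fst e) - 1) div r^3 = w div r) (concat (map (\<lambda>k. blk (r^2) es (w mod r * r + k)) [0..<r]))"
      by (simp add: sel1_def filter_concat comp_def)
    also have "concat (map (\<lambda>k. blk (r^2) es (w mod r * r + k)) [0..<r]) = blk (r * r^2) es (w mod r)"
      by (rule blk_concat_blk[symmetric, where m=r]) (use r len in \<open>simp_all add: r4(2) r3 mult.commute mult.left_commute\<close>)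
    also have "r * r^2 = r^3" by (simp add: r3)
    finally show ?thesis by (simp add: es2_def)
  qed
  have i2: "idx2 r w b < r^3 \<and> src2 r (idx2 r w b) = w * r + b" if w: "w < r^2" and b: "b < r" for w b
  proof -
    have r: "w div r < r" "w mod r < r" using w by (cases r; simp add: power2_eq_square less_mult_imp_div_less)+
    have "idx2 r w b < r * r * r" unfolding idx2_def by (intro mult_add_less r b)
    moreover have "idx2 r w b mod r = w mod r" "idx2 r w b div r = w div r * r + b"
      using r(2) by (simp_all add: idx2_def)
    moreover have "idx2 r w b div r^2 = w div r"
      unfolding power2_eq_square div_mult2_eq using calculation(3) b by simp
    ultimately show ?thesis using b by (simp add: src2_def power3_eq_cube)
  qed
  have s2: "\<exists>w<r^2. \<exists>b<r. m = idx2 r w b" if m: "m < r^3" for m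
  proof -
    have r: "0 < r" using m by (cases r) auto
    have "m div r^2 < r" using m by (simp add: r3 less_mult_imp_div_less mult.commute)
    then have "m div r^2 * r + m mod r < r^2" using mult_add_less[of "m div r^2" r "m mod r" r] r by (simp add: power2_eq_square)
    moreover have "m div r mod r < r" using r by simp
    moreover have "m = idx2 r (m div r^2 * r + m mod r) (m div r mod r)"
      using r by (simp add: idx2_def power2_eq_square div_mult2_eq)
    ultimately show ?thesis by blast
  qed
  have b2: "src2 r m < r^3" if "m < r^3" for m
    using s2[OF that] i2 mult_add_less[of _ "r^2" _ r] by (auto simp: r3)
  \<comment> \<open>Dividing the bucket number \<open>w div r * r + b\<close> by \<open>r\<close>
    gives the chunk \<open>w div r\<close>, so the filter of the first phase is implied by that of
    the second.\<close>
  have sel2: "filter (\<lambda>e. (\<rho> (fst e) - 1) div r^2 = w div r * r + b) (es2 w) = sel2 r \<rho> es w b" if "b < r" for w b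
  proof -
    have "(x - 1) div r^3 = w div r" if "(x - 1) div r^2 = w div r * r + b" for x
      using that \<open>b < r\<close> by (simp add: r3 div_mult2_eq)
    then show ?thesis unfolding sel2_def es2_def by (auto intro!: filter_cong)
  qed
  have m2: "dist_msgs ?n L q2 r (\<lambda>w b. filter (\<lambda>e. (\<rho> (fst e) - 1) div r^2 = w div r * r + b) (es2 w))
      = dist_msgs ?n L q2 r (sel2 r \<rho> es)"
    by (rule dist_msgs_cong) (rule sel2)
  have g2': "(\<forall>w<r^2. \<forall>b<r. length (filter (\<lambda>e. (\<rho> (fst e) - 1) div r^2 = w div r * r + b) (es2 w)) \<le> q2) \<longleftrightarrow> g2"
    unfolding g2_def by (simp add: sel2 del: One_nat_def)
  have p2: "distribution_phase2 r q1 q2 E D L \<rho> (srv', tr') = map_pmf (\<lambda>ys2. (Some (), srv'(ArrT2 := spread q2 (r^3) (src2 r) ys2),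
      tr' @ dist_trans r (r * q1) q2 (idx2 r) ArrT1 ArrT2 (spread q1 (r^3) (src1 r) ys) ys2)) (mapM_pmf E (dist_msgs ?n L q2 r (sel2 r \<rho> es)))"
    if g: g1 g2 and ys: "map D ys = map Some (dist_msgs ?n L q1 r (sel1 r \<rho> es))"
      and srv': "srv' ArrT1 = spread q1 (r^3) (src1 r) ys" "length (srv' ArrT2) = r^3 * q2" for srv' tr' ys
    unfolding body2 m2[symmetric]
    by (rule distribution_loop(1)[where n="?n" and D=D and L=L and es=es2 and bt="\<lambda>w xs b. filter (\<lambda>e. (\<rho> (fst e) - 1) div r^2 = w div r * r + b) xs",
          OF _ srv' e2[OF g(1) _ ys] i2 s2]) (use g g2' in auto)
  have n2: "fst z = None" if "g1" "\<not> g2" and ys: "map D ys = map Some (dist_msgs ?n L q1 r (sel1 r \<rho> es))"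
      and srv': "srv' ArrT1 = spread q1 (r^3) (src1 r) ys" "length (srv' ArrT2) = r^3 * q2"
      and z: "z \<in> set_pmf (distribution_phase2 r q1 q2 E D L \<rho> (srv', tr'))" for srv' tr' ys z
    by (rule distribution_loop(2)[where n="?n" and D=D and L=L and es=es2 and bt="\<lambda>w xs b. filter (\<lambda>e. (\<rho> (fst e) - 1) div r^2 = w div r * r + b) xs",
          OF _ srv' e2[OF \<open>g1\<close> _ ys] i2 s2 _ z[unfolded body2]]) (use that(1,2) g2' in auto)
  have arr: "length (arrange ?n \<rho> es) = ?n"
    using arg_cong[OF map_arrange[OF df imf], of length] by (simp del: upt_Suc)
  \<comment> \<open>Bucket \<open>u\<close> of \<open>T2\<close> receives a batch from each bucket
    of chunk \<open>u div r\<close> of \<open>T1\<close>; these cover the whole input, so the bucket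
    contains exactly the elements destined for bucket \<open>u\<close>.\<close>
  have e3: "sort_key (\<lambda>e. \<rho> (fst e)) (real_elements ?n D (read_range (u * (r * q2)) (r * q2) (spread q2 (r^3) (src2 r) ys)))
      = blk (r^2) (arrange ?n \<rho> es) u"
    if g2 and u: "u < r^2" and ys: "map D ys = map Some (dist_msgs ?n L q2 r (sel2 r \<rho> es))" for u ys
  proof -
    have r: "u div r < r" "u mod r < r" using u by (cases r; simp add: power2_eq_square less_mult_imp_div_less)+
    have "real_elements ?n D (read_range (u * (r * q2)) (r * q2) (spread q2 (r^3) (src2 r) ys))
      = concat (map (\<lambda>k. sel2 r \<rho> es (u div r * r + k) (u mod r)) [0..<r])"
    proof (rule real_elements_bucket[OF ys _ u b2])
      show "length (sel2 r \<rho> es w c) \<le> q2 \<and> (\<forall>e\<in>set (sel2 r \<rho> es w c). fst e \<le> ?n)" if "w < r^2" "c < r" for w c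
        using \<open>g2\<close> that keys sub2 unfolding g2_def by fast
      fix k assume k: "k < r"
      have 1: "u div r * r + k < r^2" using mult_add_less[OF r(1) k] by (simp add: power2_eq_square)
      have "idx2 r (u div r * r + k) (u mod r) = u * r + k"
        using k by (simp add: idx2_def)
      then have "src2 r (u * r + k) = (u div r * r + k) * r + u mod r"
        using i2[OF 1 r(2)] by simp
      with 1 r show "u div r * r + k < r^2 \<and> u mod r < r \<and> src2 r (u * r + k) = (u div r * r + k) * r + u mod r" by simp
    qed
    also have "\<dots> = filter (\<lambda>e. (\<rho> (fst e) - 1) div r^2 = u) (concat (map (\<lambda>k. blk (r^3) es k) [0..<r]))"
      by (auto simp: sel2_def filter_concat comp_def intro!: arg_cong[where f=concat] map_cong)
    also have "concat (map (\<lambda>k. blk (r^3) es k) [0..<r]) = es"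
      by (rule concat_blk) (simp add: len r4(2))
    finally show ?thesis
      using sort_key_bucket[OF df imf[unfolded r4(1)] u] by (simp only: r4(1)[symmetric])
  qed
  have p3: "cleanup_phase r q2 E D \<rho> (srv', tr') = map_pmf (\<lambda>ys3. (Some (), srv'(ArrO := ys3),
      tr' @ clean_trans r q2 (spread q2 (r^3) (src2 r) ys) ys3)) (mapM_pmf E (map (real_slot ?n) (arrange ?n \<rho> es)))"
    if g2 and ys: "map D ys = map Some (dist_msgs ?n L q2 r (sel2 r \<rho> es))"
      and srv': "srv' ArrT2 = spread q2 (r^3) (src2 r) ys" "length (srv' ArrO) = r^4" for srv' tr' ys
    by (rule cleanup_loop[OF srv' e3[OF \<open>g2\<close> _ ys] arr])
  let ?A = "\<lambda>ys. spread q1 (r^3) (src1 r) ys" and ?B = "\<lambda>ys. spread q2 (r^3) (src2 r) ys"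
  let ?m1 = "dist_msgs ?n L q1 r (sel1 r \<rho> es)" and ?m2 = "dist_msgs ?n L q2 r (sel2 r \<rho> es)"
    and ?m3 = "map (real_slot ?n) (arrange ?n \<rho> es)"
  {
    assume "pass_good r q1 q2 \<rho> es"
    then have g: g1 g2 using good by auto
    define f where "f ys = srv(ArrT1 := ?A (take (r^3 * q1) ys), ArrT2 := ?B (take (r^3 * q2) (drop (r^3 * q1) ys)),
       ArrO := drop (r^3 * q1 + r^3 * q2) ys)" for ys
    have "optim_shuffle_pass r q1 q2 E D L \<rho> (srv, tr) = bind_pmf (mapM_pmf E ?m1) (\<lambda>y1.
        bind_pmf (mapM_pmf E ?m2) (\<lambda>y2. map_pmf (\<lambda>y3. (Some (), srv(ArrT1 := ?A y1, ArrT2 := ?B y2, ArrO := y3),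
            ((tr @ dist_trans r (r^2) q1 (idx1 r) ArrI ArrT1 (srv ArrI) y1) @ dist_trans r (r * q1) q2 (idx2 r) ArrT1 ArrT2 (?A y1) y2)
               @ clean_trans r q2 (?B y2) y3)) (mapM_pmf E ?m3)))"
      unfolding optim_shuffle_pass_def
    proof (subst bind_client_map[where m="distribution_phase1 r q1 E D L \<rho>" and s="(srv, tr)", OF p1[OF g(1)]], rule bind_pmf_cong[OF refl])
      fix y1 assume y1: "y1 \<in> set_pmf (mapM_pmf E ?m1)"
      let ?s = "(srv(ArrT1 := ?A y1), tr @ dist_trans r (r^2) q1 (idx1 r) ArrI ArrT1 (srv ArrI) y1)"
      show "bind_client (distribution_phase2 r q1 q2 E D L \<rho>) (\<lambda>_. cleanup_phase r q2 E D \<rho>) ?s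
        = bind_pmf (mapM_pmf E ?m2) (\<lambda>y2. map_pmf (\<lambda>y3. (Some (), srv(ArrT1 := ?A y1, ArrT2 := ?B y2, ArrO := y3),
            ((tr @ dist_trans r (r^2) q1 (idx1 r) ArrI ArrT1 (srv ArrI) y1) @ dist_trans r (r * q1) q2 (idx2 r) ArrT1 ArrT2 (?A y1) y2)
               @ clean_trans r q2 (?B y2) y3)) (mapM_pmf E ?m3))"
      proof (subst bind_client_map[where m="distribution_phase2 r q1 q2 E D L \<rho>" and s="?s", OF p2[OF g mapM_pmf_Dec[OF DE y1]]])
        show "bind_pmf (mapM_pmf E ?m2) (\<lambda>y2. cleanup_phase r q2 E D \<rho> (srv(ArrT1 := ?A y1, ArrT2 := ?B y2),
            (tr @ dist_trans r (r^2) q1 (idx1 r) ArrI ArrT1 (srv ArrI) y1) @ dist_trans r (r * q1) q2 (idx2 r) ArrT1 ArrT2 (?A y1) y2))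
          = bind_pmf (mapM_pmf E ?m2) (\<lambda>y2. map_pmf (\<lambda>y3. (Some (), srv(ArrT1 := ?A y1, ArrT2 := ?B y2, ArrO := y3),
            ((tr @ dist_trans r (r^2) q1 (idx1 r) ArrI ArrT1 (srv ArrI) y1) @ dist_trans r (r * q1) q2 (idx2 r) ArrT1 ArrT2 (?A y1) y2)
               @ clean_trans r q2 (?B y2) y3)) (mapM_pmf E ?m3))"
          by (rule bind_pmf_cong[OF refl], rule p3[OF g(2) mapM_pmf_Dec[OF DE]]) (use O in simp_all)
      qed (use T2 in simp_all)
    qed
    also have "\<dots> = map_pmf (\<lambda>ys. (Some (), f ys, tr @ pass_trans r q1 q2 (srv ArrI) ys)) (mapM_pmf E (pass_msgs r q1 q2 L \<rho> es))"
      unfolding pass_msgs_def mapM_pmf_append map_bind_pmf pmf.map_comp comp_def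
    proof (intro bind_pmf_cong refl map_pmf_cong)
      fix y1 y2 y3 assume "y1 \<in> set_pmf (mapM_pmf E ?m1)" "y2 \<in> set_pmf (mapM_pmf E ?m2)"
      then have "length y1 = r^3 * q1" "length y2 = r^3 * q2" by (auto dest!: mapM_pmf_length simp: length_dist_msgs)
      then show "(Some (), srv(ArrT1 := ?A y1, ArrT2 := ?B y2, ArrO := y3),
            ((tr @ dist_trans r (r^2) q1 (idx1 r) ArrI ArrT1 (srv ArrI) y1) @ dist_trans r (r * q1) q2 (idx2 r) ArrT1 ArrT2 (?A y1) y2)
               @ clean_trans r q2 (?B y2) y3)
         = (Some (), f (y1 @ y2 @ y3), tr @ pass_trans r q1 q2 (srv ArrI) (y1 @ y2 @ y3))"
        by (simp add: f_def pass_trans_def)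
    qed
    finally have "optim_shuffle_pass r q1 q2 E D L \<rho> (srv, tr) =
        map_pmf (\<lambda>ys. (Some (), f ys, tr @ pass_trans r q1 q2 (srv ArrI) ys)) (mapM_pmf E (pass_msgs r q1 q2 L \<rho> es))" .
    moreover have "length (f ys ArrT1) = r^3 * q1 \<and> length (f ys ArrT2) = r^3 * q2"
      if "length ys = r^3 * q1 + r^3 * q2 + r^4" for ys
      using that by (simp add: f_def T1c length_spread b2)
    ultimately show "\<exists>f. (\<forall>ys. f ys ArrI = srv ArrI \<and> f ys ArrO = drop (r^3 * q1 + r^3 * q2) ys \<and>
          (length ys = r^3 * q1 + r^3 * q2 + r^4 \<longrightarrow> length (f ys ArrT1) = r^3 * q1 \<and> length (f ys ArrT2) = r^3 * q2)) \<and>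
      optim_shuffle_pass r q1 q2 E D L \<rho> (srv, tr) =
        map_pmf (\<lambda>ys. (Some (), f ys, tr @ pass_trans r q1 q2 (srv ArrI) ys)) (mapM_pmf E (pass_msgs r q1 q2 L \<rho> es))"
      by (intro exI[of _ f]) (simp add: f_def)
  }
  {
    assume ng: "\<not> pass_good r q1 q2 \<rho> es" and z: "z \<in> set_pmf (optim_shuffle_pass r q1 q2 E D L \<rho> (srv, tr))"
    show "fst z = None"
    proof (cases g1)
      case False
      show ?thesis
        by (rule bind_client_None[OF n1[OF False] z[unfolded optim_shuffle_pass_def]])
    next
      case True
      then have "\<not> g2" using ng good by simp
      from z obtain y1 where y1: "y1 \<in> set_pmf (mapM_pmf E ?m1)"
        and z: "z \<in> set_pmf (bind_client (distribution_phase2 r q1 q2 E D L \<rho>) (\<lambda>_. cleanup_phase r q2 E D \<rho>)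
          (srv(ArrT1 := ?A y1), tr @ dist_trans r (r^2) q1 (idx1 r) ArrI ArrT1 (srv ArrI) y1))"
        unfolding optim_shuffle_pass_def bind_client_map[where m="distribution_phase1 r q1 E D L \<rho>" and s="(srv, tr)", OF p1[OF True]] by auto
      show ?thesis
        by (rule bind_client_None[OF n2[OF True \<open>\<not> g2\<close> mapM_pmf_Dec[OF DE y1]] z]) (use T2 in simp_all)
    qed
  }
qed

subsection \<open>The whole shuffle\<close>

definition plan :: "nat \<Rightarrow> nat \<Rightarrow> nat \<Rightarrow> nat \<Rightarrow> (nat \<Rightarrow> nat) \<Rightarrow> (nat \<Rightarrow> nat) \<Rightarrow> element list \<Rightarrow> bits list" where
  "plan r q1 q2 L \<pi>1 \<pi> es = pass_msgs r q1 q2 L \<pi>1 es @ pass_msgs r q1 q2 L \<pi> (arrange (r^4) \<pi>1 es)"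

text \<open>\<open>ys\<close> are the encryptions made in both passes, in order. No key, value or
  permutation occurs: the output array and everything that the server sees are determined by
  ciphertexts, which is what makes the shuffle oblivious.\<close>

definition fmt :: "nat \<Rightarrow> nat \<Rightarrow> nat \<Rightarrow> bits list \<Rightarrow> bits list \<Rightarrow> bits list option \<times> transcript" where
  "fmt r q1 q2 cs ys = (Some (drop (r^3 * q1 + r^3 * q2) (drop (r^3 * q1 + r^3 * q2 + r^4) ys)),
     pass_trans r q1 q2 cs (take (r^3 * q1 + r^3 * q2 + r^4) ys)
   @ pass_trans r q1 q2 (drop (r^3 * q1 + r^3 * q2) (take (r^3 * q1 + r^3 * q2 + r^4) ys))
       (drop (r^3 * q1 + r^3 * q2 + r^4) ys))"

definition run_good :: "nat \<Rightarrow> nat \<Rightarrow> nat \<Rightarrow> (nat \<Rightarrow> nat) \<Rightarrow> (nat \<Rightarrow> nat) \<Rightarrow> element list \<Rightarrow> bool" where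
  "run_good r q1 q2 \<pi>1 \<pi> es \<longleftrightarrow> pass_good r q1 q2 \<pi>1 es \<and> pass_good r q1 q2 \<pi> (arrange (r^4) \<pi>1 es)"

definition keyed :: "nat \<Rightarrow> element list \<Rightarrow> bool" where
  "keyed n es \<longleftrightarrow> length es = n \<and> distinct (map fst es) \<and> fst ` set es = {1..n}"

lemma keyed_perm:
  assumes "keyed n es" and "\<rho> permutes {1..n}"
  shows "distinct (map (\<lambda>e. \<rho> (fst e)) es)" and "(\<lambda>e. \<rho> (fst e)) ` set es = {1..n}"
proof -
  show "distinct (map (\<lambda>e. \<rho> (fst e)) es)"
    using assms permutes_inj_on[OF assms(2), of "fst ` set es"]
    by (simp add: keyed_def distinct_map comp_inj_on[unfolded comp_def])
  show "(\<lambda>e. \<rho> (fst e)) ` set es = {1..n}"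
    using assms permutes_image[OF assms(2)] by (simp add: keyed_def image_image[symmetric])
qed

lemma arrange_perm:
  assumes "keyed n es" and "\<rho> permutes {1..n}"
  shows "map (\<lambda>e. \<rho> (fst e)) (arrange n \<rho> es) = [1..<Suc n]" and "set (arrange n \<rho> es) = set es"
  using map_arrange[OF keyed_perm[OF assms]] set_arrange[of \<rho> es n] keyed_perm(2)[OF assms] by auto

lemma keyed_arrange:
  assumes "keyed n es" and "\<rho> permutes {1..n}"
  shows "keyed n (arrange n \<rho> es)"
proof -
  have "length (arrange n \<rho> es) = n"
    using arg_cong[OF arrange_perm(1)[OF assms], of length] by simp
  moreover have "distinct (map \<rho> (map fst (arrange n \<rho> es)))"
    using arrange_perm(1)[OF assms] distinct_upt[of 1 "Suc n"] by (simp add: comp_def del: upt_Suc)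
  ultimately show ?thesis
    using arrange_perm(2)[OF assms] assms(1) unfolding keyed_def by (simp add: distinct_map)
qed

lemma length_pass_msgs:
  "keyed (r^4) es \<Longrightarrow> \<rho> permutes {1..r^4} \<Longrightarrow> length (pass_msgs r q1 q2 L \<rho> es) = r^3 * q1 + r^3 * q2 + r^4"
  using keyed_arrange[of "r^4" es \<rho>] by (simp add: pass_msgs_def length_dist_msgs keyed_def)

lemma drop_pass_msgs:
  "drop (r^3 * q1 + r^3 * q2) (pass_msgs r q1 q2 L \<rho> es) = map (real_slot (r^4)) (arrange (r^4) \<rho> es)"
  by (simp add: pass_msgs_def length_dist_msgs)

text \<open>\<open>X\<close> isolates the choice of the first permutation. Given this choice,
  failure does not depend on the randomness of encryption but is decided by \<open>run_good\<close>,
  so it can be charged to the permutation alone.\<close>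

lemma shuffle_plan:
  fixes p1 p2 :: real and Enc :: encryption and Dec :: decryption and r L :: nat
  assumes DE: "\<And>m c. c \<in> set_pmf (Enc key m) \<Longrightarrow> Dec key c = Some m"
    and es: "keyed (r^4) es" and \<pi>: "\<pi> permutes {1..r^4}"
    and cs: "map (Dec key) cs = map (Some \<circ> real_slot (r^4)) es"
  defines "q1 \<equiv> batch_size p1 r" and "q2 \<equiv> batch_size p2 r"
  obtains X where "optim_shuffle Enc Dec p1 p2 r L key \<pi> cs = bind_pmf (pmf_of_set {\<sigma>. \<sigma> permutes {1..r^4}}) X"
    and "\<And>\<pi>1. \<pi>1 permutes {1..r^4} \<Longrightarrow> run_good r q1 q2 \<pi>1 \<pi> es \<Longrightarrow>
           X \<pi>1 = map_pmf (fmt r q1 q2 cs) (mapM_pmf (Enc key) (plan r q1 q2 L \<pi>1 \<pi> es))"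
    and "\<And>\<pi>1 z. \<pi>1 permutes {1..r^4} \<Longrightarrow> \<not> run_good r q1 q2 \<pi>1 \<pi> es \<Longrightarrow> z \<in> set_pmf (X \<pi>1) \<Longrightarrow> fst z = None"
proof -
  let ?E = "Enc key" and ?D = "Dec key" and ?N = "r^3 * q1 + r^3 * q2"
  let ?pass = "\<lambda>\<rho>. optim_shuffle_pass r q1 q2 ?E ?D L \<rho>"
  let ?s = "(init_server r q1 q2 cs, [])"
  define Y where "Y \<pi>1 = bind_client (?pass \<pi>1) (\<lambda>_. bind_client (assign_array ArrI ArrO) (\<lambda>_. ?pass \<pi>)) ?s" for \<pi>1
  define X where "X \<pi>1 = map_pmf (\<lambda>(res, srv, tr). (map_option (\<lambda>_. srv ArrO) res, tr)) (Y \<pi>1)" for \<pi>1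
  note es' = es[unfolded keyed_def]
  have eq: "optim_shuffle Enc Dec p1 p2 r L key \<pi> cs = bind_pmf (pmf_of_set {\<sigma>. \<sigma> permutes {1..r^4}}) X"
    unfolding optim_shuffle_def optim_shuffle_client_def q1_def[symmetric] q2_def[symmetric] X_def Y_def
    by (subst bind_client_def) (simp add: sample_def bind_map_pmf map_bind_pmf)
  have lcs: "length cs = r^4" using arg_cong[OF cs, of length] es' by simp
  have pass1: "pass_good r q1 q2 \<pi>1 es \<Longrightarrow> \<exists>f. (\<forall>ys. f ys ArrI = cs \<and> f ys ArrO = drop ?N ys \<and>
          (length ys = ?N + r^4 \<longrightarrow> length (f ys ArrT1) = r^3 * q1 \<and> length (f ys ArrT2) = r^3 * q2)) \<and>
      ?pass \<pi>1 ?s = map_pmf (\<lambda>ys. (Some (), f ys, [] @ pass_trans r q1 q2 cs ys)) (mapM_pmf ?E (pass_msgs r q1 q2 L \<pi>1 es))"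
    and pass1n: "\<not> pass_good r q1 q2 \<pi>1 es \<Longrightarrow> z \<in> set_pmf (?pass \<pi>1 ?s) \<Longrightarrow> fst z = None"
    if "\<pi>1 permutes {1..r^4}" for \<pi>1 z
    using pass_client(1)[where E="?E" and D="?D" and srv="init_server r q1 q2 cs" and tr="[]" and L=L
        and ?q1.0=q1 and ?q2.0=q2 and r=r and es=es and \<rho>=\<pi>1, OF DE]
      pass_client(2)[where E="?E" and D="?D" and srv="init_server r q1 q2 cs" and tr="[]" and L=L
        and ?q1.0=q1 and ?q2.0=q2 and r=r and es=es and \<rho>=\<pi>1 and z=z, OF DE] es' that cs
    by (simp_all add: init_server_def)
  show ?thesis
  proof (rule that[OF eq])
    fix \<pi>1 assume p1: "\<pi>1 permutes {1..r^4}"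
    let ?es1 = "arrange (r^4) \<pi>1 es"
    note es1 = keyed_arrange[OF es p1, unfolded keyed_def]
    have pass2: "pass_good r q1 q2 \<pi> ?es1 \<Longrightarrow> \<exists>f. (\<forall>ys. f ys ArrO = drop ?N ys) \<and>
      ?pass \<pi> (srv(ArrI := srv ArrO), tr) = map_pmf (\<lambda>ys. (Some (), f ys, tr @ pass_trans r q1 q2 (srv ArrO) ys)) (mapM_pmf ?E (pass_msgs r q1 q2 L \<pi> ?es1))"
      and pass2n: "\<not> pass_good r q1 q2 \<pi> ?es1 \<Longrightarrow> z \<in> set_pmf (?pass \<pi> (srv(ArrI := srv ArrO), tr)) \<Longrightarrow> fst z = None"
      if "srv ArrO = drop ?N y" "y \<in> set_pmf (mapM_pmf ?E (pass_msgs r q1 q2 L \<pi>1 es))"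
        "length (srv ArrT1) = r^3 * q1" "length (srv ArrT2) = r^3 * q2" for srv y tr z
    proof -
      have "map ?D y = map Some (pass_msgs r q1 q2 L \<pi>1 es)"
        by (rule mapM_pmf_Dec[OF _ that(2)]) (rule DE)
      then have "drop ?N (map ?D y) = map Some (drop ?N (pass_msgs r q1 q2 L \<pi>1 es))" by (simp only: drop_map)
      then have "map ?D (srv ArrO) = map Some (map (real_slot (r^4)) ?es1)"
        unfolding that(1) drop_map drop_pass_msgs .
      then have D: "map ?D (srv ArrO) = map (Some \<circ> real_slot (r^4)) ?es1" by simp
      have "length (srv ArrO) = r^4" using arg_cong[OF D, of length] es1 by simp
      note P = pass_client(1)[where E="?E" and D="?D" and srv="srv(ArrI := srv ArrO)" and tr=tr and L=L
        and ?q1.0=q1 and ?q2.0=q2 and r=r and es="?es1" and \<rho>=\<pi>, OF DE]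
        pass_client(2)[where E="?E" and D="?D" and srv="srv(ArrI := srv ArrO)" and tr=tr and L=L
        and ?q1.0=q1 and ?q2.0=q2 and r=r and es="?es1" and \<rho>=\<pi> and z=z, OF DE] es1 \<pi> D that(3,4) this
      show "pass_good r q1 q2 \<pi> ?es1 \<Longrightarrow> \<exists>f. (\<forall>ys. f ys ArrO = drop ?N ys) \<and>
        ?pass \<pi> (srv(ArrI := srv ArrO), tr) = map_pmf (\<lambda>ys. (Some (), f ys, tr @ pass_trans r q1 q2 (srv ArrO) ys)) (mapM_pmf ?E (pass_msgs r q1 q2 L \<pi> ?es1))"
        using P by auto
      show "\<not> pass_good r q1 q2 \<pi> ?es1 \<Longrightarrow> z \<in> set_pmf (?pass \<pi> (srv(ArrI := srv ArrO), tr)) \<Longrightarrow> fst z = None"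
        using P by auto
    qed
    have assign: "bind_client (assign_array ArrI ArrO) (\<lambda>_. ?pass \<pi>) (srv, tr) = ?pass \<pi> (srv(ArrI := srv ArrO), tr)" for srv tr
      by (simp add: bind_client_def assign_array_def bind_return_pmf)
    have lm: "length y = ?N + r^4" if "y \<in> set_pmf (mapM_pmf ?E (pass_msgs r q1 q2 L \<pi>1 es))" for y
      using mapM_pmf_length[OF that] length_pass_msgs[OF es p1] by simp
    show "X \<pi>1 = map_pmf (fmt r q1 q2 cs) (mapM_pmf ?E (plan r q1 q2 L \<pi>1 \<pi> es))" if "run_good r q1 q2 \<pi>1 \<pi> es"
    proof -
      have g: "pass_good r q1 q2 \<pi>1 es" "pass_good r q1 q2 \<pi> ?es1" using that unfolding run_good_def by auto
      from pass1[OF p1 g(1)] obtain f where f: "\<And>ys. f ys ArrO = drop ?N ys"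
        "\<And>ys. length ys = ?N + r^4 \<Longrightarrow> length (f ys ArrT1) = r^3 * q1 \<and> length (f ys ArrT2) = r^3 * q2"
        and P: "?pass \<pi>1 ?s = map_pmf (\<lambda>ys. (Some (), f ys, [] @ pass_trans r q1 q2 cs ys)) (mapM_pmf ?E (pass_msgs r q1 q2 L \<pi>1 es))"
        by blast
      have "X \<pi>1 = bind_pmf (mapM_pmf ?E (pass_msgs r q1 q2 L \<pi>1 es)) (\<lambda>ya.
          map_pmf (\<lambda>(res, srv, tr). (map_option (\<lambda>_. srv ArrO) res, tr)) (?pass \<pi> ((f ya)(ArrI := f ya ArrO), [] @ pass_trans r q1 q2 cs ya)))"
        unfolding X_def Y_def bind_client_map[where m="?pass \<pi>1" and s="?s" and h="\<lambda>ys. (f ys, [] @ pass_trans r q1 q2 cs ys)", OF P] map_bind_pmf assign ..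
      also have "\<dots> = bind_pmf (mapM_pmf ?E (pass_msgs r q1 q2 L \<pi>1 es)) (\<lambda>ya.
          map_pmf (\<lambda>yb. fmt r q1 q2 cs (ya @ yb)) (mapM_pmf ?E (pass_msgs r q1 q2 L \<pi> ?es1)))"
      proof (rule bind_pmf_cong[OF refl])
        fix ya assume ya: "ya \<in> set_pmf (mapM_pmf ?E (pass_msgs r q1 q2 L \<pi>1 es))"
        from pass2[of "f ya" ya "[] @ pass_trans r q1 q2 cs ya", OF f(1) ya _ _ g(2)] f(2)[OF lm[OF ya]] obtain f' where f': "\<And>ys. f' ys ArrO = drop ?N ys"
          and P': "?pass \<pi> ((f ya)(ArrI := f ya ArrO), [] @ pass_trans r q1 q2 cs ya) = map_pmf (\<lambda>ys. (Some (), f' ys,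
            ([] @ pass_trans r q1 q2 cs ya) @ pass_trans r q1 q2 (f ya ArrO) ys)) (mapM_pmf ?E (pass_msgs r q1 q2 L \<pi> ?es1))"
          by blast
        show "map_pmf (\<lambda>(res, srv, tr). (map_option (\<lambda>_. srv ArrO) res, tr)) (?pass \<pi> ((f ya)(ArrI := f ya ArrO), [] @ pass_trans r q1 q2 cs ya))
          = map_pmf (\<lambda>yb. fmt r q1 q2 cs (ya @ yb)) (mapM_pmf ?E (pass_msgs r q1 q2 L \<pi> ?es1))"
          unfolding P' by (simp add: pmf.map_comp comp_def fmt_def f f' lm[OF ya])
      qed
      also have "\<dots> = map_pmf (fmt r q1 q2 cs) (mapM_pmf ?E (plan r q1 q2 L \<pi>1 \<pi> es))"
        by (simp add: plan_def mapM_pmf_append map_bind_pmf pmf.map_comp comp_def)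
      finally show ?thesis .
    qed
    show "fst z = None" if ng: "\<not> run_good r q1 q2 \<pi>1 \<pi> es" and z: "z \<in> set_pmf (X \<pi>1)" for z
    proof -
      from z obtain z' where z': "z' \<in> set_pmf (Y \<pi>1)" and "z = (\<lambda>(res, srv, tr). (map_option (\<lambda>_. srv ArrO) res, tr)) z'"
        unfolding X_def by auto
      moreover have "fst z' = None"
      proof (cases "pass_good r q1 q2 \<pi>1 es")
        case False
        show ?thesis by (rule bind_client_None[OF pass1n[OF p1 False] z'[unfolded Y_def]])
      next
        case True
        then have g: "\<not> pass_good r q1 q2 \<pi> ?es1" using ng unfolding run_good_def by auto
        from pass1[OF p1 True] obtain f where f: "\<And>ys. f ys ArrO = drop ?N ys"
          "\<And>ys. length ys = ?N + r^4 \<Longrightarrow> length (f ys ArrT1) = r^3 * q1 \<and> length (f ys ArrT2) = r^3 * q2"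
          and P: "?pass \<pi>1 ?s = map_pmf (\<lambda>ys. (Some (), f ys, [] @ pass_trans r q1 q2 cs ys)) (mapM_pmf ?E (pass_msgs r q1 q2 L \<pi>1 es))"
          by blast
        from z' obtain ya where ya: "ya \<in> set_pmf (mapM_pmf ?E (pass_msgs r q1 q2 L \<pi>1 es))"
          and "z' \<in> set_pmf (?pass \<pi> ((f ya)(ArrI := f ya ArrO), [] @ pass_trans r q1 q2 cs ya))"
          unfolding Y_def bind_client_map[where m="?pass \<pi>1" and s="?s" and h="\<lambda>ys. (f ys, [] @ pass_trans r q1 q2 cs ys)", OF P] assign by auto
        from pass2n[of "f ya" ya z' "[] @ pass_trans r q1 q2 cs ya", OF f(1) ya _ _ g this(2)] f(2)[OF lm[OF ya]] show ?thesis by blast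
      qed
      ultimately show ?thesis by (cases z') auto
    qed
  qed
qed

section \<open>Tail bounds for uniform permutations\<close>

section \<open>Overflowing batches\<close>

lemma sum_Pow_power:
  fixes z :: real
  assumes "finite S"
  shows "(\<Sum>J\<in>Pow S. z ^ card J) = (1 + z) ^ card S"
proof -
  have "(1 + z) ^ card S = (\<Prod>x\<in>S. z + 1)" by (simp add: add.commute)
  also have "\<dots> = (\<Sum>J\<in>Pow S. (\<Prod>x\<in>J. z) * (\<Prod>x\<in>S - J. 1))" by (rule prod_add[OF assms])
  finally show ?thesis by simp
qed

text \<open>Given that \<open>J\<close> is mapped into \<open>T\<close>, an element outside \<open>J\<close> is no more likely than any other
  element to be mapped into \<open>T\<close>.\<close>

lemma card_permutes_into:
  assumes A: "finite A" and "J \<subseteq> A" and T: "T \<subseteq> A"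
  shows "real (card {\<pi>. \<pi> permutes A \<and> \<pi> ` J \<subseteq> T}) \<le> fact (card A) * (real (card T) / real (card A)) ^ card J"
proof -
  have "finite J" using assms by (simp add: finite_subset)
  then show ?thesis using \<open>J \<subseteq> A\<close>
  proof (induction J)
    case empty
    then show ?case using card_permutations[OF refl A] by simp
  next
    case (insert a J)
    define P where "P = {\<pi>. \<pi> permutes A \<and> \<pi> ` J \<subseteq> T}"
    define N where "N x = card {\<pi>\<in>P. \<pi> x \<in> T}" for x
    have finP: "finite P" unfolding P_def by (rule finite_subset[OF _ finite_permutations[OF A]]) auto
    have le: "N a \<le> N x" if "x \<in> A" for x
    proof (cases "x \<in> J")
      case True
      then have "{\<pi>\<in>P. \<pi> x \<in> T} = P" by (auto simp: P_def)
      then show ?thesis unfolding N_def by (auto intro: card_mono[OF finP])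
    next
      case False
      \<comment> \<open>Composition with this transposition fixes the behaviour on \<open>J\<close>
        and moves the image of \<open>a\<close> to \<open>x\<close>, so it maps the permutations
        counted by \<open>N a\<close> injectively into those counted by \<open>N x\<close>.\<close>
      let ?t = "Transposition.transpose a x"
      have t: "?t permutes A" using insert.prems that by (intro permutes_swap_id) auto
      have tJ: "?t y = y" if "y \<in> J" for y
        using that False insert.hyps(2) by (auto simp: Transposition.transpose_def)
      show ?thesis unfolding N_def
      proof (rule card_inj_on_le[where f="\<lambda>\<pi>. \<pi> \<circ> ?t"])
        show "inj_on (\<lambda>\<pi>. \<pi> \<circ> ?t) {\<pi> \<in> P. \<pi> a \<in> T}"
          by (rule inj_onI) (metis comp_assoc comp_id transpose_comp_involutory)
        show "(\<lambda>\<pi>. \<pi> \<circ> ?t) ` {\<pi> \<in> P. \<pi> a \<in> T} \<subseteq> {\<pi> \<in> P. \<pi> x \<in> T}"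
          using t by (auto simp: P_def tJ permutes_compose)
        show "finite {\<pi> \<in> P. \<pi> x \<in> T}" using finP by auto
      qed
    qed
    \<comment> \<open>\<open>N a\<close> is minimal, hence at most the average. The average is found
      by double counting, as every permutation sends exactly \<open>card T\<close> elements into
      \<open>T\<close>.\<close>
    have "card A * N a \<le> (\<Sum>x\<in>A. N x)"
      using sum_mono[of A "\<lambda>_. N a" N] le by simp
    also have "\<dots> = (\<Sum>x\<in>A. \<Sum>\<pi>\<in>P. if \<pi> x \<in> T then 1 else 0)"
      unfolding N_def using finP by (simp add: sum.If_cases Int_def)
    also have "\<dots> = (\<Sum>\<pi>\<in>P. \<Sum>x\<in>A. if \<pi> x \<in> T then 1 else 0)" by (rule sum.swap)
    also have "\<dots> = (\<Sum>\<pi>\<in>P. card T)"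
    proof (rule sum.cong[OF refl])
      fix \<pi> assume "\<pi> \<in> P"
      then have \<pi>: "\<pi> permutes A" by (simp add: P_def)
      have "{x\<in>A. \<pi> x \<in> T} = inv \<pi> ` T"
        using \<pi> T by (force simp: image_iff permutes_inverses permutes_in_image[OF permutes_inv[OF \<pi>]])
      moreover have "card (inv \<pi> ` T) = card T"
        by (rule card_image) (rule permutes_inj_on[OF permutes_inv[OF \<pi>]])
      ultimately show "(\<Sum>x\<in>A. if \<pi> x \<in> T then 1 else 0) = card T"
        using A by (simp add: sum.If_cases Int_def)
    qed
    finally have *: "card A * N a \<le> card P * card T" by simp
    have nz: "card A > 0" using insert.prems A by (auto simp: card_gt_0_iff)
    have "{\<pi>. \<pi> permutes A \<and> \<pi> ` insert a J \<subseteq> T} = {\<pi>\<in>P. \<pi> a \<in> T}" by (auto simp: P_def)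
    then have "real (card {\<pi>. \<pi> permutes A \<and> \<pi> ` insert a J \<subseteq> T}) = real (N a)" by (simp add: N_def)
    also have "\<dots> \<le> real (card P) * (real (card T) / real (card A))"
      using nz of_nat_mono[OF *, where 'a=real] by (simp add: field_simps)
    also have "\<dots> \<le> (fact (card A) * (real (card T) / real (card A)) ^ card J) * (real (card T) / real (card A))"
      using insert unfolding P_def by (intro mult_right_mono) auto
    finally show ?case
      unfolding card_insert_disjoint[OF insert.hyps] by (simp only: power_Suc mult_ac)
  qed
qed

text \<open>A Chernoff bound with base \<open>p\<close>, where \<open>p ^ card (B \<pi>)\<close> is
  expanded over the subsets of \<open>S\<close> that are mapped into \<open>T\<close>. The mean is
  at most \<open>r\<close>; among all bases \<open>s\<close>, \<open>p\<close> minimises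
  \<open>exp ((s - 1) * r) / s ^ (p * r)\<close>, and the resulting exponent is the rate function of
  the Poisson distribution.\<close>

lemma permutes_overflow:
  fixes p :: real and q r :: nat
  assumes A: "finite A" and S: "S \<subseteq> A" and T: "T \<subseteq> A" and p: "p > 1" and q: "p * real r \<le> real q"
    and ST: "card S * card T \<le> card A * r"
  shows "measure_pmf.prob (pmf_of_set {\<pi>. \<pi> permutes A}) {\<pi>. card {x\<in>S. \<pi> x \<in> T} > q}
    \<le> exp (- (p * ln p - p + 1) * real r)"
proof -
  let ?P = "{\<pi>. \<pi> permutes A}" and ?u = "real (card T) / real (card A)"
  define B where "B \<pi> = {x\<in>S. \<pi> x \<in> T}" for \<pi> :: "'a \<Rightarrow> 'a"
  have finP: "finite ?P" by (rule finite_permutations[OF A])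
  have cP: "card ?P = fact (card A)" by (rule card_permutations[OF refl A])
  have finS: "finite S" using S A by (rule finite_subset)
  have neP: "?P \<noteq> {}" using permutes_id by blast
  have u: "(p - 1) * ?u * real (card S) \<le> (p - 1) * real r"
  proof -
    have "?u * real (card S) \<le> real r"
    proof (cases "card A = 0")
      case False
      then show ?thesis using of_nat_mono[OF ST, where 'a=real] by (simp add: field_simps)
    qed simp
    then have "(p - 1) * (?u * real (card S)) \<le> (p - 1) * real r" using p by (intro mult_left_mono) auto
    then show ?thesis by (simp only: mult.assoc)
  qed
  have "(\<Sum>\<pi>\<in>?P. p ^ card (B \<pi>)) = (\<Sum>\<pi>\<in>?P. \<Sum>J\<in>Pow S. if \<pi> ` J \<subseteq> T then (p - 1) ^ card J else 0)"
  proof (rule sum.cong[OF refl])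
    fix \<pi>
    have "p ^ card (B \<pi>) = (\<Sum>J\<in>Pow (B \<pi>). (p - 1) ^ card J)"
      using sum_Pow_power[of "B \<pi>" "p - 1"] finS by (simp add: B_def)
    also have "Pow (B \<pi>) = {J \<in> Pow S. \<pi> ` J \<subseteq> T}" by (auto simp: B_def)
    finally show "p ^ card (B \<pi>) = (\<Sum>J\<in>Pow S. if \<pi> ` J \<subseteq> T then (p - 1) ^ card J else 0)"
      using finS by (simp add: sum.If_cases Int_def)
  qed
  also have "\<dots> = (\<Sum>J\<in>Pow S. \<Sum>\<pi>\<in>?P. if \<pi> ` J \<subseteq> T then (p - 1) ^ card J else 0)" by (rule sum.swap)
  also have "\<dots> = (\<Sum>J\<in>Pow S. real (card {\<pi>. \<pi> permutes A \<and> \<pi> ` J \<subseteq> T}) * (p - 1) ^ card J)"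
    using finP by (simp add: sum.If_cases Int_def)
  also have "\<dots> \<le> (\<Sum>J\<in>Pow S. fact (card A) * ((p - 1) * ?u) ^ card J)"
  proof (rule sum_mono)
    fix J assume "J \<in> Pow S"
    then have "real (card {\<pi>. \<pi> permutes A \<and> \<pi> ` J \<subseteq> T}) * (p - 1) ^ card J
      \<le> (fact (card A) * ?u ^ card J) * (p - 1) ^ card J"
      using S p by (intro mult_right_mono card_permutes_into A T) auto
    then show "real (card {\<pi>. \<pi> permutes A \<and> \<pi> ` J \<subseteq> T}) * (p - 1) ^ card J \<le> fact (card A) * ((p - 1) * ?u) ^ card J"
      by (simp only: power_mult_distrib mult_ac)
  qed
  also have "\<dots> = fact (card A) * (1 + (p - 1) * ?u) ^ card S"
    using sum_Pow_power[OF finS, of "(p - 1) * ?u"] by (simp add: sum_distrib_left[symmetric])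
  also have "\<dots> \<le> fact (card A) * exp ((p - 1) * ?u) ^ card S"
    using p by (intro mult_left_mono power_mono exp_ge_add_one_self) auto
  also have "\<dots> \<le> fact (card A) * exp ((p - 1) * real r)"
    using u by (intro mult_left_mono) (simp_all add: exp_of_nat2_mult[symmetric])
  finally have mgf: "(\<Sum>\<pi>\<in>?P. p ^ card (B \<pi>)) \<le> fact (card A) * exp ((p - 1) * real r)" .
  have "real (card {\<pi>\<in>?P. card (B \<pi>) > q}) * exp (p * ln p * real r) \<le> (\<Sum>\<pi>\<in>{\<pi>\<in>?P. card (B \<pi>) > q}. p ^ card (B \<pi>))"
  proof -
    have "exp (p * ln p * real r) \<le> p ^ m" if "m > q" for m
    proof -
      have "p * ln p * real r \<le> real m * ln p"
        using mult_right_mono[of "p * real r" "real m" "ln p"] p q that by (simp add: mult_ac)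
      then have "exp (p * ln p * real r) \<le> exp (real m * ln p)" by simp
      then show ?thesis using p by (simp add: exp_of_nat_mult)
    qed
    then show ?thesis using sum_mono[of "{\<pi>\<in>?P. card (B \<pi>) > q}" "\<lambda>_. exp (p * ln p * real r)"] by auto
  qed
  also have "\<dots> \<le> (\<Sum>\<pi>\<in>?P. p ^ card (B \<pi>))"
    using p finP by (intro sum_mono2) auto
  finally have "real (card {\<pi>\<in>?P. card (B \<pi>) > q}) * exp (p * ln p * real r) \<le> fact (card A) * exp ((p - 1) * real r)"
    using mgf by linarith
  then have "real (card {\<pi>\<in>?P. card (B \<pi>) > q}) / fact (card A) \<le> exp ((p - 1) * real r) / exp (p * ln p * real r)"
    by (simp add: field_simps)
  also have "\<dots> = exp (- (p * ln p - p + 1) * real r)"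
    by (simp add: exp_diff[symmetric] algebra_simps)
  finally show ?thesis
    by (simp add: measure_pmf_of_set[OF neP finP] cP B_def Int_def)
qed

lemma rate_pos: "p > 1 \<Longrightarrow> p * ln p - p + 1 > (0::real)"
proof -
  assume p: "p > 1"
  have "ln (1 / p) \<le> 1 / p - 1" "ln (1 / p) \<noteq> 1 / p - 1"
    using p ln_le_minus_one[of "1 / p"] ln_eq_minus_one[of "1 / p"] by auto
  then have "- ln p < 1 / p - 1" using p by (simp add: ln_div)
  then have "p * - ln p < p * (1 / p - 1)" using p by (intro mult_strict_left_mono) auto
  then show ?thesis using p by (simp add: algebra_simps)
qed

text \<open>Four kinds of overflow, one for each phase of each pass, with \<open>r ^ 3\<close>
  batches of every kind and probability at most \<open>exp (- \<epsilon> * r)\<close> per batch;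
  \<open>r ^ 3\<close> is rounded up to \<open>n = r ^ 4\<close>.\<close>

definition failure_bound :: "real \<Rightarrow> nat \<Rightarrow> real" where
  "failure_bound \<epsilon> n = 4 * real n * exp (- \<epsilon> * root 4 (real n))"

lemma negligible_failure_bound:
  assumes "\<epsilon> > 0"
  shows "negligible (failure_bound \<epsilon>)"
  unfolding negligible_def
proof
  fix c :: nat
  \<comment> \<open>This power of the fourth root is \<open>n ^ (c + 1)\<close>: one factor
    \<open>n\<close> occurs in the bound itself, the others compensate for
    \<open>1 / n ^ c\<close>.\<close>
  let ?m = "4 * (c + 1)"
  have root4: "root 4 x = sqrt (sqrt x)" for x
    using real_root_mult_exp[of 2 2 x] by (simp add: sqrt_def)
  have "filterlim (\<lambda>n. \<epsilon> * root 4 (real n)) at_top sequentially"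
    unfolding root4 using assms
    by (intro filterlim_tendsto_pos_mult_at_top[OF tendsto_const] filterlim_compose[OF sqrt_at_top]
        filterlim_real_sequentially) auto
  from filterlim_compose[OF tendsto_power_div_exp_0[of ?m] this]
  have "(\<lambda>n. 4 / \<epsilon> ^ ?m * ((\<epsilon> * root 4 (real n)) ^ ?m / exp (\<epsilon> * root 4 (real n)))) \<longlonglongrightarrow> 4 / \<epsilon> ^ ?m * 0"
    by (intro tendsto_intros) (simp add: comp_def)
  then have "\<forall>\<^sub>F n in sequentially. 4 / \<epsilon> ^ ?m * ((\<epsilon> * root 4 (real n)) ^ ?m / exp (\<epsilon> * root 4 (real n))) < 1"
    by (rule order_tendstoD) simp
  with eventually_gt_at_top[of 0] show "\<forall>\<^sub>F n in sequentially. \<bar>failure_bound \<epsilon> n\<bar> \<le> 1 / real n ^ c"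
  proof eventually_elim
    case (elim n)
    have "(\<epsilon> * root 4 (real n)) ^ ?m = \<epsilon> ^ ?m * real n ^ (c + 1)"
      unfolding power_mult_distrib power_mult[of "root 4 (real n)"] by simp
    then have "4 / \<epsilon> ^ ?m * ((\<epsilon> * root 4 (real n)) ^ ?m / exp (\<epsilon> * root 4 (real n))) = failure_bound \<epsilon> n * real n ^ c"
      using assms by (simp add: failure_bound_def exp_minus field_simps)
    then show ?case using elim by (simp add: field_simps failure_bound_def)
  qed
qed

text \<open>The hypothesis forces \<open>n\<close> to infinity and, moreover, at least at the speed
  of a root of \<open>k\<close>; so any power of \<open>k\<close> is below some power of
  \<open>n k\<close>.\<close>

lemma negligible_comp:
  assumes \<nu>: "negligible \<nu>" and d: "\<forall>\<^sub>F k in sequentially. k \<le> n k ^ d"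
  shows "negligible (\<lambda>k. \<nu> (n k))"
  unfolding negligible_def
proof
  fix c :: nat
  have "filterlim n at_top sequentially"
    unfolding filterlim_at_top
  proof
    fix N
    show "\<forall>\<^sub>F k in sequentially. N \<le> n k"
      using d eventually_gt_at_top[of "N ^ d"]
    proof eventually_elim
      case (elim k)
      show ?case
      proof (rule ccontr)
        assume "\<not> N \<le> n k"
        then have "n k ^ d \<le> N ^ d" by (intro power_mono) auto
        then show False using elim by linarith
      qed
    qed
  qed
  moreover have "\<forall>\<^sub>F m in sequentially. \<bar>\<nu> m\<bar> \<le> 1 / real m ^ (d * c)" using \<nu> unfolding negligible_def by blast
  ultimately have "\<forall>\<^sub>F k in sequentially. \<bar>\<nu> (n k)\<bar> \<le> 1 / real (n k) ^ (d * c)"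
    by (rule eventually_compose_filterlim[rotated])
  with d eventually_gt_at_top[of 0] show "\<forall>\<^sub>F k in sequentially. \<bar>\<nu> (n k)\<bar> \<le> 1 / real k ^ c"
  proof eventually_elim
    case (elim k)
    have "real k ^ c \<le> (real (n k) ^ d) ^ c"
      using of_nat_mono[OF elim(1), where 'a=real] by (intro power_mono) auto
    then have "1 / real (n k) ^ (d * c) \<le> 1 / real k ^ c"
      using elim(2) by (intro frac_le) (auto simp: power_mult)
    then show ?case using elim by linarith
  qed
qed

lemma card_div_block: "card {x \<in> {1..n}. (x - 1) div q = (c::nat)} \<le> q" if "q > 0"
proof -
  have "{x \<in> {1..n}. (x - 1) div q = c} \<subseteq> {c * q + 1..c * q + q}"
  proof
    fix x assume x: "x \<in> {x \<in> {1..n}. (x - 1) div q = c}"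
    then have "c * q \<le> x - 1" "x - 1 < c * q + q" "1 \<le> x"
      using div_times_less_eq_dividend[of "x - 1" q] dividend_less_div_times[of q "x - 1"] that by auto
    then show "x \<in> {c * q + 1..c * q + q}" by auto
  qed
  from card_mono[OF _ this] show ?thesis by simp
qed

lemma distinct_filter_blk: "keyed n es \<Longrightarrow> distinct (map fst (filter P (blk q es w)))"
  by (simp add: keyed_def distinct_map_filter blk_def drop_map[symmetric] take_map[symmetric])

lemma length_filter_blk_le:
  assumes "keyed n es" and "finite X" and "\<And>e. e \<in> set (blk q es w) \<Longrightarrow> P e \<Longrightarrow> fst e \<in> X"
  shows "length (filter P (blk q es w)) \<le> card X"
proof -
  have "length (filter P (blk q es w)) = card (fst ` set (filter P (blk q es w)))"
    using distinct_card[OF distinct_filter_blk[OF assms(1), of P q w]] by simp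
  also have "\<dots> \<le> card X" using assms(3) by (intro card_mono assms(2)) auto
  finally show ?thesis .
qed

lemma blk_arrange:
  assumes "keyed (m * q) es" and "\<rho> permutes {1..m * q}" and "w < m" and "e \<in> set (blk q (arrange (m * q) \<rho> es) w)"
  shows "(\<rho> (fst e) - 1) div q = w"
proof -
  have "\<rho> (fst e) \<in> set (map (\<lambda>e. \<rho> (fst e)) (blk q (arrange (m * q) \<rho> es) w))" using assms(4) by auto
  also have "map (\<lambda>e. \<rho> (fst e)) (blk q (arrange (m * q) \<rho> es) w) = [w * q + 1..<w * q + q + 1]"
    unfolding map_blk arrange_perm(1)[OF assms(1,2)] by (rule blk_upt[OF assms(3)])
  finally show ?thesis by (intro div_nat_eqI) (auto simp: algebra_simps)
qed

lemma card_keys_blk: "keyed n es \<Longrightarrow> card (fst ` set (blk q es w)) \<le> q"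
  using card_length[of "map fst (blk q es w)"] by (simp add: blk_def)

text \<open>Every batch of either pass is included in a set of keys that is fixed in advance and
  that \<open>\<pi>1\<close> sends to fixed positions, so one tail bound for \<open>\<pi>1\<close>
  and a union bound are enough. In the second pass the fixed keys are determined by
  \<open>\<pi>\<close> and the positions by the block that is read.\<close>

lemma run_good_prob:
  fixes p1 p2 :: real and r :: nat
  assumes p: "p1 > 1" "p2 > 1" and es: "keyed (r^4) es" and \<pi>: "\<pi> permutes {1..r^4}"
    and \<epsilon>: "\<epsilon> \<le> p1 * ln p1 - p1 + 1" "\<epsilon> \<le> p2 * ln p2 - p2 + 1"
  shows "measure_pmf.prob (pmf_of_set {\<sigma>. \<sigma> permutes {1..r^4}})
     {\<pi>1. \<not> run_good r (batch_size p1 r) (batch_size p2 r) \<pi>1 \<pi> es} \<le> failure_bound \<epsilon> (r^4)"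
proof -
  let ?A = "{1..r^4}" and ?q1 = "batch_size p1 r" and ?q2 = "batch_size p2 r" and ?\<delta> = "exp (- \<epsilon> * real r)"
  let ?P = "pmf_of_set {\<sigma>. \<sigma> permutes ?A}"
  let ?ev = "\<lambda>q S T. {\<pi>1. card {x \<in> S. \<pi>1 x \<in> T} > q}"
  have fin: "finite {\<sigma>. \<sigma> permutes ?A}" and ne: "{\<sigma>. \<sigma> permutes ?A} \<noteq> {}"
    using permutes_id[of ?A] by (simp add: finite_permutations, blast)
  have r4: "r^4 = r^2 * r^2" "r^4 = r * r^3" by (simp_all add: power_add[symmetric] power_Suc[symmetric] del: power_Suc)
  define T where "T q c = {x \<in> ?A. (x - 1) div q = c}" for q c
  define S where "S q c = {x \<in> ?A. \<pi> x \<in> T q c}" for q c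
  define K where "K q w = fst ` set (blk q es w)" for q w
  have T: "card (T q c) \<le> q" if "q > 0" for q c unfolding T_def by (rule card_div_block[OF that])
  have S: "card (S q c) \<le> q" if "q > 0" for q c
  proof -
    have "card (S q c) \<le> card (T q c)"
      by (rule card_inj_on_le[where f=\<pi>]) (use permutes_inj_on[OF \<pi>] in \<open>auto simp: S_def T_def\<close>)
    then show ?thesis using T[OF that, of c] by linarith
  qed
  have K: "card (K q w) \<le> q" for q w unfolding K_def by (rule card_keys_blk[OF es])
  have sub: "T q c \<subseteq> ?A" "S q c \<subseteq> ?A" "K q c \<subseteq> ?A" for q c
    using es set_blk[of q es c] by (auto simp: T_def S_def K_def keyed_def)
  \<comment> \<open>First pass: the keys \<open>K\<close> of the block read, sent by
    \<open>\<pi>1\<close> to the target positions. Second pass: the keys \<open>S\<close> that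
    \<open>\<pi>\<close> sends to the target positions, put by \<open>\<pi>1\<close> into the block
    read.\<close>
  define bad where "bad w c = (?ev ?q1 (K (r^2) w) (T (r^3) c) \<union> ?ev ?q2 (K (r^3) (w mod r)) (T (r^2) (w div r * r + c)))
     \<union> (?ev ?q1 (S (r^3) c) (T (r^2) w) \<union> ?ev ?q2 (S (r^2) (w div r * r + c)) (T (r^3) (w mod r)))" for w c
  have cover: "{\<pi>1. \<not> run_good r ?q1 ?q2 \<pi>1 \<pi> es} \<inter> {\<sigma>. \<sigma> permutes ?A} \<subseteq> (\<Union>z\<in>{..<r^2} \<times> {..<r}. bad (fst z) (snd z))"
  proof
    fix \<pi>1 assume "\<pi>1 \<in> {\<pi>1. \<not> run_good r ?q1 ?q2 \<pi>1 \<pi> es} \<inter> {\<sigma>. \<sigma> permutes ?A}"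
    then have \<pi>1: "\<pi>1 permutes ?A" and ng: "\<not> run_good r ?q1 ?q2 \<pi>1 \<pi> es" by auto
    let ?es1 = "arrange (r^4) \<pi>1 es"
    have es1: "keyed (r^4) ?es1" by (rule keyed_arrange[OF es \<pi>1])
    have inT: "(\<rho> (fst e) - 1) div q = c \<Longrightarrow> \<rho> (fst e) \<in> T q c" if "\<rho> permutes ?A" "fst e \<in> ?A" for \<rho> e q c
      using that permutes_in_image[OF that(1), of "fst e"] by (auto simp: T_def)
    have keys: "fst e \<in> ?A" if "e \<in> set (blk q xs w)" "keyed (r^4) xs" for q xs w and e :: element
      using that set_blk[of q xs w] unfolding keyed_def by blast
    have 1: "length (sel1 r \<pi>1 es w c) \<le> card {x \<in> K (r^2) w. \<pi>1 x \<in> T (r^3) c}" for w c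
      unfolding sel1_def
      by (rule length_filter_blk_le[OF es]) (use inT[OF \<pi>1 keys[OF _ es]] in \<open>auto simp: K_def\<close>)
    have 2: "length (sel2 r \<pi>1 es w c) \<le> card {x \<in> K (r^3) (w mod r). \<pi>1 x \<in> T (r^2) (w div r * r + c)}" for w c
      unfolding sel2_def
      by (rule length_filter_blk_le[OF es]) (use inT[OF \<pi>1 keys[OF _ es]] in \<open>auto simp: K_def\<close>)
    have finS: "finite (S q c)" for q c by (simp add: S_def)
    have 3: "length (sel1 r \<pi> ?es1 w c) \<le> card {x \<in> S (r^3) c. \<pi>1 x \<in> T (r^2) w}" if "w < r^2" for w c
      unfolding sel1_def
    proof (rule length_filter_blk_le[OF es1])
      fix e assume e: "e \<in> set (blk (r^2) ?es1 w)" "(\<pi> (fst e) - 1) div r^3 = c"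
      have u: "(\<pi>1 (fst e) - 1) div r^2 = w"
        by (rule blk_arrange[OF es[unfolded r4(1)] \<pi>1[unfolded r4(1)] that e(1)[unfolded r4(1)]])
      then show "fst e \<in> {x \<in> S (r^3) c. \<pi>1 x \<in> T (r^2) w}"
        using inT[OF \<pi> keys[OF e(1) es1] e(2)] inT[OF \<pi>1 keys[OF e(1) es1] u] keys[OF e(1) es1] by (simp add: S_def)
    qed (simp add: finS)
    have 4: "length (sel2 r \<pi> ?es1 w c) \<le> card {x \<in> S (r^2) (w div r * r + c). \<pi>1 x \<in> T (r^3) (w mod r)}"
      if "w < r^2" for w c
      unfolding sel2_def
    proof (rule length_filter_blk_le[OF es1])
      fix e assume e: "e \<in> set (blk (r^3) ?es1 (w mod r))" "(\<pi> (fst e) - 1) div r^2 = w div r * r + c"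
      have "w mod r < r" using that by (cases r) auto
      then have u: "(\<pi>1 (fst e) - 1) div r^3 = w mod r"
        by (rule blk_arrange[OF es[unfolded r4(2)] \<pi>1[unfolded r4(2)] _ e(1)[unfolded r4(2)]])
      then show "fst e \<in> {x \<in> S (r^2) (w div r * r + c). \<pi>1 x \<in> T (r^3) (w mod r)}"
        using inT[OF \<pi> keys[OF e(1) es1] e(2)] inT[OF \<pi>1 keys[OF e(1) es1] u] keys[OF e(1) es1] by (simp add: S_def)
    qed (simp add: finS)
    from ng obtain w c where wc: "w < r^2" "c < r"
      and "length (sel1 r \<pi>1 es w c) > ?q1 \<or> length (sel2 r \<pi>1 es w c) > ?q2 \<or>
           length (sel1 r \<pi> ?es1 w c) > ?q1 \<or> length (sel2 r \<pi> ?es1 w c) > ?q2"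
      unfolding run_good_def pass_good_def not_le[symmetric] by blast
    then have "\<pi>1 \<in> bad w c"
      using 1[of w c] 2[of w c] 3[OF wc(1), of c] 4[OF wc(1), of c] unfolding bad_def by auto
    then show "\<pi>1 \<in> (\<Union>z\<in>{..<r^2} \<times> {..<r}. bad (fst z) (snd z))" using wc by force
  qed
  have ev: "measure_pmf.prob ?P (?ev (batch_size p r) X Y) \<le> ?\<delta>"
    if "X \<subseteq> ?A" "Y \<subseteq> ?A" "card X \<le> a" "card Y \<le> b" "a * b = r^4 * r" "p > 1" "\<epsilon> \<le> p * ln p - p + 1" for p X Y a b
  proof -
    have "measure_pmf.prob ?P (?ev (batch_size p r) X Y) \<le> exp (- (p * ln p - p + 1) * real r)"
    proof (rule permutes_overflow)
      show "p * real r \<le> real (batch_size p r)" unfolding batch_size_def by linarith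
      show "card X * card Y \<le> card ?A * r" using mult_le_mono[OF that(3,4)] that(5) by simp
    qed (use that in auto)
    also have "\<dots> \<le> ?\<delta>"
      unfolding exp_le_cancel_iff by (rule mult_right_mono) (use that(7) in auto)
    finally show ?thesis .
  qed
  have un: "measure_pmf.prob ?P (X \<union> Y) \<le> measure_pmf.prob ?P X + measure_pmf.prob ?P Y" for X Y
    by (rule measure_Un_le) auto
  have bad: "measure_pmf.prob ?P (bad w c) \<le> 4 * ?\<delta>" if "r > 0" for w c
  proof -
    \<comment> \<open>Each event pairs a set of at most \<open>r ^ 2\<close> elements with one of at
      most \<open>r ^ 3\<close>, or conversely; relative to \<open>r ^ 4\<close> positions the
      expected batch has at most \<open>r\<close> elements.\<close>
    have a: "r^2 * r^3 = r^4 * r" "r^3 * r^2 = r^4 * r" by (simp_all add: eval_nat_numeral)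
    have pos: "r^2 > 0" "r^3 > 0" using that by auto
    show ?thesis unfolding bad_def
      using un[of "?ev ?q1 (K (r^2) w) (T (r^3) c) \<union> ?ev ?q2 (K (r^3) (w mod r)) (T (r^2) (w div r * r + c))"
          "?ev ?q1 (S (r^3) c) (T (r^2) w) \<union> ?ev ?q2 (S (r^2) (w div r * r + c)) (T (r^3) (w mod r))"]
        un[of "?ev ?q1 (K (r^2) w) (T (r^3) c)" "?ev ?q2 (K (r^3) (w mod r)) (T (r^2) (w div r * r + c))"]
        un[of "?ev ?q1 (S (r^3) c) (T (r^2) w)" "?ev ?q2 (S (r^2) (w div r * r + c)) (T (r^3) (w mod r))"]
        ev[OF sub(3,1) K T[OF pos(2)] a(1) p(1) \<epsilon>(1), of w c]
        ev[OF sub(3,1) K T[OF pos(1)] a(2) p(2) \<epsilon>(2), of "w mod r" "w div r * r + c"]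
        ev[OF sub(2,1) S[OF pos(2)] T[OF pos(1)] a(2) p(1) \<epsilon>(1), of c w]
        ev[OF sub(2,1) S[OF pos(1)] T[OF pos(2)] a(1) p(2) \<epsilon>(2), of "w div r * r + c" "w mod r"]
      by linarith
  qed
  have "measure_pmf.prob ?P {\<pi>1. \<not> run_good r ?q1 ?q2 \<pi>1 \<pi> es}
    = measure_pmf.prob ?P ({\<pi>1. \<not> run_good r ?q1 ?q2 \<pi>1 \<pi> es} \<inter> {\<sigma>. \<sigma> permutes ?A})"
    by (rule measure_Int_set_pmf[of ?P, unfolded set_pmf_of_set[OF ne fin], symmetric])
  also have "\<dots> \<le> measure_pmf.prob ?P (\<Union>z\<in>{..<r^2} \<times> {..<r}. bad (fst z) (snd z))"
    by (rule measure_pmf.finite_measure_mono[OF cover]) simp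
  also have "\<dots> \<le> (\<Sum>z\<in>{..<r^2} \<times> {..<r}. measure_pmf.prob ?P (bad (fst z) (snd z)))"
    by (rule measure_UNION_le) auto
  also have "\<dots> \<le> (\<Sum>z\<in>{..<r^2} \<times> {..<r}. 4 * ?\<delta>)"
    by (rule sum_mono) (rule bad, auto)
  also have "\<dots> = 4 * real (r^3) * ?\<delta>" by (simp add: power3_eq_cube power2_eq_square)
  also have "\<dots> \<le> 4 * real (r^4) * ?\<delta>"
    by (intro mult_right_mono mult_left_mono of_nat_mono) (cases r, auto intro!: power_increasing)
  also have "\<dots> = failure_bound \<epsilon> (r^4)"
    by (simp add: failure_bound_def real_root_power[symmetric] real_root_pos2)
  finally show ?thesis .
qed

lemma prob_bind_le:
  assumes "\<And>x y. x \<in> set_pmf p \<Longrightarrow> x \<notin> B \<Longrightarrow> y \<in> set_pmf (f x) \<Longrightarrow> y \<notin> A"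
  shows "measure_pmf.prob (bind_pmf p f) A \<le> measure_pmf.prob p B"
proof -
  have "emeasure (bind_pmf p f) A = (\<integral>\<^sup>+x. emeasure (f x) A \<partial>p)" by simp
  also have "\<dots> \<le> (\<integral>\<^sup>+x. indicator B x \<partial>p)"
  proof (rule nn_integral_pmf_mono)
    fix x assume x: "x \<in> set_pmf p"
    show "emeasure (f x) A \<le> indicator B x"
    proof (cases "x \<in> B")
      case False
      then have "measure_pmf.prob (f x) A = 0" using assms[OF x] by (auto simp: measure_pmf_zero_iff)
      then show ?thesis by (simp add: measure_pmf.emeasure_eq_measure)
    qed (simp add: measure_pmf.emeasure_le_1)
  qed
  finally show ?thesis by (simp add: measure_pmf.emeasure_eq_measure)
qed

lemma optim_shuffle_whp:
  fixes p1 p2 :: real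
  assumes p: "p1 > 1" "p2 > 1" and enc: "symmetric_encryption Gen Enc Dec"
  shows "shuffles_whp Gen Enc Dec p1 p2"
proof -
  \<comment> \<open>The smaller of the rates belonging to the two batch sizes serves for
    both.\<close>
  define \<epsilon> where "\<epsilon> = min (p1 * ln p1 - p1 + 1) (p2 * ln p2 - p2 + 1)"
  have \<epsilon>: "\<epsilon> > 0" "\<epsilon> \<le> p1 * ln p1 - p1 + 1" "\<epsilon> \<le> p2 * ln p2 - p2 + 1"
    using rate_pos[OF p(1)] rate_pos[OF p(2)] by (auto simp: \<epsilon>_def)
  show ?thesis unfolding shuffles_whp_def
  proof (rule exI[of _ "failure_bound \<epsilon>"], intro conjI allI ballI impI)
    show "negligible (failure_bound \<epsilon>)" by (rule negligible_failure_bound[OF \<epsilon>(1)])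
    fix k r L v \<pi>0 \<pi> key cs
    assume key: "key \<in> set_pmf (Gen k)" and \<pi>0: "\<pi>0 permutes {1..r^4}" and \<pi>: "\<pi> permutes {1..r^4}"
      and cs: "encrypts_arranged Enc key (r^4) v \<pi>0 cs"
    let ?n = "r^4" and ?q1 = "batch_size p1 r" and ?q2 = "batch_size p2 r"
    have DE: "c \<in> set_pmf (Enc key m) \<Longrightarrow> Dec key c = Some m" for m c
      using enc key unfolding symmetric_encryption_def by blast
    define es where "es = map (\<lambda>p. (inv \<pi>0 p, v (inv \<pi>0 p))) [1..<Suc ?n]"
    have keyed: "keyed ?n es"
      unfolding keyed_def es_def
      using permutes_inj_on[OF permutes_inv[OF \<pi>0]] permutes_image[OF permutes_inv[OF \<pi>0]]
      by (simp add: comp_def distinct_map atLeastLessThanSuc_atLeastAtMost image_image del: upt_Suc)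
    have D: "map (Dec key) cs = map (Some \<circ> real_slot ?n) es"
    proof (rule nth_equalityI)
      show "length (map (Dec key) cs) = length (map (Some \<circ> real_slot ?n) es)"
        using cs by (simp add: es_def encrypts_arranged_def del: upt_Suc)
      fix i assume "i < length (map (Dec key) cs)"
      then have i: "i < ?n" using cs by (simp add: encrypts_arranged_def)
      let ?x = "inv \<pi>0 (Suc i)"
      have "?x \<in> {1..?n}" using i permutes_in_image[OF permutes_inv[OF \<pi>0], of "Suc i"] by simp
      moreover have "\<pi>0 ?x = Suc i" by (rule permutes_inverses(1)[OF \<pi>0])
      ultimately have "cs ! i \<in> set_pmf (Enc key (real_slot ?n (?x, v ?x)))"
        using cs unfolding encrypts_arranged_def by (metis diff_Suc_1)
      then show "map (Dec key) cs ! i = map (Some \<circ> real_slot ?n) es ! i"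
        using i cs DE by (simp add: es_def encrypts_arranged_def del: upt_Suc)
    qed
    from shuffle_plan[where Enc=Enc and key=key and Dec=Dec and r=r and es=es and \<pi>=\<pi> and cs=cs and L=L
        and ?p1.0=p1 and ?p2.0=p2, OF DE keyed \<pi> D]
    obtain X where X: "optim_shuffle Enc Dec p1 p2 r L key \<pi> cs = bind_pmf (pmf_of_set {\<sigma>. \<sigma> permutes {1..?n}}) X"
      and good: "\<And>\<pi>1. \<pi>1 permutes {1..?n} \<Longrightarrow> run_good r ?q1 ?q2 \<pi>1 \<pi> es \<Longrightarrow>
           X \<pi>1 = map_pmf (fmt r ?q1 ?q2 cs) (mapM_pmf (Enc key) (plan r ?q1 ?q2 L \<pi>1 \<pi> es))"
      and bad: "\<And>\<pi>1 z. \<pi>1 permutes {1..?n} \<Longrightarrow> \<not> run_good r ?q1 ?q2 \<pi>1 \<pi> es \<Longrightarrow> z \<in> set_pmf (X \<pi>1) \<Longrightarrow> fst z = None"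
      by metis
    let ?P = "pmf_of_set {\<sigma>. \<sigma> permutes {1..?n}}"
    have fin: "finite {\<sigma>. \<sigma> permutes {1..?n}}" and ne: "{\<sigma>. \<sigma> permutes {1..?n}} \<noteq> {}"
      using permutes_id[of "{1..?n}"] by (simp add: finite_permutations, blast)
    note setP = set_pmf_of_set[OF ne fin]
    show "measure_pmf.prob (optim_shuffle Enc Dec p1 p2 r L key \<pi> cs) {z. fst z = None} \<le> failure_bound \<epsilon> ?n"
    proof -
      have "measure_pmf.prob (bind_pmf ?P X) {z. fst z = None} \<le> measure_pmf.prob ?P {\<pi>1. \<not> run_good r ?q1 ?q2 \<pi>1 \<pi> es}"
      proof (rule prob_bind_le)
        fix \<pi>1 z assume "\<pi>1 \<in> set_pmf ?P" "\<pi>1 \<notin> {\<pi>1. \<not> run_good r ?q1 ?q2 \<pi>1 \<pi> es}" "z \<in> set_pmf (X \<pi>1)"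
        then show "z \<notin> {z. fst z = None}" using good[of \<pi>1] unfolding setP by (auto simp: fmt_def)
      qed
      also have "\<dots> \<le> failure_bound \<epsilon> ?n" by (rule run_good_prob[OF p keyed \<pi> \<epsilon>(2,3)])
      finally show ?thesis unfolding X .
    qed
    fix out tr assume "(Some out, tr) \<in> set_pmf (optim_shuffle Enc Dec p1 p2 r L key \<pi> cs)"
    then obtain \<pi>1 where \<pi>1: "\<pi>1 permutes {1..?n}" and z: "(Some out, tr) \<in> set_pmf (X \<pi>1)"
      unfolding X set_bind_pmf setP by blast
    have rg: "run_good r ?q1 ?q2 \<pi>1 \<pi> es" using bad[OF \<pi>1 _ z] by auto
    obtain ys where ys: "ys \<in> set_pmf (mapM_pmf (Enc key) (plan r ?q1 ?q2 L \<pi>1 \<pi> es))"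
      and "(Some out, tr) = fmt r ?q1 ?q2 cs ys"
      using z unfolding good[OF \<pi>1 rg] by auto
    let ?N = "r^3 * ?q1 + r^3 * ?q2" and ?es1 = "arrange ?n \<pi>1 es"
    let ?es2 = "arrange ?n \<pi> ?es1"
    have out: "out = drop ?N (drop (?N + ?n) ys)" using \<open>_ = fmt r ?q1 ?q2 cs ys\<close> by (simp add: fmt_def)
    have k1: "keyed ?n ?es1" by (rule keyed_arrange[OF keyed \<pi>1])
    have l: "list_all2 (\<lambda>c m. c \<in> set_pmf (Enc key m)) ys (plan r ?q1 ?q2 L \<pi>1 \<pi> es)"
      by (rule mapM_pmf_set[OF ys])
    have "drop ?N (drop (?N + ?n) (plan r ?q1 ?q2 L \<pi>1 \<pi> es)) = map (real_slot ?n) ?es2"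
      unfolding plan_def using length_pass_msgs[OF keyed \<pi>1] drop_pass_msgs by simp
    then have l2: "list_all2 (\<lambda>c m. c \<in> set_pmf (Enc key m)) out (map (real_slot ?n) ?es2)"
      using list_all2_dropI[OF list_all2_dropI[OF l, of "?N + ?n"], of ?N] unfolding out by simp
    have k2: "keyed ?n ?es2" by (rule keyed_arrange[OF k1 \<pi>])
    have set2: "set ?es2 = set es" using arrange_perm(2)[OF k1 \<pi>] arrange_perm(2)[OF keyed \<pi>1] by simp
    show "encrypts_arranged Enc key ?n v \<pi> out" unfolding encrypts_arranged_def
    proof (intro conjI ballI)
      show len: "length out = ?n" using list_all2_lengthD[OF l2] k2 by (simp add: keyed_def)
      fix x assume x: "x \<in> {1..?n}"
      then have px: "\<pi> x \<in> {1..?n}" using permutes_in_image[OF \<pi>] by simp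
      let ?i = "\<pi> x - 1"
      have i: "?i < ?n" using px by auto
      have li: "?i < length ?es2" using k2 i by (simp add: keyed_def)
      have "\<pi> (fst (?es2 ! ?i)) = map (\<lambda>e. \<pi> (fst e)) ?es2 ! ?i" using li by simp
      also have "\<dots> = \<pi> x" unfolding arrange_perm(1)[OF k1 \<pi>] using px by (auto simp del: upt_Suc)
      finally have "fst (?es2 ! ?i) = x" using permutes_inj[OF \<pi>] by (simp add: inj_eq)
      moreover have "?es2 ! ?i \<in> set es" using nth_mem[OF li] set2 by simp
      ultimately have "?es2 ! ?i = (x, v x)" by (auto simp: es_def simp del: upt_Suc)
      then show "out ! ?i \<in> set_pmf (Enc key (real_slot ?n (x, v x)))"
        using list_all2_nthD[OF l2, of ?i] i len li by simp
    qed
  qed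
qed

section \<open>A polynomial-time simulator of the shuffle game\<close>

section \<open>Simulating the shuffle\<close>

subsection \<open>The shuffle in polynomial time\<close>

text \<open>Requests and responses are computed as tuples that have the same code.\<close>

lemma fp_recode:
  assumes "fp f" and "\<And>a. enc (g a) = enc (f a)"
  shows "fp g"
proof -
  obtain p h where p: "pmono h" "\<And>a. runs (exec p (enc a)) (h (esize a)) (Done (f a))"
    "\<And>a. esize (f a) \<le> h (esize a)" using assms(1) by (rule ptimeE) auto
  have "esize (g a) \<le> h (esize a)" for a using p(3)[of a] assms(2)[of a] by (simp add: esize_def)
  then show ?thesis
    by (intro ptimeI[where p=p and g=h and h=h] p(1) runs_Done_cong[OF p(2)]) (simp_all add: assms(2))
qed

lemma fp_div [fp_intros]:
  assumes "fp f" and "fp g"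
  shows "fp (\<lambda>x. f x div g x :: nat)"
proof -
  \<comment> \<open>The quotient counts the positive multiples of \<open>g x\<close> up to
    \<open>f x\<close>. Division by zero is set apart, because then every candidate would be
    counted.\<close>
  have "fp (\<lambda>x. if g x = 0 then 0 else length (filter (\<lambda>i. Suc i * g x \<le> f x) [0..<f x]))"
    by (intro fp_intros assms ptime_comp[OF assms(1)] ptime_comp[OF assms(2)])
  moreover have "(if n = 0 then 0 else length (filter (\<lambda>i. Suc i * n \<le> m) [0..<m])) = m div n" for m n :: nat
  proof (cases "n = 0")
    case False
    have "{i. i < m \<and> Suc i * n \<le> m} = {..<m div n}"
      using False less_le_trans[OF _ div_le_dividend[of m n]]
      by (auto simp: less_eq_div_iff_mult_less_eq[symmetric] simp del: mult_Suc)
    then show ?thesis using False by (simp add: length_filter_conv_card cong: conj_cong del: mult_Suc)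
  qed simp
  ultimately show ?thesis by simp
qed

lemma fp_mod [fp_intros]: "fp f \<Longrightarrow> fp g \<Longrightarrow> fp (\<lambda>x. f x mod g x :: nat)"
  unfolding minus_div_mult_eq_mod[symmetric] by (intro fp_intros)

text \<open>In unary the divisor \<open>2 ^ g x\<close> would be exponentially large; repeated
  halving avoids computing it.\<close>

lemma fp_shift:
  assumes "fp f" and "fp g"
  shows "fp (\<lambda>x. f x div 2 ^ g x :: nat)"
proof -
  have "fp (\<lambda>x. fold (\<lambda>_ y. y div 2) (replicate (g x) ()) (f x))"
    by (rule fp_fold[where G="\<lambda>_. 0"]) (intro fp_intros fp_replicate_unit assms pmono_intros | simp)+
  moreover have "fold (\<lambda>_ y. y div 2) (replicate k ()) m = m div 2 ^ k" for k and m :: nat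
    by (induction k arbitrary: m) (auto simp: div_mult2_eq)
  ultimately show ?thesis by simp
qed

lemma less_key_width_iff: "i < key_width n \<longleftrightarrow> n div 2 ^ i \<noteq> 0"
proof
  assume "i < key_width n"
  then have "\<not> n < 2 ^ i" unfolding key_width_def by (rule not_less_Least)
  then show "n div 2 ^ i \<noteq> 0" by (simp add: div_eq_0_iff)
next
  assume "n div 2 ^ i \<noteq> 0"
  then have "2 ^ i \<le> n" by (simp add: div_eq_0_iff not_less)
  then have "(2::nat) ^ i < 2 ^ key_width n" using less_key_width[of n] by linarith
  then show "i < key_width n" by simp
qed

lemma key_width_le: "key_width n \<le> n"
  unfolding key_width_def by (rule Least_le) (rule less_exp)

lemma fp_key_width [fp_intros]:
  assumes "fp f"
  shows "fp (\<lambda>x. key_width (f x))"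
proof -
  have "fp (\<lambda>x. length (filter (\<lambda>i. f x div 2 ^ i \<noteq> 0) [0..<f x]))"
    by (intro fp_length fp_filter fp_Not fp_nat_eq fp_shift fp_upt fp_const fp_snd fp_id assms ptime_comp[OF assms fp_fst1])
  moreover have "length (filter (\<lambda>i. n div 2 ^ i \<noteq> 0) [0..<n]) = key_width n" for n :: nat
  proof -
    have "{i. i < n \<and> n div 2 ^ i \<noteq> 0} = {..<key_width n}"
      using key_width_le[of n] less_key_width_iff[of _ n] by (auto dest: less_le_trans)
    then show ?thesis by (simp add: length_filter_conv_card cong: conj_cong)
  qed
  ultimately show ?thesis by simp
qed

lemma fp_bits_of_nat [fp_intros]:
  assumes "fp f" and "fp g"
  shows "fp (\<lambda>x. map (bit (f x :: nat)) [0..<g x])"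
proof -
  have "fp (\<lambda>x. map (\<lambda>i. f x div 2 ^ i mod 2 = 1) [0..<g x])"
    by (intro fp_map fp_nat_eq fp_mod fp_shift fp_upt fp_const fp_snd fp_id assms ptime_comp[OF assms(1) fp_fst1])
  then show ?thesis by (simp add: bit_iff_odd[abs_def] odd_iff_mod_2_eq_one)
qed

lemma fp_real_slot [fp_intros]: "fp f \<Longrightarrow> fp g \<Longrightarrow> fp (\<lambda>x. real_slot (f x) (g x))"
  unfolding real_slot_def by (intro fp_intros)

lemma fp_dummy_slot [fp_intros]: "fp f \<Longrightarrow> fp g \<Longrightarrow> fp (\<lambda>x. dummy_slot (f x) (g x))"
  unfolding dummy_slot_def by (intro fp_intros)

lemma fun_of_perm_list_eq:
  "fun_of_perm_list ps x = (if x = 0 then x else case drop (x - 1) ps of [] \<Rightarrow> x | y # ys \<Rightarrow> y)"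
proof (cases "x \<in> {1..length ps}")
  case True
  then have "x - 1 < length ps" by auto
  then show ?thesis using True by (simp add: fun_of_perm_list_def Cons_nth_drop_Suc[symmetric])
qed (auto simp: fun_of_perm_list_def)

lemma fp_fun_of_perm_list [fp_intros]: "fp f \<Longrightarrow> fp g \<Longrightarrow> fp (\<lambda>x. fun_of_perm_list (f x) (g x))"
  unfolding fun_of_perm_list_eq by (intro fp_intros)

lemma fp_arrange:
  "fp (\<lambda>z :: nat \<times> nat list \<times> element list. arrange (fst z) (fun_of_perm_list (fst (snd z))) (snd (snd z)))"
  unfolding arrange_def by (intro fp_intros)

lemma fp_pass_msgs:
  "fp (\<lambda>z :: nat \<times> nat \<times> nat \<times> nat \<times> nat list \<times> element list.
     pass_msgs (fst z) (fst (snd z)) (fst (snd (snd z))) (fst (snd (snd (snd z))))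
       (fun_of_perm_list (fst (snd (snd (snd (snd z)))))) (snd (snd (snd (snd (snd z))))))"
  unfolding pass_msgs_def dist_msgs_def pad_def sel1_def sel2_def blk_def arrange_def
  by (intro fp_intros)

lemma fp_plan [fp_intros]:
  assumes "fp r" and "fp q1" and "fp q2" and "fp L" and "fp ps1" and "fp ps" and "fp es"
  shows "fp (\<lambda>x. plan (r x) (q1 x) (q2 x) (L x) (fun_of_perm_list (ps1 x)) (fun_of_perm_list (ps x)) (es x))"
proof -
  note P = ptime_comp[OF fp_pass_msgs, of "\<lambda>x. (r x, q1 x, q2 x, L x, f x, e x)" for f e, simplified]
  have "fp (\<lambda>x. arrange (r x ^ 4) (fun_of_perm_list (ps1 x)) (es x))"
    using ptime_comp[OF fp_arrange, of "\<lambda>x. (r x ^ 4, ps1 x, es x)"] assms by (simp add: fp_intros)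
  then show ?thesis
    unfolding plan_def by (intro fp_append P fp_pair assms)
qed

instantiation arr :: codable
begin
definition enc_arr :: "arr \<Rightarrow> data" where "enc_arr = data_of_arr"
instance ..
end

instantiation request :: codable
begin
definition enc_request :: "request \<Rightarrow> data" where "enc_request = data_of_request"
instance ..
end

instantiation response :: codable
begin
definition enc_response :: "response \<Rightarrow> data" where "enc_response = data_of_response"
instance ..
end

lemma data_of_run_enc: "data_of_run z = enc z"
proof -
  have "data_of_option (map_option data_of_bits_list out) = enc out" for out :: "bits list option"
    by (cases out) (simp_all add: enc_bits_list)
  moreover have "data_of_list (map (\<lambda>(rq, rs). Cell (data_of_request rq) (data_of_response rs)) tr) = enc tr" for tr :: transcript
    by (induction tr) (auto simp: enc_request_def enc_response_def)
  ultimately show ?thesis by (cases z) simp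
qed

lemma fp_requests [fp_intros]:
  "fp f \<Longrightarrow> fp g \<Longrightarrow> fp (\<lambda>x. GetRange S (f x) (g x))"
  "fp f \<Longrightarrow> fp a \<Longrightarrow> fp (\<lambda>x. PutRange S (f x) (a x))"
  "fp ws \<Longrightarrow> fp (\<lambda>x. PutRangeDist S (ws x))"
  "fp a \<Longrightarrow> fp (\<lambda>x. Elems (a x))"
proof -
  have pairs: "data_of_list (map (\<lambda>(loc, a). Cell (data_of_nat loc) (data_of_bits_list a)) ws) = enc ws" for ws
    by (induction ws) (auto simp: enc_bits_list enc_nat_def)
  show "fp f \<Longrightarrow> fp g \<Longrightarrow> fp (\<lambda>x. GetRange S (f x) (g x))"
    by (rule fp_recode[where f="\<lambda>x. (0::nat, S, f x, g x, ())"]) (simp_all add: fp_intros enc_request_def enc_arr_def enc_nat_def)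
  show "fp f \<Longrightarrow> fp a \<Longrightarrow> fp (\<lambda>x. PutRange S (f x) (a x))"
    by (rule fp_recode[where f="\<lambda>x. (1::nat, S, f x, a x, ())"]) (simp_all add: fp_intros enc_request_def enc_arr_def enc_nat_def enc_bits_list)
  show "fp ws \<Longrightarrow> fp (\<lambda>x. PutRangeDist S (ws x))"
    by (rule fp_recode[where f="\<lambda>x. (3::nat, S, ws x, ())"])
       (simp_all only: fp_intros, simp only: enc_request_def enc_arr_def data_of_request.simps pairs enc_pair, simp add: enc_nat_def)
  show "fp a \<Longrightarrow> fp (\<lambda>x. Elems (a x))"
    by (rule fp_recode[where f="\<lambda>x. (0::nat, a x, ())"]) (simp_all add: fp_intros enc_response_def enc_nat_def enc_bits_list)
qed

lemma fp_blk [fp_intros]: "fp q \<Longrightarrow> fp ys \<Longrightarrow> fp w \<Longrightarrow> fp (\<lambda>x. blk (q x) (ys x) (w x))"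
  unfolding blk_def by (intro fp_intros)

lemma fp_read_range [fp_intros]: "fp l \<Longrightarrow> fp k \<Longrightarrow> fp A \<Longrightarrow> fp (\<lambda>x. read_range (l x) (k x) (A x))"
  unfolding read_range_def by (intro fp_intros)

lemma fp_clean_trans:
  "fp (\<lambda>z :: nat \<times> nat \<times> bits list \<times> bits list. clean_trans (fst z) (fst (snd z)) (fst (snd (snd z))) (snd (snd (snd z))))"
  unfolding clean_trans_def by (intro fp_concat fp_map fp_intros)

lemma fp_dist_trans:
  assumes "fp (\<lambda>z. idx (fst z) (fst (snd z)) (snd (snd z)))"
  shows "fp (\<lambda>z :: nat \<times> nat \<times> nat \<times> bits list \<times> bits list. dist_trans (fst z) (fst (snd z)) (fst (snd (snd z)))
     (idx (fst z)) R S (fst (snd (snd (snd z)))) (snd (snd (snd (snd z)))))"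
  unfolding dist_trans_def
  by (intro fp_concat fp_map fp_Cons fp_pair fp_requests fp_intros
      ptime_comp[OF assms, of "\<lambda>w :: ((nat \<times> nat \<times> nat \<times> bits list \<times> bits list) \<times> nat) \<times> nat. (fst (fst (fst w)), snd (fst w), snd w)", unfolded fst_conv snd_conv])

lemma fp_spread:
  assumes "fp (\<lambda>z. src (fst z) (snd z))"
  shows "fp (\<lambda>z :: nat \<times> nat \<times> bits list. spread (fst z) (fst (snd z) ^ 3) (src (fst (snd z))) (snd (snd z)))"
  unfolding spread_def
  by (intro fp_concat fp_map fp_blk fp_intros
      ptime_comp[OF assms, of "\<lambda>w :: (nat \<times> nat \<times> bits list) \<times> nat. (fst (snd (fst w)), snd w)", unfolded fst_conv snd_conv])

lemma fp_pass_trans: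
  "fp (\<lambda>z :: nat \<times> nat \<times> nat \<times> bits list \<times> bits list.
     pass_trans (fst z) (fst (snd z)) (fst (snd (snd z))) (fst (snd (snd (snd z)))) (snd (snd (snd (snd z)))))"
proof -
  have i1: "fp (\<lambda>z. idx1 (fst z) (fst (snd z)) (snd (snd z)))" and i2: "fp (\<lambda>z. idx2 (fst z) (fst (snd z)) (snd (snd z)))"
    unfolding idx1_def idx2_def by (intro fp_intros)+
  have s1: "fp (\<lambda>z. src1 (fst z) (snd z))" and s2: "fp (\<lambda>z. src2 (fst z) (snd z))"
    unfolding src1_def src2_def by (intro fp_intros)+
  note C = ptime_comp[OF fp_clean_trans, of "\<lambda>z. (a z, b z, c z, d z)" for a b c d, simplified]
    and D1 = ptime_comp[OF fp_dist_trans[OF i1], of "\<lambda>z. (a z, b z, c z, d z, e z)" for a b c d e, simplified]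
    and D2 = ptime_comp[OF fp_dist_trans[OF i2], of "\<lambda>z. (a z, b z, c z, d z, e z)" for a b c d e, simplified]
    and S1 = ptime_comp[OF fp_spread[OF s1], of "\<lambda>z. (a z, b z, c z)" for a b c, simplified]
    and S2 = ptime_comp[OF fp_spread[OF s2], of "\<lambda>z. (a z, b z, c z)" for a b c, simplified]
  show ?thesis
    unfolding pass_trans_def
    by (rule fp_append D1 D2 C S1 S2 fp_pair fp_fst fp_snd fp_id fp_take fp_drop fp_mult fp_power fp_add)+
qed

lemma fp_fmt [fp_intros]:
  assumes "fp r" and "fp q1" and "fp q2" and "fp cs" and "fp ys"
  shows "fp (\<lambda>x. fmt (r x) (q1 x) (q2 x) (cs x) (ys x))"
proof -
  note P = ptime_comp[OF fp_pass_trans, of "\<lambda>x. (r x, q1 x, q2 x, c x, y x)" for c y, simplified]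
  show ?thesis unfolding fmt_def by (intro fp_intros P assms)
qed

subsection \<open>Checking and decoding arrays\<close>

lemma distinct_full:
  assumes "length xs = n" and "{1..n} \<subseteq> set xs"
  shows "distinct xs" and "set xs = {1..n}"
proof -
  show "set xs = {1..n}" using assms card_length[of xs] by (intro card_seteq[symmetric]) auto
  then show "distinct xs" using assms by (intro card_distinct) simp
qed

text \<open>By the pigeonhole principle a list of length \<open>n\<close> that covers all keys has
  no repetitions. The remaining quantifiers range over lists, so validity can be decided by the
  closure rules.\<close>

lemma valid_array_iff:
  "valid_array n A \<longleftrightarrow> length A = n \<and> (\<forall>x\<in>set [1..<Suc n]. \<exists>e\<in>set A. fst e = x) \<and>
     (\<forall>e\<in>set A. length (snd e) = value_length A)"
proof -
  have s: "set [1..<Suc n] = {1..n}" by auto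
  have "(\<forall>x\<in>{1..n}. \<exists>e\<in>set A. fst e = x) \<longleftrightarrow> {1..n} \<subseteq> set (map fst A)"
    unfolding subset_eq set_map image_iff by (intro ball_cong bex_cong refl eq_commute)
  moreover have "(\<forall>(x, v)\<in>set A. length v = value_length A) \<longleftrightarrow> (\<forall>e\<in>set A. length (snd e) = value_length A)"
    by (simp add: split_beta)
  moreover have "length A = n \<Longrightarrow> {1..n} \<subseteq> set (map fst A) \<Longrightarrow> distinct (map fst A) \<and> fst ` set A = {1..n}"
    using distinct_full[of "map fst A" n] by simp
  ultimately show ?thesis unfolding valid_array_def s by auto
qed

lemma valid_perm_iff:
  "valid_perm n ps \<longleftrightarrow> length ps = n \<and> (\<forall>x\<in>set [1..<Suc n]. \<exists>y\<in>set ps. y = x)"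
proof -
  have s: "set [1..<Suc n] = {1..n}" by auto
  show ?thesis unfolding valid_perm_def s using distinct_full[of ps n] by blast
qed

lemma fp_value_length [fp_intros]: "fp f \<Longrightarrow> fp (\<lambda>x. value_length (f x))"
proof -
  assume "fp f"
  then have "fp (\<lambda>x. case f x of [] \<Rightarrow> 0 | e # es \<Rightarrow> length (snd e))" by (intro fp_intros)
  moreover have "(case A of [] \<Rightarrow> 0 | e # es \<Rightarrow> length (snd e)) = value_length A" for A
    by (auto simp: value_length_def split: list.split)
  ultimately show ?thesis by simp
qed

lemma fp_valid_array [fp_intros]:
  assumes "fp n" and "fp f"
  shows "fp (\<lambda>x. valid_array (n x) (f x))"
  unfolding valid_array_iff by (intro fp_intros assms ptime_comp[OF assms(2)])

lemma fp_valid_perm [fp_intros]: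
  assumes "fp n" and "fp f"
  shows "fp (\<lambda>x. valid_perm (n x) (f x))"
  unfolding valid_perm_iff by (intro fp_intros assms ptime_comp[OF assms(2)])

text \<open>Ill-formed slots are decoded to elements with the illegal key \<open>0\<close>.\<close>

definition decode_elem :: "nat \<Rightarrow> data \<Rightarrow> element" where
  "decode_elem n d = (let m = bits_of_data (car d); v = drop (Suc (key_width n)) m in
     case filter (\<lambda>x. m = real_slot n (x, v)) [1..<Suc n] of [] \<Rightarrow> (0, []) | x # xs \<Rightarrow> (x, v))"

definition decode_array :: "nat \<Rightarrow> data \<Rightarrow> element list" where
  "decode_array n d = map (decode_elem n) (list_of_data d)"

lemma fp_decode_array [fp_intros]: "fp n \<Longrightarrow> fp f \<Longrightarrow> fp (\<lambda>x. decode_array (n x) (f x))"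
proof -
  assume *: "fp n" "fp f"
  have "fp (\<lambda>z. decode_elem (fst z) (snd z))"
    unfolding decode_elem_def Let_def by (intro fp_intros)
  then have "fp (\<lambda>z. decode_elem (n (fst z)) (snd z))"
    by (rule ptime_comp[where G="\<lambda>z. Done (decode_elem (fst z) (snd z))" and f="\<lambda>z. (n (fst z), snd z)",
          unfolded fst_conv snd_conv]) (intro fp_intros ptime_comp[OF *(1) fp_fst1])
  then show ?thesis unfolding decode_array_def by (intro fp_intros *)
qed

lemma decode_elem_Some:
  assumes "fst (decode_elem n (enc z)) \<noteq> 0"
  shows "z = Some (real_slot n (decode_elem n (enc z)))"
proof -
  define m where "m = bits_of_data (car (enc z))"
  define v where "v = drop (Suc (key_width n)) m"
  obtain x xs where f: "filter (\<lambda>x. m = real_slot n (x, v)) [1..<Suc n] = x # xs"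
    using assms unfolding decode_elem_def m_def[symmetric] v_def[symmetric] Let_def
    by (cases "filter (\<lambda>x. m = real_slot n (x, v)) [1..<Suc n]") auto
  then have "x \<in> set (filter (\<lambda>x. m = real_slot n (x, v)) [1..<Suc n])" by simp
  then have m: "m = real_slot n (x, v)" by simp
  moreover have "decode_elem n (enc z) = (x, v)"
    unfolding decode_elem_def m_def[symmetric] v_def[symmetric] Let_def f by simp
  moreover have "z = Some m"
  proof (cases z)
    case None
    then have "m = []" by (simp add: m_def bits_of_data_def)
    then show ?thesis using m by (simp add: real_slot_def)
  qed (simp add: m_def)
  ultimately show ?thesis by simp
qed

lemma decode_elem_real:
  assumes "fst e \<in> {1..n}"
  shows "decode_elem n (enc (Some (real_slot n e))) = e"
proof -
  obtain x v where e: "e = (x, v)" by (cases e)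
  have v: "drop (Suc (key_width n)) (real_slot n (x, v)) = v" by (simp add: real_slot_def)
  have "(real_slot n (x, v) = real_slot n (y, v)) = (y = x)" if "y \<in> set [1..<Suc n]" for y
    using that assms open_real_slot[of "(y, v)" n] open_real_slot[of "(x, v)" n] by (auto simp: e simp del: upt_Suc)
  then have "filter (\<lambda>y. real_slot n (x, v) = real_slot n (y, v)) [1..<Suc n] = filter (\<lambda>y. y = x) [1..<Suc n]"
    by (intro filter_cong) auto
  moreover have x: "x \<in> set (filter (\<lambda>y. y = x) [1..<Suc n])" using assms by (auto simp: e)
  then have "filter (\<lambda>y. y = x) [1..<Suc n] \<noteq> []" by (metis empty_iff list.set(1))
  then obtain y xs where xs: "filter (\<lambda>y. y = x) [1..<Suc n] = y # xs" unfolding neq_Nil_conv by blast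
  then have "y \<in> set (filter (\<lambda>y. y = x) [1..<Suc n])" by simp
  then have "filter (\<lambda>y. y = x) [1..<Suc n] = x # xs" using xs by simp
  ultimately show ?thesis
    unfolding decode_elem_def Let_def e by (simp add: v del: upt_Suc)
qed

lemma decode_array_valid:
  fixes D :: "bits \<Rightarrow> bits option" and n :: nat
  defines "A cs \<equiv> decode_array n (enc (map D cs))"
  shows "valid_enc_array n D cs \<longleftrightarrow> valid_array n (A cs)"
    and "valid_array n (A cs) \<Longrightarrow> map D cs = map (Some \<circ> real_slot n) (A cs)"
    and "valid_array n (A cs) \<Longrightarrow> enc_value_length n D cs = value_length (A cs)"
proof -
  have A: "A cs = map (\<lambda>c. decode_elem n (enc (D c))) cs"
    by (simp add: A_def decode_array_def comp_def)
  show 1: "map D cs = map (Some \<circ> real_slot n) (A cs)" if "valid_array n (A cs)"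
    unfolding A map_map
  proof (rule map_cong[OF refl])
    fix c assume "c \<in> set cs"
    then have "fst (decode_elem n (enc (D c))) \<in> {1..n}"
      using that unfolding valid_array_def A by force
    then show "D c = ((Some \<circ> real_slot n) \<circ> (\<lambda>c. decode_elem n (enc (D c)))) c"
      using decode_elem_Some[of n "D c"] by simp
  qed
  show "valid_enc_array n D cs \<longleftrightarrow> valid_array n (A cs)"
  proof
    assume "valid_enc_array n D cs"
    then obtain B where B: "valid_array n B" "map D cs = map (Some \<circ> real_slot n) B"
      unfolding valid_enc_array_def by auto
    have "A cs = map (\<lambda>z. decode_elem n (enc z)) (map D cs)" by (simp add: A)
    also have "\<dots> = map (\<lambda>e. e) B"
      unfolding B(2) map_map
    proof (rule map_cong[OF refl])
      fix e assume "e \<in> set B"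
      then have "fst e \<in> {1..n}" using B(1) unfolding valid_array_def by blast
      then show "((\<lambda>z. decode_elem n (enc z)) \<circ> (Some \<circ> real_slot n)) e = e" using decode_elem_real[of e n] by simp
    qed
    finally show "valid_array n (A cs)" using B(1) by simp
  next
    assume "valid_array n (A cs)"
    then show "valid_enc_array n D cs" using 1 unfolding valid_enc_array_def by auto
  qed
  show "enc_value_length n D cs = value_length (A cs)" if "valid_array n (A cs)"
  proof -
    have "\<forall>e\<in>set (A cs). fst e \<le> n" using that unfolding valid_array_def by force
    then show ?thesis unfolding enc_value_length_def using real_elements_real[OF 1[OF that]] by simp
  qed
qed

lemma fp_array_of_data [fp_intros]: "fp f \<Longrightarrow> fp (\<lambda>x. array_of_data (f x))"
  unfolding array_of_data_def element_of_data_def by (intro fp_intros)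

lemma fp_perm_list_of_data [fp_intros]: "fp f \<Longrightarrow> fp (\<lambda>x. perm_list_of_data (f x))"
  unfolding perm_list_of_data_def by (intro fp_intros)

subsection \<open>Random permutations\<close>

text \<open>Random insertion: a permutation of \<open>m\<close> numbers has \<open>m + 1\<close>
  gaps, and \<open>Choose m\<close> has exactly \<open>m + 1\<close> outcomes. Gap and shorter
  permutation can be recovered from the result, which is therefore exactly uniform.\<close>

definition rand_perm :: "nat \<Rightarrow> nat list comp" where
  "rand_perm n = foldM (\<lambda>m ps. bind_comp (Choose m Done) (\<lambda>j. Done (take j ps @ Suc m # drop j ps))) [0..<n] []"

lemma rand_perm_outcomes:
  "ps \<in> outcomes (foldM (\<lambda>m ps. bind_comp (Choose m Done) (\<lambda>j. Done (take j ps @ Suc m # drop j ps))) [0..<n] [])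
     \<Longrightarrow> length ps = n \<and> set ps \<subseteq> {1..n}"
proof (induction n arbitrary: ps)
  case (Suc n)
  let ?F = "foldM (\<lambda>m ps. bind_comp (Choose m Done) (\<lambda>j. Done (take j ps @ Suc m # drop j ps))) [0..<n] []"
  have "ps \<in> (\<Union>qs\<in>outcomes ?F. \<Union>j\<le>n. {take j qs @ Suc n # drop j qs})"
    using Suc.prems by (simp add: foldM_append outcomes_bind)
  then obtain qs j where "qs \<in> outcomes ?F" and j: "j \<le> n" and ps: "ps = take j qs @ Suc n # drop j qs" by blast
  then have qs: "length qs = n" "set qs \<subseteq> {1..n}" using Suc.IH[of qs] by auto
  have "set (take j qs) \<union> set (drop j qs) = set qs" by (metis append_take_drop_id set_append)
  then have "set ps = insert (Suc n) (set qs)" unfolding ps by auto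
  then show ?case using qs j ps by auto
qed simp

lemma ptime_rand_perm [fp_intros]:
  assumes "fp f"
  shows "ptime (\<lambda>x. rand_perm (f x))"
proof -
  have "ptime (\<lambda>n. foldM (\<lambda>m ps. bind_comp (Choose m Done) (\<lambda>j. Done (take j ps @ Suc m # drop j ps))) [0..<n] [])"
  proof (rule ptime_foldM)
    show "pmono (\<lambda>n. n * (n + 1))" by (intro pmono_intros)
    fix n xs ys and ps :: "nat list" assume "[0..<n] = xs @ ys"
      and ps: "ps \<in> outcomes (foldM (\<lambda>m ps. bind_comp (Choose m Done) (\<lambda>j. Done (take j ps @ Suc m # drop j ps))) xs [])"
    then have "take (length xs) [0..<n] = xs" and m: "length xs \<le> n"
      by (simp, metis le_add1 length_append length_upt minus_nat.diff_0)
    then have xs: "[0..<length xs] = xs" by (simp add: take_upt)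
    have *: "length ps = length xs \<and> set ps \<subseteq> {1..length xs}"
      by (rule rand_perm_outcomes) (simp only: xs ps)
    have "esize ps \<le> length ps * (n + 1)"
      using * m by (intro esize_list_le) auto
    also have "\<dots> \<le> n * (n + 1)" using * m by (intro mult_le_mono1) simp
    finally show "esize ps \<le> esize n * (esize n + 1)" by simp
  qed (intro fp_intros)+
  from ptime_comp[OF this assms] show ?thesis unfolding rand_perm_def .
qed

lemma finite_valid_perm: "finite {ps. valid_perm n ps}" and ex_valid_perm: "{ps. valid_perm n ps} \<noteq> {}"
proof -
  have "{ps. valid_perm n ps} \<subseteq> {ps. set ps \<subseteq> {1..n} \<and> length ps = n}" by (auto simp: valid_perm_def)
  then show "finite {ps. valid_perm n ps}" by (rule finite_subset) (rule finite_lists_length_eq, simp)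
  have "valid_perm n [1..<Suc n]" by (auto simp: valid_perm_def simp del: upt_Suc)
  then show "{ps. valid_perm n ps} \<noteq> {}" by blast
qed

lemma pair_pmf_of_set:
  assumes "finite A" "A \<noteq> {}" "finite B" "B \<noteq> {}"
  shows "pair_pmf (pmf_of_set A) (pmf_of_set B) = pmf_of_set (A \<times> B)"
proof (rule pmf_eqI)
  fix z show "pmf (pair_pmf (pmf_of_set A) (pmf_of_set B)) z = pmf (pmf_of_set (A \<times> B)) z"
    using assms by (cases z) (simp add: pmf_pair indicator_def card_cartesian_product)
qed

lemma valid_perm_insert:
  assumes v: "valid_perm n ps" and j: "j \<le> n"
  shows "valid_perm (Suc n) (take j ps @ Suc n # drop j ps)"
proof -
  have len: "length ps = n" and dist: "distinct ps" and set: "set ps = {1..n}"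
    using v unfolding valid_perm_def by blast+
  have un: "set (take j ps) \<union> set (drop j ps) = {1..n}" unfolding set[symmetric] by (metis append_take_drop_id set_append)
  have nin: "Suc n \<notin> {1..n}" by simp
  have ins: "insert (Suc n) {1..n} = {1..Suc n}" by (simp add: atLeastAtMostSuc_conv)
  have "set (take j ps @ Suc n # drop j ps) = insert (Suc n) (set (take j ps) \<union> set (drop j ps))" by simp
  also have "\<dots> = {1..Suc n}" by (simp only: un ins)
  finally have 1: "set (take j ps @ Suc n # drop j ps) = {1..Suc n}" .
  have "set (take j ps) \<inter> set (drop j ps) = {}" by (rule set_take_disj_set_drop_if_distinct[OF dist order_refl])
  moreover have "Suc n \<notin> set (take j ps)" "Suc n \<notin> set (drop j ps)" using un nin by blast+
  ultimately have "distinct (take j ps @ Suc n # drop j ps)"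
    unfolding distinct_append distinct.simps list.set using distinct_take[OF dist] distinct_drop[OF dist] by blast
  moreover have "length (take j ps @ Suc n # drop j ps) = Suc n" using len j by simp
  ultimately show ?thesis using 1 unfolding valid_perm_def by blast
qed

lemma bij_betw_insert_at:
  "bij_betw (\<lambda>(ps, j). take j ps @ Suc n # drop j ps) ({ps. valid_perm n ps} \<times> {..n}) {ps. valid_perm (Suc n) ps}"
proof (rule bij_betw_byWitness[where f'="\<lambda>xs. (removeAll (Suc n) xs, length (takeWhile (\<lambda>x. x \<noteq> Suc n) xs))"])
  have nin: "Suc n \<notin> set (take j ps)" "Suc n \<notin> set (drop j ps)" if "valid_perm n ps" for ps j
    using that set_take_subset[of j ps] set_drop_subset[of j ps] by (auto simp: valid_perm_def)
  have un: "set (take j ps) \<union> set (drop j ps) = set ps" for ps :: "nat list" and j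
    by (metis append_take_drop_id set_append)
  show "\<forall>z\<in>{ps. valid_perm n ps} \<times> {..n}. (\<lambda>xs. (removeAll (Suc n) xs, length (takeWhile (\<lambda>x. x \<noteq> Suc n) xs)))
      ((\<lambda>(ps, j). take j ps @ Suc n # drop j ps) z) = z"
  proof (rule ballI)
    fix z :: "nat list \<times> nat" assume "z \<in> {ps. valid_perm n ps} \<times> {..n}"
    then obtain ps j where z: "z = (ps, j)" and v: "valid_perm n ps" and j: "j \<le> n" by auto
    have "takeWhile (\<lambda>x. x \<noteq> Suc n) (take j ps @ Suc n # drop j ps) = take j ps"
      using nin(1)[OF v] by (subst takeWhile_append2) auto
    then show "(\<lambda>xs. (removeAll (Suc n) xs, length (takeWhile (\<lambda>x. x \<noteq> Suc n) xs)))
        ((\<lambda>(ps, j). take j ps @ Suc n # drop j ps) z) = z"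
      using v j nin[OF v, of j] by (simp add: z removeAll_id valid_perm_def)
  qed
  have split: "\<exists>ys zs. xs = ys @ Suc n # zs \<and> Suc n \<notin> set ys \<and> Suc n \<notin> set zs \<and> removeAll (Suc n) xs = ys @ zs
      \<and> takeWhile (\<lambda>x. x \<noteq> Suc n) xs = ys" if "valid_perm (Suc n) xs" for xs
  proof -
    have "Suc n \<in> set xs" and dist: "distinct xs" using that by (auto simp: valid_perm_def)
    from split_list_first[OF this(1)] obtain ys zs where xs: "xs = ys @ Suc n # zs" and y: "Suc n \<notin> set ys" by blast
    have z: "Suc n \<notin> set zs" using dist unfolding xs by simp
    have "takeWhile (\<lambda>x. x \<noteq> Suc n) xs = ys" unfolding xs using y by (subst takeWhile_append2) auto
    moreover have "removeAll (Suc n) xs = ys @ zs" unfolding xs using y z by simp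
    ultimately show ?thesis using xs y z by blast
  qed
  show "\<forall>xs\<in>{ps. valid_perm (Suc n) ps}. (\<lambda>(ps, j). take j ps @ Suc n # drop j ps)
      (removeAll (Suc n) xs, length (takeWhile (\<lambda>x. x \<noteq> Suc n) xs)) = xs"
  proof (rule ballI)
    fix xs assume "xs \<in> {ps. valid_perm (Suc n) ps}"
    then have "valid_perm (Suc n) xs" by simp
    from split[OF this] show "(\<lambda>(ps, j). take j ps @ Suc n # drop j ps) (removeAll (Suc n) xs, length (takeWhile (\<lambda>x. x \<noteq> Suc n) xs)) = xs"
    proof (elim exE conjE)
      fix ys zs assume 1: "xs = ys @ Suc n # zs" and 2: "removeAll (Suc n) xs = ys @ zs" and 3: "takeWhile (\<lambda>x. x \<noteq> Suc n) xs = ys"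
      show ?thesis unfolding 2 3 by (simp add: 1)
    qed
  qed
  show "(\<lambda>(ps, j). take j ps @ Suc n # drop j ps) ` ({ps. valid_perm n ps} \<times> {..n}) \<subseteq> {ps. valid_perm (Suc n) ps}"
  proof (rule image_subsetI)
    fix z :: "nat list \<times> nat" assume "z \<in> {ps. valid_perm n ps} \<times> {..n}"
    then show "(\<lambda>(ps, j). take j ps @ Suc n # drop j ps) z \<in> {ps. valid_perm (Suc n) ps}"
      by (cases z) (simp add: valid_perm_insert)
  qed
  show "(\<lambda>xs. (removeAll (Suc n) xs, length (takeWhile (\<lambda>x. x \<noteq> Suc n) xs))) ` {ps. valid_perm (Suc n) ps}
      \<subseteq> {ps. valid_perm n ps} \<times> {..n}"
  proof (rule image_subsetI)
    fix xs assume "xs \<in> {ps. valid_perm (Suc n) ps}"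
    then have v: "valid_perm (Suc n) xs" by simp
    from split[OF v] show "(removeAll (Suc n) xs, length (takeWhile (\<lambda>x. x \<noteq> Suc n) xs)) \<in> {ps. valid_perm n ps} \<times> {..n}"
    proof (elim exE conjE)
      fix ys zs assume xs: "xs = ys @ Suc n # zs" "Suc n \<notin> set ys" "Suc n \<notin> set zs"
        "removeAll (Suc n) xs = ys @ zs" "takeWhile (\<lambda>x. x \<noteq> Suc n) xs = ys"
      have v': "valid_perm (Suc n) (ys @ Suc n # zs)" using v unfolding xs(1) .
      have "set (ys @ zs) = set (ys @ Suc n # zs) - {Suc n}" using xs(2,3) by auto
      also have "\<dots> = {1..Suc n} - {Suc n}" using v' unfolding valid_perm_def by simp
      also have "\<dots> = {1..n}" by auto
      finally have "set (ys @ zs) = {1..n}" .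
      moreover have "distinct (ys @ zs)" "length (ys @ zs) = n" using v' unfolding valid_perm_def by simp_all
      ultimately show ?thesis unfolding xs(4,5) valid_perm_def by simp
    qed
  qed
qed

lemma interact_rand_perm: "interact orc (rand_perm n) s = map_pmf (\<lambda>ps. (ps, s)) (pmf_of_set {ps. valid_perm n ps})"
proof (induction n)
  case 0
  have "{ps. valid_perm 0 ps} = {[]}" by (auto simp: valid_perm_def)
  then show ?case by (simp add: rand_perm_def pmf_of_set_singleton)
next
  case (Suc n)
  have "interact orc (rand_perm (Suc n)) s = bind_pmf (pmf_of_set {ps. valid_perm n ps}) (\<lambda>ps.
      bind_pmf (pmf_of_set {..n}) (\<lambda>j. return_pmf (take j ps @ Suc n # drop j ps, s)))"
    using Suc by (simp add: rand_perm_def foldM_append interact_bind bind_map_pmf)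
  also have "\<dots> = map_pmf (\<lambda>ps. (ps, s)) (map_pmf (\<lambda>(ps, j). take j ps @ Suc n # drop j ps)
      (pair_pmf (pmf_of_set {ps. valid_perm n ps}) (pmf_of_set {..n})))"
    by (simp add: pair_pmf_def map_bind_pmf map_pmf_def bind_assoc_pmf bind_return_pmf)
  also have "pair_pmf (pmf_of_set {ps. valid_perm n ps}) (pmf_of_set {..n}) = pmf_of_set ({ps. valid_perm n ps} \<times> {..n})"
    by (rule pair_pmf_of_set) (use finite_valid_perm ex_valid_perm in auto)
  also have "map_pmf (\<lambda>(ps, j). take j ps @ Suc n # drop j ps) \<dots> = pmf_of_set {ps. valid_perm (Suc n) ps}"
    by (rule map_pmf_of_set_bij_betw[OF bij_betw_insert_at]) (use finite_valid_perm ex_valid_perm in auto)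
  finally show ?case .
qed

lemma fun_of_perm_list_permutes:
  assumes "valid_perm n ps"
  shows "fun_of_perm_list ps permutes {1..n}"
proof (rule bij_imp_permutes)
  let ?f = "fun_of_perm_list ps"
  have len: "length ps = n" and set: "set ps = {1..n}" using assms by (auto simp: valid_perm_def)
  show "?f x = x" if "x \<notin> {1..n}" for x using that len by (auto simp: fun_of_perm_list_def)
  have sub: "?f ` {1..n} \<subseteq> {1..n}"
  proof (rule image_subsetI)
    fix x assume x: "x \<in> {1..n}"
    then have "x - 1 < length ps" using len by auto
    then have "ps ! (x - 1) \<in> set ps" by (rule nth_mem)
    then show "?f x \<in> {1..n}" using x set len by (simp add: fun_of_perm_list_def)
  qed
  have sup: "{1..n} \<subseteq> ?f ` {1..n}"
  proof
    fix y assume "y \<in> {1..n}"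
    then obtain i where "i < n" "ps ! i = y" using set len by (metis in_set_conv_nth)
    then have "?f (Suc i) = y" "Suc i \<in> {1..n}" using len by (auto simp: fun_of_perm_list_def)
    then show "y \<in> ?f ` {1..n}" by blast
  qed
  show "bij_betw ?f {1..n} {1..n}"
    by (rule bij_betw_imageI[OF finite_surj_inj[OF _ sup]]) (use sub sup in auto)
qed

lemma map_fun_of_perm_list:
  "map_pmf fun_of_perm_list (pmf_of_set {ps. valid_perm n ps}) = pmf_of_set {\<sigma>. \<sigma> permutes {1..n}}"
proof (rule map_pmf_of_set_bij_betw[OF bij_betw_byWitness[where f'="\<lambda>\<sigma>. map \<sigma> [1..<Suc n]"] ex_valid_perm finite_valid_perm])
  show "\<forall>ps\<in>{ps. valid_perm n ps}. map (fun_of_perm_list ps) [1..<Suc n] = ps"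
    by (auto simp: valid_perm_def fun_of_perm_list_def intro!: nth_equalityI simp del: upt_Suc)
  show "\<forall>\<sigma>\<in>{\<sigma>. \<sigma> permutes {1..n}}. fun_of_perm_list (map \<sigma> [1..<Suc n]) = \<sigma>"
  proof (intro ballI ext)
    fix \<sigma> x assume "\<sigma> \<in> {\<sigma>. \<sigma> permutes {1..n}}"
    then show "fun_of_perm_list (map \<sigma> [1..<Suc n]) x = \<sigma> x"
      by (cases "x \<in> {1..n}") (auto simp: fun_of_perm_list_def permutes_def simp del: upt_Suc)
  qed
  show "fun_of_perm_list ` {ps. valid_perm n ps} \<subseteq> {\<sigma>. \<sigma> permutes {1..n}}"
    using fun_of_perm_list_permutes by auto
  show "(\<lambda>\<sigma>. map \<sigma> [1..<Suc n]) ` {\<sigma>. \<sigma> permutes {1..n}} \<subseteq> {ps. valid_perm n ps}"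
  proof (rule image_subsetI)
    fix \<sigma> assume "\<sigma> \<in> {\<sigma>. \<sigma> permutes {1..n}}"
    then have \<sigma>: "\<sigma> permutes {1..n}" by simp
    have s: "set [1..<Suc n] = {1..n}" by auto
    show "map \<sigma> [1..<Suc n] \<in> {ps. valid_perm n ps}"
      using permutes_inj_on[OF \<sigma>] permutes_image[OF \<sigma>]
      unfolding valid_perm_def mem_Collect_eq distinct_map set_map s by (simp del: upt_Suc)
  qed
qed

subsection \<open>The simulator\<close>

definition ask_enc :: "nat \<Rightarrow> bits list \<Rightarrow> bits list comp" where
  "ask_enc N ms = bind_comp (Ask (enc (0::nat, ms)) (\<lambda>r. Done (trunc N r))) (\<lambda>d. Done (bits_list_of_data d))"

text \<open>Parameters of the simulator: \<open>r\<close>, the batch sizes, and a bound on the answers of the oracle.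
  Its state also contains the bit of the challenger and the state of the game.\<close>

type_synonym sim_params = "nat \<times> nat \<times> nat \<times> nat"
type_synonym sim_state = "sim_params \<times> bool \<times> shuffle_state"

text \<open>The messages of a run never depend on earlier ciphertexts, so all of them are computed
  in advance and encrypted by a single query. Overflow is not checked; such runs are accounted for
  by the failure probability.\<close>

definition sim_shuffle :: "sim_params \<Rightarrow> bits list \<Rightarrow> element list \<Rightarrow> nat list \<Rightarrow> data comp" where
  "sim_shuffle P cs A ps = (case P of (r, q1, q2, N) \<Rightarrow> bind_comp (rand_perm (r^4)) (\<lambda>ps1.
     bind_comp (ask_enc N (plan r q1 q2 (value_length A) (fun_of_perm_list ps1) (fun_of_perm_list ps) A))
       (\<lambda>ys. Done (enc (fmt r q1 q2 cs ys)))))"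

definition sim_plain :: "sim_params \<Rightarrow> element list \<Rightarrow> nat list \<Rightarrow> data comp" where
  "sim_plain P A ps = (case P of (r, q1, q2, N) \<Rightarrow>
     bind_comp (ask_enc N (map (real_slot (r^4)) A)) (\<lambda>cs. sim_shuffle P cs A ps))"

primrec sim_query :: "sim_state \<Rightarrow> shuffle_query \<Rightarrow> (data \<times> sim_state) comp" where
  "sim_query st (PlainQ A ps) = (case st of (P, b, ch, lost) \<Rightarrow>
     if \<not> ch \<and> valid_array (fst P ^ 4) A \<and> valid_perm (fst P ^ 4) ps
     then bind_comp (sim_plain P A ps) (\<lambda>d. Done (d, (P, b, ch, lost)))
     else Done (Atom, (P, b, ch, True)))"
| "sim_query st (ShuffleChallengeQ A0 ps0 A1 ps1) = (case st of (P, b, ch, lost) \<Rightarrow>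
     if \<not> ch \<and> valid_array (fst P ^ 4) A0 \<and> valid_perm (fst P ^ 4) ps0 \<and> valid_array (fst P ^ 4) A1 \<and> valid_perm (fst P ^ 4) ps1
        \<and> value_length A0 = value_length A1
     then bind_comp (sim_plain P (if b then A1 else A0) (if b then ps1 else ps0)) (\<lambda>d. Done (d, (P, b, True, lost)))
     else Done (Atom, (P, b, ch, True)))"
| "sim_query st (EncryptedQ cs ps) = (case st of (P, b, ch, lost) \<Rightarrow>
     bind_comp (Ask (enc (1::nat, cs)) (\<lambda>r. Done (trunc (snd (snd (snd P))) r))) (\<lambda>d.
       if ch \<and> length cs = fst P ^ 4 \<and> valid_array (fst P ^ 4) (decode_array (fst P ^ 4) d) \<and> valid_perm (fst P ^ 4) ps
       then bind_comp (sim_shuffle P cs (decode_array (fst P ^ 4) d) ps) (\<lambda>d. Done (d, (P, b, ch, lost)))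
       else Done (Atom, (P, b, ch, True))))"

lemma ptime_ask_enc [fp_intros]: "fp N \<Longrightarrow> fp ms \<Longrightarrow> ptime (\<lambda>x. ask_enc (N x) (ms x))"
  unfolding ask_enc_def by (intro fp_intros)

lemma ptime_sim_shuffle [fp_intros]:
  assumes "fp P" and "fp cs" and "fp A" and "fp ps"
  shows "ptime (\<lambda>x. sim_shuffle (P x) (cs x) (A x) (ps x))"
proof -
  have base: "ptime (\<lambda>z :: sim_params \<times> bits list \<times> element list \<times> nat list.
      sim_shuffle (fst z) (fst (snd z)) (fst (snd (snd z))) (snd (snd (snd z))))"
    unfolding sim_shuffle_def by (intro fp_intros)
  show ?thesis
    by (rule ptime_comp[OF base, of "\<lambda>x. (P x, cs x, A x, ps x)", unfolded fst_conv snd_conv]) (intro fp_pair assms)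
qed

lemma ptime_sim_plain [fp_intros]:
  assumes "fp P" and "fp A" and "fp ps"
  shows "ptime (\<lambda>x. sim_plain (P x) (A x) (ps x))"
proof -
  have base: "ptime (\<lambda>z :: sim_params \<times> element list \<times> nat list. sim_plain (fst z) (fst (snd z)) (snd (snd z)))"
    unfolding sim_plain_def by (intro fp_intros)
  show ?thesis
    by (rule ptime_comp[OF base, of "\<lambda>x. (P x, A x, ps x)", unfolded fst_conv snd_conv]) (intro fp_pair assms)
qed

lemma ptime_sim_query: "ptime (\<lambda>z. sim_query (snd z) (shuffle_query_of_data (fst z)))"
  unfolding shuffle_query_of_data_def Let_def if_distrib[of "sim_query s" for s] sim_query.simps
  by (intro fp_intros)

lemma sim_query_params: "z \<in> outcomes (sim_query st Q) \<Longrightarrow> fst (snd z) = fst st \<and> fst (snd (snd z)) = fst (snd st)"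
  by (cases Q; cases st) (auto simp: outcomes_bind split: if_splits)

definition sim_oracle :: "encryption \<Rightarrow> decryption \<Rightarrow> bits \<Rightarrow> (nat \<Rightarrow> bool) \<Rightarrow> sim_state \<times> lr_state \<Rightarrow> data
    \<Rightarrow> (data \<times> sim_state \<times> lr_state) pmf" where
  "sim_oracle Enc Dec key w s q = map_pmf (\<lambda>((d, st), u). (d, (st, u)))
     (interact (\<lambda>s d. lr_oracle Enc Dec key w s (cpa_query_of_data d)) (sim_query (fst s) (shuffle_query_of_data q)) (snd s))"

text \<open>One key and one security parameter are fixed. \<open>B\<close> is the adversary's
  budget, \<open>V\<close> bounds the values in its arrays, whether written in a query or obtained
  by decryption, and \<open>r ^ 4\<close> also bounds the key width of a slot; \<open>G\<close>
  bounds the ciphertexts of such slots. \<open>N\<close> is large enough for the encryptions of both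
  passes and for the decryptions of one query.\<close>

locale simulation =
  fixes Enc :: encryption and Dec :: decryption and key :: bits and p1 p2 :: real
    and r q1 q2 N B G V :: nat and \<delta> :: real
  assumes DE: "\<And>m c. c \<in> set_pmf (Enc key m) \<Longrightarrow> Dec key c = Some m"
    and q: "q1 = batch_size p1 r" "q2 = batch_size p2 r"
    and Enc_length: "\<And>m c. length m \<le> 1 + r^4 + V \<Longrightarrow> c \<in> set_pmf (Enc key m) \<Longrightarrow> length c \<le> G"
    and Dec_length: "\<And>m c. length c \<le> B \<Longrightarrow> Dec key c = Some m \<Longrightarrow> length m \<le> V"
    and BV: "B \<le> V"
    and N: "(2 * (r^3 * q1 + r^3 * q2 + r^4)) * (2 * G + 2) \<le> N" "B * (2 * V + 2) \<le> N"
    and \<delta>: "\<delta> \<ge> 0"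
    and fail: "\<And>es \<pi>. keyed (r^4) es \<Longrightarrow> \<pi> permutes {1..r^4} \<Longrightarrow>
      measure_pmf.prob (pmf_of_set {\<sigma>. \<sigma> permutes {1..r^4}}) {\<pi>1. \<not> run_good r q1 q2 \<pi>1 \<pi> es} \<le> \<delta>"
begin

abbreviation P :: sim_params where "P \<equiv> (r, q1, q2, N)"

abbreviation lr :: "(nat \<Rightarrow> bool) \<Rightarrow> lr_state \<Rightarrow> data \<Rightarrow> (data \<times> lr_state) pmf" where
  "lr w s d \<equiv> lr_oracle Enc Dec key w s (cpa_query_of_data d)"

lemma interact_ask_enc:
  "interact (lr w) (ask_enc N ms) (i, tab) = map_pmf (\<lambda>cs. (bits_list_of_data (trunc N (enc cs)), (Suc i, zip cs ms @ tab)))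
     (mapM_pmf (Enc key) (if w i then ms else map zeros ms))"
  by (simp add: ask_enc_def interact_bind bind_map_pmf map_pmf_def bind_assoc_pmf bind_return_pmf del: enc_pair)

lemma trunc_fits:
  assumes "cs \<in> set_pmf (mapM_pmf (Enc key) ms)" and "length ms \<le> 2 * (r^3 * q1 + r^3 * q2 + r^4)"
    and "\<And>m. m \<in> set ms \<Longrightarrow> length m \<le> 1 + r^4 + V"
  shows "bits_list_of_data (trunc N (enc cs)) = cs"
proof -
  have l: "list_all2 (\<lambda>c m. c \<in> set_pmf (Enc key m)) cs ms" by (rule mapM_pmf_set[OF assms(1)])
  have "esize cs \<le> length cs * (2 * G + 1)"
  proof (rule esize_list_le)
    fix c assume "c \<in> set cs"
    then obtain i where "i < length cs" "c = cs ! i" by (auto simp: in_set_conv_nth)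
    with l have "ms ! i \<in> set ms" "c \<in> set_pmf (Enc key (ms ! i))" by (auto simp: list_all2_conv_all_nth)
    then have "length c \<le> G" using Enc_length assms(3) by blast
    then show "esize c \<le> 2 * G" using esize_bits[of c] by linarith
  qed
  also have "\<dots> \<le> (2 * (r^3 * q1 + r^3 * q2 + r^4)) * (2 * G + 2)"
    using list_all2_lengthD[OF l] assms(2) by (intro mult_le_mono) auto
  finally show ?thesis using N(1) by (simp add: trunc_enc)
qed

definition tab_ok :: "(bits \<times> bits) list \<Rightarrow> bool" where
  "tab_ok tab \<longleftrightarrow> (\<forall>(c, m)\<in>set tab. Dec key c = Some m)"

lemma tab_ok_zip: "cs \<in> set_pmf (mapM_pmf (Enc key) ms) \<Longrightarrow> tab_ok tab \<Longrightarrow> tab_ok (zip cs ms @ tab)"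
  using DE by (fastforce simp: tab_ok_def list_all2_iff dest!: mapM_pmf_set)

lemma tab_ok_lookup: "tab_ok tab \<Longrightarrow> lookup_dec Dec key tab c = Dec key c"
  by (auto simp: tab_ok_def lookup_dec_def split: option.split dest!: map_of_SomeD)

lemma valid_array_keyed: "valid_array n A \<Longrightarrow> keyed n A"
  by (simp add: valid_array_def keyed_def)

lemma value_lengths: "valid_array n A \<Longrightarrow> e \<in> set A \<Longrightarrow> length (snd e) = value_length A"
  by (auto simp: valid_array_def)

lemma pad_lengths:
  "(\<And>e. e \<in> set es \<Longrightarrow> length (snd e) = L) \<Longrightarrow> m \<in> set (pad n L k es) \<Longrightarrow> length m = 1 + key_width n + L"
  unfolding pad_def by (auto simp: length_slots dest!: in_set_takeD)

lemma pass_msgs_lengths: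
  assumes L: "\<And>e. e \<in> set es \<Longrightarrow> length (snd e) = L" and m: "m \<in> set (pass_msgs r q1 q2 L \<rho> es)"
  shows "length m = 1 + key_width (r^4) + L"
proof -
  have sub: "set (sel1 r \<rho> es w c) \<subseteq> set es" "set (sel2 r \<rho> es w c) \<subseteq> set es" "set (arrange (r^4) \<rho> es) \<subseteq> set es" for w c
    unfolding sel1_def sel2_def arrange_def using set_blk[of _ es] by (auto simp: subset_iff simp del: upt_Suc)
  have "length m = 1 + key_width (r^4) + L" if mem: "m \<in> set (dist_msgs (r^4) L k r bt)" and bt: "\<And>w c. set (bt w c) \<subseteq> set es" for k bt
  proof -
    obtain w c where "m \<in> set (pad (r^4) L k (bt w c))" using mem unfolding dist_msgs_def by auto
    then show ?thesis by (rule pad_lengths[rotated]) (use bt L in blast)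
  qed
  note dist = this
  from m consider "m \<in> set (dist_msgs (r^4) L q1 r (sel1 r \<rho> es))" | "m \<in> set (dist_msgs (r^4) L q2 r (sel2 r \<rho> es))"
    | e where "e \<in> set (arrange (r^4) \<rho> es)" "m = real_slot (r^4) e"
    unfolding pass_msgs_def by auto
  then show ?thesis
  proof cases
    case 1
    then show ?thesis by (rule dist) (rule sub(1))
  next
    case 2
    then show ?thesis by (rule dist) (rule sub(2))
  next
    case 3
    then show ?thesis using sub(3) L[of e] by (auto simp: length_slots)
  qed
qed

lemma plan_lengths:
  assumes A: "valid_array (r^4) A" and ps: "valid_perm (r^4) ps1" "valid_perm (r^4) ps"
  defines "M \<equiv> plan r q1 q2 (value_length A) (fun_of_perm_list ps1) (fun_of_perm_list ps) A"
  shows "length M = 2 * (r^3 * q1 + r^3 * q2 + r^4)" and "m \<in> set M \<Longrightarrow> length m = 1 + key_width (r^4) + value_length A"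
proof -
  note p1 = fun_of_perm_list_permutes[OF ps(1)] and p2 = fun_of_perm_list_permutes[OF ps(2)]
  note k = valid_array_keyed[OF A]
  note k1 = keyed_arrange[OF k p1]
  show "length M = 2 * (r^3 * q1 + r^3 * q2 + r^4)"
    unfolding M_def plan_def using length_pass_msgs[OF k p1] length_pass_msgs[OF k1 p2] by simp
  have "length (snd e) = value_length A" if "e \<in> set (arrange (r^4) (fun_of_perm_list ps1) A)" for e
    using that arrange_perm(2)[OF k p1] value_lengths[OF A] by simp
  then show "m \<in> set M \<Longrightarrow> length m = 1 + key_width (r^4) + value_length A"
    unfolding M_def plan_def set_append
    by (elim UnE) (erule pass_msgs_lengths[rotated]; use value_lengths[OF A] in blast)+
qed

text \<open>Both sides are coupled through the same first permutation, given as a list. If it is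
  good, the real and the simulated run are the same function of the same encryptions; the other
  permutations have probability at most \<open>\<delta>\<close>.\<close>

lemma sim_shuffle_hop:
  assumes A: "valid_array (r^4) A" and ps: "valid_perm (r^4) ps" and L: "value_length A \<le> V"
    and cs: "map (Dec key) cs = map (Some \<circ> real_slot (r^4)) A" and tab: "tab_ok tab"
  shows "hop (ennreal \<delta>) (\<lambda>z x. enc z = fst x \<and> tab_ok (snd (snd x)))
     (optim_shuffle Enc Dec p1 p2 r (value_length A) key (fun_of_perm_list ps) cs)
     (interact (lr (\<lambda>_. True)) (sim_shuffle P cs A ps) (i, tab))"
proof -
  let ?L = "value_length A" and ?\<pi> = "fun_of_perm_list ps" and ?V = "pmf_of_set {ps. valid_perm (r^4) ps}"
  note k = valid_array_keyed[OF A] and \<pi> = fun_of_perm_list_permutes[OF ps]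
  have setV: "set_pmf ?V = {ps. valid_perm (r^4) ps}" by (rule set_pmf_of_set[OF ex_valid_perm finite_valid_perm])
  have kw: "1 + key_width (r^4) + ?L \<le> 1 + r^4 + V" using key_width_le[of "r^4"] L by linarith
  from shuffle_plan[where Enc=Enc and key=key and Dec=Dec and r=r and es=A and \<pi>="?\<pi>" and cs=cs and L="?L"
        and ?p1.0=p1 and ?p2.0=p2, OF DE k \<pi> cs, folded q]
  obtain X where X: "optim_shuffle Enc Dec p1 p2 r ?L key ?\<pi> cs = bind_pmf (pmf_of_set {\<sigma>. \<sigma> permutes {1..r^4}}) X"
    and good: "\<And>\<pi>1. \<pi>1 permutes {1..r^4} \<Longrightarrow> run_good r q1 q2 \<pi>1 ?\<pi> A \<Longrightarrow>
           X \<pi>1 = map_pmf (fmt r q1 q2 cs) (mapM_pmf (Enc key) (plan r q1 q2 ?L \<pi>1 ?\<pi> A))"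
    by metis
  have 1: "optim_shuffle Enc Dec p1 p2 r ?L key ?\<pi> cs = bind_pmf ?V (\<lambda>ps1. X (fun_of_perm_list ps1))"
    unfolding X map_fun_of_perm_list[symmetric] bind_map_pmf ..
  have 2: "interact (lr (\<lambda>_. True)) (sim_shuffle P cs A ps) (i, tab) = bind_pmf ?V (\<lambda>ps1.
      map_pmf (\<lambda>ys. (enc (fmt r q1 q2 cs (bits_list_of_data (trunc N (enc ys)))),
          (Suc i, zip ys (plan r q1 q2 ?L (fun_of_perm_list ps1) ?\<pi> A) @ tab)))
        (mapM_pmf (Enc key) (plan r q1 q2 ?L (fun_of_perm_list ps1) ?\<pi> A)))"
    by (simp add: sim_shuffle_def interact_bind interact_rand_perm interact_ask_enc bind_map_pmf map_pmf_def
        bind_assoc_pmf bind_return_pmf)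
  let ?good = "\<lambda>ps1. run_good r q1 q2 (fun_of_perm_list ps1) ?\<pi> A"
  have "hop (ennreal \<delta> + 0) (\<lambda>z x. enc z = fst x \<and> tab_ok (snd (snd x)))
     (optim_shuffle Enc Dec p1 p2 r ?L key ?\<pi> cs)
     (interact (lr (\<lambda>_. True)) (sim_shuffle P cs A ps) (i, tab))"
    unfolding 1 2
  proof (rule hop_bind[where R="\<lambda>x y. x = y \<and> ?good x"])
    have "measure_pmf.prob ?V {ps1. \<not> ?good ps1} = measure_pmf.prob (map_pmf fun_of_perm_list ?V) {\<pi>1. \<not> run_good r q1 q2 \<pi>1 ?\<pi> A}"
      by (simp add: vimage_def)
    also have "\<dots> \<le> \<delta>" unfolding map_fun_of_perm_list by (rule fail[OF k \<pi>])
    finally show "hop (ennreal \<delta>) (\<lambda>x y. x = y \<and> ?good x) ?V ?V"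
      by (intro hop_bad) (simp add: measure_pmf.emeasure_eq_measure ennreal_leI)
    fix x y assume "x \<in> set_pmf ?V" and "y \<in> set_pmf ?V" and "x = y \<and> ?good x"
    then have v: "valid_perm (r^4) x" and g: "?good x" and y: "y = x" unfolding setV by auto
    let ?M = "plan r q1 q2 ?L (fun_of_perm_list x) ?\<pi> A"
    have fits: "bits_list_of_data (trunc N (enc ys)) = ys" if "ys \<in> set_pmf (mapM_pmf (Enc key) ?M)" for ys
      using that kw plan_lengths(1)[OF A v ps] by (intro trunc_fits[where ms="?M"]) (auto dest!: plan_lengths(2)[OF A v ps])
    show "hop 0 (\<lambda>z x. enc z = fst x \<and> tab_ok (snd (snd x))) (X (fun_of_perm_list x))
        (map_pmf (\<lambda>ys. (enc (fmt r q1 q2 cs (bits_list_of_data (trunc N (enc ys)))),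
          (Suc i, zip ys (plan r q1 q2 ?L (fun_of_perm_list y) ?\<pi> A) @ tab)))
        (mapM_pmf (Enc key) (plan r q1 q2 ?L (fun_of_perm_list y) ?\<pi> A)))"
      unfolding y good[OF fun_of_perm_list_permutes[OF v] g]
      by (rule hop_rel_pmf) (auto simp: pmf.rel_map fits tab_ok_zip[OF _ tab] intro!: rel_pmf_reflI)
  qed
  then show ?thesis by simp
qed

lemma plain_messages:
  assumes "valid_array (r^4) A" and "m \<in> set (map (real_slot (r^4)) A)"
  shows "length m = 1 + key_width (r^4) + value_length A"
  using assms(2) value_lengths[OF assms(1)] by (auto simp: length_slots)

lemma sim_plain_hop:
  assumes A: "valid_array (r^4) A" and ps: "valid_perm (r^4) ps" and L: "value_length A \<le> V" and tab: "tab_ok tab"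
  shows "hop (ennreal \<delta>) (\<lambda>d x. d = fst x \<and> tab_ok (snd (snd x)))
     (shuffle_plain Enc (r^4) (\<lambda>L. optim_shuffle Enc Dec p1 p2 r L) key A ps)
     (interact (lr (\<lambda>_. True)) (sim_plain P A ps) (i, tab))"
proof -
  let ?M = "map (real_slot (r^4)) A"
  have "length A = r^4" using A by (simp add: valid_array_def)
  then have fits: "bits_list_of_data (trunc N (enc cs)) = cs" if "cs \<in> set_pmf (mapM_pmf (Enc key) ?M)" for cs
    using that key_width_le[of "r^4"] L plain_messages[OF A] by (intro trunc_fits[where ms="?M"]) (auto simp del: set_map)
  have "interact (lr (\<lambda>_. True)) (sim_plain P A ps) (i, tab) = bind_pmf (mapM_pmf (Enc key) ?M) (\<lambda>cs.
      interact (lr (\<lambda>_. True)) (sim_shuffle P (bits_list_of_data (trunc N (enc cs))) A ps) (Suc i, zip cs ?M @ tab))"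
    by (simp add: sim_plain_def interact_bind interact_ask_enc bind_map_pmf)
  moreover have "hop (0 + ennreal \<delta>) (\<lambda>d x. d = fst x \<and> tab_ok (snd (snd x)))
     (shuffle_plain Enc (r^4) (\<lambda>L. optim_shuffle Enc Dec p1 p2 r L) key A ps) \<dots>"
    unfolding shuffle_plain_def
  proof (rule hop_bind[where R="(=)"])
    show "hop 0 (=) (mapM_pmf (Enc key) ?M) (mapM_pmf (Enc key) ?M)"
      by (rule hop_rel_pmf) (simp add: pmf.rel_eq)
    fix cs cs' assume cs: "cs \<in> set_pmf (mapM_pmf (Enc key) ?M)" and "cs = cs'"
    have D: "map (Dec key) cs = map (Some \<circ> real_slot (r^4)) A"
      using mapM_pmf_Dec[of "Enc key" "Dec key" cs ?M, OF DE cs] by simp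
    have "hop (ennreal \<delta> + 0) (\<lambda>d x. d = fst x \<and> tab_ok (snd (snd x)))
      (bind_pmf (optim_shuffle Enc Dec p1 p2 r (value_length A) key (fun_of_perm_list ps) cs) (\<lambda>z. return_pmf (data_of_run z)))
      (bind_pmf (interact (lr (\<lambda>_. True)) (sim_shuffle P cs A ps) (Suc i, zip cs ?M @ tab)) return_pmf)"
      by (rule hop_bind[OF sim_shuffle_hop[OF A ps L D tab_ok_zip[OF cs tab]]])
         (auto intro!: hop_all simp: data_of_run_enc)
    then show "hop (ennreal \<delta>) (\<lambda>d x. d = fst x \<and> tab_ok (snd (snd x)))
       (map_pmf data_of_run (optim_shuffle Enc Dec p1 p2 r (value_length A) key (fun_of_perm_list ps) cs))
       (interact (lr (\<lambda>_. True)) (sim_shuffle P (bits_list_of_data (trunc N (enc cs'))) A ps) (Suc i, zip cs' ?M @ tab))"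
      using fits[OF cs] by (simp add: \<open>cs = cs'\<close>[symmetric] map_pmf_def bind_return_pmf')
  qed
  ultimately show ?thesis by simp
qed

lemma esize_cdr_array: "e \<in> set (array_of_data d) \<Longrightarrow> length (snd e) \<le> size d"
proof (induction d)
  case (Cell x y)
  have "length (bits_of_data (cdr x)) \<le> size x"
    using length_le_esize[of "bits_of_data (cdr x)"] esize_bits_of_data[of "cdr x"] size_car_cdr[of x] by linarith
  then show ?case using Cell by (auto simp: array_of_data_def element_of_data_def)
qed (simp add: array_of_data_def)

lemma value_length_array: "value_length (array_of_data d) \<le> size d"
proof (cases "array_of_data d")
  case (Cons e es)
  then show ?thesis using esize_cdr_array[of e d] by (cases e) (simp add: value_length_def)
qed (simp add: value_length_def)

definition real_rel :: "bool \<Rightarrow> nat \<Rightarrow> shuffle_state \<Rightarrow> sim_state \<times> lr_state \<Rightarrow> bool" where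
  "real_rel b t s s' \<longleftrightarrow> t \<le> B \<and> fst s' = (P, b, s) \<and> tab_ok (snd (snd s'))"

lemma dec_answer_size:
  fixes f :: "bits \<Rightarrow> bits option"
  assumes "\<And>c m. c \<in> set cs \<Longrightarrow> f c = Some m \<Longrightarrow> length m \<le> V" and "length cs \<le> B"
  shows "esize (map f cs) \<le> N"
proof -
  have "esize (map f cs) \<le> length (map f cs) * ((2 * V + 1) + 1)"
  proof (rule esize_list_le)
    fix z assume "z \<in> set (map f cs)"
    then obtain c where c: "c \<in> set cs" "z = f c" by auto
    show "esize z \<le> 2 * V + 1"
    proof (cases z)
      case (Some m)
      then have "length m \<le> V" using assms(1)[OF c(1)] c(2) by simp
      then show ?thesis using esize_bits[of m] Some by simp
    qed simp
  qed
  also have "\<dots> \<le> B * (2 * V + 2)" using assms(2) by (intro mult_le_mono) simp_all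
  finally show ?thesis using N(2) by linarith
qed

lemma real_step:
  assumes R: "real_rel b t s s'" and q: "size d < t"
  shows "hop (ennreal \<delta>) (\<lambda>z1 z2. fst z1 = fst z2 \<and> real_rel b (t - 1 - size d) (snd z1) (snd z2))
     (shuffle_oracle Enc Dec (r^4) (optim_shuffle Enc Dec p1 p2 r) key b s (shuffle_query_of_data d))
     (sim_oracle Enc Dec key (\<lambda>_. True) s' d)"
proof -
  obtain ch lost where s: "s = (ch, lost)" by (cases s)
  obtain i tab where s': "s' = ((P, b, ch, lost), (i, tab))" and tab: "tab_ok tab"
    using R by (cases s') (auto simp: real_rel_def s)
  have t: "t \<le> B" "size d \<le> B" using R q by (auto simp: real_rel_def)
  let ?R = "\<lambda>z1 z2. fst z1 = fst z2 \<and> real_rel b (t - 1 - size d) (snd z1) (snd z2)"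
  have lose: "hop (ennreal \<delta>) ?R (return_pmf (Atom, (ch, True))) (return_pmf (Atom, ((P, b, ch, True), (i, tab))))"
    by (rule hop_mono[OF hop_all[where R="?R"]]) (use t tab in \<open>auto simp: real_rel_def\<close>)
  have wrap: "hop (ennreal \<delta>) ?R (map_pmf (\<lambda>d. (f d, (ch', lost))) X)
        (map_pmf (\<lambda>((d, st), u). (d, (st, u))) (interact (lr w) (bind_comp Y (\<lambda>d. Done (d, (P, b, ch', lost)))) u))"
    if "hop (ennreal \<delta>) (\<lambda>d x. f d = fst x \<and> tab_ok (snd (snd x))) X (interact (lr w) Y u)" for f X w Y u ch'
  proof -
    have "hop (ennreal \<delta> + 0) ?R (bind_pmf X (\<lambda>d. return_pmf (f d, (ch', lost))))
       (bind_pmf (interact (lr w) Y u) (\<lambda>x. return_pmf (fst x, ((P, b, ch', lost), snd x))))"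
      by (rule hop_bind[OF that]) (use t in \<open>auto intro!: hop_all simp: real_rel_def\<close>)
    moreover have "map_pmf (\<lambda>((d, st), u). (d, (st, u))) (interact (lr w) (bind_comp Y (\<lambda>d. Done (d, (P, b, ch', lost)))) u)
      = bind_pmf (interact (lr w) Y u) (\<lambda>x. return_pmf (fst x, ((P, b, ch', lost), snd x)))"
      unfolding interact_bind map_bind_pmf by (simp add: split_def)
    moreover have "map_pmf (\<lambda>d. (f d, (ch', lost))) X = bind_pmf X (\<lambda>d. return_pmf (f d, (ch', lost)))"
      by (simp add: map_pmf_def)
    ultimately show ?thesis by (simp only: add_0_right)
  qed
  let ?a = "cdr d"
  have sz: "size ?a \<le> B" "size (car ?a) \<le> B" "size (cdr ?a) \<le> B" "size (car (car ?a)) \<le> B" "size (car (cdr ?a)) \<le> B"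
    using t size_car_cdr[of d] size_car_cdr[of ?a] size_car_cdr[of "car ?a"] size_car_cdr[of "cdr ?a"] by linarith+
  have vl: "value_length (array_of_data x) \<le> V" if "size x \<le> B" for x
    using value_length_array[of x] that BV by linarith
  consider "nat_of_data (car d) = 0" | "nat_of_data (car d) = 1" | "nat_of_data (car d) > 1" by linarith
  then show ?thesis
  proof cases
    case 1
    then have Q: "shuffle_query_of_data d = PlainQ (array_of_data (car ?a)) (perm_list_of_data (cdr ?a))"
      by (simp add: shuffle_query_of_data_def Let_def)
    show ?thesis
    proof (cases "\<not> ch \<and> valid_array (r^4) (array_of_data (car ?a)) \<and> valid_perm (r^4) (perm_list_of_data (cdr ?a))")
      case True
      then show ?thesis unfolding sim_oracle_def Q s s'
        using wrap[OF sim_plain_hop[of "array_of_data (car ?a)" "perm_list_of_data (cdr ?a)" tab i, OF _ _ vl[OF sz(2)] tab]]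
        by simp
    next
      case False
      then show ?thesis unfolding sim_oracle_def Q s s' using lose by auto
    qed
  next
    case 2
    let ?A0 = "array_of_data (car (car ?a))" and ?A1 = "array_of_data (car (cdr ?a))"
    let ?p0 = "perm_list_of_data (cdr (car ?a))" and ?p1 = "perm_list_of_data (cdr (cdr ?a))"
    have Q: "shuffle_query_of_data d = ShuffleChallengeQ ?A0 ?p0 ?A1 ?p1"
      using 2 by (simp add: shuffle_query_of_data_def Let_def)
    show ?thesis
    proof (cases "\<not> ch \<and> valid_array (r^4) ?A0 \<and> valid_perm (r^4) ?p0 \<and> valid_array (r^4) ?A1 \<and> valid_perm (r^4) ?p1
         \<and> value_length ?A0 = value_length ?A1")
      case True
      then show ?thesis unfolding sim_oracle_def Q s s'
        using wrap[OF sim_plain_hop[of "if b then ?A1 else ?A0" "if b then ?p1 else ?p0" tab i, OF _ _ _ tab]]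
          vl[OF sz(4)] vl[OF sz(5)] by (cases b) simp_all
    next
      case False
      then show ?thesis unfolding sim_oracle_def Q s s' using lose by auto
    qed
  next
    case 3
    let ?cs = "bits_list_of_data (car ?a)" and ?ps = "perm_list_of_data (cdr ?a)"
    have Q: "shuffle_query_of_data d = EncryptedQ ?cs ?ps"
      using 3 by (simp add: shuffle_query_of_data_def Let_def)
    let ?A = "decode_array (r^4) (enc (map (Dec key) ?cs))"
    have cs: "esize ?cs \<le> B" using esize_bits_list_of_data[of "car ?a"] sz(2) by linarith
    then have lc: "length ?cs \<le> B" "\<And>c. c \<in> set ?cs \<Longrightarrow> length c \<le> B"
      using length_le_esize[of ?cs] length_le_esize_mem[of _ ?cs] by (auto intro: order_trans)
    have tr: "trunc N (enc (map (Dec key) ?cs)) = enc (map (Dec key) ?cs)"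
      by (intro trunc_enc dec_answer_size lc) (use Dec_length lc in blast)
    have dec: "interact (lr (\<lambda>_. True)) (sim_query (P, b, ch, lost) (EncryptedQ ?cs ?ps)) (i, tab)
      = interact (lr (\<lambda>_. True)) (if ch \<and> length ?cs = r^4 \<and> valid_array (r^4) ?A \<and> valid_perm (r^4) ?ps
         then bind_comp (sim_shuffle P ?cs ?A ?ps) (\<lambda>d. Done (d, (P, b, ch, lost)))
         else Done (Atom, (P, b, ch, True))) (i, tab)"
      by (simp add: interact_bind bind_return_pmf tr tab_ok_lookup[OF tab, abs_def] del: enc_pair enc_Suc)
    have len: "length ?cs = r^4" if "valid_array (r^4) ?A"
      using that by (simp add: valid_array_def decode_array_def)
    show ?thesis
    proof (cases "ch \<and> valid_array (r^4) ?A \<and> valid_perm (r^4) ?ps")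
      case True
      note D = decode_array_valid[of "r^4" "Dec key" ?cs]
      have vA: "valid_array (r^4) ?A" using True by blast
      \<comment> \<open>The values are not written in the query, so their length is read off from
        the first slot, which is the decryption of a ciphertext in the query.\<close>
      have L: "value_length ?A \<le> V"
      proof (cases ?A)
        case (Cons e es)
        then obtain c cs' where c: "?cs = c # cs'" by (cases ?cs) (auto simp: decode_array_def)
        have "map (Dec key) ?cs = map (Some \<circ> real_slot (r^4)) (e # es)" by (rule D(2)[OF vA, unfolded Cons])
        then have "hd (map (Dec key) ?cs) = Some (real_slot (r^4) e)" by simp
        moreover have "hd (map (Dec key) ?cs) = Dec key c" by (simp only: c list.map list.sel(1))
        ultimately have "Dec key c = Some (real_slot (r^4) e)" by simp
        then have "length (real_slot (r^4) e) \<le> V" using Dec_length lc(2)[of c] by (simp add: c)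
        then show ?thesis by (cases e) (simp add: Cons value_length_def length_slots)
      qed (simp add: value_length_def)
      have "hop (ennreal \<delta>) (\<lambda>z x. data_of_run z = fst x \<and> tab_ok (snd (snd x)))
        (optim_shuffle Enc Dec p1 p2 r (value_length ?A) key (fun_of_perm_list ?ps) ?cs)
        (interact (lr (\<lambda>_. True)) (sim_shuffle P ?cs ?A ?ps) (i, tab))"
        unfolding data_of_run_enc using True by (intro sim_shuffle_hop L tab D(2)) auto
      note W = wrap[OF this, of ch]
      have 1: "shuffle_oracle Enc Dec (r^4) (optim_shuffle Enc Dec p1 p2 r) key b (ch, lost) (EncryptedQ ?cs ?ps)
        = map_pmf (\<lambda>z. (data_of_run z, (ch, lost))) (optim_shuffle Enc Dec p1 p2 r (value_length ?A) key (fun_of_perm_list ?ps) ?cs)"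
        unfolding shuffle_oracle.simps D(1) D(3)[OF vA] by (rule if_P) (rule True)
      have 2: "(if ch \<and> length ?cs = r^4 \<and> valid_array (r^4) ?A \<and> valid_perm (r^4) ?ps
         then bind_comp (sim_shuffle P ?cs ?A ?ps) (\<lambda>d. Done (d, (P, b, ch, lost)))
         else Done (Atom, (P, b, ch, True))) = bind_comp (sim_shuffle P ?cs ?A ?ps) (\<lambda>d. Done (d, (P, b, ch, lost)))"
        by (rule if_P) (use True len in blast)
      show ?thesis
        unfolding sim_oracle_def Q s s' fst_conv snd_conv dec 1 2 by (rule W)
    next
      case False
      have 1: "shuffle_oracle Enc Dec (r^4) (optim_shuffle Enc Dec p1 p2 r) key b (ch, lost) (EncryptedQ ?cs ?ps)
        = return_pmf (Atom, (ch, True))"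
        unfolding shuffle_oracle.simps decode_array_valid(1) by (rule if_not_P) (rule False)
      have 2: "(if ch \<and> length ?cs = r^4 \<and> valid_array (r^4) ?A \<and> valid_perm (r^4) ?ps
         then bind_comp (sim_shuffle P ?cs ?A ?ps) (\<lambda>d. Done (d, (P, b, ch, lost)))
         else Done (Atom, (P, b, ch, True))) = Done (Atom, (P, b, ch, True))"
        by (rule if_not_P) (use False in blast)
      show ?thesis
        unfolding sim_oracle_def Q s s' fst_conv snd_conv dec 1 2 using lose by simp
    qed
  qed
qed

end

section \<open>Adversaries with a simulated oracle are adversaries\<close>

section \<open>Compiled adversaries\<close>

lemma subst_comp_inv:
  assumes "\<And>t s q r s'. I t s \<Longrightarrow> size q < t \<Longrightarrow> (r, s') \<in> outcomes (h q s) \<Longrightarrow> I (t - 1 - size q) s'"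
    and "paced m t" and "I t s" and "z \<in> outcomes (subst_comp h m s)"
  shows "\<exists>t. I t (snd z)"
  using assms(2-4)
proof (induction m arbitrary: t s)
  case (Choose n f)
  then obtain i where "z \<in> outcomes (subst_comp h (f i) s)" by auto
  then show ?case using Choose.prems by (intro Choose.IH[OF rangeI, of i t s]) auto
next
  case (Ask q f)
  then obtain y where y: "y \<in> outcomes (h q s)" "z \<in> outcomes (subst_comp h (f (fst y)) (snd y))"
    by (auto simp: outcomes_bind)
  have "I (t - 1 - size q) (snd y)"
    by (rule assms(1)[of t s q "fst y"]) (use Ask.prems y in auto)
  then show ?case using Ask.prems y(2) by (intro Ask.IH[OF rangeI, of "fst y" "t - 1 - size q" "snd y"]) auto
qed auto

text \<open>The invariant has to bound the handler state throughout the run: handler calls and the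
  final verdict are polynomial only in the size of this state.\<close>

lemma compile_ppt:
  fixes init :: "nat \<Rightarrow> 's::codable comp" and h :: "data \<Rightarrow> 's \<Rightarrow> (data \<times> 's) comp" and fin :: "bool \<times> 's \<Rightarrow> bool"
  assumes p: "ppt p T" and init: "ptime init" and h: "ptime (\<lambda>z. h (fst z) (snd z))" and fin: "fp fin"
    and I0: "\<And>k s. s \<in> outcomes (init k) \<Longrightarrow> I k (T k) s"
    and I_step: "\<And>k t s q r s'. I k t s \<Longrightarrow> size q < t \<Longrightarrow> (r, s') \<in> outcomes (h q s) \<Longrightarrow> I k (t - 1 - size q) s'"
    and I_mono: "\<And>k t t' s. I k t s \<Longrightarrow> t' \<le> t \<Longrightarrow> I k t' s"
    and S: "pmono S" "\<And>k t s. I k t s \<Longrightarrow> esize s + t \<le> S k"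
  obtains B TB where "ppt B TB"
    and "\<And>k. crel (\<lambda>z b. \<exists>t'. z = Some (enc b, t')) (exec B (enc k) (TB k))
      (bind_comp (init k) (\<lambda>s. bind_comp (subst_comp h (exec p (enc k) (T k)) s)
         (\<lambda>z. Done (fin (bool_of_data (the_or Atom (map_option fst (fst z))), snd z)))))"
proof -
  obtain a where a: "\<And>k. T k \<le> k ^ a + a" using p unfolding ppt_def poly_bounded_def by auto
  have "ptime (\<lambda>k. bind_comp (init k) (\<lambda>s. Done (k, s)))"
    by (rule ptime_bind[where G="\<lambda>k s. Done (k, s)", OF init]) (intro fp_intros)
  then obtain ip gi where ip: "pmono gi" "\<And>k. runs (exec ip (enc k)) (gi k) (bind_comp (init k) (\<lambda>s. Done (k, s)))"
    by (rule ptimeE) auto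
  obtain H gh where H: "pmono gh" "\<And>q s. runs (exec H (enc (q, s))) (gh (esize (q, s))) (h q s)"
    using h by (rule ptimeE) (metis fst_conv snd_conv)
  obtain fi gf where fi: "pmono gf" "\<And>z. runs (exec fi (enc z)) (gf (esize z)) (Done (fin z))"
    using fin by (rule ptimeE) auto
  \<comment> \<open>The adversary's output is an arbitrary tree; it is normalised to the code of a
    truth value before \<open>fin\<close> reads it.\<close>
  define conv where "conv = Fork (Seq Car (Cond Id (Fork Nul Nul) Nul)) Cdr"
  define K where "K k = gh (Suc (S k + S k))" for k
  define B where "B = Seq ip (Seq (compile H p) (Seq conv fi))"
  define TB where "TB k = Suc (gi k + Suc ((K k + 40) * (k ^ a + a) + Suc (10 + gf (S k + 2))))" for k
  define out where "out k s = bind_comp (subst_comp h (exec p (enc k) (T k)) s)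
         (\<lambda>z. Done (fin (bool_of_data (the_or Atom (map_option fst (fst z))), snd z)))" for k s
  have TBp: "pmono TB" unfolding TB_def K_def
    by (intro pmono_intros pmono_comp[OF H(1)] pmono_comp[OF fi(1)] S ip)
  have conv: "runs (exec conv (enc (y, s))) 10 (Done (bool_of_data y, s))" for y :: data and s :: 's
    unfolding runs_def conv_def crel_Done_iff
    by (cases y) (auto simp: pay_def and_then_def enc_bool_def)
  have runH: "runs (exec H (Cell q (enc s))) (K k) (h q s)" if "I k t s" "size q < t" for k q s t
  proof -
    have "esize (q, s) \<le> Suc (S k + S k)" using that S(2)[OF that(1)] by simp
    then have "gh (esize (q, s)) \<le> K k" unfolding K_def by (rule pmonoD[OF H(1)])
    with H(2)[of q s] show ?thesis by (auto intro: runs_mono)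
  qed
  have runB: "runs (exec B (enc k)) (TB k) (bind_comp (init k) (out k))" for k
  proof -
    have "runs (exec (Seq (compile H p) (Seq conv fi)) (enc z)) (Suc ((K k + 40) * (k ^ a + a) + Suc (10 + gf (S k + 2)))) (out k (snd z))"
      if "z \<in> outcomes (bind_comp (init k) (\<lambda>s. Done (k, s)))" for z
    proof -
      from that obtain s where z: "z = (k, s)" and s: "s \<in> outcomes (init k)" by (auto simp: outcomes_bind)
      have "None \<notin> outcomes (exec p (enc k) (T k))" using p unfolding ppt_def by (simp add: enc_nat_def)
      then have nn: "None \<notin> fst ` outcomes (subst_comp h (exec p (enc k) (T k)) s)"
        using outcomes_subst_comp by force
      let ?M = "bind_comp (subst_comp h (exec p (enc k) (T k)) s) (\<lambda>z. Done (the_or Atom (map_option fst (fst z)), snd z))"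
      have "runs (exec (compile H p) (Cell (enc k) (enc s))) ((K k + 40) * T k) ?M"
        by (rule runs_compile[where I="I k", OF runH I_step I_mono I0[OF s] nn])
      moreover have "(K k + 40) * T k \<le> (K k + 40) * (k ^ a + a)" by (rule mult_le_mono2[OF a])
      ultimately have 1: "runs (exec (compile H p) (enc z)) ((K k + 40) * (k ^ a + a)) ?M"
        unfolding z enc_pair[of k] by (rule runs_mono)
      have "runs (exec (Seq (compile H p) (Seq conv fi)) (enc z)) (Suc ((K k + 40) * (k ^ a + a) + Suc (10 + gf (S k + 2))))
        (bind_comp ?M (\<lambda>w. Done (fin (bool_of_data (fst w), snd w))))"
      proof (rule runs_Seq[OF 1])
        fix w assume "w \<in> outcomes ?M"
        then obtain x where x: "x \<in> outcomes (subst_comp h (exec p (enc k) (T k)) s)" and w: "snd w = snd x"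
          by (auto simp: outcomes_bind)
        have "\<exists>t. I k t (snd x)"
          by (rule subst_comp_inv[where I="I k" and h=h, OF _ paced_exec I0[OF s] x]) (rule I_step)
        then obtain t where "I k t (snd w)" unfolding w by blast
        from S(2)[OF this] have "esize (bool_of_data (fst w), snd w) \<le> S k + 2"
          using esize_bool[of "bool_of_data (fst w)"] by simp
        then have "gf (esize (bool_of_data (fst w), snd w)) \<le> gf (S k + 2)" by (rule pmonoD[OF fi(1)])
        then have le: "Suc (10 + gf (esize (bool_of_data (fst w), snd w))) \<le> Suc (10 + gf (S k + 2))" by simp
        have "runs (exec (Seq conv fi) (enc (fst w, snd w))) (Suc (10 + gf (esize (bool_of_data (fst w), snd w))))
            (Done (fin (bool_of_data (fst w), snd w)))"
          by (rule runs_Seq_Done[OF conv fi(2)])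
        from runs_mono[OF this le] show "runs (exec (Seq conv fi) (enc w)) (Suc (10 + gf (S k + 2))) (Done (fin (bool_of_data (fst w), snd w)))"
          unfolding prod.collapse .
      qed
      then show ?thesis by (simp add: z out_def bind_comp_assoc)
    qed
    from runs_Seq[OF ip(2) this] show ?thesis
      unfolding B_def TB_def by (simp add: bind_comp_assoc)
  qed
  have C: "crel (\<lambda>z b. \<exists>t'. z = Some (enc b, t') \<and> t' \<le> TB k \<and> TB k \<le> t' + TB k)
        (exec B (enc k) (TB k)) (bind_comp (init k) (out k))" for k
    using runB[of k] unfolding runs_def by blast
  show ?thesis
  proof (rule that)
    show "ppt B TB"
      unfolding ppt_def
    proof (intro conjI allI notI)
      show "poly_bounded TB" using TBp by (simp add: pmono_def)
      fix k assume "None \<in> outcomes (exec B (data_of_nat k) (TB k))"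
      then show False using crel_outcomes[OF C[of k]] by (fastforce simp: enc_nat_def)
    qed
    show "crel (\<lambda>z b. \<exists>t'. z = Some (enc b, t')) (exec B (enc k) (TB k))
      (bind_comp (init k) (\<lambda>s. bind_comp (subst_comp h (exec p (enc k) (T k)) s)
         (\<lambda>z. Done (fin (bool_of_data (the_or Atom (map_option fst (fst z))), snd z)))))" for k
      unfolding out_def[symmetric] by (rule crel_mono[OF C]) blast
  qed
qed

section \<open>Independence of the challenge once zeros are encrypted\<close>

section \<open>Hiding the permutations\<close>

text \<open>Equality of the guess with the challenge bit is spelled out by connectives, to which the
  closure rules apply directly.\<close>

definition sim_won :: "bool \<times> sim_state \<Rightarrow> bool" where
  "sim_won z \<longleftrightarrow> \<not> snd (snd (snd (snd z))) \<and> (fst z \<and> fst (snd (snd z)) \<or> \<not> fst z \<and> \<not> fst (snd (snd z)))"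

definition sim_wins :: "(data \<times> nat) option \<times> sim_state \<times> lr_state \<Rightarrow> bool" where
  "sim_wins z = sim_won (bool_of_data (the_or Atom (map_option fst (fst z))), fst (snd z))"

lemma pmf_map_True: "ennreal (pmf (map_pmf f p) True) = (\<integral>\<^sup>+x. indicator {x. f x} x \<partial>measure_pmf p)"
proof -
  have "f -` {True} = {x. f x}" by auto
  then show ?thesis by (simp add: pmf_map measure_pmf.emeasure_eq_measure)
qed

context simulation
begin

lemma real_bound:
  assumes "t \<le> B"
  shows "pmf (map_pmf (\<lambda>z. wins b (snd (snd z)) (fst z))
      (interact (\<lambda>s d. shuffle_oracle Enc Dec (r^4) (optim_shuffle Enc Dec p1 p2 r) key b s (shuffle_query_of_data d))
         (exec p x t) (False, False))) True
    \<le> pmf (map_pmf sim_wins (interact (sim_oracle Enc Dec key (\<lambda>_. True)) (exec p x t) ((P, b, False, False), (0, [])))) True + real t * \<delta>"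
proof -
  let ?o1 = "\<lambda>s d. shuffle_oracle Enc Dec (r^4) (optim_shuffle Enc Dec p1 p2 r) key b s (shuffle_query_of_data d)"
  let ?o2 = "sim_oracle Enc Dec key (\<lambda>_. True)"
  have "(\<integral>\<^sup>+z. indicator {z. wins b (snd (snd z)) (fst z)} z \<partial>interact ?o1 (exec p x t) (False, False))
    \<le> (\<integral>\<^sup>+z. indicator {z. sim_wins z} z \<partial>interact ?o2 (exec p x t) ((P, b, False, False), (0, []))) + of_nat t * ennreal \<delta>"
  proof (rule interact_hop[where R="real_rel b" and dead="\<lambda>_. False" and won="\<lambda>_. False"])
    fix t' s1 s2 and d :: data assume "real_rel b t' s1 s2" "size d < t'"
    from real_step[OF this] show "hop (ennreal \<delta>) (\<lambda>z1 z2. False \<or> False \<or> fst z1 = fst z2 \<and> real_rel b (t' - 1 - size d) (snd z1) (snd z2))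
       (?o1 s1 d) (?o2 s2 d)" by simp
  next
    fix t' s1 s2 and y :: "(data \<times> nat) option" assume "real_rel b t' s1 s2"
    then show "(indicator {z. wins b (snd (snd z)) (fst z)} (y, s1) :: ennreal) \<le> indicator {z. sim_wins z} (y, s2)"
      by (auto simp: real_rel_def wins_def sim_wins_def sim_won_def split: split_indicator)
  next
    show "real_rel b t (False, False) ((P, b, False, False), (0, []))"
      using assms by (simp add: real_rel_def tab_ok_def)
  qed (auto simp: paced_exec split: split_indicator)
  then have "ennreal (pmf (map_pmf (\<lambda>z. wins b (snd (snd z)) (fst z)) (interact ?o1 (exec p x t) (False, False))) True)
    \<le> ennreal (pmf (map_pmf sim_wins (interact ?o2 (exec p x t) ((P, b, False, False), (0, [])))) True + real t * \<delta>)"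
    unfolding pmf_map_True[symmetric] using \<delta> by (simp add: ennreal_of_nat_eq_real_of_nat ennreal_mult ennreal_plus)
  then show ?thesis using \<delta> by (subst (asm) ennreal_le_iff) auto
qed

abbreviation same :: "(bits \<times> bits) list \<Rightarrow> (bits \<times> bits) list \<Rightarrow> bool" where
  "same \<equiv> list_all2 (\<lambda>x y. fst x = fst y \<and> length (snd x) = length (snd y))"

lemma same_lookup:
  assumes "same tab tab'"
  shows "rel_option (\<lambda>m m'. length m = length m') (lookup_dec Dec key tab c) (lookup_dec Dec key tab' c)"
proof -
  have "rel_option (\<lambda>m m'. length m = length m') (map_of tab c) (map_of tab' c)"
    using assms by (induction rule: list_all2_induct) auto
  moreover have "rel_option (\<lambda>m m'. length m = length m') z z" for z :: "bits option" by (cases z) auto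
  ultimately show ?thesis unfolding lookup_dec_def by (cases "map_of tab c"; cases "map_of tab' c") auto
qed

abbreviation run_rel :: "'x \<times> lr_state \<Rightarrow> 'x \<times> lr_state \<Rightarrow> bool" where
  "run_rel x y \<equiv> fst x = fst y \<and> fst (snd x) = fst (snd y) \<and> same (snd (snd x)) (snd (snd y))"

text \<open>Strings of zeros depend on lengths alone, so both sides draw the same ciphertexts; the
  difference between the messages survives only in the tables.\<close>

lemma ideal_ask:
  assumes len: "map length ms = map length ms'" and same: "same tab tab'"
  shows "rel_pmf run_rel (interact (lr (\<lambda>_. False)) (ask_enc N ms) (i, tab)) (interact (lr (\<lambda>_. False)) (ask_enc N ms') (i, tab'))"
proof -
  have "map zeros ms = map (\<lambda>l. replicate l False) (map length ms)" "map zeros ms' = map (\<lambda>l. replicate l False) (map length ms')"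
    by simp_all
  then have z: "map zeros ms' = map zeros ms" using len by simp
  have l: "length ms = length ms'" using arg_cong[OF len, of length] by simp
  have "same (zip cs ms) (zip cs ms')" for cs :: "bits list"
    unfolding list_all2_conv_all_nth
  proof (intro conjI allI impI)
    fix j assume j: "j < length (zip cs ms)"
    then have "map length ms ! j = map length ms' ! j" using len by simp
    then show "fst (zip cs ms ! j) = fst (zip cs ms' ! j)" "length (snd (zip cs ms ! j)) = length (snd (zip cs ms' ! j))"
      using j l by auto
  qed (simp add: l)
  then show ?thesis unfolding interact_ask_enc
    by (auto simp: z pmf.rel_map same intro!: rel_pmf_reflI list_all2_appendI)
qed

lemma ideal_shuffle:
  assumes A: "valid_array (r^4) A" "valid_array (r^4) A'" and ps: "valid_perm (r^4) ps" "valid_perm (r^4) ps'"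
    and L: "value_length A = value_length A'" and same: "same tab tab'"
  shows "rel_pmf run_rel (interact (lr (\<lambda>_. False)) (sim_shuffle P cs A ps) (i, tab)) (interact (lr (\<lambda>_. False)) (sim_shuffle P cs A' ps') (i, tab'))"
proof -
  let ?V = "pmf_of_set {ps. valid_perm (r^4) ps}"
  define M where "M ps1 A ps = plan r q1 q2 (value_length A) (fun_of_perm_list ps1) (fun_of_perm_list ps) A" for ps1 A ps
  have len: "map length (M ps1 A ps) = replicate (2 * (r^3 * q1 + r^3 * q2 + r^4)) (1 + key_width (r^4) + value_length A)"
    if "valid_array (r^4) A" "valid_perm (r^4) ps1" "valid_perm (r^4) ps" for ps1 A ps
  proof -
    have "map length (M ps1 A ps) = map (\<lambda>_. 1 + key_width (r^4) + value_length A) (M ps1 A ps)"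
      unfolding M_def by (rule map_cong[OF refl]) (rule plan_lengths(2)[OF that])
    then show ?thesis using plan_lengths(1)[OF that] by (simp add: M_def map_replicate_const)
  qed
  have eq: "interact (lr (\<lambda>_. False)) (sim_shuffle P cs A ps) u = bind_pmf ?V (\<lambda>ps1.
      bind_pmf (interact (lr (\<lambda>_. False)) (ask_enc N (M ps1 A ps)) u) (\<lambda>x. return_pmf (enc (fmt r q1 q2 cs (fst x)), snd x)))" for A ps u
    by (simp add: sim_shuffle_def M_def interact_bind interact_rand_perm bind_map_pmf split_def)
  show ?thesis unfolding eq
  proof (rule rel_pmf_bindI[where R="\<lambda>x y. x = y \<and> valid_perm (r^4) x"])
    show "rel_pmf (\<lambda>x y. x = y \<and> valid_perm (r^4) x) ?V ?V"
      by (rule rel_pmf_reflI) (simp add: set_pmf_of_set[OF ex_valid_perm finite_valid_perm])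
    fix x y :: "nat list" assume "x = y \<and> valid_perm (r^4) x"
    then have x: "x = y" and v: "valid_perm (r^4) y" by auto
    have "map length (M x A ps) = map length (M y A' ps')"
      unfolding x len[OF A(1) v ps(1)] len[OF A(2) v ps(2)] L ..
    from ideal_ask[OF this same] show "rel_pmf run_rel
        (bind_pmf (interact (lr (\<lambda>_. False)) (ask_enc N (M x A ps)) (i, tab)) (\<lambda>x. return_pmf (enc (fmt r q1 q2 cs (fst x)), snd x)))
        (bind_pmf (interact (lr (\<lambda>_. False)) (ask_enc N (M y A' ps')) (i, tab')) (\<lambda>x. return_pmf (enc (fmt r q1 q2 cs (fst x)), snd x)))"
      by (rule rel_pmf_bindI) simp
  qed
qed

lemma ideal_plain:
  assumes A: "valid_array (r^4) A" "valid_array (r^4) A'" and ps: "valid_perm (r^4) ps" "valid_perm (r^4) ps'"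
    and L: "value_length A = value_length A'" and same: "same tab tab'"
  shows "rel_pmf run_rel (interact (lr (\<lambda>_. False)) (sim_plain P A ps) (i, tab)) (interact (lr (\<lambda>_. False)) (sim_plain P A' ps') (i, tab'))"
proof -
  have eq: "interact (lr (\<lambda>_. False)) (sim_plain P A ps) u = bind_pmf (interact (lr (\<lambda>_. False)) (ask_enc N (map (real_slot (r^4)) A)) u)
      (\<lambda>x. interact (lr (\<lambda>_. False)) (sim_shuffle P (fst x) A ps) (snd x))" for A ps u
    by (simp add: sim_plain_def interact_bind split_def)
  have len: "map length (map (real_slot (r^4)) A) = replicate (r^4) (1 + key_width (r^4) + value_length A)"
    if "valid_array (r^4) A" for A
  proof -
    have "map length (map (real_slot (r^4)) A) = map (\<lambda>_. 1 + key_width (r^4) + value_length A) (map (real_slot (r^4)) A)"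
      by (rule map_cong[OF refl]) (rule plain_messages[OF that])
    then show ?thesis using that by (simp add: map_replicate_const valid_array_def)
  qed
  show ?thesis unfolding eq
  proof (rule rel_pmf_bindI[OF ideal_ask])
    show "map length (map (real_slot (r^4)) A) = map length (map (real_slot (r^4)) A')" using len A L by simp
    fix x y :: "bits list \<times> lr_state" assume "run_rel x y"
    then show "rel_pmf run_rel (interact (lr (\<lambda>_. False)) (sim_shuffle P (fst x) A ps) (snd x))
        (interact (lr (\<lambda>_. False)) (sim_shuffle P (fst y) A' ps') (snd y))"
      using ideal_shuffle[OF A ps L, of "snd (snd x)" "snd (snd y)" "fst x" "fst (snd x)"] by (cases "snd x"; cases "snd y") simp
  qed (rule same)
qed

text \<open>The tables contain different messages of equal lengths. The decoded arrays may thus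
  differ, but the runs on them encrypt messages of equal lengths. An answer that was cut off decodes
  to the empty array, which is valid only for \<open>n = 0\<close>; hence the case
  distinction.\<close>

lemma decoded_value_length:
  fixes f g :: "bits \<Rightarrow> bits option"
  assumes A: "valid_array n (decode_array n (trunc N (enc (map f cs))))" "valid_array n (decode_array n (trunc N (enc (map g cs))))"
    and fg: "\<And>c. rel_option (\<lambda>m m'. length m = length m') (f c) (g c)"
  shows "value_length (decode_array n (trunc N (enc (map f cs)))) = value_length (decode_array n (trunc N (enc (map g cs))))"
proof (cases "n = 0")
  case True
  then have "length (decode_array n (trunc N (enc (map f cs)))) = 0" "length (decode_array n (trunc N (enc (map g cs)))) = 0"
    using A unfolding valid_array_def by blast+
  then show ?thesis by simp
next
  case False
  have d: "decode_array n (trunc N (enc (map f cs))) = map (\<lambda>c. decode_elem n (enc (f c))) cs"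
    if "valid_array n (decode_array n (trunc N (enc (map f cs))))" for f :: "bits \<Rightarrow> bits option"
  proof (cases "size (enc (map f cs)) \<le> N")
    case True
    then show ?thesis unfolding trunc_def if_P[OF True] decode_array_def list_of_enc by simp
  next
    case False
    then have "length (decode_array n (trunc N (enc (map f cs)))) = 0" by (simp add: trunc_def decode_array_def)
    then show ?thesis using that \<open>n \<noteq> 0\<close> unfolding valid_array_def by simp
  qed
  show ?thesis
  proof (cases cs)
    case (Cons c cs')
    have e: "h c = Some (real_slot n (decode_elem n (enc (h c))))"
      if v: "valid_array n (map (\<lambda>c. decode_elem n (enc (h c))) cs)" for h :: "bits \<Rightarrow> bits option"
    proof (rule decode_elem_Some)
      have "fst (decode_elem n (enc (h c))) \<in> {1..n}" using v unfolding valid_array_def Cons by auto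
      then show "fst (decode_elem n (enc (h c))) \<noteq> 0" by simp
    qed
    have "rel_option (\<lambda>m m'. length m = length m') (Some (real_slot n (decode_elem n (enc (f c))))) (Some (real_slot n (decode_elem n (enc (g c)))))"
      using fg[of c] e[OF A(1)[unfolded d[OF A(1)]]] e[OF A(2)[unfolded d[OF A(2)]]] by simp
    then have "length (snd (decode_elem n (enc (f c)))) = length (snd (decode_elem n (enc (g c))))"
      by (simp add: length_slots)
    then show ?thesis unfolding d[OF A(1)] d[OF A(2)] unfolding Cons
      by (cases "decode_elem n (enc (f c))"; cases "decode_elem n (enc (g c))") (simp add: value_length_def)
  qed (simp only: d[OF A(1)] d[OF A(2)] list.map)
qed

definition ideal_rel :: "sim_state \<times> lr_state \<Rightarrow> sim_state \<times> lr_state \<Rightarrow> bool" where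
  "ideal_rel s s' \<longleftrightarrow> (\<exists>ch i tab tab'. s = ((P, False, ch, False), (i, tab)) \<and> s' = ((P, True, ch, False), (i, tab')) \<and> same tab tab')"

abbreviation has_lost :: "sim_state \<times> lr_state \<Rightarrow> bool" where
  "has_lost s \<equiv> snd (snd (snd (fst s)))"

text \<open>Plain and challenge queries lead to encryptions of equally long messages on both sides.
  An encrypted array may be accepted on one side only; then the other side has lost, which the
  relation admits.\<close>

lemma ideal_step:
  assumes R: "ideal_rel s s'"
  shows "hop 0 (\<lambda>z1 z2. has_lost (snd z1) \<or> has_lost (snd z2) \<or> fst z1 = fst z2 \<and> ideal_rel (snd z1) (snd z2))
     (sim_oracle Enc Dec key (\<lambda>_. False) s d) (sim_oracle Enc Dec key (\<lambda>_. False) s' d)"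
proof -
  obtain ch i tab tab' where s: "s = ((P, False, ch, False), (i, tab))" and s': "s' = ((P, True, ch, False), (i, tab'))"
    and same: "same tab tab'" using R unfolding ideal_rel_def by blast
  let ?S = "\<lambda>z1 z2. has_lost (snd z1) \<or> has_lost (snd z2) \<or> fst z1 = fst z2 \<and> ideal_rel (snd z1) (snd z2)"
  let ?i = "\<lambda>m u. map_pmf (\<lambda>((d, st), u). (d, (st, u))) (interact (lr (\<lambda>_. False)) m u)"
  have lose1: "hop 0 ?S (?i (Done (Atom, (P, b, ch', True))) u) q" for b ch' u q
    by (rule hop_all) simp
  have lose2: "hop 0 ?S q (?i (Done (Atom, (P, b, ch', True))) u)" for b ch' u q
    by (rule hop_all) simp
  have wrap: "hop 0 ?S (?i (bind_comp Y (\<lambda>d. Done (d, (P, False, ch', False)))) u) (?i (bind_comp Y' (\<lambda>d. Done (d, (P, True, ch', False)))) u')"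
    if "rel_pmf run_rel (interact (lr (\<lambda>_. False)) Y u) (interact (lr (\<lambda>_. False)) Y' u')" for Y Y' :: "data comp" and u u' ch'
  proof -
    have eq: "?i (bind_comp Y (\<lambda>d. Done (d, st))) u = bind_pmf (interact (lr (\<lambda>_. False)) Y u) (\<lambda>x. return_pmf (fst x, (st, snd x)))" for Y :: "data comp" and st u
      unfolding interact_bind map_bind_pmf by (simp add: split_def)
    show ?thesis unfolding eq
    proof (rule hop_rel_pmf, rule rel_pmf_bindI[OF that])
      fix x y :: "data \<times> lr_state" assume "run_rel x y"
      then have "ideal_rel ((P, False, ch', False), snd x) ((P, True, ch', False), snd y)"
        unfolding ideal_rel_def by (cases "snd x"; cases "snd y") simp
      then show "rel_pmf ?S (return_pmf (fst x, ((P, False, ch', False), snd x))) (return_pmf (fst y, ((P, True, ch', False), snd y)))"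
        using \<open>run_rel x y\<close> by simp
    qed
  qed
  have main: "hop 0 ?S (?i (sim_query (P, False, ch, False) Q) (i, tab)) (?i (sim_query (P, True, ch, False) Q) (i, tab'))" for Q
  proof (cases Q)
    case (PlainQ A ps)
    show ?thesis
    proof (cases "\<not> ch \<and> valid_array (r^4) A \<and> valid_perm (r^4) ps")
      case True
      then show ?thesis using wrap[OF ideal_plain[of A A ps ps tab tab' i, OF _ _ _ _ refl same], of ch] by (simp add: PlainQ)
    next
      case False
      then show ?thesis using lose1[of False ch "(i, tab)"] by (auto simp: PlainQ)
    qed
  next
    case (ShuffleChallengeQ A0 ps0 A1 ps1)
    show ?thesis
    proof (cases "\<not> ch \<and> valid_array (r^4) A0 \<and> valid_perm (r^4) ps0 \<and> valid_array (r^4) A1 \<and> valid_perm (r^4) ps1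
        \<and> value_length A0 = value_length A1")
      case True
      then show ?thesis using wrap[OF ideal_plain[of A0 A1 ps0 ps1 tab tab' i, OF _ _ _ _ _ same], of True] by (simp add: ShuffleChallengeQ)
    next
      case False
      then show ?thesis using lose1[of False ch "(i, tab)"] by (auto simp: ShuffleChallengeQ)
    qed
  next
    case (EncryptedQ cs ps)
    let ?A = "\<lambda>tab. decode_array (r^4) (trunc N (enc (map (lookup_dec Dec key tab) cs)))"
    let ?c = "\<lambda>tab. ch \<and> length cs = r^4 \<and> valid_array (r^4) (?A tab) \<and> valid_perm (r^4) ps"
    have dec: "interact (lr (\<lambda>_. False)) (sim_query (P, b, ch, False) Q) (j, tab)
      = interact (lr (\<lambda>_. False)) (if ?c tab then bind_comp (sim_shuffle P cs (?A tab) ps) (\<lambda>d. Done (d, (P, b, ch, False)))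
         else Done (Atom, (P, b, ch, True))) (j, tab)" for b tab j
      by (simp add: EncryptedQ interact_bind bind_return_pmf del: enc_pair enc_Suc)
    consider "\<not> ?c tab" | "\<not> ?c tab'" | "?c tab" "?c tab'" by blast
    then show ?thesis
    proof cases
      case 1
      show ?thesis unfolding dec if_not_P[OF 1] by (rule lose1)
    next
      case 2
      show ?thesis unfolding dec if_not_P[OF 2] by (rule lose2)
    next
      case 3
      have "value_length (?A tab) = value_length (?A tab')"
        by (rule decoded_value_length[OF _ _ same_lookup[OF same]]) (use 3 in blast)+
      then show ?thesis unfolding dec if_P[OF 3(1)] if_P[OF 3(2)]
        using 3 by (intro wrap ideal_shuffle same) blast+
    qed
  qed
  from main[of "shuffle_query_of_data d"] show ?thesis unfolding sim_oracle_def s s' fst_conv snd_conv .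
qed

lemma lost_persists: "has_lost s \<Longrightarrow> z \<in> set_pmf (sim_oracle Enc Dec key w s d) \<Longrightarrow> has_lost (snd z)"
proof -
  have "st' = snd (snd (snd st)) \<or> st'" if "(x, P', b, c, st') \<in> outcomes (sim_query st Q)" for x P' b c st' st Q
    using that by (cases Q; cases st) (auto simp: outcomes_bind split: if_splits)
  note step = this
  assume l: "has_lost s" and "z \<in> set_pmf (sim_oracle Enc Dec key w s d)"
  then obtain y where y: "y \<in> set_pmf (interact (lr w) (sim_query (fst s) (shuffle_query_of_data d)) (snd s))"
    and z: "z = (\<lambda>((d, st), u). (d, (st, u))) y" unfolding sim_oracle_def by auto
  obtain x P' b c st' u where y': "y = ((x, P', b, c, st'), u)" by (metis surj_pair)
  from step[OF outcomes_interact[OF y, unfolded y' fst_conv]] l show "has_lost (snd z)" by (auto simp: z y')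
qed

text \<open>Left: a win with bit 0, impossible after a loss. Right: a non-win with bit 1, certain
  after a loss. So lost states may be taken as \<open>dead\<close> on the left and as
  \<open>won\<close> on the right, and no error arises elsewhere.\<close>

lemma ideal_bound:
  "pmf (map_pmf sim_wins (interact (sim_oracle Enc Dec key (\<lambda>_. False)) (exec p x t) ((P, False, False, False), (0, [])))) True
   + pmf (map_pmf sim_wins (interact (sim_oracle Enc Dec key (\<lambda>_. False)) (exec p x t) ((P, True, False, False), (0, [])))) True \<le> 1"
proof -
  let ?o = "sim_oracle Enc Dec key (\<lambda>_. False)"
  let ?X = "\<lambda>b. interact ?o (exec p x t) ((P, b, False, False), (0, []))"
  have "(\<integral>\<^sup>+z. indicator {z. sim_wins z} z \<partial>?X False) \<le> (\<integral>\<^sup>+z. indicator {z. \<not> sim_wins z} z \<partial>?X True) + of_nat t * 0"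
  proof (rule interact_hop[where R="\<lambda>_. ideal_rel" and dead=has_lost and won=has_lost])
    show "hop 0 (\<lambda>z1 z2. has_lost (snd z1) \<or> has_lost (snd z2) \<or> fst z1 = fst z2 \<and> ideal_rel (snd z1) (snd z2)) (?o s1 d) (?o s2 d)"
      if "ideal_rel s1 s2" for s1 s2 d by (rule ideal_step[OF that])
    show "has_lost (snd z)" if "has_lost s" "z \<in> set_pmf (?o s q)" for s q z by (rule lost_persists[OF that])
    show "has_lost (snd z)" if "has_lost s" "z \<in> set_pmf (?o s q)" for s q z by (rule lost_persists[OF that])
    show "ideal_rel ((P, False, False, False), (0, [])) ((P, True, False, False), (0, []))"
      unfolding ideal_rel_def by (rule exI[of _ False]) simp
  qed (auto simp: paced_exec sim_wins_def sim_won_def ideal_rel_def split: split_indicator)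
  then have "ennreal (pmf (map_pmf sim_wins (?X False)) True) \<le> ennreal (pmf (map_pmf (\<lambda>z. \<not> sim_wins z) (?X True)) True)"
    unfolding pmf_map_True by simp
  then have "pmf (map_pmf sim_wins (?X False)) True \<le> pmf (map_pmf (\<lambda>z. \<not> sim_wins z) (?X True)) True"
    by simp
  also have "\<dots> = pmf (map_pmf (\<lambda>b. b = False) (map_pmf sim_wins (?X True))) True" by (simp add: pmf.map_comp comp_def)
  also have "\<dots> = 1 - pmf (map_pmf sim_wins (?X True)) True" by (subst pmf_map_eq_bool) simp
  finally show ?thesis by simp
qed

end

section \<open>Assembling the reduction to the encryption scheme\<close>

section \<open>The reduction\<close>

lemma negligible_add:
  assumes "negligible \<mu>" and "negligible \<nu>"
  shows "negligible (\<lambda>k. \<mu> k + \<nu> k)"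
  unfolding negligible_def
proof
  fix c :: nat
  have "\<forall>\<^sub>F k in sequentially. \<bar>\<mu> k\<bar> \<le> 1 / real k ^ Suc c" "\<forall>\<^sub>F k in sequentially. \<bar>\<nu> k\<bar> \<le> 1 / real k ^ Suc c"
    using assms unfolding negligible_def by blast+
  with eventually_ge_at_top[of 2] show "\<forall>\<^sub>F k in sequentially. \<bar>\<mu> k + \<nu> k\<bar> \<le> 1 / real k ^ c"
  proof eventually_elim
    case (elim k)
    have "\<bar>\<mu> k + \<nu> k\<bar> \<le> 2 / real k ^ Suc c" using elim(2,3) by simp
    also have "\<dots> = (2 / real k) * (1 / real k ^ c)" by simp
    also have "\<dots> \<le> 1 * (1 / real k ^ c)" using elim(1) by (intro mult_right_mono) auto
    finally show ?case by simp
  qed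
qed

lemma pmf_bind_mono:
  assumes "\<And>x. x \<in> set_pmf p \<Longrightarrow> pmf (f x) True \<le> pmf (g x) True + d" and "d \<ge> 0"
  shows "pmf (bind_pmf p f) True \<le> pmf (bind_pmf p g) True + d"
proof -
  have "ennreal (pmf (bind_pmf p f) True) \<le> (\<integral>\<^sup>+x. ennreal (pmf (g x) True) + ennreal d \<partial>p)"
    unfolding ennreal_pmf_bind using assms
    by (intro nn_integral_pmf_mono) (simp add: ennreal_plus[symmetric] ennreal_leI del: ennreal_plus)
  also have "\<dots> = ennreal (pmf (bind_pmf p g) True) + ennreal d"
    by (simp add: nn_integral_add ennreal_pmf_bind)
  also have "\<dots> = ennreal (pmf (bind_pmf p g) True + d)" using assms(2) by (simp add: ennreal_plus)
  finally show ?thesis using assms(2) by (subst (asm) ennreal_le_iff) auto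
qed

lemma pmf_bind_le:
  assumes "\<And>x. x \<in> set_pmf p \<Longrightarrow> pmf (f x) True \<le> c" and "c \<ge> 0"
  shows "pmf (bind_pmf p f) True \<le> c"
  using pmf_bind_mono[of p f "\<lambda>_. return_pmf False" c] assms by simp

lemma pmf_coin: "pmf (bind_pmf (pmf_of_set (UNIV :: bool set)) f) True = (pmf (f False) True + pmf (f True) True) / 2"
  by (simp add: pmf_bind_pmf_of_set UNIV_bool add.commute)

lemma map_coin: "map_pmf (\<lambda>i. 0 < i) (pmf_of_set {..1::nat}) = pmf_of_set UNIV"
proof (rule map_pmf_of_set_bij_betw)
  have "{..1::nat} = {0, 1}" by auto
  then show "bij_betw (\<lambda>i. 0 < i) {..1::nat} UNIV" by (simp add: bij_betw_def UNIV_bool)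
qed auto

lemma optim_shuffle_oblivious:
  fixes p1 p2 :: real and n r :: "nat \<Rightarrow> nat"
  assumes p: "p1 > 1" "p2 > 1" and n: "\<And>k. n k = r k ^ 4"
    and d: "\<exists>d. \<forall>\<^sub>F k in sequentially. k \<le> n k ^ d"
    and r: "poly_time_nat r"
    and q: "poly_time_nat (\<lambda>k. batch_size p1 (r k))" "poly_time_nat (\<lambda>k. batch_size p2 (r k))"
    and enc: "symmetric_encryption Gen Enc Dec" and cpa: "enc_ind_cpa Gen Enc Dec"
  shows "oblivious_shuffle Gen Enc Dec n (\<lambda>k. optim_shuffle Enc Dec p1 p2 (r k))"
  unfolding oblivious_shuffle_def
proof (intro allI impI)
  fix pr T assume pr: "ppt pr T"
  define q1 where "q1 k = batch_size p1 (r k)" for k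
  define q2 where "q2 k = batch_size p2 (r k)" for k
  obtain Fr where Fr: "ptime Fr" "\<And>k. outcomes (Fr k) = {r k}" "\<And>k orc (s :: lr_state). interact orc (Fr k) s = return_pmf (r k, s)"
    using r by (rule poly_time_nat_ptime) (rule that)
  obtain F1 where F1: "ptime F1" "\<And>k. outcomes (F1 k) = {q1 k}" "\<And>k orc (s :: lr_state). interact orc (F1 k) s = return_pmf (q1 k, s)"
    using q(1)[folded q1_def] by (rule poly_time_nat_ptime) (rule that)
  obtain F2 where F2: "ptime F2" "\<And>k. outcomes (F2 k) = {q2 k}" "\<And>k orc (s :: lr_state). interact orc (F2 k) s = return_pmf (q2 k, s)"
    using q(2)[folded q2_def] by (rule poly_time_nat_ptime) (rule that)
  have bnd: "\<exists>g. pmono g \<and> (\<forall>k. f k \<le> g k)"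
    if F: "ptime F" "\<And>k. outcomes (F k) = {f k}" for F and f :: "nat \<Rightarrow> nat"
  proof -
    obtain pp g where g: "pmono g" "\<And>k b. b \<in> outcomes (F k) \<Longrightarrow> esize b \<le> g (esize k)"
      using F(1) by (rule ptimeE) (rule that)
    have "f k \<le> g k" for k using g(2)[of "f k" k] F(2)[of k] by simp
    with g(1) show ?thesis by blast
  qed
  obtain gr where gr: "pmono gr" "\<And>k. r k \<le> gr k" using bnd[OF Fr(1,2)] by blast
  obtain g1 where g1: "pmono g1" "\<And>k. q1 k \<le> g1 k" using bnd[OF F1(1,2)] by blast
  obtain g2 where g2: "pmono g2" "\<And>k. q2 k \<le> g2 k" using bnd[OF F2(1,2)] by blast
  obtain a where a: "\<And>k. T k \<le> k ^ a + a" using pr unfolding ppt_def poly_bounded_def by auto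
  define Q where "Q k = k ^ a + a" for k
  have Qp: "pmono Q" unfolding Q_def by (intro pmono_intros)
  have TQ: "T k \<le> Q k" for k using a by (simp add: Q_def)
  obtain e where eE: "\<And>k key m c. key \<in> set_pmf (Gen k) \<Longrightarrow> c \<in> set_pmf (Enc key m) \<Longrightarrow> length c \<le> (k + length m) ^ e + e"
    and eD: "\<And>k key m c. key \<in> set_pmf (Gen k) \<Longrightarrow> Dec key c = Some m \<Longrightarrow> length m \<le> (k + length c) ^ e + e"
    using encryption_bounds[OF enc] by metis
  define V where "V k = (k + Q k) ^ e + e + Q k" for k
  define G where "G k \<rho> = (k + (1 + \<rho> ^ 4 + V k)) ^ e + e" for k \<rho> :: nat
  define X where "X k \<rho> x y = (2 * (\<rho> ^ 3 * x + \<rho> ^ 3 * y + \<rho> ^ 4)) * (2 * G k \<rho> + 2) + Q k * (2 * V k + 2)" for k \<rho> x y :: nat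
  \<comment> \<open>The truncation bound has to be computable from \<open>k\<close>. The parameters
    are therefore replaced by polynomial majorants, and \<open>N\<close> becomes an explicit
    polynomial.\<close>
  have "pmono (\<lambda>k. X k (gr k) (g1 k) (g2 k))"
    unfolding X_def G_def V_def by (intro pmono_intros Qp gr g1 g2)
  then obtain c where c: "\<And>k. X k (gr k) (g1 k) (g2 k) \<le> k ^ c + c" unfolding pmono_def poly_bounded_def by auto
  define N where "N k = k ^ c + c" for k
  have XN: "X k (r k) (q1 k) (q2 k) \<le> N k" for k
  proof -
    have 3: "r k ^ 3 \<le> gr k ^ 3" "r k ^ 4 \<le> gr k ^ 4" using gr(2)[of k] by (simp_all add: power_mono)
    have "G k (r k) \<le> G k (gr k)" unfolding G_def using 3(2) by (intro add_le_mono power_mono) simp_all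
    then have "X k (r k) (q1 k) (q2 k) \<le> X k (gr k) (g1 k) (g2 k)"
      unfolding X_def by (intro add_le_mono mult_le_mono order_refl 3 g1(2) g2(2))
    then show ?thesis using c[of k] by (simp add: N_def)
  qed
  \<comment> \<open>The simulator tosses the coin of the shuffle game itself, as the bit of the
    encryption game already decides between messages and zeros. \<open>Choose 1\<close> is a fair
    coin.\<close>
  define init :: "nat \<Rightarrow> sim_state comp" where "init k = bind_comp (Fr k) (\<lambda>\<rho>. bind_comp (F1 k) (\<lambda>x. bind_comp (F2 k) (\<lambda>y.
      bind_comp (Choose 1 Done) (\<lambda>i. Done ((\<rho>, x, y, N k), 0 < i, False, False)))))" for k
  have init: "ptime init" unfolding init_def N_def
    by (intro fp_intros ptime_comp[OF Fr(1)] ptime_comp[OF F1(1)] ptime_comp[OF F2(1)] Fr(1))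
  define h where "h d st = sim_query st (shuffle_query_of_data d)" for d and st :: sim_state
  have hp: "ptime (\<lambda>z. h (fst z) (snd z))" unfolding h_def by (rule ptime_sim_query)
  have fin: "fp sim_won" unfolding sim_won_def[abs_def] by (intro fp_intros)
  \<comment> \<open>The parameters never change and the rest of the state consists of three bits, so
    its size is bounded throughout.\<close>
  define I where "I k t st \<longleftrightarrow> t \<le> Q k \<and> fst st = (r k, q1 k, q2 k, N k)" for k t and st :: sim_state
  define S where "S k = gr k + g1 k + g2 k + N k + 9 + Q k" for k
  have Sp: "pmono S" unfolding S_def N_def by (intro pmono_intros gr g1 g2 Qp)
  obtain A TA where A: "ppt A TA" and run: "\<And>k. crel (\<lambda>z b. \<exists>t'. z = Some (enc b, t')) (exec A (enc k) (TA k))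
      (bind_comp (init k) (\<lambda>s. bind_comp (subst_comp h (exec pr (enc k) (T k)) s)
         (\<lambda>z. Done (sim_won (bool_of_data (the_or Atom (map_option fst (fst z))), snd z)))))"
  proof (rule compile_ppt[where I=I and S=S, OF pr init hp fin])
    fix k t and s :: sim_state
    show "s \<in> outcomes (init k) \<Longrightarrow> I k (T k) s"
      using TQ[of k] by (auto simp: I_def init_def outcomes_bind Fr(2) F1(2) F2(2))
    fix d r' s'
    show "I k t s \<Longrightarrow> size d < t \<Longrightarrow> (r', s') \<in> outcomes (h d s) \<Longrightarrow> I k (t - 1 - size d) s'"
      using sim_query_params[of "(r', s')" s "shuffle_query_of_data d"] unfolding I_def h_def by auto
    show "I k t s \<Longrightarrow> t' \<le> t \<Longrightarrow> I k t' s" for t' unfolding I_def by auto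
    show "esize s + t \<le> S k" if i: "I k t s"
    proof -
      obtain b ch lost where s: "s = ((r k, q1 k, q2 k, N k), b, ch, lost)" using i by (cases s) (auto simp: I_def)
      show ?thesis using i gr(2)[of k] g1(2)[of k] g2(2)[of k] esize_bool[of b] esize_bool[of ch] esize_bool[of lost]
        by (simp add: s I_def S_def)
    qed
  qed (rule Sp, rule that)
  obtain \<nu>1 where \<nu>1: "negligible \<nu>1" and LR: "\<And>k. pmf (lr_game Gen Enc Dec (\<lambda>_. True) A TA k) True
      \<le> pmf (lr_game Gen Enc Dec (\<lambda>_. False) A TA k) True + \<nu>1 k"
    using lr_security[OF enc cpa A] by blast
  define Y where "Y w key k b = map_pmf sim_wins (interact (sim_oracle Enc Dec key w) (exec pr (enc k) (T k))
      (((r k, q1 k, q2 k, N k), b, False, False), (0, [])))" for w key k b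
  \<comment> \<open>For the compiled adversary the left-or-right game is literally the shuffle game
    played on the simulated oracle, with a coin tossed inside.\<close>
  have lr_eq: "lr_game Gen Enc Dec w A TA k = bind_pmf (Gen k) (\<lambda>key. bind_pmf (pmf_of_set UNIV) (Y w key k))" for w k
    unfolding lr_game_def
  proof (rule bind_pmf_cong[OF refl])
    fix key
    let ?o = "\<lambda>s d. lr_oracle Enc Dec key w s (cpa_query_of_data d)"
    let ?K = "\<lambda>s. bind_comp (subst_comp h (exec pr (enc k) (T k)) s)
         (\<lambda>z. Done (sim_won (bool_of_data (the_or Atom (map_option fst (fst z))), snd z)))"
    have so: "(\<lambda>(s, u) q. map_pmf (\<lambda>((d, s), u). (d, (s, u))) (interact ?o (h q s) u)) = sim_oracle Enc Dec key w"
      by (simp add: fun_eq_iff sim_oracle_def h_def)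
    have step: "interact ?o (init k) (0, []) = map_pmf (\<lambda>i. (((r k, q1 k, q2 k, N k), 0 < i, False, False), (0, []))) (pmf_of_set {..1::nat})"
      by (simp add: init_def interact_bind Fr(3) F1(3) F2(3) bind_return_pmf map_pmf_def)
    have sub: "map_pmf fst (interact ?o (?K s) u) = map_pmf sim_wins (interact (sim_oracle Enc Dec key w) (exec pr (enc k) (T k)) (s, u))" for s u
      unfolding interact_bind interact_subst_comp so
      by (simp add: map_pmf_def bind_assoc_pmf bind_return_pmf split_def sim_wins_def)
    have "map_pmf (\<lambda>z. bool_of_data (the_or Atom (map_option fst (fst z)))) (interact ?o (exec A (enc k) (TA k)) (0, []))
      = map_pmf fst (interact ?o (bind_comp (init k) ?K) (0, []))"
      by (rule rel_pmf_map_eq[OF crel_interact[OF run]]) auto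
    also have "\<dots> = bind_pmf (interact ?o (init k) (0, [])) (\<lambda>x. map_pmf fst (interact ?o (?K (fst x)) (snd x)))"
      by (simp add: interact_bind[of ?o "init k" ?K] map_bind_pmf split_def)
    also have "\<dots> = bind_pmf (map_pmf (\<lambda>i. 0 < i) (pmf_of_set {..1::nat})) (Y w key k)"
      unfolding step bind_map_pmf sub Y_def by simp
    finally have "map_pmf (\<lambda>z. bool_of_data (the_or Atom (map_option fst (fst z)))) (interact ?o (exec A (enc k) (TA k)) (0, []))
      = bind_pmf (pmf_of_set UNIV) (Y w key k)"
      unfolding map_coin .
    then show "bind_pmf (interact ?o (exec A (enc k) (TA k)) (0, [])) (\<lambda>z. return_pmf (bool_of_data (the_or Atom (map_option fst (fst z)))))
       = bind_pmf (pmf_of_set UNIV) (Y w key k)"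
      by (simp only: map_pmf_def)
  qed
  define \<epsilon> where "\<epsilon> = min (p1 * ln p1 - p1 + 1) (p2 * ln p2 - p2 + 1)"
  have \<epsilon>: "\<epsilon> > 0" "\<epsilon> \<le> p1 * ln p1 - p1 + 1" "\<epsilon> \<le> p2 * ln p2 - p2 + 1"
    using rate_pos[OF p(1)] rate_pos[OF p(2)] by (auto simp: \<epsilon>_def)
  define \<delta> where "\<delta> k = failure_bound \<epsilon> (n k)" for k
  have \<delta>0: "\<delta> k \<ge> 0" for k by (simp add: \<delta>_def failure_bound_def)
  have sim: "simulation Enc Dec key p1 p2 (r k) (q1 k) (q2 k) (N k) (Q k) (G k (r k)) (V k) (\<delta> k)"
    if key: "key \<in> set_pmf (Gen k)" for key k
  proof
    show "c \<in> set_pmf (Enc key m) \<Longrightarrow> Dec key c = Some m" for m c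
      using enc key unfolding symmetric_encryption_def by blast
    show "length c \<le> G k (r k)" if "length m \<le> 1 + r k ^ 4 + V k" "c \<in> set_pmf (Enc key m)" for m c
      using eE[OF key that(2)] power_mono[of "k + length m" "k + (1 + r k ^ 4 + V k)" e] that(1) by (simp add: G_def)
    show "length m \<le> V k" if "length c \<le> Q k" "Dec key c = Some m" for m c
      using eD[OF key that(2)] power_mono[of "k + length c" "k + Q k" e] that(1) by (simp add: V_def)
    show "Q k \<le> V k" by (simp add: V_def)
    show "2 * (r k ^ 3 * q1 k + r k ^ 3 * q2 k + r k ^ 4) * (2 * G k (r k) + 2) \<le> N k" "Q k * (2 * V k + 2) \<le> N k"
      using XN[of k] unfolding X_def by linarith+
    show "measure_pmf.prob (pmf_of_set {\<sigma>. \<sigma> permutes {1..r k ^ 4}}) {\<pi>1. \<not> run_good (r k) (q1 k) (q2 k) \<pi>1 \<pi> es} \<le> \<delta> k"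
      if "keyed (r k ^ 4) es" "\<pi> permutes {1..r k ^ 4}" for es \<pi>
      unfolding q1_def q2_def \<delta>_def n by (rule run_good_prob[OF p that \<epsilon>(2,3)])
  qed (simp_all add: q1_def q2_def \<delta>0)
  show "\<exists>\<nu>. negligible \<nu> \<and> (\<forall>k. measure_pmf.prob
      (shuffle_ind_game Gen Enc Dec n (\<lambda>k. optim_shuffle Enc Dec p1 p2 (r k)) pr T k) {True} \<le> 1 / 2 + \<nu> k)"
  proof (intro exI conjI allI)
    have "negligible \<delta>" unfolding \<delta>_def using negligible_comp[OF negligible_failure_bound[OF \<epsilon>(1)]] d by blast
    then show "negligible (\<lambda>k. \<nu>1 k + real (Q k) * \<delta> k)"
      using Qp unfolding pmono_def by (intro negligible_add \<nu>1 negligible_poly_mult) auto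
    fix k
    let ?W = "\<lambda>key b. map_pmf (\<lambda>z. wins b (snd (snd z)) (fst z))
      (interact (\<lambda>s d. shuffle_oracle Enc Dec (r k ^ 4) (optim_shuffle Enc Dec p1 p2 (r k)) key b s (shuffle_query_of_data d))
         (exec pr (enc k) (T k)) (False, False))"
    have game: "shuffle_ind_game Gen Enc Dec n (\<lambda>k. optim_shuffle Enc Dec p1 p2 (r k)) pr T k
      = bind_pmf (Gen k) (\<lambda>key. bind_pmf (pmf_of_set UNIV) (?W key))"
      unfolding shuffle_ind_game_def n by (simp add: map_pmf_def split_def enc_nat_def)
    \<comment> \<open>Three moves: real runs become simulated ones at a cost of
      \<open>\<delta>\<close> per query, messages become zeros at the cost \<open>\<nu>1\<close>,
      and finally the winning probabilities for the two bits add up to at most 1.\<close>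
    have "pmf (shuffle_ind_game Gen Enc Dec n (\<lambda>k. optim_shuffle Enc Dec p1 p2 (r k)) pr T k) True
      \<le> pmf (lr_game Gen Enc Dec (\<lambda>_. True) A TA k) True + real (Q k) * \<delta> k"
      unfolding game lr_eq
    proof (intro pmf_bind_mono)
      fix key b assume "key \<in> set_pmf (Gen k)"
      from simulation.real_bound[OF sim[OF this] TQ, of b pr "enc k"]
      have "pmf (?W key b) True \<le> pmf (Y (\<lambda>_. True) key k b) True + real (T k) * \<delta> k" unfolding Y_def .
      also have "real (T k) * \<delta> k \<le> real (Q k) * \<delta> k" using TQ[of k] \<delta>0[of k] by (intro mult_right_mono) auto
      finally show "pmf (?W key b) True \<le> pmf (Y (\<lambda>_. True) key k b) True + real (Q k) * \<delta> k" by simp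
    qed (use \<delta>0 in auto)
    also have "\<dots> \<le> (pmf (lr_game Gen Enc Dec (\<lambda>_. False) A TA k) True + \<nu>1 k) + real (Q k) * \<delta> k"
      using LR[of k] by simp
    also have "pmf (lr_game Gen Enc Dec (\<lambda>_. False) A TA k) True \<le> 1 / 2"
      unfolding lr_eq
    proof (rule pmf_bind_le)
      fix key assume "key \<in> set_pmf (Gen k)"
      from simulation.ideal_bound[OF sim[OF this], of pr "enc k" "T k"]
      show "pmf (bind_pmf (pmf_of_set UNIV) (Y (\<lambda>_. False) key k)) True \<le> 1 / 2"
        unfolding pmf_coin Y_def by simp
    qed simp
    finally show "measure_pmf.prob (shuffle_ind_game Gen Enc Dec n (\<lambda>k. optim_shuffle Enc Dec p1 p2 (r k)) pr T k) {True}
       \<le> 1 / 2 + (\<nu>1 k + real (Q k) * \<delta> k)"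
      by (simp add: measure_pmf_single)
  qed
qed

theorem theorem5p6:
  fixes p1 p2 :: real and n r :: "nat \<Rightarrow> nat"
    and Gen :: keygen and Enc :: encryption and Dec :: decryption
  assumes "p1 > 1" and "p2 > 1" and "p1 \<le> p2"
    and "\<And>k. n k = r k ^ 4"
    and "poly_bounded n"
    and "\<exists>d. \<forall>\<^sub>F k in sequentially. k \<le> n k ^ d"
    and "poly_time_nat r"
    and "poly_time_nat (\<lambda>k. batch_size p1 (r k))" and "poly_time_nat (\<lambda>k. batch_size p2 (r k))"
    and "symmetric_encryption Gen Enc Dec"
    and "enc_ind_cpa Gen Enc Dec"
  shows "shuffles_whp Gen Enc Dec p1 p2 \<and>
         oblivious_shuffle Gen Enc Dec n (\<lambda>k. optim_shuffle Enc Dec p1 p2 (r k))"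
proof
  show "shuffles_whp Gen Enc Dec p1 p2" by (rule optim_shuffle_whp) fact+
  show "oblivious_shuffle Gen Enc Dec n (\<lambda>k. optim_shuffle Enc Dec p1 p2 (r k))"
    by (rule optim_shuffle_oblivious) fact+
qed

end
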